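(* Let $H\in\{\mathbb{T},\mathbb{O},\mathbb{I}\}$, $n=|H|$, and let $\psi_0=(\psi_{0,1},\psi_{0,2})\in\mathbb{R}^2$ satisfy: (i) $\cos\psi_{0,2}\neq0$, and the great circle $\{e^{\psi_{0,1}J_1}e^{\psi_{0,2}J_2}(\cos\theta,\sin\theta,0):\theta\in\mathbb{R}\}$ avoids the rotation axes of $H$, i.e. contains no vector fixed by some $L\in H\setminus\{I\}$; (ii) the circle $\xi=(0,0)$ of orientation $\psi_0$ is a nondegenerate critical point of $\Psi$, that is, $\partial_{\psi_1}\Psi=\partial_{\psi_2}\Psi=0$ at $(0,0,\psi_{0,1},\psi_{0,2})$ (the other two components $\partial_{\xi_1}\Psi,\partial_{\xi_2}\Psi$ vanish automatically at $\xi=0$ for every orientation), and the $4\times4$ Hessian of $\Psi$ in the variables $(\xi_1,\xi_2,\psi_1,\psi_2)$ is invertible at $(0,0,\psi_{0,1},\psi_{0,2})$. Then there exist $\varepsilon_0>0$ and a $C^1$ branch $\varepsilon\mapsto u_\varepsilon\in X$, $0\le\varepsilon<\varepsilon_0$, of critical points of $\mathcal{A}_H(\cdot;\varepsilon)$ with $u_0$ equal to the circular orbit $u_{0,\psi_0}$ of orientation $\psi_0$. The branch is unique up to time translation: there is a fixed neighbourhood of $u_0$ in $X$ such that, for $0<\varepsilon<\varepsilon_0$, every critical point of $\mathcal{A}_H(\cdot;\varepsilon)$ in it equals $u_\varepsilon(\cdot+\varphi)$ for some $\varphi\in S^1$. Consequently, for $0<\varepsilon<\varepsilon_0$ the $(n+1)$-body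 problem with central mass $\varepsilon^{-1}$ has the $2\pi\varepsilon^{1/2}$-periodic symmetric solutions $q_0(t)=0$, $q_L(t)=L\,u_\varepsilon(\varepsilon^{-1/2}t)$ ($L\in H$), bifurcating as $\varepsilon\to0$ from the circular orbit of orientation $\psi_0$. Moreover there are parameters $(\xi_\varepsilon,\psi_\varepsilon)$ such that, as $\varepsilon\to0$, $$u_\varepsilon=u_{\xi_\varepsilon,\psi_\varepsilon}+O(\varepsilon)\ \text{ in }X,\qquad(\xi_\varepsilon,\psi_\varepsilon)=(0,0,\psi_0)+O(\varepsilon).$$
   Context: **Groups.** $H<SO(3)$ is one of the following matrix groups, each generated by the two listed matrices $A,B$ ($I$ is the identity matrix): - $\mathbb{T}$ (tetrahedral, order 12): $A=\mathrm{diag}(1,-1,-1)$, $B=\begin{pmatrix}0&1&0\\0&0&1\\1&0&0\end{pmatrix}$. - $\mathbb{O}$ (octahedral, order 24): $A=\begin{pmatrix}0&-1&0\\1&0&0\\0&0&1\end{pmatrix}$, $B=\begin{pmatrix}-1&0&0\\0&0&1\\0&1&0\end{pmatrix}$. - $\mathbb{I}$ (icosahedral, order 60): with $\phi=\frac12(1+\sqrt5)$, $A=\frac12\begin{pmatrix}\phi-1&\phi&1\\\phi&-1&\phi-1\\1&\phi-1&-\phi\end{pmatrix}$, $B=\begin{pmatrix}0&0&1\\1&0&0\\0&1&0\end{pmatrix}$. **$(n+1)$-body problem.** A central body of mass $\mu=\varepsilon^{-1}$ at $q_0(t)\in\mathbb{R}^3$ and $n=|H|$ unit masses at $q_L(t)$,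 $L\in H$, with Newtonian potential $V=-\mu\sum_{L}|q_L-q_0|^{-1}-\sum_{\{L,L'\},L\ne L'}|q_L-q_{L'}|^{-1}$ and equations $\mu\ddot q_0=-\nabla_{q_0}V$, $\ddot q_L=-\nabla_{q_L}V$. Symmetric solutions are those with $q_0=0$, $q_L=Lq_I$ for all $L\in H$. **Reduced action.** $X=H^2_{2\pi}(\mathbb{R}^3)$ is the Sobolev space of $2\pi$-periodic $H^2$ maps $\mathbb{R}\to\mathbb{R}^3$. On the open set of $u\in X$ such that $u(\tau)\neq0$ and $u(\tau)\ne Lu(\tau)$ for all $\tau$ and all $L\in H\setminus\{I\}$, put $\mathcal{A}_H(u;\varepsilon)=\mathcal{A}_0(u)+\varepsilon\mathcal{A}_1(u)$, $$\mathcal{A}_0(u)=\int_0^{2\pi}\frac{|\dot u|^2}2+\frac1{|u|}\,d\tau,\qquad \mathcal{A}_1(u)=\frac12\int_0^{2\pi}\sum_{L\in H\setminus\{I\}}\frac1{|u-Lu|}\,d\tau.$$ Critical points are the $u$ with $-\ddot u-\frac{u}{|u|^3}-\varepsilon\sum_{L\neq I}\frac{u-Lu}{|u-Lu|^3}=0$. **Kepler ellipses and the eccentricity-vector chart.** For $e\in[0,1)$, $c_e=\sqrt{1-e^2}$, $u_e(\tau)=r(\cos\theta,\sin\theta,0)$ with $r=c_e^2/(1+e\cos\theta)$, $\dot\theta=c_e/r^2$, $\theta(0)=0$ (a $2\pi$-periodic curve). With $$J_1=\begin{pmatrix}0&0&0\\0&0&-1\\0&1&0\end{pmatrix},\quad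 J_2=\begin{pmatrix}0&0&-1\\0&0&0\\1&0&0\end{pmatrix},\quad J_3=\begin{pmatrix}0&-1&0\\1&0&0\\0&0&0\end{pmatrix},$$ for $\xi=(\xi_1,\xi_2)=(e\cos\psi_3,e\sin\psi_3)$, $e=|\xi|<1$, and $\psi=(\psi_1,\psi_2)\in\mathbb{R}^2$, let $$u_{\xi,\psi}(\tau)=e^{\psi_1J_1}e^{\psi_2J_2}e^{\psi_3J_3}\,u_e(\tau-\psi_3),$$ which at $\xi=0$ is the circular orbit $u_{0,\psi}(\tau)=e^{\psi_1J_1}e^{\psi_2J_2}(\cos\tau,\sin\tau,0)$ of orientation $\psi$. Put $\Psi(\xi_1,\xi_2,\psi_1,\psi_2):=\mathcal{A}_1(u_{\xi,\psi})$. $S^1=\mathbb{R}/2\pi\mathbb{Z}$. *)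

theory Defs
  imports
    "HOL-Analysis.Analysis"
    "HOL-Library.Landau_Symbols"
    "HOL-Algebra.Generated_Groups"
begin

definition SO3 :: "(real^3^3) monoid" where
  "SO3 = \<lparr>carrier = {Q. rotation_matrix Q}, monoid.mult = (**), one = mat 1\<rparr>"

definition tetrahedral_group :: "(real^3^3) set" where
  "tetrahedral_group = generate SO3
     {vector [vector [1, 0, 0], vector [0, -1, 0], vector [0, 0, -1]],
      vector [vector [0, 1, 0], vector [0, 0, 1], vector [1, 0, 0]]}"

definition octahedral_group :: "(real^3^3) set" where
  "octahedral_group = generate SO3
     {vector [vector [0, -1, 0], vector [1, 0, 0], vector [0, 0, 1]],
      vector [vector [-1, 0, 0], vector [0, 0, 1], vector [0, 1, 0]]}"

definition icosahedral_group :: "(real^3^3) set" where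
  "icosahedral_group = (let \<phi> = (1 + sqrt 5) / 2 in generate SO3
     {(1/2) *\<^sub>R vector [vector [\<phi> - 1, \<phi>, 1], vector [\<phi>, -1, \<phi> - 1], vector [1, \<phi> - 1, -\<phi>]],
      vector [vector [0, 0, 1], vector [1, 0, 0], vector [0, 1, 0]]})"


text \<open>The bodies other than the central one are indexed by the elements of \<open>H\<close>.
  The interaction term sums over ordered pairs, whence the factor \<open>1/2\<close>.\<close>

definition nbody_potential ::
    "(real^3^3) set \<Rightarrow> real \<Rightarrow> real^3 \<Rightarrow> (real^3^3 \<Rightarrow> real^3) \<Rightarrow> real" where
  "nbody_potential H \<mu> x0 x =
     - \<mu> * (\<Sum>L\<in>H. 1 / norm (x L - x0))
     - (1/2) * (\<Sum>L\<in>H. \<Sum>L'\<in>H - {L}. 1 / norm (x L - x L'))"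

definition has_acceleration :: "(real \<Rightarrow> real^3) \<Rightarrow> real^3 \<Rightarrow> real \<Rightarrow> bool" where
  "has_acceleration q a t \<longleftrightarrow>
     (\<exists>v. (\<forall>s. (q has_vector_derivative v s) (at s)) \<and> (v has_vector_derivative a) (at t))"

definition nbody_solution ::
    "(real^3^3) set \<Rightarrow> real \<Rightarrow> (real \<Rightarrow> real^3) \<Rightarrow> (real^3^3 \<Rightarrow> real \<Rightarrow> real^3) \<Rightarrow> bool" where
  "nbody_solution H \<mu> q0 q \<longleftrightarrow>
     (\<forall>t. (\<forall>L\<in>H. q L t \<noteq> q0 t) \<and> inj_on (\<lambda>L. q L t) H) \<and>
     (\<forall>t. \<exists>a. has_acceleration q0 a t \<and>
        GDERIV (\<lambda>x. nbody_potential H \<mu> x (\<lambda>K. q K t)) (q0 t) :> - (\<mu> *\<^sub>R a)) \<and>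
     (\<forall>t. \<forall>L\<in>H. \<exists>a. has_acceleration (q L) a t \<and>
        GDERIV (\<lambda>x. nbody_potential H \<mu> (q0 t) ((\<lambda>K. q K t)(L := x))) (q L t) :> - a)"


abbreviation velocity :: "(real \<Rightarrow> real^3) \<Rightarrow> real \<Rightarrow> real^3" where
  "velocity u t \<equiv> vector_derivative u (at t)"

text \<open>An \<open>H\<^sup>2\<close> class is identified with its \<open>C\<^sup>1\<close> representative \<open>u\<close>: its derivative is
  absolutely continuous, with a square integrable density \<open>w\<close>, the weak second derivative. By
  periodicity one period suffices. The integrals are gauge integrals; together the two integrability
  conditions say that \<open>w\<close> is Lebesgue measurable and in \<open>L\<^sup>2(0, 2\<pi>)\<close>.\<close>

definition has_second_weak_derivative :: "(real \<Rightarrow> real^3) \<Rightarrow> (real \<Rightarrow> real^3) \<Rightarrow> bool" where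
  "has_second_weak_derivative u w \<longleftrightarrow>
     (\<lambda>t. (norm (w t))\<^sup>2) integrable_on {0..2*pi} \<and>
     (\<forall>t\<in>{0..2*pi}. (w has_integral (velocity u t - velocity u 0)) {0..t})"

definition H2_periodic :: "(real \<Rightarrow> real^3) set" where
  "H2_periodic = {u. (\<forall>t. u (t + 2*pi) = u t) \<and> (\<forall>t. u differentiable (at t)) \<and>
                     (\<exists>w. has_second_weak_derivative u w)}"

text \<open>The choice is unique up to a null set in \<open>{0..2*pi}\<close>.\<close>

definition second_weak_derivative :: "(real \<Rightarrow> real^3) \<Rightarrow> real \<Rightarrow> real^3" where
  "second_weak_derivative u = (SOME w. has_second_weak_derivative u w)"

lemma has_second_weak_derivative_scaleR:
  assumes "\<And>t. u differentiable (at t)" "has_second_weak_derivative u w"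
  shows "has_second_weak_derivative (\<lambda>t. c *\<^sub>R u t) (\<lambda>t. c *\<^sub>R w t)"
proof -
  have v: "velocity (\<lambda>t. c *\<^sub>R u t) t = c *\<^sub>R velocity u t" for t
    using assms(1) by (simp add: vector_derivative_scaleR_at)
  have "(\<lambda>t. c\<^sup>2 * (norm (w t))\<^sup>2) integrable_on {0..2*pi}"
    using assms(2) unfolding has_second_weak_derivative_def
    by (intro integrable_on_mult_right) auto
  moreover have "((\<lambda>t. c *\<^sub>R w t) has_integral c *\<^sub>R (velocity u t - velocity u 0)) {0..t}"
    if "t \<in> {0..2*pi}" for t
    using assms(2) that unfolding has_second_weak_derivative_def
    by (intro has_integral_cmul) auto
  ultimately show ?thesis
    unfolding has_second_weak_derivative_def v by (simp add: power_mult_distrib scaleR_diff_right)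
qed

lemma second_weak_derivative_absolutely_integrable:
  assumes "has_second_weak_derivative u w"
  shows "w absolutely_integrable_on {0..2*pi}"
proof (rule measurable_bounded_by_integrable_imp_absolutely_integrable)
  have "w integrable_on {0..2*pi}"
    using assms unfolding has_second_weak_derivative_def
    by (metis atLeastAtMost_iff has_integral_integrable_integral order_refl pi_ge_zero
        mult_nonneg_nonneg zero_le_numeral)
  then show "w \<in> borel_measurable (lebesgue_on {0..2*pi})"
    by (rule integrable_imp_measurable)
  show "(\<lambda>t. 1 + (norm (w t))\<^sup>2) integrable_on {0..2*pi}"
    using assms unfolding has_second_weak_derivative_def
    by (intro integrable_add integrable_const_ivl) auto
  show "norm (w t) \<le> 1 + (norm (w t))\<^sup>2" for t
    using sum_squares_bound[of 1 "norm (w t)"] norm_ge_zero[of "w t"] unfolding power2_eq_square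
    by linarith
qed auto

lemma second_weak_derivative_inner_integrable:
  assumes "has_second_weak_derivative u w" "has_second_weak_derivative u' w'"
  shows "(\<lambda>t. w t \<bullet> w' t) integrable_on {0..2*pi}"
proof -
  have "(\<lambda>t. w t \<bullet> w' t) absolutely_integrable_on {0..2*pi}"
  proof (rule measurable_bounded_by_integrable_imp_absolutely_integrable)
    have "w \<in> borel_measurable (lebesgue_on {0..2*pi})"
         "w' \<in> borel_measurable (lebesgue_on {0..2*pi})"
      using assms[THEN second_weak_derivative_absolutely_integrable]
      by (auto intro!: integrable_imp_measurable set_lebesgue_integral_eq_integral(1))
    then show "(\<lambda>t. w t \<bullet> w' t) \<in> borel_measurable (lebesgue_on {0..2*pi})"
      by (rule borel_measurable_inner)
    show "(\<lambda>t. (norm (w t))\<^sup>2 + (norm (w' t))\<^sup>2) integrable_on {0..2*pi}"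
      using assms unfolding has_second_weak_derivative_def by (intro integrable_add) auto
    show "norm (w t \<bullet> w' t) \<le> (norm (w t))\<^sup>2 + (norm (w' t))\<^sup>2" for t
    proof -
      have "\<bar>w t \<bullet> w' t\<bar> \<le> norm (w t) * norm (w' t)" by (rule Cauchy_Schwarz_ineq2)
      also have "\<dots> \<le> (norm (w t))\<^sup>2 + (norm (w' t))\<^sup>2"
        using sum_squares_bound[of "norm (w t)" "norm (w' t)"]
          mult_nonneg_nonneg[OF norm_ge_zero[of "w t"] norm_ge_zero[of "w' t"]]
        by linarith
      finally show ?thesis by simp
    qed
  qed auto
  then show ?thesis by (rule set_lebesgue_integral_eq_integral(1))
qed

lemma has_second_weak_derivative_add:
  assumes u: "\<And>t. u differentiable (at t)" "has_second_weak_derivative u w"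
    and u': "\<And>t. u' differentiable (at t)" "has_second_weak_derivative u' w'"
  shows "has_second_weak_derivative (\<lambda>t. u t + u' t) (\<lambda>t. w t + w' t)"
proof -
  have v: "velocity (\<lambda>t. u t + u' t) t = velocity u t + velocity u' t" for t
    using u(1) u'(1) by (rule vector_derivative_add_at)
  have "(\<lambda>t. (norm (w t))\<^sup>2 + (norm (w' t))\<^sup>2 + 2 * (w t \<bullet> w' t)) integrable_on {0..2*pi}"
    using u(2) u'(2) second_weak_derivative_inner_integrable[OF u(2) u'(2)]
    unfolding has_second_weak_derivative_def
    by (intro integrable_add integrable_on_mult_right) auto
  moreover have "(norm (w t + w' t))\<^sup>2 = (norm (w t))\<^sup>2 + (norm (w' t))\<^sup>2 + 2 * (w t \<bullet> w' t)" for t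
    by (simp add: power2_norm_eq_inner inner_add_left inner_add_right inner_commute)
  moreover have "((\<lambda>t. w t + w' t) has_integral
      (velocity u t - velocity u 0) + (velocity u' t - velocity u' 0)) {0..t}"
    if "t \<in> {0..2*pi}" for t
    using u(2) u'(2) that unfolding has_second_weak_derivative_def
    by (intro has_integral_add) auto
  ultimately show ?thesis
    unfolding has_second_weak_derivative_def v by (simp add: algebra_simps)
qed

lemma has_second_weak_derivative_unique:
  assumes w: "has_second_weak_derivative u w" and w': "has_second_weak_derivative u w'"
  shows "\<exists>N. negligible N \<and> (\<forall>t\<in>{0..2*pi} - N. w t = w' t)"
proof -
  define g where "g t = (if t \<in> {0..2*pi} then w t - w' t else 0)" for t
  have g0: "((\<lambda>s. w s - w' s) has_integral 0) {0..t}" if "t \<in> {0..2*pi}" for t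
  proof -
    have "(w has_integral (velocity u t - velocity u 0)) {0..t}"
         "(w' has_integral (velocity u t - velocity u 0)) {0..t}"
      using w w' that unfolding has_second_weak_derivative_def by blast+
    from has_integral_diff[OF this] show ?thesis by simp
  qed
  have "((\<lambda>s. w s - w' s) has_integral 0) {0..2*pi}"
    by (rule g0) simp
  then have "(g has_integral 0) UNIV"
    unfolding g_def has_integral_restrict_UNIV .
  then have "g integrable_on UNIV" by blast
  then have int: "g integrable_on cbox a b" for a b
    using integrable_on_subcbox by blast
  have sub: "integral {x..y} g = 0" if "0 \<le> x" "x \<le> y" "y \<le> 2*pi" for x y
  proof -
    have z: "integral {0..t} g = 0" if "t \<in> {0..2*pi}" for t
    proof (rule integral_unique)
      show "(g has_integral 0) {0..t}"
        by (rule has_integral_eq[OF _ g0[OF that]]) (use that in \<open>auto simp: g_def\<close>)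
    qed
    have "g integrable_on {0..y}"
      using int[of 0 y] by (simp add: cbox_interval)
    then have "integral {0..x} g + integral {x..y} g = integral {0..y} g"
      by (rule Henstock_Kurzweil_Integration.integral_combine[OF that(1,2)])
    then show ?thesis using z[of x] z[of y] that by simp
  qed
  obtain N where N: "negligible N"
    and lim: "\<And>x e. \<lbrakk>x \<notin> N; 0 < e\<rbrakk> \<Longrightarrow> \<exists>d>0. \<forall>h. 0 < h \<and> h < d \<longrightarrow>
               norm (integral (cbox x (x + h *\<^sub>R One)) g /\<^sub>R h ^ DIM(real) - g x) < e"
    using integrable_ccontinuous_explicit[of g] int by blast
  have "w t = w' t" if t: "t \<in> {0..2*pi} - (N \<union> {2*pi})" for t
  proof (rule ccontr)
    assume "w t \<noteq> w' t"
    then have "norm (g t) > 0" using t by (auto simp: g_def)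
    then obtain d where d: "d > 0" "\<And>h. 0 < h \<Longrightarrow> h < d \<Longrightarrow>
        norm (integral (cbox t (t + h *\<^sub>R One)) g /\<^sub>R h ^ DIM(real) - g t) < norm (g t)"
      using lim[of t "norm (g t)"] t by auto
    define h where "h = min (d/2) (2*pi - t)"
    have "0 < h" "h < d" "t + h \<le> 2*pi" using d t by (auto simp: h_def)
    then show False using d(2)[of h] sub[of t "t + h"] t by simp
  qed
  moreover have "negligible (N \<union> {2*pi})" using N by simp
  ultimately show ?thesis by blast
qed

lemma velocity_continuous_on:
  assumes "has_second_weak_derivative u w"
  shows "continuous_on {0..2*pi} (velocity u)"
proof -
  have h: "\<forall>t\<in>{0..2*pi}. (w has_integral (velocity u t - velocity u 0)) {0..t}"
    using assms by (simp add: has_second_weak_derivative_def)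
  then have "w integrable_on {0..2*pi}"
    by (metis atLeastAtMost_iff has_integral_integrable_integral order_refl pi_ge_zero
        mult_nonneg_nonneg zero_le_numeral)
  then have "continuous_on {0..2*pi} (\<lambda>t. integral {0..t} w)"
    by (rule indefinite_integral_continuous_1)
  then have "continuous_on {0..2*pi} (\<lambda>t. integral {0..t} w + velocity u 0)"
    by (intro continuous_intros)
  then show ?thesis
  proof (rule continuous_on_eq)
    show "integral {0..t} w + velocity u 0 = velocity u t" if "t \<in> {0..2*pi}" for t
      using integral_unique[OF bspec[OF h that]] by simp
  qed
qed

lemma H2_periodic_scaleR:
  assumes "u \<in> H2_periodic" shows "(\<lambda>t. c *\<^sub>R u t) \<in> H2_periodic"
  using assms has_second_weak_derivative_scaleR[of u _ c]
  by (fastforce simp: H2_periodic_def)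

lemma H2_periodic_add:
  assumes "u \<in> H2_periodic" "u' \<in> H2_periodic" shows "(\<lambda>t. u t + u' t) \<in> H2_periodic"
  using assms has_second_weak_derivative_add[of u _ u']
  by (fastforce simp: H2_periodic_def)

lemma H2_periodic_zero: "(\<lambda>_. 0) \<in> H2_periodic"
  by (auto simp: H2_periodic_def has_second_weak_derivative_def intro!: exI[of _ "\<lambda>_. 0"])

typedef H2_loop = H2_periodic morphisms loop H2_loop
  using H2_periodic_zero by blast

lemma loop_differentiable: "loop u differentiable (at t)"
  using loop[of u] by (simp add: H2_periodic_def)

lemma loop_periodic: "loop u (t + 2*pi) = loop u t"
  using loop[of u] by (simp add: H2_periodic_def)

lemma second_weak_derivative_loop:
  "has_second_weak_derivative (loop u) (second_weak_derivative (loop u))"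
proof -
  have "\<exists>w. has_second_weak_derivative (loop u) w"
    using loop[of u] by (simp add: H2_periodic_def)
  then show ?thesis unfolding second_weak_derivative_def by (rule someI_ex)
qed

instantiation H2_loop :: real_inner
begin

definition zero_H2_loop :: H2_loop where "0 = H2_loop (\<lambda>_. 0)"
definition plus_H2_loop :: "H2_loop \<Rightarrow> H2_loop \<Rightarrow> H2_loop" where
  "u + v = H2_loop (\<lambda>t. loop u t + loop v t)"
definition scaleR_H2_loop :: "real \<Rightarrow> H2_loop \<Rightarrow> H2_loop" where
  "c *\<^sub>R u = H2_loop (\<lambda>t. c *\<^sub>R loop u t)"
definition uminus_H2_loop :: "H2_loop \<Rightarrow> H2_loop" where
  "- u = (-1) *\<^sub>R u" for u :: H2_loop
definition minus_H2_loop :: "H2_loop \<Rightarrow> H2_loop \<Rightarrow> H2_loop" where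
  "u - v = u + (- v)" for u v :: H2_loop
definition inner_H2_loop :: "H2_loop \<Rightarrow> H2_loop \<Rightarrow> real" where
  "u \<bullet> v = integral {0..2*pi} (\<lambda>t. loop u t \<bullet> loop v t)
         + integral {0..2*pi} (\<lambda>t. velocity (loop u) t \<bullet> velocity (loop v) t)
         + integral {0..2*pi}
             (\<lambda>t. second_weak_derivative (loop u) t \<bullet> second_weak_derivative (loop v) t)"
definition norm_H2_loop :: "H2_loop \<Rightarrow> real" where
  "norm u = sqrt (u \<bullet> u)" for u :: H2_loop
definition sgn_H2_loop :: "H2_loop \<Rightarrow> H2_loop" where
  "sgn u = inverse (norm u) *\<^sub>R u" for u :: H2_loop
definition dist_H2_loop :: "H2_loop \<Rightarrow> H2_loop \<Rightarrow> real" where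
  "dist u v = norm (u - v)" for u v :: H2_loop
definition uniformity_H2_loop :: "(H2_loop \<times> H2_loop) filter" where
  "uniformity_H2_loop = (INF e\<in>{0<..}. principal {(u, v). dist u v < e})"
definition open_H2_loop :: "H2_loop set \<Rightarrow> bool" where
  "open_H2_loop U = (\<forall>u\<in>U. eventually (\<lambda>(u', v). u' = u \<longrightarrow> v \<in> U) uniformity)"

lemma loop_zero: "loop 0 t = 0"
  by (simp add: zero_H2_loop_def H2_loop_inverse H2_periodic_zero)

lemma loop_add: "loop (u + v) t = loop u t + loop v t"
  using loop by (simp add: plus_H2_loop_def H2_loop_inverse H2_periodic_add)

lemma loop_scaleR: "loop (c *\<^sub>R u) t = c *\<^sub>R loop u t"
  using loop by (simp add: scaleR_H2_loop_def H2_loop_inverse H2_periodic_scaleR)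

lemma loop_uminus: "loop (- u) t = - loop u t"
  by (simp add: uminus_H2_loop_def loop_scaleR)

lemma loop_diff: "loop (u - v) t = loop u t - loop v t"
  by (simp add: minus_H2_loop_def loop_add loop_uminus)

lemma H2_loop_eqI: "(\<And>t. loop u t = loop v t) \<Longrightarrow> u = v"
  by (simp add: loop_inject[symmetric] fun_eq_iff)

lemma velocity_loop_add:
  "velocity (loop (u + v)) t = velocity (loop u) t + velocity (loop v) t"
  using vector_derivative_add_at[OF loop_differentiable[of u t] loop_differentiable[of v t]]
  by (simp add: loop_add[abs_def])

lemma velocity_loop_scaleR: "velocity (loop (c *\<^sub>R u)) t = c *\<^sub>R velocity (loop u) t"
  using vector_derivative_scaleR_at[OF _ loop_differentiable[of u t], of "\<lambda>_. c"]
  by (simp add: loop_scaleR[abs_def])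

lemma loop_continuous_on: "continuous_on S (loop u)"
  using loop_differentiable
  by (meson continuous_at_imp_continuous_on differentiable_imp_continuous_within)

lemma integrable_loop: "(\<lambda>t. loop u t \<bullet> loop v t) integrable_on {0..2*pi}"
  by (intro integrable_continuous_interval continuous_intros loop_continuous_on)

lemma integrable_velocity:
  "(\<lambda>t. velocity (loop u) t \<bullet> velocity (loop v) t) integrable_on {0..2*pi}"
  by (intro integrable_continuous_interval continuous_on_inner
      velocity_continuous_on[OF second_weak_derivative_loop])

lemma integrable_second:
  "(\<lambda>t. second_weak_derivative (loop u) t \<bullet> second_weak_derivative (loop v) t)
     integrable_on {0..2*pi}"
  by (rule second_weak_derivative_inner_integrable[OF second_weak_derivative_loop
        second_weak_derivative_loop])

lemma second_loop_add:
  "\<exists>N. negligible N \<and> (\<forall>t\<in>{0..2*pi} - N. second_weak_derivative (loop (u + v)) t =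
     second_weak_derivative (loop u) t + second_weak_derivative (loop v) t)"
proof (rule has_second_weak_derivative_unique[OF second_weak_derivative_loop])
  show "has_second_weak_derivative (loop (u + v))
    (\<lambda>t. second_weak_derivative (loop u) t + second_weak_derivative (loop v) t)"
    using has_second_weak_derivative_add[OF loop_differentiable second_weak_derivative_loop
        loop_differentiable second_weak_derivative_loop, of u v]
    by (simp add: loop_add[abs_def])
qed

lemma second_loop_scaleR:
  "\<exists>N. negligible N \<and> (\<forall>t\<in>{0..2*pi} - N. second_weak_derivative (loop (c *\<^sub>R u)) t =
     c *\<^sub>R second_weak_derivative (loop u) t)"
proof (rule has_second_weak_derivative_unique[OF second_weak_derivative_loop])
  show "has_second_weak_derivative (loop (c *\<^sub>R u)) (\<lambda>t. c *\<^sub>R second_weak_derivative (loop u) t)"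
    using has_second_weak_derivative_scaleR[OF loop_differentiable second_weak_derivative_loop, of c u]
    by (simp add: loop_scaleR[abs_def])
qed

instance
proof
  fix u v w :: H2_loop and a b :: real
  show "u + v + w = u + (v + w)" "u + v = v + u" "0 + u = u" "- u + u = 0" "u - v = u + - v"
    by (auto intro!: H2_loop_eqI simp: loop_add loop_zero loop_uminus loop_diff)
  show "a *\<^sub>R (u + v) = a *\<^sub>R u + a *\<^sub>R v" "(a + b) *\<^sub>R u = a *\<^sub>R u + b *\<^sub>R u"
    "a *\<^sub>R b *\<^sub>R u = (a * b) *\<^sub>R u" "1 *\<^sub>R u = u"
    by (auto intro!: H2_loop_eqI simp: loop_add loop_scaleR algebra_simps)
  show "dist u v = norm (u - v)" by (rule dist_H2_loop_def)
  show "sgn u = inverse (norm u) *\<^sub>R u" by (rule sgn_H2_loop_def)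
  show "norm u = sqrt (u \<bullet> u)" by (rule norm_H2_loop_def)
  show "uniformity = (INF e\<in>{0<..}. principal {(u, v). dist (u::H2_loop) v < e})"
    by (rule uniformity_H2_loop_def)
  show "open U = (\<forall>u\<in>U. eventually (\<lambda>(u', v). u' = u \<longrightarrow> v \<in> U) uniformity)" for U :: "H2_loop set"
    by (rule open_H2_loop_def)
  show "u \<bullet> v = v \<bullet> u"
    by (simp add: inner_H2_loop_def inner_commute)
  show "(u + v) \<bullet> w = u \<bullet> w + v \<bullet> w"
  proof -
    obtain N where N: "negligible N" "\<And>t. t \<in> {0..2*pi} - N \<Longrightarrow>
        second_weak_derivative (loop (u + v)) t =
        second_weak_derivative (loop u) t + second_weak_derivative (loop v) t"
      using second_loop_add by meson
    have "integral {0..2*pi}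
        (\<lambda>t. second_weak_derivative (loop (u + v)) t \<bullet> second_weak_derivative (loop w) t) =
      integral {0..2*pi}
        (\<lambda>t. second_weak_derivative (loop u) t \<bullet> second_weak_derivative (loop w) t
           + second_weak_derivative (loop v) t \<bullet> second_weak_derivative (loop w) t)"
      by (rule integral_spike[OF N(1)]) (simp add: N(2) inner_add_left)
    then show ?thesis
      unfolding inner_H2_loop_def
      by (simp add: loop_add velocity_loop_add inner_add_left integrable_loop integrable_velocity
          integrable_second Henstock_Kurzweil_Integration.integral_add)
  qed
  show scale: "(a *\<^sub>R u) \<bullet> v = a * (u \<bullet> v)" for a :: real and u v :: H2_loop
  proof -
    obtain N where N: "negligible N" "\<And>t. t \<in> {0..2*pi} - N \<Longrightarrow>
        second_weak_derivative (loop (a *\<^sub>R u)) t = a *\<^sub>R second_weak_derivative (loop u) t"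
      using second_loop_scaleR by meson
    have "integral {0..2*pi}
        (\<lambda>t. second_weak_derivative (loop (a *\<^sub>R u)) t \<bullet> second_weak_derivative (loop v) t) =
      integral {0..2*pi}
        (\<lambda>t. a * (second_weak_derivative (loop u) t \<bullet> second_weak_derivative (loop v) t))"
      by (rule integral_spike[OF N(1)]) (simp add: N(2))
    then show ?thesis
      unfolding inner_H2_loop_def
      by (simp add: loop_scaleR velocity_loop_scaleR distrib_left)
  qed
  have nn: "0 \<le> integral {0..2*pi} (\<lambda>t. loop u t \<bullet> loop u t)"
    "0 \<le> integral {0..2*pi} (\<lambda>t. velocity (loop u) t \<bullet> velocity (loop u) t)"
    "0 \<le> integral {0..2*pi}
       (\<lambda>t. second_weak_derivative (loop u) t \<bullet> second_weak_derivative (loop u) t)"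
    by (auto intro!: Henstock_Kurzweil_Integration.integral_nonneg
        integrable_loop integrable_velocity integrable_second)
  then show "0 \<le> u \<bullet> u" by (simp add: inner_H2_loop_def)
  show "u \<bullet> u = 0 \<longleftrightarrow> u = 0"
  proof
    assume "u \<bullet> u = 0"
    then have "integral {0..2*pi} (\<lambda>t. loop u t \<bullet> loop u t) = 0"
      using nn by (simp add: inner_H2_loop_def)
    then have "((\<lambda>t. loop u t \<bullet> loop u t) has_integral 0) (cbox 0 (2*pi))"
      using integrable_loop[of u u] by (metis cbox_interval has_integral_integral)
    then have z: "loop u t = 0" if "t \<in> {0..2*pi}" for t
    proof -
      have "continuous_on (cbox 0 (2*pi)) (\<lambda>t. loop u t \<bullet> loop u t)"
        by (intro continuous_on_inner loop_continuous_on)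
      moreover have "box 0 (2*pi) \<noteq> {}" by (simp add: not_le)
      ultimately have "loop u t \<bullet> loop u t = 0"
        using has_integral_0_cbox_imp_0[of 0 "2*pi" "\<lambda>t. loop u t \<bullet> loop u t" t] that
          \<open>(_ has_integral 0) (cbox 0 (2*pi))\<close> by (simp add: cbox_interval)
      then show ?thesis by simp
    qed
    have shift: "loop u (t + of_int k * (2*pi)) = loop u t" for t k
    proof (induction k rule: int_induct[where k = 0])
      case (step1 i)
      then show ?case using loop_periodic[of u "t + of_int i * (2*pi)"] by (simp add: algebra_simps)
    next
      case (step2 i)
      then show ?case using loop_periodic[of u "t + of_int (i - 1) * (2*pi)"]
        by (simp add: algebra_simps)
    qed simp
    show "u = 0"
    proof (rule H2_loop_eqI)
      fix t
      define k where "k = \<lfloor>t / (2*pi)\<rfloor>"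
      have "of_int k \<le> t / (2*pi)" "t / (2*pi) < of_int k + 1"
        unfolding k_def by linarith+
      then have "t - of_int k * (2*pi) \<in> {0..2*pi}"
        by (simp add: field_simps)
      then have "loop u (t - of_int k * (2*pi)) = 0" by (rule z)
      then show "loop u t = loop 0 t"
        using shift[of "t - of_int k * (2*pi)" k] by (simp add: loop_zero)
    qed
  next
    assume "u = 0"
    then have "u = 0 *\<^sub>R u"
      by (auto intro!: H2_loop_eqI simp: loop_zero loop_scaleR)
    then show "u \<bullet> u = 0"
      using scale[of 0 u u] by simp
  qed
qed

end


definition action0 :: "(real \<Rightarrow> real^3) \<Rightarrow> real" where
  "action0 u = integral {0..2*pi} (\<lambda>\<tau>. (norm (velocity u \<tau>))\<^sup>2 / 2 + 1 / norm (u \<tau>))"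

definition action1 :: "(real^3^3) set \<Rightarrow> (real \<Rightarrow> real^3) \<Rightarrow> real" where
  "action1 H u =
     (1/2) * integral {0..2*pi} (\<lambda>\<tau>. \<Sum>L\<in>H - {mat 1}. 1 / norm (u \<tau> - L *v u \<tau>))"

definition reduced_action :: "(real^3^3) set \<Rightarrow> real \<Rightarrow> H2_loop \<Rightarrow> real" where
  "reduced_action H \<epsilon> u = action0 (loop u) + \<epsilon> * action1 H (loop u)"

definition collision_free :: "(real^3^3) set \<Rightarrow> H2_loop set" where
  "collision_free H =
     {u. \<forall>\<tau>. loop u \<tau> \<noteq> 0 \<and> (\<forall>L\<in>H - {mat 1}. loop u \<tau> \<noteq> L *v loop u \<tau>)}"

definition critical_point :: "(real^3^3) set \<Rightarrow> real \<Rightarrow> H2_loop \<Rightarrow> bool" where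
  "critical_point H \<epsilon> u \<longleftrightarrow>
     u \<in> collision_free H \<and> (reduced_action H \<epsilon> has_derivative (\<lambda>_. 0)) (at u)"


definition matrix_exp :: "real^3^3 \<Rightarrow> real^3^3" where
  "matrix_exp M = (\<Sum>k. (1 / fact k) *\<^sub>R (((**) M ^^ k) (mat 1)))"

definition J1 :: "real^3^3" where
  "J1 = vector [vector [0, 0, 0], vector [0, 0, -1], vector [0, 1, 0]]"

definition J2 :: "real^3^3" where
  "J2 = vector [vector [0, 0, -1], vector [0, 0, 0], vector [1, 0, 0]]"

definition J3 :: "real^3^3" where
  "J3 = vector [vector [0, -1, 0], vector [1, 0, 0], vector [0, 0, 0]]"

definition kepler_radius :: "real \<Rightarrow> real \<Rightarrow> real" where
  "kepler_radius e \<theta> = (1 - e\<^sup>2) / (1 + e * cos \<theta>)"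

definition true_anomaly :: "real \<Rightarrow> real \<Rightarrow> real" where
  "true_anomaly e = (THE \<theta>. \<theta> 0 = 0 \<and>
     (\<forall>\<tau>. (\<theta> has_real_derivative sqrt (1 - e\<^sup>2) / (kepler_radius e (\<theta> \<tau>))\<^sup>2) (at \<tau>)))"

definition kepler_ellipse :: "real \<Rightarrow> real \<Rightarrow> real^3" where
  "kepler_ellipse e \<tau> = (let \<theta> = true_anomaly e \<tau> in
     kepler_radius e \<theta> *\<^sub>R vector [cos \<theta>, sin \<theta>, 0])"

definition orientation :: "real^2 \<Rightarrow> real^3^3" where
  "orientation \<psi> = matrix_exp ((\<psi>$1) *\<^sub>R J1) ** matrix_exp ((\<psi>$2) *\<^sub>R J2)"

text \<open>The angle \<open>\<psi>\<^sub>3\<close> with \<open>\<xi> = (e cos \<psi>\<^sub>3, e sin \<psi>\<^sub>3)\<close> is taken to be the principal argument.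
  The value does not depend on that choice: the orbit is \<open>2\<pi>\<close>-periodic in \<open>\<psi>\<^sub>3\<close>, and independent
  of \<open>\<psi>\<^sub>3\<close> if \<open>\<xi> = 0\<close>.\<close>

definition kepler_chart :: "real^2 \<Rightarrow> real^2 \<Rightarrow> real \<Rightarrow> real^3" where
  "kepler_chart \<xi> \<psi> \<tau> = (let \<psi>3 = Arg (Complex (\<xi>$1) (\<xi>$2)) in
     (orientation \<psi> ** matrix_exp (\<psi>3 *\<^sub>R J3)) *v kepler_ellipse (norm \<xi>) (\<tau> - \<psi>3))"

definition circular_orbit :: "real^2 \<Rightarrow> real \<Rightarrow> real^3" where
  "circular_orbit \<psi> \<tau> = orientation \<psi> *v vector [cos \<tau>, sin \<tau>, 0]"

text \<open>The coordinates of the argument are \<open>(\<xi>\<^sub>1, \<xi>\<^sub>2, \<psi>\<^sub>1, \<psi>\<^sub>2)\<close>.\<close>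

definition Psi :: "(real^3^3) set \<Rightarrow> real^4 \<Rightarrow> real" where
  "Psi H p = action1 H (kepler_chart (vector [p$1, p$2]) (vector [p$3, p$4]))"

definition partial_derivative :: "'n::finite \<Rightarrow> (real^'n \<Rightarrow> real) \<Rightarrow> real^'n \<Rightarrow> real" where
  "partial_derivative i f p = deriv (\<lambda>s. f (p + s *\<^sub>R axis i 1)) 0"

definition hessian :: "(real^'n::finite \<Rightarrow> real) \<Rightarrow> real^'n \<Rightarrow> real^'n^'n" where
  "hessian f p = (\<chi> i j. partial_derivative i (partial_derivative j f) p)"

end

theory Submission
  imports Defs
begin

text \<open>Write a solution near the circular orbit as \<open>k(q, t) + \<epsilon> w(t)\<close>, where \<open>k(q, \<cdot>)\<close> is the Kepler
  ellipse with parameters \<open>q\<close>. After division by \<open>\<epsilon>\<close> the equation of motion becomes a regular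
  boundary value problem for \<open>w\<close>, \<open>q\<close> and two scalars: the velocity excess \<open>\<sigma>\<close> along the ellipse and a
  multiplier \<open>\<kappa>\<close> for the velocity jump at the end of the period. At \<open>\<epsilon> = 0\<close> its linearisation in \<open>w\<close>
  has the Jacobi fields of the Kepler problem as cokernel, and pairing with them turns solvability
  into the critical point condition for \<open>\<Psi>\<close>, the derivative in \<open>q\<close> into the Hessian of \<open>\<Psi>\<close>. Hence the
  implicit function theorem in the space of continuous functions yields the branch, and conservation
  of energy shows that the multiplier vanishes. Conversely a critical point close to the
  circular orbit in \<open>H\<^sup>2\<close> is \<open>C\<^sup>1\<close>-close; a time shift puts its initial state on an ellipse of the chart,
  and the linearised problem bounds \<open>w\<close>, so that it lies in the domain of uniqueness.
  The Hessian is invertible only if \<open>H\<close> is finite, since for infinite \<open>H\<close> the sums are \<open>0\<close>.\<close>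

section \<open>Continuously differentiable maps\<close>

text \<open>At \<open>\<epsilon> = 0\<close> every ellipse of the chart and each of its time shifts
  is a \<open>2\<pi>\<close>-periodic solution. The linearised equation thus has a five-dimensional
  space of periodic solutions, and the implicit function theorem does not apply to the action
  itself; dividing the deviation by \<open>\<epsilon>\<close> lifts the degeneracy. A state near the
  circle has six coordinates: four for the ellipse, one for the phase, one for the energy. The phase
  is removed by prescribing \<open>w(0) = 0\<close> and \<open>w'(0)\<close> parallel to the
  velocity of the ellipse, while \<open>\<sigma>\<close> carries the energy. The six numbers
  \<open>q\<close>, \<open>\<sigma>\<close>, \<open>\<kappa>\<close> then match the six closing
  conditions on position and velocity. Continuous functions suffice as unknowns because a solution
  regains two derivatives from the equation. A second obstacle is smoothness of the chart at
  eccentricity 0, where the perihelion is undefined; it is met by coordinates built on the eccentric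
  longitude. The condition on the cosine says that the two orientation angles are independent
  coordinates of the orbital plane.\<close>

definition C1_on :: "'a::real_normed_vector set \<Rightarrow> ('a \<Rightarrow> 'b::real_normed_vector) \<Rightarrow> bool" where
  "C1_on S f \<longleftrightarrow>
     (\<exists>f'. (\<forall>x\<in>S. (f has_derivative blinfun_apply (f' x)) (at x)) \<and> continuous_on S f')"

text \<open>Reduced to \<open>C1_on\<close> for the derivative as a map into the bounded linear
  operators, so that closure properties of order two follow from those of order one. All derivatives
  are full derivatives at the point, not derivatives within the set.\<close>

definition C2_on :: "'a::real_normed_vector set \<Rightarrow> ('a \<Rightarrow> 'b::real_normed_vector) \<Rightarrow> bool" where
  "C2_on S f \<longleftrightarrow>
     (\<exists>f'. (\<forall>x\<in>S. (f has_derivative blinfun_apply (f' x)) (at x)) \<and> C1_on S f')"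

lemma C1_onI:
  "(\<And>x. x \<in> S \<Longrightarrow> (f has_derivative blinfun_apply (f' x)) (at x)) \<Longrightarrow> continuous_on S f' \<Longrightarrow> C1_on S f"
  by (auto simp: C1_on_def)

lemma C2_onI:
  "(\<And>x. x \<in> S \<Longrightarrow> (f has_derivative blinfun_apply (f' x)) (at x)) \<Longrightarrow> C1_on S f' \<Longrightarrow> C2_on S f"
  by (auto simp: C2_on_def)

lemma C1_on_subset: "C1_on S f \<Longrightarrow> T \<subseteq> S \<Longrightarrow> C1_on T f"
  unfolding C1_on_def by (meson continuous_on_subset subsetD)

lemma C1_on_continuous: "C1_on S f \<Longrightarrow> continuous_on S f"
  unfolding C1_on_def
  by (meson continuous_at_imp_continuous_on has_derivative_continuous)

lemma C2_on_imp_C1_on: "C2_on S f \<Longrightarrow> C1_on S f"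
  unfolding C2_on_def by (auto intro!: C1_onI dest: C1_on_continuous)

lemma C1_on_derivative_continuous:
  assumes "C1_on S f" "\<And>x. x \<in> S \<Longrightarrow> (f has_derivative blinfun_apply (f' x)) (at x)"
  shows "continuous_on S f'"
proof -
  obtain g where g: "\<And>x. x \<in> S \<Longrightarrow> (f has_derivative blinfun_apply (g x)) (at x)" "continuous_on S g"
    using assms(1) by (auto simp: C1_on_def)
  have "g x = f' x" if "x \<in> S" for x
    using has_derivative_unique[OF g(1)[OF that] assms(2)[OF that]] by (simp add: blinfun_apply_inject)
  then show ?thesis using g(2) by (metis (mono_tags, lifting) continuous_on_cong)
qed

lemma C1_on_cong_open:
  assumes "open S" "\<And>x. x \<in> S \<Longrightarrow> f x = g x" "C1_on S f"
  shows "C1_on S g"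
proof -
  obtain f' where f': "\<And>x. x \<in> S \<Longrightarrow> (f has_derivative blinfun_apply (f' x)) (at x)" "continuous_on S f'"
    using assms(3) by (auto simp: C1_on_def)
  show ?thesis
    by (rule C1_onI[OF has_derivative_transform_within_open[OF f'(1) assms(1)] f'(2)])
      (use assms in auto)
qed

text \<open>Derivatives at a point are unique, so one global choice of the derivative agrees with
  every local witness and inherits its continuity.\<close>

lemma C1_on_locally:
  assumes "\<And>x. x \<in> S \<Longrightarrow> \<exists>U. open U \<and> x \<in> U \<and> C1_on U f"
  shows "C1_on S f"
proof -
  define f' where "f' x = (SOME A. (f has_derivative blinfun_apply A) (at x))" for x
  have f': "(f has_derivative blinfun_apply (f' x)) (at x)"
    if "C1_on U f" "x \<in> U" for U x
  proof -
    have "\<exists>A. (f has_derivative blinfun_apply A) (at x)" using that by (auto simp: C1_on_def)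
    then show ?thesis unfolding f'_def by (rule someI_ex)
  qed
  show ?thesis
  proof (rule C1_onI)
    show "(f has_derivative blinfun_apply (f' x)) (at x)" if "x \<in> S" for x
      using assms[OF that] f' by blast
    show "continuous_on S f'"
    proof (rule continuous_at_imp_continuous_on, rule ballI)
      fix x assume "x \<in> S"
      then obtain U where U: "open U" "x \<in> U" "C1_on U f" using assms by blast
      then have "continuous_on U f'" using C1_on_derivative_continuous f' by blast
      then show "isCont f' x" using U continuous_on_eq_continuous_at by blast
    qed
  qed
qed

lemma C1_on_const [simp, intro]: "C1_on S (\<lambda>_. c)"
  by (rule C1_onI[where f' = "\<lambda>_. 0"]) (auto simp: zero_blinfun.rep_eq)

lemma C2_on_const [simp, intro]: "C2_on S (\<lambda>_. c)"
  by (rule C2_onI[where f' = "\<lambda>_. 0"]) (auto simp: zero_blinfun.rep_eq)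

lemma C2_on_bounded_linear: "bounded_linear f \<Longrightarrow> C2_on S f"
  by (rule C2_onI[where f' = "\<lambda>_. Blinfun f"])
    (auto simp: bounded_linear_Blinfun_apply bounded_linear_imp_has_derivative)

lemma C1_on_bounded_linear: "bounded_linear f \<Longrightarrow> C1_on S f"
  by (rule C2_on_imp_C1_on[OF C2_on_bounded_linear])

lemma C1_on_compose:
  assumes g: "C1_on T g" and f: "C1_on S f" and im: "f ` S \<subseteq> T"
  shows "C1_on S (\<lambda>x. g (f x))"
proof -
  obtain g' where g': "\<And>x. x \<in> T \<Longrightarrow> (g has_derivative blinfun_apply (g' x)) (at x)" "continuous_on T g'"
    using g by (auto simp: C1_on_def)
  obtain f' where f': "\<And>x. x \<in> S \<Longrightarrow> (f has_derivative blinfun_apply (f' x)) (at x)" "continuous_on S f'"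
    using f by (auto simp: C1_on_def)
  show ?thesis
  proof (rule C1_onI[where f' = "\<lambda>x. g' (f x) o\<^sub>L f' x"])
    show "((\<lambda>x. g (f x)) has_derivative blinfun_apply (g' (f x) o\<^sub>L f' x)) (at x)" if "x \<in> S" for x
      using has_derivative_compose[OF f'(1)[OF that] g'(1)] im that
      by (auto simp: blinfun_compose.rep_eq o_def)
    show "continuous_on S (\<lambda>x. g' (f x) o\<^sub>L f' x)"
      by (intro continuous_intros f' continuous_on_compose2[OF g'(2) C1_on_continuous[OF f]]) (use im in auto)
  qed
qed

lemma C1_on_Pair:
  assumes f: "C1_on S f" and g: "C1_on S g"
  shows "C1_on S (\<lambda>x. (f x, g x))"
proof -
  obtain g' where g': "\<And>x. x \<in> S \<Longrightarrow> (g has_derivative blinfun_apply (g' x)) (at x)" "continuous_on S g'"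
    using g by (auto simp: C1_on_def)
  obtain f' where f': "\<And>x. x \<in> S \<Longrightarrow> (f has_derivative blinfun_apply (f' x)) (at x)" "continuous_on S f'"
    using f by (auto simp: C1_on_def)
  have b: "bounded_linear (\<lambda>y::'b. (y, 0::'c))" "bounded_linear (\<lambda>y::'c. (0::'b, y))"
    by (intro bounded_linear_intros)+
  show ?thesis
  proof (rule C1_onI[where f' = "\<lambda>x. (Blinfun (\<lambda>y. (y,0)) o\<^sub>L f' x) + (Blinfun (\<lambda>y. (0,y)) o\<^sub>L g' x)"])
    show "((\<lambda>x. (f x, g x)) has_derivative
        blinfun_apply ((Blinfun (\<lambda>y. (y,0)) o\<^sub>L f' x) + (Blinfun (\<lambda>y. (0,y)) o\<^sub>L g' x))) (at x)" if "x \<in> S" for x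
      using has_derivative_Pair[OF f'(1)[OF that] g'(1)[OF that]]
      by (simp add: plus_blinfun.rep_eq bounded_linear_Blinfun_apply[OF b(1)] bounded_linear_Blinfun_apply[OF b(2)])
    show "continuous_on S (\<lambda>x. (Blinfun (\<lambda>y. (y,0)) o\<^sub>L f' x) + (Blinfun (\<lambda>y. (0,y)) o\<^sub>L g' x))"
      by (intro continuous_intros f' g')
  qed
qed

text \<open>The derivative of a bounded bilinear map depends linearly on the base point. Composition
  with a pair then covers every product used below.\<close>

lemma C2_on_bilinear_pair:
  assumes "bounded_bilinear B"
  shows "C2_on S (\<lambda>p. B (fst p) (snd p))"
proof -
  interpret bounded_bilinear B by fact
  show ?thesis
  proof (rule C2_onI[where f' = "\<lambda>p. (prod_right (fst p) o\<^sub>L snd_blinfun) + (prod_left (snd p) o\<^sub>L fst_blinfun)"])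
    show "((\<lambda>p. B (fst p) (snd p)) has_derivative
      blinfun_apply ((prod_right (fst p) o\<^sub>L snd_blinfun) + (prod_left (snd p) o\<^sub>L fst_blinfun))) (at p)" for p
      by (auto intro!: derivative_eq_intros FDERIV simp: plus_blinfun.rep_eq prod_left.rep_eq prod_right.rep_eq)
    show "C1_on S (\<lambda>p. (prod_right (fst p) o\<^sub>L snd_blinfun) + (prod_left (snd p) o\<^sub>L fst_blinfun))"
      by (intro C1_on_bounded_linear bounded_linear_intros
        bounded_linear_compose[OF bounded_linear_prod_left] bounded_linear_compose[OF bounded_linear_prod_right]
        bounded_linear_fst bounded_linear_snd bounded_linear_add
        bounded_linear_compose[OF bounded_bilinear.bounded_linear_left[OF bounded_bilinear_blinfun_compose]])
  qed
qed

lemma C1_on_bilinear: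
  assumes "bounded_bilinear B" "C1_on S f" "C1_on S g"
  shows "C1_on S (\<lambda>x. B (f x) (g x))"
  using C1_on_compose[OF C2_on_imp_C1_on[OF C2_on_bilinear_pair[OF assms(1)]] C1_on_Pair[OF assms(2,3)], of UNIV]
  by simp

lemma C1_on_linear:
  assumes "bounded_linear B" "C1_on S f"
  shows "C1_on S (\<lambda>x. B (f x))"
  using C1_on_compose[OF C1_on_bounded_linear[OF assms(1)] assms(2), of UNIV] by simp

text \<open>By the chain rule the derivative is an operator product of two maps of class C1, and the
  product of operators is bounded bilinear.\<close>

lemma C2_on_compose:
  assumes g: "C2_on T g" and f: "C2_on S f" and im: "f ` S \<subseteq> T"
  shows "C2_on S (\<lambda>x. g (f x))"
proof -
  obtain g' where g': "\<And>x. x \<in> T \<Longrightarrow> (g has_derivative blinfun_apply (g' x)) (at x)" "C1_on T g'"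
    using g by (auto simp: C2_on_def)
  obtain f' where f': "\<And>x. x \<in> S \<Longrightarrow> (f has_derivative blinfun_apply (f' x)) (at x)" "C1_on S f'"
    using f by (auto simp: C2_on_def)
  show ?thesis
  proof (rule C2_onI[where f' = "\<lambda>x. g' (f x) o\<^sub>L f' x"])
    show "((\<lambda>x. g (f x)) has_derivative blinfun_apply (g' (f x) o\<^sub>L f' x)) (at x)" if "x \<in> S" for x
      using has_derivative_compose[OF f'(1)[OF that] g'(1)] im that
      by (auto simp: blinfun_compose.rep_eq o_def)
    show "C1_on S (\<lambda>x. g' (f x) o\<^sub>L f' x)"
      by (rule C1_on_bilinear[OF bounded_bilinear_blinfun_compose C1_on_compose[OF g'(2) C2_on_imp_C1_on[OF f] im] f'(2)])
  qed
qed

lemma C2_on_Pair: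
  assumes f: "C2_on S f" and g: "C2_on S g"
  shows "C2_on S (\<lambda>x. (f x, g x))"
proof -
  obtain g' where g': "\<And>x. x \<in> S \<Longrightarrow> (g has_derivative blinfun_apply (g' x)) (at x)" "C1_on S g'"
    using g by (auto simp: C2_on_def)
  obtain f' where f': "\<And>x. x \<in> S \<Longrightarrow> (f has_derivative blinfun_apply (f' x)) (at x)" "C1_on S f'"
    using f by (auto simp: C2_on_def)
  have b: "bounded_linear (\<lambda>y::'b. (y, 0::'c))" "bounded_linear (\<lambda>y::'c. (0::'b, y))"
    by (intro bounded_linear_intros)+
  show ?thesis
  proof (rule C2_onI[where f' = "\<lambda>x. (Blinfun (\<lambda>y. (y,0)) o\<^sub>L f' x) + (Blinfun (\<lambda>y. (0,y)) o\<^sub>L g' x)"])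
    show "((\<lambda>x. (f x, g x)) has_derivative
        blinfun_apply ((Blinfun (\<lambda>y. (y,0)) o\<^sub>L f' x) + (Blinfun (\<lambda>y. (0,y)) o\<^sub>L g' x))) (at x)" if "x \<in> S" for x
      using has_derivative_Pair[OF f'(1)[OF that] g'(1)[OF that]]
      by (simp add: plus_blinfun.rep_eq bounded_linear_Blinfun_apply[OF b(1)] bounded_linear_Blinfun_apply[OF b(2)])
    have "bounded_linear (\<lambda>p. (Blinfun (\<lambda>y::'b. (y,0::'c)) o\<^sub>L (fst p :: 'a \<Rightarrow>\<^sub>L 'b)) + (Blinfun (\<lambda>y::'c. (0::'b,y)) o\<^sub>L (snd p)))"
      by (intro bounded_linear_add bounded_linear_compose[OF bounded_bilinear.bounded_linear_right[OF bounded_bilinear_blinfun_compose]]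
        bounded_linear_fst bounded_linear_snd)
    from C1_on_linear[OF this C1_on_Pair[OF f'(2) g'(2)]]
    show "C1_on S (\<lambda>x. (Blinfun (\<lambda>y. (y,0)) o\<^sub>L f' x) + (Blinfun (\<lambda>y. (0,y)) o\<^sub>L g' x))"
      by simp
  qed
qed

lemma C2_on_bilinear:
  assumes "bounded_bilinear B" "C2_on S f" "C2_on S g"
  shows "C2_on S (\<lambda>x. B (f x) (g x))"
  using C2_on_compose[OF C2_on_bilinear_pair[OF assms(1)] C2_on_Pair[OF assms(2,3)], of UNIV]
  by simp

lemma C2_on_linear:
  assumes "bounded_linear B" "C2_on S f"
  shows "C2_on S (\<lambda>x. B (f x))"
  using C2_on_compose[OF C2_on_bounded_linear[OF assms(1)] assms(2), of UNIV] by simp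

section \<open>Closure of C1 and C2 maps under elementary operations\<close>

lemma C1_on_vector_derivative:
  assumes "\<And>x. x \<in> T \<Longrightarrow> (g has_vector_derivative g' x) (at x)" "continuous_on T g'"
  shows "C1_on T g"
  by (rule C1_onI[where f' = "\<lambda>x. blinfun_scaleR_left (g' x)"])
    (use assms in \<open>auto simp: has_vector_derivative_def intro!: continuous_intros\<close>)

lemma C1_on_real_derivative:
  assumes "\<And>x. x \<in> T \<Longrightarrow> (g has_real_derivative g' x) (at x)" "continuous_on T g'"
  shows "C1_on T g"
  using C1_on_vector_derivative[of T g g'] assms by (simp add: has_real_derivative_iff_has_vector_derivative)

lemma C2_on_real_derivative:
  assumes "\<And>x. x \<in> T \<Longrightarrow> (g has_real_derivative g' x) (at x)" "C1_on T g'"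
  shows "C2_on T g"
proof (rule C2_onI[where f' = "\<lambda>x. blinfun_scaleR_left (g' x)"])
  show "(g has_derivative blinfun_apply (blinfun_scaleR_left (g' x))) (at x)" if "x \<in> T" for x
    using assms(1)[OF that] by (simp add: has_real_derivative_iff_has_vector_derivative has_vector_derivative_def)
  show "C1_on T (\<lambda>x. blinfun_scaleR_left (g' x))"
    by (rule C1_on_linear[OF bounded_linear_blinfun_scaleR_left assms(2)])
qed

lemma C1_on_id [simp, intro]: "C1_on S (\<lambda>x. x)" and C2_on_id [simp, intro]: "C2_on S (\<lambda>x. x)"
  by (auto intro!: C1_on_bounded_linear C2_on_bounded_linear bounded_linear_ident)

named_theorems C_intros

lemmas [C_intros] = C1_on_const C2_on_const C1_on_id C2_on_id C1_on_Pair C2_on_Pair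

lemma C1_on_add [C_intros]: "C1_on S f \<Longrightarrow> C1_on S g \<Longrightarrow> C1_on S (\<lambda>x. f x + g x)"
  and C2_on_add [C_intros]: "C2_on S f \<Longrightarrow> C2_on S g \<Longrightarrow> C2_on S (\<lambda>x. f x + g x)"
  using C1_on_linear[OF bounded_linear_add[OF bounded_linear_fst bounded_linear_snd] C1_on_Pair]
    C2_on_linear[OF bounded_linear_add[OF bounded_linear_fst bounded_linear_snd] C2_on_Pair]
  by force+

lemma C1_on_diff [C_intros]: "C1_on S f \<Longrightarrow> C1_on S g \<Longrightarrow> C1_on S (\<lambda>x. f x - g x)"
  and C2_on_diff [C_intros]: "C2_on S f \<Longrightarrow> C2_on S g \<Longrightarrow> C2_on S (\<lambda>x. f x - g x)"
  using C1_on_linear[OF bounded_linear_sub[OF bounded_linear_fst bounded_linear_snd] C1_on_Pair]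
    C2_on_linear[OF bounded_linear_sub[OF bounded_linear_fst bounded_linear_snd] C2_on_Pair]
  by force+

lemma C1_on_minus [C_intros]: "C1_on S f \<Longrightarrow> C1_on S (\<lambda>x. - f x)"
  and C2_on_minus [C_intros]: "C2_on S f \<Longrightarrow> C2_on S (\<lambda>x. - f x)"
  by (erule C1_on_linear[OF bounded_linear_minus[OF bounded_linear_ident]] C2_on_linear[OF bounded_linear_minus[OF bounded_linear_ident]])+

lemma C1_on_fst [C_intros]: "C1_on S f \<Longrightarrow> C1_on S (\<lambda>x. fst (f x))"
  and C2_on_fst [C_intros]: "C2_on S f \<Longrightarrow> C2_on S (\<lambda>x. fst (f x))"
  and C1_on_snd [C_intros]: "C1_on S f \<Longrightarrow> C1_on S (\<lambda>x. snd (f x))"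
  and C2_on_snd [C_intros]: "C2_on S f \<Longrightarrow> C2_on S (\<lambda>x. snd (f x))"
  by (erule C1_on_linear[OF bounded_linear_fst] C2_on_linear[OF bounded_linear_fst]
    C1_on_linear[OF bounded_linear_snd] C2_on_linear[OF bounded_linear_snd])+

lemma C1_on_vec_nth [C_intros]: "C1_on S f \<Longrightarrow> C1_on S (\<lambda>x. f x $ i)"
  and C2_on_vec_nth [C_intros]: "C2_on S f \<Longrightarrow> C2_on S (\<lambda>x. f x $ i)"
  by (erule C1_on_linear[OF bounded_linear_vec_nth] C2_on_linear[OF bounded_linear_vec_nth])+

lemma C1_on_scaleR [C_intros]: "C1_on S f \<Longrightarrow> C1_on S g \<Longrightarrow> C1_on S (\<lambda>x. f x *\<^sub>R g x)"
  and C2_on_scaleR [C_intros]: "C2_on S f \<Longrightarrow> C2_on S g \<Longrightarrow> C2_on S (\<lambda>x. f x *\<^sub>R g x)"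
  by (erule (1) C1_on_bilinear[OF bounded_bilinear_scaleR] C2_on_bilinear[OF bounded_bilinear_scaleR])+

lemma C1_on_mult [C_intros]: "C1_on S f \<Longrightarrow> C1_on S g \<Longrightarrow> C1_on S (\<lambda>x. f x * g x :: real)"
  and C2_on_mult [C_intros]: "C2_on S f \<Longrightarrow> C2_on S g \<Longrightarrow> C2_on S (\<lambda>x. f x * g x :: real)"
  by (erule (1) C1_on_bilinear[OF bounded_bilinear_mult] C2_on_bilinear[OF bounded_bilinear_mult])+

lemma C1_on_inner [C_intros]: "C1_on S f \<Longrightarrow> C1_on S g \<Longrightarrow> C1_on S (\<lambda>x. f x \<bullet> g x :: real)"
  and C2_on_inner [C_intros]: "C2_on S f \<Longrightarrow> C2_on S g \<Longrightarrow> C2_on S (\<lambda>x. f x \<bullet> g x :: real)"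
  by (erule (1) C1_on_bilinear[OF bounded_bilinear_inner] C2_on_bilinear[OF bounded_bilinear_inner])+

lemma C1_on_power [C_intros]: "C1_on S f \<Longrightarrow> C1_on S (\<lambda>x. f x ^ n :: real)"
  and C2_on_power [C_intros]: "C2_on S f \<Longrightarrow> C2_on S (\<lambda>x. f x ^ n :: real)"
  by (induction n) (auto intro: C_intros)

lemma C1_on_sum [C_intros]: "(\<And>i. i \<in> I \<Longrightarrow> C1_on S (f i)) \<Longrightarrow> C1_on S (\<lambda>x. \<Sum>i\<in>I. f i x)"
  and C2_on_sum [C_intros]: "(\<And>i. i \<in> I \<Longrightarrow> C2_on S (f i)) \<Longrightarrow> C2_on S (\<lambda>x. \<Sum>i\<in>I. f i x)"
  by (induction I rule: infinite_finite_induct) (auto intro: C_intros)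

lemma C1_on_inverse [C_intros]: "C1_on S f \<Longrightarrow> (\<And>x. x \<in> S \<Longrightarrow> f x \<noteq> 0) \<Longrightarrow> C1_on S (\<lambda>x. inverse (f x) :: real)"
  and C2_on_inverse [C_intros]: "C2_on S f \<Longrightarrow> (\<And>x. x \<in> S \<Longrightarrow> f x \<noteq> 0) \<Longrightarrow> C2_on S (\<lambda>x. inverse (f x) :: real)"
proof -
  have 1: "C1_on (- {0}) (inverse :: real \<Rightarrow> real)"
    by (rule C1_on_real_derivative[where g' = "\<lambda>x. - (inverse x ^ 2)"])
      (auto intro!: derivative_eq_intros continuous_intros simp: power2_eq_square)
  have 2: "C2_on (- {0}) (inverse :: real \<Rightarrow> real)"
    by (rule C2_on_real_derivative[where g' = "\<lambda>x. - (inverse x ^ 2)"])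
      (auto intro!: derivative_eq_intros C1_on_minus C1_on_mult 1 simp: power2_eq_square)
  show "C1_on S (\<lambda>x. inverse (f x))" if "C1_on S f" "\<And>x. x \<in> S \<Longrightarrow> f x \<noteq> 0"
    by (rule C1_on_compose[OF 1]) (use that in auto)
  show "C2_on S (\<lambda>x. inverse (f x))" if "C2_on S f" "\<And>x. x \<in> S \<Longrightarrow> f x \<noteq> 0"
    by (rule C2_on_compose[OF 2]) (use that in auto)
qed

lemma C1_on_divide [C_intros]: "C1_on S f \<Longrightarrow> C1_on S g \<Longrightarrow> (\<And>x. x \<in> S \<Longrightarrow> g x \<noteq> 0) \<Longrightarrow> C1_on S (\<lambda>x. f x / g x :: real)"
  and C2_on_divide [C_intros]: "C2_on S f \<Longrightarrow> C2_on S g \<Longrightarrow> (\<And>x. x \<in> S \<Longrightarrow> g x \<noteq> 0) \<Longrightarrow> C2_on S (\<lambda>x. f x / g x :: real)"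
  using C1_on_mult[OF _ C1_on_inverse] C2_on_mult[OF _ C2_on_inverse] by (force simp: divide_inverse)+

lemma C1_on_sin [C_intros]: "C1_on S f \<Longrightarrow> C1_on S (\<lambda>x. sin (f x) :: real)"
  and C1_on_cos [C_intros]: "C1_on S f \<Longrightarrow> C1_on S (\<lambda>x. cos (f x) :: real)"
  and C2_on_sin [C_intros]: "C2_on S f \<Longrightarrow> C2_on S (\<lambda>x. sin (f x) :: real)"
  and C2_on_cos [C_intros]: "C2_on S f \<Longrightarrow> C2_on S (\<lambda>x. cos (f x) :: real)"
proof -
  have s: "C1_on UNIV (sin :: real \<Rightarrow> real)"
    by (rule C1_on_real_derivative[where g' = cos]) (auto intro!: derivative_eq_intros continuous_intros)
  have c: "C1_on UNIV (cos :: real \<Rightarrow> real)"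
    by (rule C1_on_real_derivative[where g' = "\<lambda>x. - sin x"]) (auto intro!: derivative_eq_intros continuous_intros)
  have s2: "C2_on UNIV (sin :: real \<Rightarrow> real)"
    by (rule C2_on_real_derivative[where g' = cos]) (auto intro!: derivative_eq_intros c)
  have c2: "C2_on UNIV (cos :: real \<Rightarrow> real)"
    by (rule C2_on_real_derivative[where g' = "\<lambda>x. - sin x"]) (auto intro!: derivative_eq_intros C1_on_minus s)
  show "C1_on S f \<Longrightarrow> C1_on S (\<lambda>x. sin (f x) :: real)" "C1_on S f \<Longrightarrow> C1_on S (\<lambda>x. cos (f x) :: real)"
    "C2_on S f \<Longrightarrow> C2_on S (\<lambda>x. sin (f x) :: real)" "C2_on S f \<Longrightarrow> C2_on S (\<lambda>x. cos (f x) :: real)"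
    using C1_on_compose[OF s] C1_on_compose[OF c] C2_on_compose[OF s2] C2_on_compose[OF c2] by auto
qed

lemma C1_on_sqrt [C_intros]: "C1_on S f \<Longrightarrow> (\<And>x. x \<in> S \<Longrightarrow> 0 < f x) \<Longrightarrow> C1_on S (\<lambda>x. sqrt (f x))"
  and C2_on_sqrt [C_intros]: "C2_on S f \<Longrightarrow> (\<And>x. x \<in> S \<Longrightarrow> 0 < f x) \<Longrightarrow> C2_on S (\<lambda>x. sqrt (f x))"
proof -
  have 1: "C1_on {0<..} sqrt"
    by (rule C1_on_real_derivative[where g' = "\<lambda>x. inverse (2 * sqrt x)"])
      (auto intro!: derivative_eq_intros continuous_intros simp: field_simps)
  have 2: "C2_on {0<..} sqrt"
    by (rule C2_on_real_derivative[where g' = "\<lambda>x. inverse (2 * sqrt x)"])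
      (auto intro!: derivative_eq_intros C_intros 1 simp: field_simps)
  show "C1_on S (\<lambda>x. sqrt (f x))" if "C1_on S f" "\<And>x. x \<in> S \<Longrightarrow> 0 < f x"
    by (rule C1_on_compose[OF 1]) (use that in auto)
  show "C2_on S (\<lambda>x. sqrt (f x))" if "C2_on S f" "\<And>x. x \<in> S \<Longrightarrow> 0 < f x"
    by (rule C2_on_compose[OF 2]) (use that in auto)
qed

lemma C1_on_norm [C_intros]: "C1_on S f \<Longrightarrow> (\<And>x. x \<in> S \<Longrightarrow> f x \<noteq> 0) \<Longrightarrow> C1_on S (\<lambda>x. norm (f x :: 'c::real_inner))"
  and C2_on_norm [C_intros]: "C2_on S f \<Longrightarrow> (\<And>x. x \<in> S \<Longrightarrow> f x \<noteq> 0) \<Longrightarrow> C2_on S (\<lambda>x. norm (f x :: 'c::real_inner))"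
  unfolding norm_eq_sqrt_inner by (auto intro!: C_intros)

lemma C1_on_blinfun_apply [C_intros]: "C1_on S f \<Longrightarrow> C1_on S g \<Longrightarrow> C1_on S (\<lambda>x. blinfun_apply (f x) (g x))"
  by (rule C1_on_bilinear[OF bounded_bilinear_blinfun_apply])

lemma C1_on_matrix_vector_mult [C_intros]: "C1_on S f \<Longrightarrow> C1_on S (\<lambda>x. (L::real^'n^'m) *v f x)"
  and C2_on_matrix_vector_mult [C_intros]: "C2_on S f \<Longrightarrow> C2_on S (\<lambda>x. (L::real^'n^'m) *v f x)"
  by (erule C1_on_linear[OF matrix_vector_mul_bounded_linear] C2_on_linear[OF matrix_vector_mul_bounded_linear])+

section \<open>Inverse functions in Banach spaces\<close>

text \<open>Near \<open>x0\<close> the map \<open>x - B (f x)\<close> has derivative of norm at most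
  1/2 and is a contraction; a fixed point of \<open>x - B (f x) + B y\<close> solves
  \<open>f x = y\<close> because \<open>B\<close> is injective. The same smallness makes every
  \<open>f' x\<close> in the ball invertible with a uniformly bounded inverse, from which the
  inverse map gets a continuous derivative.\<close>

theorem inverse_function_banach:
  fixes f :: "'a::banach \<Rightarrow> 'b::banach"
  assumes S: "open S" "x0 \<in> S" and f: "C1_on S f"
    and A: "(f has_derivative blinfun_apply A) (at x0)"
    and BA: "B o\<^sub>L A = id_blinfun" and AB: "A o\<^sub>L B = id_blinfun"
  obtains U V g where "open U" "U \<subseteq> S" "x0 \<in> U" "open V" "f x0 \<in> V"
    "\<And>x. x \<in> U \<Longrightarrow> f x \<in> V \<and> g (f x) = x" "\<And>y. y \<in> V \<Longrightarrow> g y \<in> U \<and> f (g y) = y"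
    "C1_on V g"
proof -
  obtain f' where f': "\<And>x. x \<in> S \<Longrightarrow> (f has_derivative blinfun_apply (f' x)) (at x)" "continuous_on S f'"
    using f unfolding C1_on_def by blast
  have f'0: "f' x0 = A"
    using has_derivative_unique[OF f'(1)[OF S(2)] A] by (simp add: blinfun_apply_inject)
  have AB': "blinfun_apply A (blinfun_apply B h) = h" for h
    using AB by (metis blinfun_apply_blinfun_compose blinfun_apply_id_blinfun)
  define N where "N = norm B + 1"
  have N: "N > 0" "norm (blinfun_apply B y) \<le> N * norm y" for y
  proof -
    show "N > 0" using norm_ge_zero[of B] by (simp only: N_def)
    have "norm B * norm y \<le> N * norm y" by (intro mult_right_mono) (auto simp: N_def)
    then show "norm (blinfun_apply B y) \<le> N * norm y" using norm_blinfun[of B y] by linarith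
  qed
  have cont: "continuous_on S (\<lambda>x. B o\<^sub>L f' x)" by (intro continuous_intros f')
  have "\<exists>R>0. ball x0 R \<subseteq> S \<and> (\<forall>x\<in>ball x0 R. norm ((B o\<^sub>L f' x) - id_blinfun) \<le> 1/2)"
  proof -
    obtain d1 where d1: "d1 > 0" "ball x0 d1 \<subseteq> S" using S open_contains_ball by blast
    obtain d2 where d2: "d2 > 0" "\<And>x. x \<in> S \<Longrightarrow> dist x x0 < d2 \<Longrightarrow> dist (B o\<^sub>L f' x) (B o\<^sub>L f' x0) < 1/2"
      using cont S(2) unfolding continuous_on_iff by (metis half_gt_zero_iff zero_less_one)
    show ?thesis
    proof (intro exI[of _ "min d1 d2"] conjI ballI)
      fix x assume "x \<in> ball x0 (min d1 d2)"
      then have "x \<in> S" "dist x x0 < d2" using d1 by (auto simp: dist_commute)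
      then show "norm ((B o\<^sub>L f' x) - id_blinfun) \<le> 1/2"
        using d2(2)[of x] by (simp add: f'0 BA dist_norm)
    qed (use d1 d2 in auto)
  qed
  then obtain R where R: "R > 0" "ball x0 R \<subseteq> S"
    "\<And>x. x \<in> ball x0 R \<Longrightarrow> norm ((B o\<^sub>L f' x) - id_blinfun) \<le> 1/2" by blast
  define \<phi> where "\<phi> x = x - blinfun_apply B (f x)" for x
  have \<phi>: "norm (\<phi> x - \<phi> y) \<le> 1/2 * norm (x - y)" if "x \<in> ball x0 R" "y \<in> ball x0 R" for x y
  proof (rule differentiable_bound[OF convex_ball])
    show "(\<phi> has_derivative blinfun_apply (id_blinfun - (B o\<^sub>L f' x))) (at x within ball x0 R)"
      if "x \<in> ball x0 R" for x
      unfolding \<phi>_def using that R(2)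
      by (auto intro!: derivative_eq_intros has_derivative_at_withinI[OF f'(1)] simp: minus_blinfun.rep_eq)
    show "onorm (blinfun_apply (id_blinfun - (B o\<^sub>L f' x))) \<le> 1/2" if "x \<in> ball x0 R" for x
      using R(3)[OF that] by (simp add: norm_blinfun.rep_eq[symmetric] norm_minus_commute)
  qed (use that in auto)
  have lip: "norm (x - y) \<le> 2 * N * norm (f x - f y)" if "x \<in> ball x0 R" "y \<in> ball x0 R" for x y
  proof -
    have "x - y = (\<phi> x - \<phi> y) + blinfun_apply B (f x - f y)"
      by (simp add: \<phi>_def blinfun.bilinear_simps)
    then have "norm (x - y) \<le> norm (\<phi> x - \<phi> y) + norm (blinfun_apply B (f x - f y))"
      by (metis norm_triangle_ineq)
    then show ?thesis using \<phi>[OF that] N(2)[of "f x - f y"] by (simp add: algebra_simps)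
  qed
  \<comment> \<open>Fixed points are sought in the closed ball of radius \<open>R/2\<close>. The
    contraction contributes at most \<open>R/4\<close>, and with this radius the shift by
    \<open>B (y - f x0)\<close> contributes at most another \<open>R/4\<close>.\<close>
  define \<rho> where "\<rho> = R / (4 * N)"
  have \<rho>: "\<rho> > 0" using R N by (simp add: \<rho>_def)
  define V where "V = ball (f x0) \<rho>"
  have solve: "\<exists>x\<in>ball x0 R. f x = y" if "y \<in> V" for y
  proof -
    define \<psi> where "\<psi> x = \<phi> x + blinfun_apply B y" for x
    have "\<exists>!x\<in>cball x0 (R/2). \<psi> x = x"
    proof (rule Banach_fix[of _ "1/2"])
      show "complete (cball x0 (R/2))" by (simp add: complete_eq_closed)
      show "\<psi> ` cball x0 (R/2) \<subseteq> cball x0 (R/2)"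
      proof
        fix z assume "z \<in> \<psi> ` cball x0 (R/2)"
        then obtain x where x: "x \<in> cball x0 (R/2)" "z = \<psi> x" by blast
        have "\<psi> x - x0 = (\<phi> x - \<phi> x0) + blinfun_apply B (y - f x0)"
          by (simp add: \<psi>_def \<phi>_def blinfun.bilinear_simps)
        then have "norm (\<psi> x - x0) \<le> norm (\<phi> x - \<phi> x0) + norm (blinfun_apply B (y - f x0))"
          by (metis norm_triangle_ineq)
        also have "\<dots> \<le> 1/2 * norm (x - x0) + N * norm (y - f x0)"
          using x R by (intro add_mono N(2) \<phi>) auto
        also have "\<dots> \<le> 1/2 * (R/2) + N * \<rho>"
          using x that N(1) by (intro add_mono mult_left_mono) (auto simp: V_def dist_norm norm_minus_commute)
        also have "\<dots> = R / 2" using N by (simp add: \<rho>_def)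
        finally show "z \<in> cball x0 (R/2)" using x by (simp add: dist_norm norm_minus_commute)
      qed
      show "dist (\<psi> x) (\<psi> x') \<le> 1/2 * dist x x'" if "x \<in> cball x0 (R/2)" "x' \<in> cball x0 (R/2)" for x x'
        using \<phi>[of x x'] that R by (auto simp: \<psi>_def dist_norm)
    qed (use R in auto)
    then obtain x where x: "x \<in> cball x0 (R/2)" "\<psi> x = x" by blast
    then have "blinfun_apply B (y - f x) = 0" by (simp add: \<psi>_def \<phi>_def blinfun.bilinear_simps)
    then have "y - f x = 0" using AB'[of "y - f x"] by (simp add: blinfun.bilinear_simps)
    then show ?thesis using x R by (intro bexI[of _ x]) auto
  qed
  define g where "g y = (SOME x. x \<in> ball x0 R \<and> f x = y)" for y
  have g: "g y \<in> ball x0 R \<and> f (g y) = y" if "y \<in> V" for y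
    unfolding g_def by (rule someI_ex) (use solve[OF that] in blast)
  have glip: "norm (g y - g y') \<le> 2 * N * norm (y - y')" if "y \<in> V" "y' \<in> V" for y y'
    using lip[of "g y" "g y'"] g[OF that(1)] g[OF that(2)] by simp
  have gcont: "continuous_on V g"
    by (rule lipschitz_on_continuous_on[of "2 * N"], rule lipschitz_onI)
      (use glip N in \<open>auto simp: dist_norm\<close>)
  define U where "U = {x \<in> ball x0 R. f x \<in> V}"
  have U: "open U"
  proof -
    have "continuous_on (ball x0 R) f" using C1_on_continuous[OF f] R(2) continuous_on_subset by blast
    then have "open (f -` V \<inter> ball x0 R)"
      using iffD1[OF continuous_on_open_vimage[OF open_ball]] unfolding V_def by blast
    moreover have "U = f -` V \<inter> ball x0 R" by (auto simp: U_def)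
    ultimately show ?thesis by simp
  qed
  \<comment> \<open>Since \<open>id - B f'(x)\<close> has norm at most 1/2, \<open>f' x\<close> is
    bounded below and \<open>h + B (k - f' x h)\<close> is a contraction in \<open>h\<close> whose
    fixed point solves \<open>f' x h = k\<close>. The bound \<open>2 * N\<close> does not depend on
    \<open>x\<close>, which the continuity argument for the inverses needs.\<close>
  have inv: "\<exists>C. C o\<^sub>L f' x = id_blinfun \<and> f' x o\<^sub>L C = id_blinfun \<and> norm C \<le> 2 * N" if x: "x \<in> ball x0 R" for x
  proof -
    have small: "norm (h - blinfun_apply B (blinfun_apply (f' x) h)) \<le> 1/2 * norm h" for h
    proof -
      have "norm (blinfun_apply ((B o\<^sub>L f' x) - id_blinfun) h) \<le> 1/2 * norm h"
        by (rule order_trans[OF norm_blinfun mult_right_mono[OF R(3)[OF x]]]) simp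
      then show ?thesis by (simp add: minus_blinfun.rep_eq norm_minus_commute)
    qed
    have low: "norm h \<le> 2 * N * norm (blinfun_apply (f' x) h)" for h
    proof -
      have "norm h \<le> norm (h - blinfun_apply B (blinfun_apply (f' x) h)) + norm (blinfun_apply B (blinfun_apply (f' x) h))"
        using norm_triangle_sub by (metis add.commute)
      then show ?thesis using small[of h] N(2)[of "blinfun_apply (f' x) h"] by (simp add: algebra_simps)
    qed
    have surj: "\<exists>h. blinfun_apply (f' x) h = k" for k
    proof -
      define \<psi> where "\<psi> h = h + blinfun_apply B (k - blinfun_apply (f' x) h)" for h
      have "\<exists>!h\<in>UNIV. \<psi> h = h"
      proof (rule Banach_fix[of _ "1/2"])
        show "complete (UNIV :: 'a set)" by (simp add: complete_UNIV)
        show "dist (\<psi> h) (\<psi> h') \<le> 1/2 * dist h h'" for h h'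
          using small[of "h - h'"] by (simp add: \<psi>_def dist_norm blinfun.bilinear_simps algebra_simps)
      qed auto
      then obtain h where "\<psi> h = h" by blast
      then have "blinfun_apply B (k - blinfun_apply (f' x) h) = 0" by (simp add: \<psi>_def)
      then have "k - blinfun_apply (f' x) h = 0" using AB'[of "k - blinfun_apply (f' x) h"] by (simp add: blinfun.bilinear_simps)
      then show ?thesis by (metis eq_iff_diff_eq_0)
    qed
    have inj: "h = h'" if "blinfun_apply (f' x) h = blinfun_apply (f' x) h'" for h h'
      using low[of "h - h'"] that by (simp add: blinfun.bilinear_simps)
    define c where "c k = (SOME h. blinfun_apply (f' x) h = k)" for k
    have c: "blinfun_apply (f' x) (c k) = k" for k unfolding c_def by (rule someI_ex[OF surj])
    have "bounded_linear c"
    proof (rule bounded_linear_intro[where K = "2 * N"])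
      show "c (k + k') = c k + c k'" for k k' by (rule inj) (simp add: c blinfun.bilinear_simps)
      show "c (r *\<^sub>R k) = r *\<^sub>R c k" for r k by (rule inj) (simp add: c blinfun.bilinear_simps)
      show "norm (c k) \<le> norm k * (2 * N)" for k using low[of "c k"] by (simp add: c mult.commute)
    qed
    note ap = bounded_linear_Blinfun_apply[OF this]
    have "norm (Blinfun c) \<le> 2 * N"
      by (rule norm_blinfun_bound) (use low[of "c _"] N in \<open>auto simp: ap c\<close>)
    moreover have "Blinfun c o\<^sub>L f' x = id_blinfun" by (rule blinfun_eqI, rule inj) (simp add: ap c)
    moreover have "f' x o\<^sub>L Blinfun c = id_blinfun" by (rule blinfun_eqI) (simp add: ap c)
    ultimately show ?thesis by blast
  qed
  define G where "G y = (SOME C. C o\<^sub>L f' (g y) = id_blinfun \<and> f' (g y) o\<^sub>L C = id_blinfun \<and> norm C \<le> 2 * N)" for y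
  have G: "G y o\<^sub>L f' (g y) = id_blinfun" "f' (g y) o\<^sub>L G y = id_blinfun" "norm (G y) \<le> 2 * N" if "y \<in> V" for y
    using someI_ex[OF inv[of "g y"]] g[OF that] unfolding G_def by blast+
  have oV: "open V" by (simp add: V_def)
  have "C1_on V g"
  proof (rule C1_onI)
    fix y assume y: "y \<in> V"
    show "(g has_derivative blinfun_apply (G y)) (at y)"
    proof (rule has_derivative_inverse_basic[OF f'(1) _ _ _ oV y])
      show "g y \<in> S" using g[OF y] R(2) by blast
      show "blinfun_apply (G y) \<circ> blinfun_apply (f' (g y)) = id"
        unfolding blinfun_compose.rep_eq[symmetric] G(1)[OF y] by (simp add: id_blinfun.rep_eq id_def)
      show "continuous (at y) g" using gcont oV y continuous_on_eq_continuous_at by blast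
      show "bounded_linear (blinfun_apply (G y))" by (rule blinfun.bounded_linear_right)
      show "f (g z) = z" if "z \<in> V" for z using g[OF that] by blast
    qed
  next
    show "continuous_on V G"
      unfolding continuous_on_def
    proof
      fix y assume y: "y \<in> V"
      have lim: "((\<lambda>z. (2 * N) * norm (f' (g y) - f' (g z)) * (2 * N)) \<longlongrightarrow> (2 * N) * norm (f' (g y) - f' (g y)) * (2 * N)) (at y within V)"
      proof -
        have "continuous_on V (\<lambda>z. f' (g z))"
          by (rule continuous_on_compose2[OF f'(2) gcont]) (use g R(2) in blast)
        then have "((\<lambda>z. f' (g z)) \<longlongrightarrow> f' (g y)) (at y within V)" using y by (simp add: continuous_on_def)
        then show ?thesis by (intro tendsto_mult tendsto_norm tendsto_diff tendsto_const)
      qed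
      have "((\<lambda>z. norm (G z - G y)) \<longlongrightarrow> 0) (at y within V)"
      proof (rule tendsto_sandwich[OF _ _ tendsto_const])
        show "\<forall>\<^sub>F z in at y within V. norm (G z - G y) \<le> (2 * N) * norm (f' (g y) - f' (g z)) * (2 * N)"
          unfolding eventually_at_filter
        proof (rule always_eventually, intro allI impI)
          fix z assume z: "z \<in> V"
          \<comment> \<open>The difference of two inverses factors through the difference of the
            operators that they invert.\<close>
          have "G z - G y = (G z o\<^sub>L (f' (g y) - f' (g z))) o\<^sub>L G y"
          proof (rule blinfun_eqI)
            fix h
            have "blinfun_apply (G z) (blinfun_apply (f' (g z)) k) = k" for k
              unfolding blinfun_apply_blinfun_compose[symmetric] G(1)[OF z] by simp
            moreover have "blinfun_apply (f' (g y)) (blinfun_apply (G y) h) = h"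
              unfolding blinfun_apply_blinfun_compose[symmetric] G(2)[OF y] by simp
            ultimately show "blinfun_apply (G z - G y) h = blinfun_apply ((G z o\<^sub>L (f' (g y) - f' (g z))) o\<^sub>L G y) h"
              by (simp add: blinfun.bilinear_simps)
          qed
          then have "norm (G z - G y) \<le> norm (G z) * norm (f' (g y) - f' (g z)) * norm (G y)"
            using order_trans[OF norm_blinfun_compose mult_right_mono[OF norm_blinfun_compose norm_ge_zero]] by simp
          also have "\<dots> \<le> (2 * N) * norm (f' (g y) - f' (g z)) * (2 * N)"
            using G(3)[OF z] G(3)[OF y] N(1) by (intro mult_mono) auto
          finally show "norm (G z - G y) \<le> (2 * N) * norm (f' (g y) - f' (g z)) * (2 * N)" .
        qed
        show "((\<lambda>z. (2 * N) * norm (f' (g y) - f' (g z)) * (2 * N)) \<longlongrightarrow> 0) (at y within V)" using lim by simp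
      qed simp
      then show "(G \<longlongrightarrow> G y) (at y within V)" by (rule LIM_zero_cancel[OF tendsto_norm_zero_cancel])
    qed
  qed
  moreover have "x0 \<in> U" "f x0 \<in> V" using R \<rho> by (auto simp: U_def V_def)
  moreover have "f x \<in> V \<and> g (f x) = x" if "x \<in> U" for x
    using that g[of "f x"] lip[of "g (f x)" x] by (auto simp: U_def)
  moreover have "g y \<in> U \<and> f (g y) = y" if "y \<in> V" for y
    using that g[of y] by (auto simp: U_def)
  moreover have "U \<subseteq> S" using R(2) by (auto simp: U_def)
  ultimately show thesis using that[of U V g] U oV by blast
qed

text \<open>Summability of the powers replaces the usual condition that the norm is less than 1: the
  Volterra operator to which this is applied need not be small, but its iterates decay
  factorially.\<close>

lemma neumann_inverse:
  fixes K :: "'a::banach \<Rightarrow>\<^sub>L 'a"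
  assumes "summable (\<lambda>n. norm (((o\<^sub>L) K ^^ n) id_blinfun))"
  obtains T where "T o\<^sub>L (id_blinfun - K) = id_blinfun" "(id_blinfun - K) o\<^sub>L T = id_blinfun"
proof -
  define P where "P n = ((o\<^sub>L) K ^^ n) id_blinfun" for n
  have P0: "P 0 = id_blinfun" and PS: "P (Suc n) = K o\<^sub>L P n" for n by (auto simp: P_def)
  have PS': "P n o\<^sub>L K = P (Suc n)" for n
  proof (induction n)
    case (Suc n)
    have "P (Suc n) o\<^sub>L K = K o\<^sub>L (P n o\<^sub>L K)" by (auto simp: PS intro!: blinfun_eqI)
    then show ?case using Suc by (simp add: PS)
  qed (auto simp: P0 PS intro!: blinfun_eqI)
  have sP: "summable P" unfolding P_def by (rule summable_norm_cancel[OF assms])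
  define T where "T = (\<Sum>n. P n)"
  have split: "T = id_blinfun + (\<Sum>n. P (Suc n))"
    unfolding T_def suminf_split_head[OF sP] P0 by simp
  have "K o\<^sub>L T = (\<Sum>n. P (Suc n))"
    unfolding T_def PS
    by (rule bounded_linear.suminf[OF bounded_bilinear.bounded_linear_right[OF bounded_bilinear_blinfun_compose] sP])
  moreover have "T o\<^sub>L K = (\<Sum>n. P (Suc n))"
    unfolding T_def PS'[symmetric]
    by (rule bounded_linear.suminf[OF bounded_bilinear.bounded_linear_left[OF bounded_bilinear_blinfun_compose] sP])
  moreover have "(id_blinfun - K) o\<^sub>L T = T - (K o\<^sub>L T)" "T o\<^sub>L (id_blinfun - K) = T - (T o\<^sub>L K)"
    by (auto intro!: blinfun_eqI simp: blinfun.bilinear_simps)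
  ultimately show thesis using that[of T] split by simp
qed

text \<open>Eliminating the infinite-dimensional unknown by \<open>S\<close> leaves the Schur
  complement \<open>D - C S B\<close> between spaces of equal finite dimension. A kernel vector of
  the complement extends to one of \<open>L\<close>, so injectivity of \<open>L\<close> makes the
  complement bijective. Invertibility of the bordered operator is thereby reduced to a kernel
  computation.\<close>

lemma bordered_inverse:
  fixes A :: "'e::banach \<Rightarrow>\<^sub>L 'e" and B :: "'r::euclidean_space \<Rightarrow>\<^sub>L 'e"
    and C :: "'e \<Rightarrow>\<^sub>L 'q::euclidean_space" and D :: "'r \<Rightarrow>\<^sub>L 'q"
    and L :: "('e \<times> 'r) \<Rightarrow>\<^sub>L ('e \<times> 'q)"
  assumes dim: "DIM('r) = DIM('q)"
    and SA: "S o\<^sub>L A = id_blinfun" and AS: "A o\<^sub>L S = id_blinfun"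
    and L: "\<And>z r. blinfun_apply L (z, r) = (A z + B r, C z + D r)"
    and inj: "\<And>z r. blinfun_apply L (z, r) = 0 \<Longrightarrow> z = 0 \<and> r = 0"
  obtains R where "R o\<^sub>L L = id_blinfun" "L o\<^sub>L R = id_blinfun"
proof -
  have SA': "S (A h) = h" and AS': "A (S h) = h" for h
    using SA AS by (metis blinfun_apply_blinfun_compose blinfun_apply_id_blinfun)+
  define M where "M r = D r - C (S (B r))" for r
  have linM: "linear M"
    by (rule linearI) (simp_all add: M_def blinfun.bilinear_simps algebra_simps)
  have injM: "inj M"
    unfolding linear_injective_0[OF linM]
  proof (intro allI impI)
    fix r assume "M r = 0"
    then have "blinfun_apply L (- S (B r), r) = 0"
      by (simp add: L M_def blinfun.bilinear_simps AS' zero_prod_def)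
    then show "r = 0" using inj by blast
  qed
  have "dim (range M) = DIM('r)" using dim_image_eq[OF linM, of UNIV] injM by simp
  then have "span (range M) = UNIV" using dim dim_eq_full by metis
  then have surj: "surj M" using linear_subspace_image[OF linM subspace_UNIV] span_eq_iff by metis
  obtain m where m: "linear m" "m \<circ> M = id" using linear_injective_left_inverse[OF linM injM] by blast
  have bm: "bounded_linear m" using m linear_conv_bounded_linear by blast
  have m'2: "m (M r) = r" for r using m(2) by (metis comp_apply id_apply)
  have m'1: "M (m d) = d" for d
  proof -
    obtain r where "d = M r" using surj by blast
    then show ?thesis by (simp add: m'2)
  qed
  note m' = m'1 m'2
  define R0 where "R0 p = (S (fst p - B (m (snd p - C (S (fst p))))), m (snd p - C (S (fst p))))" for p
  have bR: "bounded_linear R0"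
    unfolding R0_def
    by (intro bounded_linear_Pair bounded_linear_compose[OF blinfun.bounded_linear_right] bounded_linear_sub
        bounded_linear_compose[OF bm] bounded_linear_fst bounded_linear_snd)
  have "Blinfun R0 o\<^sub>L L = id_blinfun"
  proof (rule blinfun_eqI)
    fix p :: "'e \<times> 'r"
    obtain z r where p: "p = (z, r)" by fastforce
    have "C z + D r - C (S (A z + B r)) = M r" by (simp add: M_def blinfun.bilinear_simps SA')
    then show "blinfun_apply (Blinfun R0 o\<^sub>L L) p = blinfun_apply id_blinfun p"
      by (simp add: p L bounded_linear_Blinfun_apply[OF bR] R0_def m') (simp add: blinfun.bilinear_simps SA')
  qed
  moreover have "L o\<^sub>L Blinfun R0 = id_blinfun"
  proof (rule blinfun_eqI)
    fix p :: "'e \<times> 'q"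
    obtain k d where p: "p = (k, d)" by fastforce
    define r where "r = m (d - C (S k))"
    have "M r = d - C (S k)" by (simp add: r_def m')
    then have "C (S (k - B r)) + D r = d" by (simp add: M_def blinfun.bilinear_simps algebra_simps)
    then show "blinfun_apply (L o\<^sub>L Blinfun R0) p = blinfun_apply id_blinfun p"
      by (simp add: p L bounded_linear_Blinfun_apply[OF bR] R0_def r_def[symmetric] AS')
  qed
  ultimately show thesis using that by blast
qed

section \<open>Superposition operators on continuous functions\<close>

text \<open>Functions on one period are extended to the line by their end values, so that bounded
  continuous functions on the reals play the role of continuous functions on
  \<open>{0..2*pi}\<close>. An arbitrary element of that space need not be constant outside the
  interval; where its norm matters, this has to be shown.\<close>

definition clip :: "real \<Rightarrow> real" where "clip t = max 0 (min (2*pi) t)"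

lemma clip_mem [simp]: "clip t \<in> {0..2*pi}"
  by (auto simp: clip_def)

lemma clip_id: "t \<in> {0..2*pi} \<Longrightarrow> clip t = t"
  by (auto simp: clip_def)

lemma continuous_on_clip [continuous_intros]: "continuous_on S clip"
  unfolding clip_def by (intro continuous_intros)

definition mkC :: "(real \<Rightarrow> 'b::real_normed_vector) \<Rightarrow> (real \<Rightarrow>\<^sub>C 'b)" where
  "mkC f = Bcontfun (\<lambda>t. f (clip t))"

lemma mkC_apply:
  assumes "continuous_on {0..2*pi} f"
  shows "apply_bcontfun (mkC f) t = f (clip t)"
proof -
  have "bounded (f ` {0..2*pi})" using assms by (intro compact_imp_bounded compact_continuous_image) auto
  then have "bounded (range (\<lambda>t. f (clip t)))"
    by (rule bounded_subset) (auto simp del: clip_mem intro!: imageI clip_mem)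
  moreover have "continuous_on UNIV (\<lambda>t. f (clip t))"
    by (rule continuous_on_compose2[OF assms]) (auto intro: continuous_intros simp del: atLeastAtMost_iff)
  ultimately have "(\<lambda>t. f (clip t)) \<in> bcontfun" by (auto simp: bcontfun_def)
  then show ?thesis by (simp add: mkC_def Bcontfun_inverse)
qed

lemma mkC_eq: "continuous_on {0..2*pi} f \<Longrightarrow> t \<in> {0..2*pi} \<Longrightarrow> apply_bcontfun (mkC f) t = f t"
  by (simp add: mkC_apply clip_id del: atLeastAtMost_iff)

lemma norm_mkC:
  assumes "continuous_on {0..2*pi} f" "\<And>t. t \<in> {0..2*pi} \<Longrightarrow> norm (f t) \<le> B"
  shows "norm (mkC f) \<le> B"
  by (rule norm_bound) (use assms in \<open>simp add: mkC_apply del: atLeastAtMost_iff\<close>)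

lemma mkC_cong: "(\<And>t. t \<in> {0..2*pi} \<Longrightarrow> f t = g t) \<Longrightarrow> mkC f = mkC g"
  by (simp add: mkC_def del: atLeastAtMost_iff)

lemma mkC_add: "continuous_on {0..2*pi} f \<Longrightarrow> continuous_on {0..2*pi} g \<Longrightarrow> mkC (\<lambda>t. f t + g t) = mkC f + mkC g"
  by (rule bcontfun_eqI) (simp add: mkC_apply continuous_on_add plus_bcontfun.rep_eq)

lemma mkC_diff: "continuous_on {0..2*pi} f \<Longrightarrow> continuous_on {0..2*pi} g \<Longrightarrow> mkC (\<lambda>t. f t - g t) = mkC f - mkC g"
  by (rule bcontfun_eqI) (simp add: mkC_apply continuous_on_diff minus_bcontfun.rep_eq)

lemma mkC_scaleR: "continuous_on {0..2*pi} f \<Longrightarrow> mkC (\<lambda>t. c *\<^sub>R f t) = c *\<^sub>R mkC f"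
  by (rule bcontfun_eqI) (simp add: mkC_apply continuous_on_scaleR scaleR_bcontfun.rep_eq)

lemma bounded_linear_eval: "bounded_linear (\<lambda>f :: real \<Rightarrow>\<^sub>C 'b::real_normed_vector. apply_bcontfun f t)"
  by (rule bounded_linear_intro[where K = 1])
    (simp_all add: plus_bcontfun.rep_eq scaleR_bcontfun.rep_eq norm_bounded)

text \<open>Along a continuous path the partial derivative of \<open>G\<close> has, by compactness,
  a modulus of continuity that is uniform in \<open>t\<close>; the mean value inequality turns this
  into differentiability in the supremum norm. The abstract evaluation \<open>ev\<close> lets the
  same result serve for functions paired with parameters and for Sobolev loops.\<close>

lemma nemytskii:
  fixes G :: "real \<times> 'z::real_normed_vector \<Rightarrow> 'w::real_normed_vector"
    and ev :: "real \<Rightarrow> 'x::real_normed_vector \<Rightarrow> 'z"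
  assumes W: "open W" and G: "C1_on W G"
    and lin: "\<And>t. bounded_linear (ev t)"
    and bd: "\<And>t x. t \<in> {0..2*pi} \<Longrightarrow> norm (ev t x) \<le> C * norm x"
    and cont: "\<And>x. continuous_on {0..2*pi} (\<lambda>t. ev t x)"
  shows "open {x. \<forall>t\<in>{0..2*pi}. (t, ev t x) \<in> W}"
    and "C1_on {x. \<forall>t\<in>{0..2*pi}. (t, ev t x) \<in> W} (\<lambda>x. mkC (\<lambda>t. G (t, ev t x)))"
proof -
  define K where "K = {0..2*pi}"
  define X where "X = {x. \<forall>t\<in>K. (t, ev t x) \<in> W}"
  define C' where "C' = \<bar>C\<bar> + 1"
  have C': "C' > 0" by (simp add: C'_def)
  have bd': "norm (ev t x) \<le> C' * norm x" if "t \<in> K" for t x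
  proof -
    have "C * norm x \<le> C' * norm x" by (intro mult_right_mono) (auto simp: C'_def)
    then show ?thesis using bd[of t x] that unfolding K_def by linarith
  qed
  have evdiff: "ev t x - ev t y = ev t (x - y)" for t x y
    using linear_diff[OF bounded_linear.linear[OF lin]] by metis
  obtain G' where G': "\<And>p. p \<in> W \<Longrightarrow> (G has_derivative blinfun_apply (G' p)) (at p)" "continuous_on W G'"
    using G unfolding C1_on_def by blast
  have bl: "bounded_linear (\<lambda>z::'z. (0::real, z))" by (intro bounded_linear_intros)
  define Gz where "Gz p = G' p o\<^sub>L Blinfun (\<lambda>z. (0, z))" for p
  have Gz_cont: "continuous_on W Gz" unfolding Gz_def by (intro continuous_intros G')
  have Gz: "((\<lambda>z. G (t, z)) has_derivative blinfun_apply (Gz (t, z))) (at z)" if "(t, z) \<in> W" for t z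
  proof -
    have "((\<lambda>z. (t, z)) has_derivative (\<lambda>z. (0, z))) (at z)" by (auto intro!: derivative_eq_intros)
    from has_derivative_compose[OF this G'(1)[OF that]]
    show ?thesis by (simp add: Gz_def blinfun_compose.rep_eq bounded_linear_Blinfun_apply[OF bl] o_def)
  qed
  have pathcont: "continuous_on K (\<lambda>t. (t, ev t x))" for x
    unfolding K_def by (intro continuous_intros cont)
  \<comment> \<open>The graph of the path is compact in the open set \<open>W\<close>, which yields
    a tube of fixed width around it; on the tube the oscillation of \<open>Gz\<close> at a fixed
    time is controlled uniformly over the compact time interval.\<close>
  have unif: "\<exists>d>0. \<forall>t\<in>K. \<forall>z. norm (z - ev t x) < d \<longrightarrow>
      (t, z) \<in> W \<and> norm (Gz (t, z) - Gz (t, ev t x)) \<le> e" if x: "x \<in> X" and e: "e > 0" for x e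
  proof -
    have "compact ((\<lambda>t. (t, ev t x)) ` K)" using pathcont by (intro compact_continuous_image) (auto simp: K_def)
    moreover have "(\<lambda>t. (t, ev t x)) ` K \<subseteq> W" using x by (auto simp: X_def)
    ultimately obtain \<epsilon> where \<epsilon>: "\<epsilon> > 0" "(\<Union>p\<in>(\<lambda>t. (t, ev t x)) ` K. ball p \<epsilon>) \<subseteq> W"
      using compact_subset_open_imp_ball_epsilon_subset W by metis
    have inW: "(t, z) \<in> W" if "t \<in> K" "norm (z - ev t x) < \<epsilon>" for t z
      using \<epsilon>(2) that by (force simp: dist_norm dist_Pair_Pair norm_minus_commute)
    have "continuous_on (ball 0 \<epsilon> \<times> K) (\<lambda>p. Gz (snd p, ev (snd p) x + fst p))"
    proof (rule continuous_on_compose2[OF Gz_cont])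
      show "continuous_on (ball 0 \<epsilon> \<times> K) (\<lambda>p. (snd p, ev (snd p) x + fst p))"
        by (intro continuous_intros continuous_on_compose2[OF cont[of x]]) (auto simp: K_def)
      show "(\<lambda>p. (snd p, ev (snd p) x + fst p)) ` (ball 0 \<epsilon> \<times> K) \<subseteq> W" using inW by auto
    qed
    then obtain X0 where X0: "0 \<in> X0" "open X0"
      "\<forall>h\<in>X0 \<inter> ball 0 \<epsilon>. \<forall>t\<in>K. dist (Gz (t, ev t x + h)) (Gz (t, ev t x + 0)) \<le> e"
      using \<epsilon> e by (elim continuous_on_prod_compactE[where e = e and ?x0.0 = 0]) (auto simp: K_def)
    obtain d where d: "d > 0" "ball 0 d \<subseteq> X0" using X0 open_contains_ball by metis
    show ?thesis
    proof (intro exI[of _ "min d \<epsilon>"] conjI ballI allI impI)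
      fix t z assume t: "t \<in> K" and z: "norm (z - ev t x) < min d \<epsilon>"
      then show "(t, z) \<in> W" using inW by simp
      have "z - ev t x \<in> X0 \<inter> ball 0 \<epsilon>" using z d by auto
      then show "norm (Gz (t, z) - Gz (t, ev t x)) \<le> e" using bspec[OF bspec[OF X0(3)] t] by (fastforce simp: dist_norm)
    qed (use d \<epsilon> in auto)
  qed
  have near: "y \<in> X \<and> (\<forall>t\<in>K. norm (ev t y - ev t x) < d)"
    if "norm (y - x) < d / C'" "\<forall>t\<in>K. \<forall>z. norm (z - ev t x) < d \<longrightarrow> (t, z) \<in> W" for x y d
  proof -
    have "norm (ev t y - ev t x) < d" if "t \<in> K" for t
    proof -
      have "norm (ev t y - ev t x) \<le> C' * norm (y - x)" using bd'[OF that, of "y - x"] by (simp add: evdiff)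
      also have "\<dots> < d" using \<open>norm (y - x) < d / C'\<close> C' by (simp add: field_simps)
      finally show ?thesis .
    qed
    then show ?thesis using that(2) by (auto simp: X_def)
  qed
  have "open X"
    unfolding open_contains_ball
  proof
    fix x assume "x \<in> X"
    then obtain d where "d > 0" "\<forall>t\<in>K. \<forall>z. norm (z - ev t x) < d \<longrightarrow> (t, z) \<in> W"
      using unif[of x 1] by auto
    then show "\<exists>e>0. ball x e \<subseteq> X"
      using near[of _ x d] C' by (intro exI[of _ "d / C'"]) (auto simp: dist_norm norm_minus_commute)
  qed
  then show "open {x. \<forall>t\<in>{0..2*pi}. (t, ev t x) \<in> W}" by (simp add: X_def K_def)
  define D where "D x h t = blinfun_apply (Gz (t, ev t x)) (ev t h)" for x h t
  have Gzc: "continuous_on K (\<lambda>t. Gz (t, ev t x))" if "x \<in> X" for x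
    by (rule continuous_on_compose2[OF Gz_cont pathcont]) (use that in \<open>auto simp: X_def\<close>)
  have Dcont: "continuous_on {0..2*pi} (D x h)" if "x \<in> X" for x h
    using Gzc[OF that] cont[of h] unfolding D_def K_def by (intro continuous_intros)
  define N' where "N' x = Blinfun (\<lambda>h. mkC (D x h))" for x
  have Dlin: "D x (h + h') t = D x h t + D x h' t" "D x (r *\<^sub>R h) t = r *\<^sub>R D x h t" for x h h' r t
    using linear_add[OF bounded_linear.linear[OF lin]] linear_scale[OF bounded_linear.linear[OF lin]]
    by (simp_all add: D_def blinfun.bilinear_simps)
  have blN: "bounded_linear (\<lambda>h. mkC (D x h))" if x: "x \<in> X" for x
  proof -
    have "bounded ((\<lambda>t. Gz (t, ev t x)) ` K)"
      using Gzc[OF x] by (intro compact_imp_bounded compact_continuous_image) (auto simp: K_def)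
    then obtain M where M: "M > 0" "\<And>t. t \<in> K \<Longrightarrow> norm (Gz (t, ev t x)) \<le> M"
      unfolding bounded_pos by auto
    show ?thesis
    proof (rule bounded_linear_intro[where K = "M * C'"])
      show "mkC (D x (h + h')) = mkC (D x h) + mkC (D x h')" for h h'
        using mkC_add[OF Dcont[OF x] Dcont[OF x], of h h'] by (simp add: Dlin[abs_def])
      show "mkC (D x (r *\<^sub>R h)) = r *\<^sub>R mkC (D x h)" for r h
        using mkC_scaleR[OF Dcont[OF x], of r h] by (simp add: Dlin[abs_def])
      show "norm (mkC (D x h)) \<le> norm h * (M * C')" for h
      proof (rule norm_mkC[OF Dcont[OF x]])
        fix t assume "t \<in> {0..2*pi}"
        then have t: "t \<in> K" by (simp add: K_def)
        have "norm (D x h t) \<le> norm (Gz (t, ev t x)) * norm (ev t h)" unfolding D_def by (rule norm_blinfun)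
        also have "\<dots> \<le> M * (C' * norm h)" using M t bd'[OF t] by (intro mult_mono) auto
        finally show "norm (D x h t) \<le> norm h * (M * C')" by (simp add: mult_ac)
      qed
    qed
  qed
  have N'_apply: "blinfun_apply (N' x) h = mkC (D x h)" if "x \<in> X" for x h
    unfolding N'_def by (simp add: bounded_linear_Blinfun_apply[OF blN[OF that]])
  have Gcont: "continuous_on {0..2*pi} (\<lambda>t. G (t, ev t x))" if "x \<in> X" for x
    using continuous_on_compose2[OF C1_on_continuous[OF G] pathcont[of x]] that by (auto simp: X_def K_def)
  have "C1_on X (\<lambda>x. mkC (\<lambda>t. G (t, ev t x)))"
  proof (rule C1_onI)
    fix x assume x: "x \<in> X"
    show "((\<lambda>x. mkC (\<lambda>t. G (t, ev t x))) has_derivative blinfun_apply (N' x)) (at x)"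
      unfolding has_derivative_at_alt
    proof (intro conjI allI impI)
      show "bounded_linear (blinfun_apply (N' x))" by (rule blinfun.bounded_linear_right)
      fix e :: real assume e: "e > 0"
      then have e': "e / C' > 0" using C' by simp
      obtain d where d: "d > 0" "\<forall>t\<in>K. \<forall>z. norm (z - ev t x) < d \<longrightarrow>
          (t, z) \<in> W \<and> norm (Gz (t, z) - Gz (t, ev t x)) \<le> e / C'"
        using unif[OF x e'] by blast
      show "\<exists>d>0. \<forall>y. norm (y - x) < d \<longrightarrow>
          norm (mkC (\<lambda>t. G (t, ev t y)) - mkC (\<lambda>t. G (t, ev t x)) - blinfun_apply (N' x) (y - x)) \<le> e * norm (y - x)"
      proof (intro exI[of _ "d / C'"] conjI allI impI)
        show "d / C' > 0" using d C' by simp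
        fix y assume y: "norm (y - x) < d / C'"
        have yX: "y \<in> X" and yt: "\<And>t. t \<in> K \<Longrightarrow> norm (ev t y - ev t x) < d"
          using near[OF y] d by auto
        have "norm (mkC (\<lambda>t. G (t, ev t y) - G (t, ev t x) - D x (y - x) t)) \<le> e * norm (y - x)"
        proof (rule norm_mkC)
          show "continuous_on {0..2*pi} (\<lambda>t. G (t, ev t y) - G (t, ev t x) - D x (y - x) t)"
            by (intro continuous_on_diff Gcont x yX Dcont)
          fix t assume "t \<in> {0..2*pi}"
          then have t: "t \<in> K" by (simp add: K_def)
          \<comment> \<open>With the linear part at the base point subtracted, the mean value
            inequality only sees the variation of \<open>Gz\<close>, which is small on the
            tube.\<close>
          define g where "g z = G (t, z) - blinfun_apply (Gz (t, ev t x)) z" for z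
          have "norm (g (ev t y) - g (ev t x)) \<le> (e / C') * norm (ev t y - ev t x)"
          proof (rule differentiable_bound[where S = "ball (ev t x) d" and f' = "\<lambda>z. blinfun_apply (Gz (t, z) - Gz (t, ev t x))"])
            show "(g has_derivative blinfun_apply (Gz (t, z) - Gz (t, ev t x))) (at z within ball (ev t x) d)"
              if "z \<in> ball (ev t x) d" for z
            proof -
              have "(t, z) \<in> W" using d(2) t that by (auto simp: dist_norm norm_minus_commute)
              from has_derivative_at_withinI[OF Gz[OF this]] show ?thesis
                unfolding g_def minus_blinfun.rep_eq
                by (intro has_derivative_diff bounded_linear_imp_has_derivative blinfun.bounded_linear_right)
            qed
            show "onorm (blinfun_apply (Gz (t, z) - Gz (t, ev t x))) \<le> e / C'" if "z \<in> ball (ev t x) d" for z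
              unfolding norm_blinfun.rep_eq[symmetric]
              using d(2) t that by (auto simp: dist_norm norm_minus_commute)
          qed (use yt[OF t] d in \<open>auto simp: dist_norm norm_minus_commute\<close>)
          also have "\<dots> \<le> (e / C') * (C' * norm (y - x))"
            using bd'[OF t, of "y - x"] e' by (intro mult_left_mono) (auto simp: evdiff)
          finally have "norm (g (ev t y) - g (ev t x)) \<le> e * norm (y - x)" using C' by simp
          moreover have "g (ev t y) - g (ev t x) = G (t, ev t y) - G (t, ev t x) - D x (y - x) t"
            unfolding g_def D_def evdiff[symmetric] by (simp add: blinfun.bilinear_simps)
          ultimately show "norm (G (t, ev t y) - G (t, ev t x) - D x (y - x) t) \<le> e * norm (y - x)" by simp
        qed
        then show "norm (mkC (\<lambda>t. G (t, ev t y)) - mkC (\<lambda>t. G (t, ev t x)) - blinfun_apply (N' x) (y - x)) \<le> e * norm (y - x)"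
          unfolding N'_apply[OF x]
          using mkC_diff[OF continuous_on_diff[OF Gcont[OF yX] Gcont[OF x]] Dcont[OF x]]
            mkC_diff[OF Gcont[OF yX] Gcont[OF x]] by simp
      qed
    qed
  next
    show "continuous_on X N'"
      unfolding continuous_on_iff
    proof (intro ballI allI impI)
      fix x and e :: real assume x: "x \<in> X" and e: "e > 0"
      then have e': "e / (2 * C') > 0" using C' by simp
      obtain d where d: "d > 0" "\<forall>t\<in>K. \<forall>z. norm (z - ev t x) < d \<longrightarrow>
          (t, z) \<in> W \<and> norm (Gz (t, z) - Gz (t, ev t x)) \<le> e / (2 * C')"
        using unif[OF x e'] by blast
      show "\<exists>d>0. \<forall>y\<in>X. dist y x < d \<longrightarrow> dist (N' y) (N' x) < e"
      proof (intro exI[of _ "d / C'"] conjI ballI impI)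
        show "d / C' > 0" using d C' by simp
        fix y assume yX: "y \<in> X" and "dist y x < d / C'"
        then have yt: "\<And>t. t \<in> K \<Longrightarrow> norm (ev t y - ev t x) < d"
          using near[of y x d] d by (auto simp: dist_norm)
        have "norm (N' y - N' x) \<le> e / 2"
        proof (rule norm_blinfun_bound)
          fix h
          have "blinfun_apply (N' y - N' x) h = mkC (\<lambda>t. D y h t - D x h t)"
            unfolding mkC_diff[OF Dcont[OF yX] Dcont[OF x]]
            by (simp add: minus_blinfun.rep_eq N'_apply x yX)
          moreover have "norm (mkC (\<lambda>t. D y h t - D x h t)) \<le> e / 2 * norm h"
          proof (rule norm_mkC[OF continuous_on_diff[OF Dcont[OF yX] Dcont[OF x]]])
            fix t assume "t \<in> {0..2*pi}"
            then have t: "t \<in> K" by (simp add: K_def)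
            have "D y h t - D x h t = blinfun_apply (Gz (t, ev t y) - Gz (t, ev t x)) (ev t h)"
              by (simp add: D_def minus_blinfun.rep_eq)
            then have "norm (D y h t - D x h t) \<le> norm (Gz (t, ev t y) - Gz (t, ev t x)) * norm (ev t h)"
              using norm_blinfun by metis
            also have "\<dots> \<le> e / (2 * C') * (C' * norm h)"
              using d(2) t yt[OF t] bd'[OF t, of h] e' by (intro mult_mono) auto
            finally show "norm (D y h t - D x h t) \<le> e / 2 * norm h" using C' by simp
          qed
          ultimately show "norm (blinfun_apply (N' y - N' x) h) \<le> e / 2 * norm h" by simp
        qed (use e in simp)
        then show "dist (N' y) (N' x) < e" using e by (simp add: dist_norm)
      qed
    qed
  qed
  then show "C1_on {x. \<forall>t\<in>{0..2*pi}. (t, ev t x) \<in> W} (\<lambda>x. mkC (\<lambda>t. G (t, ev t x)))"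
    by (simp add: X_def K_def)
qed

section \<open>Integration operators of Volterra type\<close>

definition IC :: "(real \<Rightarrow>\<^sub>C 'b::euclidean_space) \<Rightarrow>\<^sub>L (real \<Rightarrow>\<^sub>C 'b)" where
  "IC = Blinfun (\<lambda>h. mkC (\<lambda>t. integral {0..t} (apply_bcontfun h)))"

lemma bcontfun_integrable: "apply_bcontfun h integrable_on {a..b}" for h :: "real \<Rightarrow>\<^sub>C 'b::euclidean_space"
  by (rule integrable_continuous_interval) simp

lemma integral_bcontfun_continuous:
  "continuous_on {0..2*pi} (\<lambda>t. integral {0..t} (apply_bcontfun h))" for h :: "real \<Rightarrow>\<^sub>C 'b::euclidean_space"
  by (rule indefinite_integral_continuous_1[OF bcontfun_integrable])

lemma IC_mkC:
  fixes h :: "real \<Rightarrow>\<^sub>C 'b::euclidean_space"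
  shows "blinfun_apply IC h = mkC (\<lambda>t. integral {0..t} (apply_bcontfun h))"
proof -
  have "bounded_linear (\<lambda>h :: real \<Rightarrow>\<^sub>C 'b. mkC (\<lambda>t. integral {0..t} (apply_bcontfun h)))"
  proof (rule bounded_linear_intro[where K = "2 * pi"])
    show "mkC (\<lambda>t. integral {0..t} (apply_bcontfun (h + k))) =
      mkC (\<lambda>t. integral {0..t} (apply_bcontfun h)) + mkC (\<lambda>t. integral {0..t} (apply_bcontfun k))" for h k :: "real \<Rightarrow>\<^sub>C 'b"
      unfolding mkC_add[OF integral_bcontfun_continuous integral_bcontfun_continuous, symmetric]
      by (simp add: plus_bcontfun.rep_eq Henstock_Kurzweil_Integration.integral_add bcontfun_integrable)
    show "mkC (\<lambda>t. integral {0..t} (apply_bcontfun (r *\<^sub>R h))) =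
      r *\<^sub>R mkC (\<lambda>t. integral {0..t} (apply_bcontfun h))" for r and h :: "real \<Rightarrow>\<^sub>C 'b"
      unfolding mkC_scaleR[OF integral_bcontfun_continuous, symmetric]
      by (simp add: scaleR_bcontfun.rep_eq)
    show "norm (mkC (\<lambda>t. integral {0..t} (apply_bcontfun h))) \<le> norm h * (2 * pi)" for h :: "real \<Rightarrow>\<^sub>C 'b"
    proof (rule norm_mkC[OF integral_bcontfun_continuous])
      fix t assume t: "t \<in> {0..2*pi}"
      have "norm (integral {0..t} (apply_bcontfun h)) \<le> norm h * (t - 0)"
        by (rule integral_bound) (use t in \<open>auto simp: norm_bounded\<close>)
      also have "\<dots> \<le> norm h * (2 * pi)" using t by (intro mult_left_mono) auto
      finally show "norm (integral {0..t} (apply_bcontfun h)) \<le> norm h * (2 * pi)" .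
    qed
  qed
  then show ?thesis by (simp add: IC_def bounded_linear_Blinfun_apply)
qed

lemma IC_apply: "t \<in> {0..2*pi} \<Longrightarrow> apply_bcontfun (blinfun_apply IC h) t = integral {0..t} (apply_bcontfun h)"
  by (simp add: IC_mkC mkC_eq integral_bcontfun_continuous del: atLeastAtMost_iff)

lemma IC_has_derivative:
  assumes "t \<in> {0..2*pi}"
  shows "((\<lambda>t. apply_bcontfun (blinfun_apply IC h) t) has_vector_derivative apply_bcontfun h t) (at t within {0..2*pi})"
proof -
  have "((\<lambda>t. integral {0..t} (apply_bcontfun h)) has_vector_derivative apply_bcontfun h t) (at t within {0..2*pi})"
    by (rule integral_has_vector_derivative[OF _ assms]) simp
  then show ?thesis
    by (rule has_vector_derivative_transform[rotated 2]) (use assms in \<open>auto simp: IC_apply\<close>)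
qed

lemma IC_0 [simp]: "apply_bcontfun (blinfun_apply IC h) 0 = 0"
  by (simp add: IC_apply)

text \<open>Iterating the pointwise bound integrates powers of \<open>t\<close>: at time
  \<open>t\<close> the \<open>n\<close>-th iterate is at most \<open>(c * t) ^ n / fact n\<close>,
  so the Neumann series converges for every \<open>c\<close>. The assumption \<open>clipped\<close>
  carries the bound from the interval to the supremum over the line.\<close>

lemma volterra_summable:
  fixes K :: "(real \<Rightarrow>\<^sub>C 'b::euclidean_space) \<Rightarrow>\<^sub>L (real \<Rightarrow>\<^sub>C 'b)"
  assumes c: "c \<ge> 0"
    and K: "\<And>z t. t \<in> {0..2*pi} \<Longrightarrow>
       norm (apply_bcontfun (blinfun_apply K z) t) \<le> c * integral {0..t} (\<lambda>s. norm (apply_bcontfun z s))"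
    and clipped: "\<And>z t. apply_bcontfun (blinfun_apply K z) t = apply_bcontfun (blinfun_apply K z) (clip t)"
  shows "summable (\<lambda>n. norm (((o\<^sub>L) K ^^ n) id_blinfun))"
proof -
  define P where "P n = ((o\<^sub>L) K ^^ n) id_blinfun" for n
  have PS: "blinfun_apply (P (Suc n)) z = blinfun_apply K (blinfun_apply (P n) z)" for n z by (simp add: P_def)
  have est: "\<forall>t\<in>{0..2*pi}. norm (apply_bcontfun (blinfun_apply (P n) z) t) \<le> (c * t) ^ n / fact n * norm z" for n z
  proof (induction n)
    case 0
    then show ?case by (simp add: P_def norm_bounded)
  next
    case (Suc n)
    show ?case
    proof
      fix t assume t: "t \<in> {0..2*pi}"
      have hi: "((\<lambda>s. (c * s) ^ n / fact n * norm z) has_integral (c ^ n * t ^ Suc n / fact (Suc n) * norm z)) {0..t}"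
      proof -
        have "((\<lambda>s. (c * s) ^ n / fact n * norm z) has_integral
          (\<lambda>s. c ^ n * s ^ Suc n / fact (Suc n) * norm z) t - (\<lambda>s. c ^ n * s ^ Suc n / fact (Suc n) * norm z) 0) {0..t}"
        proof (rule fundamental_theorem_of_calculus)
          show "((\<lambda>s. c ^ n * s ^ Suc n / fact (Suc n) * norm z) has_vector_derivative (c * s) ^ n / fact n * norm z) (at s within {0..t})" for s
          proof -
            have "((\<lambda>s. c ^ n * s ^ Suc n / fact (Suc n) * norm z) has_real_derivative
              c ^ n * (real (Suc n) * s ^ n) / fact (Suc n) * norm z) (at s within {0..t})"
              by (auto intro!: derivative_eq_intros simp del: power_Suc)
            moreover have "c ^ n * (real (Suc n) * s ^ n) / fact (Suc n) * norm z = (c * s) ^ n / fact n * norm z"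
            proof -
              have "c ^ n * (real (Suc n) * s ^ n) = real (Suc n) * (c * s) ^ n"
                by (simp add: power_mult_distrib)
              then show ?thesis unfolding fact_Suc of_nat_mult by (simp del: of_nat_Suc)
            qed
            ultimately show ?thesis unfolding has_real_derivative_iff_has_vector_derivative by metis
          qed
        qed (use t in auto)
        then show ?thesis by simp
      qed
      have "norm (apply_bcontfun (blinfun_apply (P (Suc n)) z) t)
          \<le> c * integral {0..t} (\<lambda>s. norm (apply_bcontfun (blinfun_apply (P n) z) s))"
        unfolding PS by (rule K[OF t])
      also have "\<dots> \<le> c * integral {0..t} (\<lambda>s. (c * s) ^ n / fact n * norm z)"
        using Suc t hi
        by (intro mult_left_mono c integral_le integrable_continuous_interval continuous_on_norm) (auto intro!: continuous_intros)
      also have "\<dots> = (c * t) ^ Suc n / fact (Suc n) * norm z"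
        using integral_unique[OF hi] by (simp add: power_mult_distrib)
      finally show "norm (apply_bcontfun (blinfun_apply (P (Suc n)) z) t) \<le> (c * t) ^ Suc n / fact (Suc n) * norm z" .
    qed
  qed
  \<comment> \<open>Stated for successors because only values of \<open>K\<close> are constant
    outside the interval; the identity, which is \<open>P 0\<close>, is not of this kind.\<close>
  have bound: "norm (P (Suc n)) \<le> (c * (2 * pi)) ^ Suc n / fact (Suc n)" for n
  proof (rule norm_blinfun_bound)
    fix z
    show "norm (blinfun_apply (P (Suc n)) z) \<le> (c * (2 * pi)) ^ Suc n / fact (Suc n) * norm z"
    proof (rule norm_bound)
      fix t
      have "norm (apply_bcontfun (blinfun_apply (P (Suc n)) z) (clip t)) \<le> (c * clip t) ^ Suc n / fact (Suc n) * norm z"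
        using est clip_mem by blast
      also have "\<dots> \<le> (c * (2 * pi)) ^ Suc n / fact (Suc n) * norm z"
        using clip_mem[of t] c
        by (intro mult_right_mono divide_right_mono power_mono mult_left_mono) auto
      finally show "norm (apply_bcontfun (blinfun_apply (P (Suc n)) z) t) \<le> (c * (2 * pi)) ^ Suc n / fact (Suc n) * norm z"
        unfolding PS using clipped by metis
    qed
  qed (use c in simp)
  have "summable (\<lambda>n. inverse (fact n) * (c * (2 * pi)) ^ n)" by (rule summable_exp)
  then have "summable (\<lambda>n. (c * (2 * pi)) ^ Suc n / fact (Suc n))"
    by (subst summable_Suc_iff) (simp add: field_simps)
  then have "summable (\<lambda>n. norm (P (Suc n)))"
    by (rule summable_comparison_test'[where N = 0]) (use bound in auto)
  then show ?thesis by (subst (asm) summable_Suc_iff) (simp add: P_def)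
qed

section \<open>The symmetry groups and the forces\<close>

declare transpose_matrix_vector [simp del]

lemma SO3_simps:
  "carrier SO3 = {Q. rotation_matrix Q}" "x \<otimes>\<^bsub>SO3\<^esub> y = x ** y" "\<one>\<^bsub>SO3\<^esub> = mat 1"
  by (simp_all add: SO3_def)

lemma rotation_matrix_mult: "rotation_matrix A \<Longrightarrow> rotation_matrix B \<Longrightarrow> rotation_matrix (A ** B)"
  for A B :: "real^'n^'n"
  by (simp add: rotation_matrix_def orthogonal_matrix_mul det_mul)

lemma rotation_matrix_transpose: "rotation_matrix A \<Longrightarrow> rotation_matrix (transpose A)"
  by (simp add: rotation_matrix_def orthogonal_matrix_transpose)

lemma group_SO3: "group SO3"
proof (rule groupI)
  fix x assume "x \<in> carrier SO3"
  then have "transpose x \<in> carrier SO3 \<and> transpose x \<otimes>\<^bsub>SO3\<^esub> x = \<one>\<^bsub>SO3\<^esub>"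
    by (auto simp: SO3_simps rotation_matrix_transpose) (auto simp: rotation_matrix_def orthogonal_matrix_def)
  then show "\<exists>y\<in>carrier SO3. y \<otimes>\<^bsub>SO3\<^esub> x = \<one>\<^bsub>SO3\<^esub>" by blast
next
  show "\<one>\<^bsub>SO3\<^esub> \<in> carrier SO3"
    by (simp add: SO3_simps rotation_matrix_def orthogonal_matrix_id)
qed (auto simp: SO3_simps rotation_matrix_mult matrix_mul_assoc)

lemma inv_SO3: "x \<in> carrier SO3 \<Longrightarrow> inv\<^bsub>SO3\<^esub> x = transpose x"
proof (rule group.inv_equality[OF group_SO3])
  assume "x \<in> carrier SO3"
  then show "transpose x \<otimes>\<^bsub>SO3\<^esub> x = \<one>\<^bsub>SO3\<^esub>" "transpose x \<in> carrier SO3"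
    by (auto simp: SO3_simps rotation_matrix_transpose) (auto simp: rotation_matrix_def orthogonal_matrix_def)
qed

text \<open>These are the properties of the three groups that enter the analysis.
  \<open>no_fixed_vector\<close> makes sums over an orbit vanish, which keeps the central body at
  rest.\<close>

locale symmetry_group =
  fixes H :: "(real^3^3) set"
  assumes finite_H: "finite H"
    and orthogonal_H: "L \<in> H \<Longrightarrow> orthogonal_matrix L"
    and one_H: "mat 1 \<in> H"
    and mult_H: "L \<in> H \<Longrightarrow> K \<in> H \<Longrightarrow> L ** K \<in> H"
    and transpose_H: "L \<in> H \<Longrightarrow> transpose L \<in> H"
    and no_fixed_vector: "(\<And>L. L \<in> H \<Longrightarrow> L *v x = x) \<Longrightarrow> x = 0"

lemma symmetry_group_generate:
  assumes "finite (generate SO3 {A, B})" "rotation_matrix A" "rotation_matrix B"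
    and fixed: "\<And>x. A *v x = x \<Longrightarrow> B *v x = x \<Longrightarrow> x = 0"
  shows "symmetry_group (generate SO3 {A, B})"
proof -
  have sub: "{A, B} \<subseteq> carrier SO3" using assms by (auto simp: SO3_simps)
  have car: "generate SO3 {A, B} \<subseteq> carrier SO3" by (rule group.generate_incl[OF group_SO3 sub])
  have grp: "subgroup (generate SO3 {A, B}) SO3" by (rule group.generate_is_subgroup[OF group_SO3 sub])
  show ?thesis
  proof
    show "orthogonal_matrix L" if "L \<in> generate SO3 {A, B}" for L
      using that car by (auto simp: SO3_simps rotation_matrix_def)
    show "mat 1 \<in> generate SO3 {A, B}" using subgroup.one_closed[OF grp] by (simp add: SO3_simps)
    show "L ** K \<in> generate SO3 {A, B}" if "L \<in> generate SO3 {A, B}" "K \<in> generate SO3 {A, B}" for L K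
      using subgroup.m_closed[OF grp that] by (simp add: SO3_simps)
    show "transpose L \<in> generate SO3 {A, B}" if "L \<in> generate SO3 {A, B}" for L
      using subgroup.m_inv_closed[OF grp that] inv_SO3[of L] that car by auto
    show "x = 0" if "\<And>L. L \<in> generate SO3 {A, B} \<Longrightarrow> L *v x = x" for x
      by (rule fixed) (auto intro!: that generate.incl)
  qed (fact assms)
qed

lemmas matrix_explicit = matrix_matrix_mult_def matrix_vector_mult_def transpose_def mat_def vec_eq_iff
  forall_3 sum_3

text \<open>Finiteness is a hypothesis here, supplied later by the invertible Hessian, so the group
  elements need not be enumerated. It remains to see that the two generators are rotations without a
  common fixed vector.\<close>

lemma symmetry_group_of_cases:
  assumes "H \<in> {tetrahedral_group, octahedral_group, icosahedral_group}" "finite H"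
  shows "symmetry_group H"
proof -
  consider "H = tetrahedral_group" | "H = octahedral_group" | "H = icosahedral_group" using assms by blast
  then show ?thesis
  proof cases
    case 1
    show ?thesis
      using assms(2) unfolding 1 tetrahedral_group_def
    proof (rule symmetry_group_generate)
      show "rotation_matrix (vector [vector [1, 0, 0], vector [0, -1, 0], vector [0, 0, -1]] :: real^3^3)"
        "rotation_matrix (vector [vector [0, 1, 0], vector [0, 0, 1], vector [1, 0, 0]] :: real^3^3)"
        unfolding rotation_matrix_def orthogonal_matrix by (auto simp: matrix_explicit det_3)
      fix x :: "real^3"
      assume "(vector [vector [1, 0, 0], vector [0, -1, 0], vector [0, 0, -1]] :: real^3^3) *v x = x"
        "(vector [vector [0, 1, 0], vector [0, 0, 1], vector [1, 0, 0]] :: real^3^3) *v x = x"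
      from this[THEN arg_cong, of "\<lambda>v. v $ 1"] this[THEN arg_cong, of "\<lambda>v. v $ 2"] this[THEN arg_cong, of "\<lambda>v. v $ 3"]
      have "x $ 1 = 0" "x $ 2 = 0" "x $ 3 = 0" by (simp_all add: matrix_vector_mult_def sum_3)
      then show "x = 0" by (simp add: vec_eq_iff forall_3)
    qed
  next
    case 2
    show ?thesis
      using assms(2) unfolding 2 octahedral_group_def
    proof (rule symmetry_group_generate)
      show "rotation_matrix (vector [vector [0, -1, 0], vector [1, 0, 0], vector [0, 0, 1]] :: real^3^3)"
        "rotation_matrix (vector [vector [-1, 0, 0], vector [0, 0, 1], vector [0, 1, 0]] :: real^3^3)"
        unfolding rotation_matrix_def orthogonal_matrix by (auto simp: matrix_explicit det_3)
      fix x :: "real^3"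
      assume "(vector [vector [0, -1, 0], vector [1, 0, 0], vector [0, 0, 1]] :: real^3^3) *v x = x"
        "(vector [vector [-1, 0, 0], vector [0, 0, 1], vector [0, 1, 0]] :: real^3^3) *v x = x"
      from this[THEN arg_cong, of "\<lambda>v. v $ 1"] this[THEN arg_cong, of "\<lambda>v. v $ 2"] this[THEN arg_cong, of "\<lambda>v. v $ 3"]
      have "x $ 1 = 0" "x $ 2 = 0" "x $ 3 = 0" by (simp_all add: matrix_vector_mult_def sum_3)
      then show "x = 0" by (simp add: vec_eq_iff forall_3)
    qed
  next
    case 3
    define \<phi> where "\<phi> = (1 + sqrt 5) / 2"
    \<comment> \<open>The quadratic relation of the golden ratio, used as a rewrite rule, reduces
      all entries and the determinant to linear expressions in \<open>\<phi>\<close>.\<close>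
    have "2 * \<phi> - 1 = sqrt 5" by (simp add: \<phi>_def add_divide_distrib)
    then have "(2 * \<phi> - 1)\<^sup>2 = 5" by simp
    then have sq: "\<phi> * \<phi> = \<phi> + 1" by (simp add: power2_eq_square algebra_simps)
    have cube: "\<phi> * (\<phi> * \<phi>) = 2 * \<phi> + 1" by (simp add: sq algebra_simps)
    show ?thesis
      using assms(2) unfolding 3 icosahedral_group_def Let_def \<phi>_def[symmetric]
    proof (rule symmetry_group_generate)
      show "rotation_matrix ((1/2) *\<^sub>R vector [vector [\<phi> - 1, \<phi>, 1], vector [\<phi>, -1, \<phi> - 1], vector [1, \<phi> - 1, -\<phi>]] :: real^3^3)"
        unfolding rotation_matrix_def orthogonal_matrix
        by (auto simp: matrix_explicit det_3 field_simps sq cube)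
      show "rotation_matrix (vector [vector [0, 0, 1], vector [1, 0, 0], vector [0, 1, 0]] :: real^3^3)"
        unfolding rotation_matrix_def orthogonal_matrix by (auto simp: matrix_explicit det_3)
      fix x :: "real^3"
      assume A: "((1/2) *\<^sub>R vector [vector [\<phi> - 1, \<phi>, 1], vector [\<phi>, -1, \<phi> - 1], vector [1, \<phi> - 1, -\<phi>]] :: real^3^3) *v x = x"
        and B: "(vector [vector [0, 0, 1], vector [1, 0, 0], vector [0, 1, 0]] :: real^3^3) *v x = x"
      have "x $ 3 = x $ 1" "x $ 1 = x $ 2"
        using arg_cong[OF B, of "\<lambda>v. v $ 1"] arg_cong[OF B, of "\<lambda>v. v $ 2"]
        by (simp_all add: matrix_vector_mult_def sum_3)
      moreover have "(1/2) * (1 * x $ 1 + (\<phi> - 1) * x $ 2 - \<phi> * x $ 3) = x $ 3"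
        using arg_cong[OF A, of "\<lambda>v. v $ 3"] by (simp add: matrix_vector_mult_def sum_3 field_simps)
      ultimately show "x = 0" by (auto simp: vec_eq_iff forall_3 algebra_simps)
    qed
  qed
qed

section \<open>The Kepler force and the averaged pair interaction\<close>

definition kepler_force :: "real^3 \<Rightarrow> real^3" where
  "kepler_force x = - ((1 / norm x ^ 3) *\<^sub>R x)"

definition pair_potential :: "(real^3^3) set \<Rightarrow> real^3 \<Rightarrow> real" where
  "pair_potential H x = (1/2) * (\<Sum>L\<in>H - {mat 1}. 1 / norm (x - L *v x))"

definition pair_force :: "(real^3^3) set \<Rightarrow> real^3 \<Rightarrow> real^3" where
  "pair_force H x = - (\<Sum>L\<in>H - {mat 1}. (1 / norm (x - L *v x) ^ 3) *\<^sub>R (x - L *v x))"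

definition off_axes :: "(real^3^3) set \<Rightarrow> (real^3) set" where
  "off_axes H = {x. x \<noteq> 0 \<and> (\<forall>L\<in>H - {mat 1}. x \<noteq> L *v x)}"

definition kepler_force' :: "real^3 \<Rightarrow> (real^3) \<Rightarrow>\<^sub>L (real^3)" where
  "kepler_force' x = (3 * (1 / norm x) ^ 5) *\<^sub>R (blinfun_scaleR_left x o\<^sub>L blinfun_inner_right x) - ((1 / norm x) ^ 3) *\<^sub>R id_blinfun"

lemma kepler_force'_apply:
  "blinfun_apply (kepler_force' x) y = - ((1 / norm x ^ 3) *\<^sub>R y) + (3 * (x \<bullet> y) / norm x ^ 5) *\<^sub>R x"
  by (simp add: kepler_force'_def minus_blinfun.rep_eq scaleR_blinfun.rep_eq blinfun_inner_right.rep_eq power_divide algebra_simps)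

lemma norm_power_has_derivative:
  fixes x :: "'a::real_inner"
  assumes "x \<noteq> 0"
  shows "((\<lambda>x. 1 / norm x) has_derivative (\<lambda>h. - (1 / norm x ^ 3) * (x \<bullet> h))) (at x)"
proof -
  have "((\<lambda>x. norm x) has_derivative (\<lambda>h. (x \<bullet> h) / norm x)) (at x)"
    using has_derivative_norm[OF assms] by (simp add: sgn_div_norm inner_commute divide_inverse mult.commute)
  then have "((\<lambda>x. 1 / norm x) has_derivative (\<lambda>h. - ((x \<bullet> h) / norm x) / (norm x * norm x))) (at x)"
    using assms by (auto intro!: derivative_eq_intros simp: field_simps)
  then show ?thesis by (simp add: power3_eq_cube field_simps)
qed

lemma kepler_potential_has_derivative:
  "x \<noteq> 0 \<Longrightarrow> ((\<lambda>x. 1 / norm x) has_derivative (\<lambda>h. kepler_force x \<bullet> h)) (at x)" for x :: "real^3"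
  using norm_power_has_derivative[of x] by (simp add: kepler_force_def)

lemma kepler_force_has_derivative:
  assumes "x \<noteq> 0"
  shows "(kepler_force has_derivative blinfun_apply (kepler_force' x)) (at x)"
proof -
  have "((\<lambda>x. - (((1 / norm x) ^ 3) *\<^sub>R x)) has_derivative
      (\<lambda>h. - ((1 / norm x) ^ 3 *\<^sub>R h + (of_nat 3 * (- (1 / norm x ^ 3) * (x \<bullet> h)) * (1 / norm x) ^ (3 - 1)) *\<^sub>R x))) (at x)"
    by (intro has_derivative_minus has_derivative_scaleR has_derivative_power norm_power_has_derivative[OF assms] has_derivative_ident)
  moreover have "of_nat 3 * (- (1 / norm x ^ 3) * (x \<bullet> h)) * (1 / norm x) ^ (3 - 1) = - (3 * (x \<bullet> h) / norm x ^ 5)" for h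
    using assms by (simp add: power_divide flip: power_add)
  ultimately have "((\<lambda>x. - (((1 / norm x) ^ 3) *\<^sub>R x)) has_derivative blinfun_apply (kepler_force' x)) (at x)"
    by (simp add: kepler_force'_apply[abs_def] power_divide)
  then show ?thesis by (simp add: kepler_force_def[abs_def] power_divide)
qed

lemma C2_on_kepler_force: "C2_on (- {0}) kepler_force"
  unfolding kepler_force_def[abs_def] by (auto intro!: C_intros)

lemma C1_on_kepler_force': "C1_on (- {0}) kepler_force'"
proof -
  obtain g where g: "\<And>x. x \<in> - {0} \<Longrightarrow> (kepler_force has_derivative blinfun_apply (g x)) (at x)" "C1_on (- {0}) g"
    using C2_on_kepler_force unfolding C2_on_def by blast
  have "g x = kepler_force' x" if "x \<in> - {0}" for x
    using has_derivative_unique[OF g(1)[OF that] kepler_force_has_derivative] that by (simp add: blinfun_apply_inject)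
  then show ?thesis by (intro C1_on_cong_open[OF _ _ g(2)]) auto
qed

lemma kepler_force'_symmetric: "blinfun_apply (kepler_force' x) a \<bullet> b = blinfun_apply (kepler_force' x) b \<bullet> a"
  by (simp add: kepler_force'_apply inner_add_left inner_diff_left inner_diff_right inner_commute)

text \<open>The difference quotient of the Kepler force, written without division by the increment
  so that it extends smoothly to \<open>e = 0\<close>.\<close>

definition force_quotient :: "real^3 \<Rightarrow> real^3 \<Rightarrow> real \<Rightarrow> real^3" where
  "force_quotient x y e = (let a = norm x; b = norm (x + e *\<^sub>R y) in
     - ((1 / b ^ 3) *\<^sub>R y) + ((2 * (x \<bullet> y) + e * (y \<bullet> y)) * (a\<^sup>2 + a * b + b\<^sup>2) / ((a + b) * (a ^ 3 * b ^ 3))) *\<^sub>R x)"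

text \<open>With the distances \<open>a\<close> and \<open>b\<close>, the difference of inverse
  cubes is \<open>(b - a) * (a^2 + a*b + b^2) / (a^3 * b^3)\<close>, and \<open>b - a\<close> is
  \<open>b^2 - a^2\<close> divided by \<open>a + b\<close>. The increment \<open>e\<close> is an
  explicit factor of \<open>b^2 - a^2\<close>, so it can be taken out algebraically.\<close>

lemma force_quotient:
  assumes "x \<noteq> 0" "x + e *\<^sub>R y \<noteq> 0"
  shows "kepler_force (x + e *\<^sub>R y) = kepler_force x + e *\<^sub>R force_quotient x y e"
proof -
  define a b where "a = norm x" and "b = norm (x + e *\<^sub>R y)"
  have ab: "a > 0" "b > 0" using assms by (auto simp: a_def b_def)
  have "b\<^sup>2 - a\<^sup>2 = e * (2 * (x \<bullet> y) + e * (y \<bullet> y))"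
    unfolding a_def b_def power2_norm_eq_inner
    by (simp add: inner_add_left inner_add_right inner_commute algebra_simps)
  then have "(b - a) * (a + b) = e * (2 * (x \<bullet> y) + e * (y \<bullet> y))" by (simp add: power2_eq_square algebra_simps)
  then have *: "e * (2 * (x \<bullet> y) + e * (y \<bullet> y)) / (a + b) = b - a" using ab by (simp add: field_simps)
  have "e * ((2 * (x \<bullet> y) + e * (y \<bullet> y)) * (a\<^sup>2 + a * b + b\<^sup>2) / ((a + b) * (a ^ 3 * b ^ 3)))
      = (e * (2 * (x \<bullet> y) + e * (y \<bullet> y)) / (a + b)) * (a\<^sup>2 + a * b + b\<^sup>2) / (a ^ 3 * b ^ 3)" by simp
  also have "\<dots> = (b - a) * (a\<^sup>2 + a * b + b\<^sup>2) / (a ^ 3 * b ^ 3)" unfolding * ..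
  also have "(b - a) * (a\<^sup>2 + a * b + b\<^sup>2) = b ^ 3 - a ^ 3" by (simp add: power2_eq_square power3_eq_cube algebra_simps)
  also have "(b ^ 3 - a ^ 3) / (a ^ 3 * b ^ 3) = 1 / a ^ 3 - 1 / b ^ 3" using ab by (simp add: field_simps)
  finally have **: "e * ((2 * (x \<bullet> y) + e * (y \<bullet> y)) * (a\<^sup>2 + a * b + b\<^sup>2) / ((a + b) * (a ^ 3 * b ^ 3))) = 1 / a ^ 3 - 1 / b ^ 3" .
  have "e *\<^sub>R force_quotient x y e = - ((e / b ^ 3) *\<^sub>R y) + (1 / a ^ 3 - 1 / b ^ 3) *\<^sub>R x"
    unfolding force_quotient_def Let_def a_def[symmetric] b_def[symmetric] scaleR_add_right scaleR_scaleR **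
    by simp
  then show ?thesis
    unfolding kepler_force_def a_def[symmetric] b_def[symmetric] by (simp add: algebra_simps)
qed

lemma force_quotient_0: "x \<noteq> 0 \<Longrightarrow> force_quotient x y 0 = blinfun_apply (kepler_force' x) y"
proof -
  assume "x \<noteq> 0"
  then have "2 * (x \<bullet> y) * ((norm x)\<^sup>2 + norm x * norm x + (norm x)\<^sup>2) / ((norm x + norm x) * (norm x ^ 3 * norm x ^ 3)) = 3 * (x \<bullet> y) / norm x ^ 5"
    by (simp add: field_simps eval_nat_numeral)
  then show ?thesis by (simp add: force_quotient_def Let_def kepler_force'_apply)
qed

lemma C1_on_force_quotient:
  assumes "C1_on S f" "C1_on S g" "C1_on S h" "\<And>p. p \<in> S \<Longrightarrow> f p \<noteq> 0" "\<And>p. p \<in> S \<Longrightarrow> f p + h p *\<^sub>R g p \<noteq> 0"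
  shows "C1_on S (\<lambda>p. force_quotient (f p) (g p) (h p))"
proof -
  have "norm (f p) + norm (f p + h p *\<^sub>R g p) \<noteq> 0" if "p \<in> S" for p
    using assms(4)[OF that] norm_ge_zero[of "f p + h p *\<^sub>R g p"] by (simp add: add_nonneg_eq_0_iff)
  then show ?thesis unfolding force_quotient_def Let_def using assms by (intro C_intros) auto
qed

context symmetry_group
begin

lemma norm_H: "L \<in> H \<Longrightarrow> norm (L *v x) = norm x"
  using orthogonal_H orthogonal_transformation_matrix
  by (metis matrix_of_matrix_vector_mul matrix_vector_mul_linear orthogonal_transformation)

lemma transpose_mult: "L \<in> H \<Longrightarrow> transpose L ** L = mat 1" "L \<in> H \<Longrightarrow> L ** transpose L = mat 1"
  using orthogonal_H by (auto simp: orthogonal_matrix_def)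

lemma transpose_vector_mult: "L \<in> H \<Longrightarrow> transpose L *v (L *v x) = x" "L \<in> H \<Longrightarrow> L *v (transpose L *v x) = x"
  using transpose_mult by (auto simp: matrix_vector_mul_assoc)

lemma sum_transpose: "(\<Sum>L\<in>H - {mat 1}. g (transpose L)) = (\<Sum>L\<in>H - {mat 1}. g L)"
  by (rule sum.reindex_bij_witness[where i = transpose and j = transpose])
    (use transpose_H in \<open>auto simp: transpose_transpose, (metis transpose_transpose transpose_mat)+\<close>)

text \<open>The distances belonging to \<open>L\<close> and \<open>transpose L\<close> agree, and
  moving \<open>L\<close> across the inner product sends the difference vector of \<open>L\<close>
  to minus that of its transpose. After reindexing by transposition the part of the derivative
  containing \<open>L *v h\<close> repeats the other part, and the two copies cancel the factor
  1/2.\<close>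

lemma pair_potential_has_derivative:
  assumes "x \<in> off_axes H"
  shows "(pair_potential H has_derivative (\<lambda>h. pair_force H x \<bullet> h)) (at x)"
proof -
  define d where "d L = (1 / norm (x - L *v x) ^ 3) *\<^sub>R (x - L *v x)" for L :: "real^3^3"
  have ne: "x - L *v x \<noteq> 0" if "L \<in> H - {mat 1}" for L using assms that by (auto simp: off_axes_def)
  have "((\<lambda>x. 1 / norm (x - L *v x)) has_derivative (\<lambda>h. - (d L \<bullet> (h - L *v h)))) (at x)" if "L \<in> H - {mat 1}" for L
  proof -
    have "((\<lambda>x. x - L *v x) has_derivative (\<lambda>h. h - L *v h)) (at x)"
      by (intro has_derivative_diff has_derivative_ident bounded_linear_imp_has_derivative matrix_vector_mul_bounded_linear)
    from has_derivative_compose[OF this norm_power_has_derivative[OF ne[OF that]]]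
    show ?thesis by (simp add: d_def)
  qed
  then have "(pair_potential H has_derivative (\<lambda>h. (1/2) * (\<Sum>L\<in>H - {mat 1}. - (d L \<bullet> (h - L *v h))))) (at x)"
    unfolding pair_potential_def[abs_def] by (intro has_derivative_mult_right has_derivative_sum) auto
  moreover have "(1/2) * (\<Sum>L\<in>H - {mat 1}. - (d L \<bullet> (h - L *v h))) = pair_force H x \<bullet> h" for h
  proof -
    have tr: "- (d L \<bullet> (h - L *v h)) = - (d L \<bullet> h) - d (transpose L) \<bullet> h" if "L \<in> H" for L
    proof -
      have "norm (x - L *v x) = norm (x - transpose L *v x)"
      proof -
        have "x - L *v x = - (L *v (x - transpose L *v x))"
          by (simp add: matrix_vector_mult_diff_distrib transpose_vector_mult that)
        then show ?thesis using norm_H[OF that] by (metis norm_minus_cancel)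
      qed
      moreover have "(x - L *v x) \<bullet> (L *v h) = - ((x - transpose L *v x) \<bullet> h)"
      proof -
        have "(x - L *v x) \<bullet> (L *v h) = (transpose L *v (x - L *v x)) \<bullet> h"
          by (simp add: dot_lmul_matrix transpose_matrix_vector)
        then show ?thesis
          by (simp add: matrix_vector_mult_diff_distrib transpose_vector_mult that inner_diff_left)
      qed
      ultimately show ?thesis by (simp add: d_def inner_diff_right)
    qed
    have "(\<Sum>L\<in>H - {mat 1}. - (d L \<bullet> (h - L *v h))) = (\<Sum>L\<in>H - {mat 1}. - (d L \<bullet> h) - d (transpose L) \<bullet> h)"
      using tr by (intro sum.cong) auto
    also have "\<dots> = 2 * (\<Sum>L\<in>H - {mat 1}. - (d L \<bullet> h))"
      using sum_transpose[of "\<lambda>L. d L \<bullet> h"] by (simp add: sum_subtractf sum_negf)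
    finally show ?thesis by (simp add: pair_force_def d_def inner_sum_left sum_negf)
  qed
  ultimately show ?thesis by simp
qed

lemma open_off_axes: "open (off_axes H)"
proof -
  have "off_axes H = - {0} \<inter> (\<Inter>L\<in>H - {mat 1}. {x. x - L *v x \<noteq> 0})" by (auto simp: off_axes_def)
  moreover have "open {x. x - L *v x \<noteq> 0}" for L :: "real^3^3"
    by (intro open_Collect_neq continuous_intros matrix_vector_mult_linear_continuous_on)
  ultimately show ?thesis using finite_H by (auto intro!: open_Int open_INT open_delete)
qed

lemma C1_on_pair_force: "C1_on (off_axes H) (pair_force H)"
  unfolding pair_force_def[abs_def] by (intro C_intros) (auto simp: off_axes_def)

lemma C2_on_pair_potential: "C2_on (off_axes H) (pair_potential H)"
  unfolding pair_potential_def[abs_def] by (intro C_intros) (auto simp: off_axes_def)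

lemma pair_force_minus: "pair_force H (- x) = - pair_force H x"
proof -
  have "L *v (- x) = - (L *v x)" for L :: "real^3^3"
    using matrix_vector_mult_diff_distrib[of L 0 x] by simp
  then have "- x - L *v (- x) = - (x - L *v x)" for L :: "real^3^3" by simp
  then show ?thesis unfolding pair_force_def by (simp only: norm_minus_cancel scaleR_minus_right sum_negf)
qed

end

section \<open>The chart of Kepler ellipses\<close>

lemma abs_cos_sin_comb: "a * cos x + b * sin x \<le> sqrt (a\<^sup>2 + b\<^sup>2)"
proof (rule real_le_rsqrt)
  have "(a * cos x + b * sin x)\<^sup>2 + (a * sin x - b * cos x)\<^sup>2 = a\<^sup>2 + b\<^sup>2"
    using sin_cos_squared_add[of x] by algebra
  then show "(a * cos x + b * sin x)\<^sup>2 \<le> a\<^sup>2 + b\<^sup>2" using zero_le_power2[of "a * sin x - b * cos x"] by linarith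
qed

lemma kepler_denominator_pos: "a\<^sup>2 + b\<^sup>2 < 1 \<Longrightarrow> 0 < 1 - a * cos x - b * sin x" for a b x :: real
proof -
  assume "a\<^sup>2 + b\<^sup>2 < 1"
  then have "sqrt (a\<^sup>2 + b\<^sup>2) < 1" by simp
  then show ?thesis using abs_cos_sin_comb[of a x b] by linarith
qed

text \<open>The solution of Kepler's equation, shifted by the longitude of the perihelion so that it
  stays smooth at eccentricity \<open>0\<close>: if \<open>a = e cos \<psi>\<^sub>3\<close> and \<open>b = e sin \<psi>\<^sub>3\<close> then
  \<open>ecc a b t - \<psi>\<^sub>3\<close> is the eccentric anomaly at time \<open>t - \<psi>\<^sub>3\<close>.\<close>

definition ecc :: "real \<Rightarrow> real \<Rightarrow> real \<Rightarrow> real" where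
  "ecc a b t = (THE F. F - a * sin F + b * cos F = t)"

lemma ecc_ex1:
  fixes a b t :: real
  assumes "a\<^sup>2 + b\<^sup>2 < 1"
  shows "\<exists>!F. F - a * sin F + b * cos F = t"
proof -
  define f where "f F = F - a * sin F + b * cos F" for F :: real
  have der: "(f has_real_derivative 1 - a * cos F - b * sin F) (at F)" for F
    unfolding f_def by (auto intro!: derivative_eq_intros)
  have inc: "f x < f y" if "x < y" for x y
    by (rule DERIV_pos_imp_increasing[OF that]) (use der kepler_denominator_pos[OF assms] in blast)
  have small: "\<bar>- a * sin F + b * cos F\<bar> \<le> 1" for F
  proof -
    have "sqrt (b\<^sup>2 + a\<^sup>2) \<le> 1" using assms by (simp add: add.commute)
    then show ?thesis
      using abs_cos_sin_comb[of b F "-a"] abs_cos_sin_comb[of "-b" F a] unfolding abs_le_iff power2_minus by linarith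
  qed
  \<comment> \<open>The trigonometric terms of Kepler's equation are at most 1 in absolute value, so
    the root lies within distance 2 of \<open>t\<close>.\<close>
  have "\<exists>F. t - 2 \<le> F \<and> F \<le> t + 2 \<and> f F = t"
  proof (rule IVT)
    show "f (t - 2) \<le> t" "t \<le> f (t + 2)" using small[of "t - 2"] small[of "t + 2"] by (auto simp: f_def abs_le_iff)
    show "\<forall>x. t - 2 \<le> x \<and> x \<le> t + 2 \<longrightarrow> isCont f x" using der DERIV_isCont by blast
  qed simp
  then show ?thesis using inc unfolding f_def by (metis linorder_neq_iff order_less_irrefl)
qed

lemma ecc_eq: "a\<^sup>2 + b\<^sup>2 < 1 \<Longrightarrow> ecc a b t - a * sin (ecc a b t) + b * cos (ecc a b t) = t"
  unfolding ecc_def by (rule theI'[OF ecc_ex1])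

lemma ecc_unique: "a\<^sup>2 + b\<^sup>2 < 1 \<Longrightarrow> F - a * sin F + b * cos F = t \<Longrightarrow> ecc a b t = F"
  using ecc_ex1 ecc_eq by blast

lemma ecc_periodic: "a\<^sup>2 + b\<^sup>2 < 1 \<Longrightarrow> ecc a b (t + 2*pi) = ecc a b t + 2*pi"
  by (rule ecc_unique) (use ecc_eq[of a b t] in simp_all)

lemma ecc_circle: "ecc 0 0 t = t"
  by (rule ecc_unique) auto

definition disc3 :: "(real \<times> real \<times> real) set" where
  "disc3 = {x. (fst x)\<^sup>2 + (fst (snd x))\<^sup>2 < 1}"

lemma open_disc3: "open disc3"
  unfolding disc3_def by (intro open_Collect_less continuous_intros)

text \<open>The map that replaces the third coordinate by the left side of Kepler's equation is
  locally invertible, since its derivative in that direction is the positive radius. Global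
  uniqueness of the root identifies the local inverse with \<open>ecc\<close>.\<close>

lemma C1_on_ecc3: "C1_on disc3 (\<lambda>x. ecc (fst x) (fst (snd x)) (snd (snd x)))"
proof (rule C1_on_locally)
  fix x :: "real \<times> real \<times> real" assume x: "x \<in> disc3"
  obtain a b t where abt: "x = (a, b, t)" using prod_cases3 by blast
  have ab: "a\<^sup>2 + b\<^sup>2 < 1" using x by (simp add: abt disc3_def)
  define F where "F = ecc a b t"
  define r where "r = 1 - a * cos F - b * sin F"
  have r: "r > 0" unfolding r_def by (rule kepler_denominator_pos[OF ab])
  define f where "f x = (fst x, fst (snd x), snd (snd x) - fst x * sin (snd (snd x)) + fst (snd x) * cos (snd (snd x)))"
    for x :: "real \<times> real \<times> real"
  define A where "A h = (fst h, fst (snd h), r * snd (snd h) - sin F * fst h + cos F * fst (snd h))" for h :: "real \<times> real \<times> real"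
  define B where "B h = (fst h, fst (snd h), (1 / r) * (snd (snd h) + sin F * fst h - cos F * fst (snd h)))" for h :: "real \<times> real \<times> real"
  have blA: "bounded_linear A" unfolding A_def
    by (intro bounded_linear_Pair bounded_linear_add bounded_linear_sub bounded_linear_const_mult bounded_linear_fst
        bounded_linear_compose[OF bounded_linear_fst] bounded_linear_compose[OF bounded_linear_snd] bounded_linear_snd)
  have blB: "bounded_linear B" unfolding B_def
    by (intro bounded_linear_Pair bounded_linear_add bounded_linear_sub bounded_linear_const_mult bounded_linear_fst
        bounded_linear_compose[OF bounded_linear_fst] bounded_linear_compose[OF bounded_linear_snd] bounded_linear_snd)
  have Cf: "C1_on disc3 f" unfolding f_def by (intro C_intros)
  have fd: "(f has_derivative blinfun_apply (Blinfun A)) (at (a, b, F))"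
    unfolding bounded_linear_Blinfun_apply[OF blA] f_def A_def r_def
    by (auto intro!: derivative_eq_intros simp: algebra_simps)
  have AB: "A (B h) = h" "B (A h) = h" for h using r by (simp_all add: A_def B_def)
  have x0: "(a, b, F) \<in> disc3" using ab by (simp add: disc3_def)
  have BA1: "Blinfun B o\<^sub>L Blinfun A = id_blinfun" "Blinfun A o\<^sub>L Blinfun B = id_blinfun"
    by (auto intro!: blinfun_eqI simp: bounded_linear_Blinfun_apply[OF blA] bounded_linear_Blinfun_apply[OF blB] AB)
  obtain U V g where g: "open U" "U \<subseteq> disc3" "open V" "f (a, b, F) \<in> V"
    "\<And>y. y \<in> V \<Longrightarrow> g y \<in> U \<and> f (g y) = y" "C1_on V g"
    using inverse_function_banach[OF open_disc3 x0 Cf fd BA1] by metis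
  have "f (a, b, F) = x" using ecc_eq[OF ab, of t] by (simp add: f_def abt F_def)
  then have "x \<in> V" using g by simp
  moreover have "C1_on V (\<lambda>x. ecc (fst x) (fst (snd x)) (snd (snd x)))"
  proof (rule C1_on_cong_open[OF g(3)])
    show "C1_on V (\<lambda>y. snd (snd (g y)))" by (intro C_intros g)
    fix y assume "y \<in> V"
    then have gy: "g y \<in> disc3" "f (g y) = y" using g(2) g(5)[of y] by blast+
    then have "fst (g y) = fst y" "fst (snd (g y)) = fst (snd y)"
      "snd (snd (g y)) - fst y * sin (snd (snd (g y))) + fst (snd y) * cos (snd (snd (g y))) = snd (snd y)"
      by (auto simp: f_def prod_eq_iff)
    then show "snd (snd (g y)) = ecc (fst y) (fst (snd y)) (snd (snd y))"
      using gy(1) by (intro ecc_unique[symmetric]) (auto simp: disc3_def)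
  qed
  ultimately show "\<exists>U. open U \<and> x \<in> U \<and> C1_on U (\<lambda>x. ecc (fst x) (fst (snd x)) (snd (snd x)))" using g by blast
qed

text \<open>Implicit differentiation expresses the derivative of \<open>ecc\<close> through sines
  and cosines of \<open>ecc\<close> itself over a nonvanishing denominator. As \<open>ecc\<close> is
  already C1, so is this expression.\<close>

lemma C2_on_ecc3: "C2_on disc3 (\<lambda>x. ecc (fst x) (fst (snd x)) (snd (snd x)))"
proof -
  define e where "e x = ecc (fst x) (fst (snd x)) (snd (snd x))" for x
  have Ce: "C1_on disc3 e" using C1_on_ecc3 unfolding e_def .
  then obtain e' where e': "\<And>x. x \<in> disc3 \<Longrightarrow> (e has_derivative blinfun_apply (e' x)) (at x)" "continuous_on disc3 e'"
    unfolding C1_on_def by blast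
  define d where "d x = inverse (1 - fst x * cos (e x) - fst (snd x) * sin (e x)) *\<^sub>R
     (((snd_blinfun :: (real \<times> real) \<Rightarrow>\<^sub>L real) o\<^sub>L (snd_blinfun :: (real \<times> real \<times> real) \<Rightarrow>\<^sub>L (real \<times> real))) + sin (e x) *\<^sub>R fst_blinfun - cos (e x) *\<^sub>R (fst_blinfun o\<^sub>L snd_blinfun))" for x
  have pos: "1 - fst x * cos (e x) - fst (snd x) * sin (e x) \<noteq> 0" if "x \<in> disc3" for x
    using that kepler_denominator_pos[of "fst x" "fst (snd x)" "e x"] by (auto simp: disc3_def)
  have "e' x = d x" if x: "x \<in> disc3" for x
  proof (rule blinfun_eqI)
    fix h
    have "((\<lambda>x. e x - fst x * sin (e x) + fst (snd x) * cos (e x)) has_derivative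
      (\<lambda>h. blinfun_apply (e' x) h - (fst h * sin (e x) + fst x * (cos (e x) * blinfun_apply (e' x) h))
        + (fst (snd h) * cos (e x) + fst (snd x) * (- sin (e x) * blinfun_apply (e' x) h)))) (at x)"
      by (auto intro!: derivative_eq_intros e'(1)[OF x] simp: algebra_simps)
    moreover have "((\<lambda>x. e x - fst x * sin (e x) + fst (snd x) * cos (e x)) has_derivative (\<lambda>h. snd (snd h))) (at x)"
    proof (rule has_derivative_transform_within_open[OF _ open_disc3 x])
      show "((\<lambda>x. snd (snd x)) has_derivative (\<lambda>h. snd (snd h))) (at x)" by (auto intro!: derivative_eq_intros)
      show "snd (snd y) = e y - fst y * sin (e y) + fst (snd y) * cos (e y)" if "y \<in> disc3" for y
        using ecc_eq[of "fst y" "fst (snd y)" "snd (snd y)"] that by (simp add: e_def disc3_def)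
    qed
    ultimately have "blinfun_apply (e' x) h - (fst h * sin (e x) + fst x * (cos (e x) * blinfun_apply (e' x) h))
        + (fst (snd h) * cos (e x) + fst (snd x) * (- sin (e x) * blinfun_apply (e' x) h)) = snd (snd h)"
      by (rule has_derivative_unique[THEN fun_cong])
    then have "(1 - fst x * cos (e x) - fst (snd x) * sin (e x)) * blinfun_apply (e' x) h =
        snd (snd h) + sin (e x) * fst h - cos (e x) * fst (snd h)"
      by (simp add: algebra_simps)
    then have "blinfun_apply (e' x) h = inverse (1 - fst x * cos (e x) - fst (snd x) * sin (e x)) *
        (snd (snd h) + sin (e x) * fst h - cos (e x) * fst (snd h))"
      by (metis (no_types) pos[OF x] mult.assoc left_inverse mult_1)
    then show "blinfun_apply (e' x) h = blinfun_apply (d x) h"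
      by (simp add: d_def scaleR_blinfun.rep_eq plus_blinfun.rep_eq minus_blinfun.rep_eq)
  qed
  then have "\<And>x. x \<in> disc3 \<Longrightarrow> (e has_derivative blinfun_apply (d x)) (at x)" using e' by metis
  moreover have "C1_on disc3 d" unfolding d_def by (intro C_intros Ce) (use pos in auto)
  ultimately have "C2_on disc3 e" by (rule C2_onI)
  then show ?thesis unfolding e_def .
qed

lemma C2_on_ecc [C_intros]:
  assumes "C2_on S f" "C2_on S g" "C2_on S h" "\<And>x. x \<in> S \<Longrightarrow> (f x)\<^sup>2 + (g x)\<^sup>2 < 1"
  shows "C2_on S (\<lambda>x. ecc (f x) (g x) (h x))"
proof -
  have "(\<lambda>x. (f x, g x, h x)) ` S \<subseteq> disc3" using assms(4) by (auto simp: disc3_def)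
  from C2_on_compose[OF C2_on_ecc3 C2_on_Pair[OF assms(1) C2_on_Pair[OF assms(2,3)]] this]
  show ?thesis by simp
qed

text \<open>Regularity supplies the existence of the derivative, and differentiating Kepler's
  equation along the line gives its value.\<close>

lemma ecc_line_has_derivative:
  assumes "a\<^sup>2 + b\<^sup>2 < 1"
  shows "((\<lambda>s. ecc (a + s * \<alpha>) (b + s * \<beta>) (t + s * \<tau>)) has_real_derivative
    (\<tau> + \<alpha> * sin (ecc a b t) - \<beta> * cos (ecc a b t)) / (1 - a * cos (ecc a b t) - b * sin (ecc a b t))) (at 0)"
proof -
  define S where "S = {s. (a + s * \<alpha>)\<^sup>2 + (b + s * \<beta>)\<^sup>2 < 1}"
  have S: "open S" "0 \<in> S" unfolding S_def using assms by (auto intro!: open_Collect_less continuous_intros)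
  define E where "E s = ecc (a + s * \<alpha>) (b + s * \<beta>) (t + s * \<tau>)" for s
  have "C2_on S E" unfolding E_def by (intro C_intros) (auto simp: S_def)
  then obtain E' where E': "(E has_derivative blinfun_apply E') (at 0)" using S unfolding C2_on_def by blast
  have "blinfun_apply E' = (*) (blinfun_apply E' 1)"
  proof
    fix h :: real
    have "blinfun_apply E' (h *\<^sub>R 1) = h *\<^sub>R blinfun_apply E' 1" by (rule blinfun.scaleR_right)
    then show "blinfun_apply E' h = blinfun_apply E' 1 * h" by (simp add: mult.commute)
  qed
  then have d: "(E has_real_derivative blinfun_apply E' 1) (at 0)"
    using E' by (simp add: has_field_derivative_def)
  have "((\<lambda>s. E s - (a + s * \<alpha>) * sin (E s) + (b + s * \<beta>) * cos (E s)) has_real_derivative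
    blinfun_apply E' 1 - (\<alpha> * sin (E 0) + a * (cos (E 0) * blinfun_apply E' 1)) + (\<beta> * cos (E 0) - b * (sin (E 0) * blinfun_apply E' 1))) (at 0)"
    by (auto intro!: derivative_eq_intros d)
  moreover have "((\<lambda>s. E s - (a + s * \<alpha>) * sin (E s) + (b + s * \<beta>) * cos (E s)) has_real_derivative \<tau>) (at 0)"
  proof (rule has_field_derivative_transform_within_open[OF _ S])
    show "((\<lambda>s. t + s * \<tau>) has_real_derivative \<tau>) (at 0)" by (auto intro!: derivative_eq_intros)
  qed (auto simp: E_def S_def ecc_eq)
  ultimately have "blinfun_apply E' 1 - (\<alpha> * sin (E 0) + a * (cos (E 0) * blinfun_apply E' 1)) + (\<beta> * cos (E 0) - b * (sin (E 0) * blinfun_apply E' 1)) = \<tau>"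
    by (rule DERIV_unique)
  then have "blinfun_apply E' 1 * (1 - a * cos (E 0) - b * sin (E 0)) = \<tau> + \<alpha> * sin (E 0) - \<beta> * cos (E 0)"
    by (simp add: algebra_simps)
  then have "blinfun_apply E' 1 = (\<tau> + \<alpha> * sin (E 0) - \<beta> * cos (E 0)) / (1 - a * cos (E 0) - b * sin (E 0))"
    by (intro nonzero_eq_divide_eq[THEN iffD2]) (use kepler_denominator_pos[OF assms, of "E 0"] in linarith)
  then show ?thesis using d unfolding E_def by simp
qed

lemma ecc_has_derivative:
  assumes "a\<^sup>2 + b\<^sup>2 < 1"
  shows "((\<lambda>t. ecc a b t) has_real_derivative 1 / (1 - a * cos (ecc a b t) - b * sin (ecc a b t))) (at t)"
proof -
  have "((\<lambda>s. ecc a b (t + s)) has_real_derivative 1 / (1 - a * cos (ecc a b t) - b * sin (ecc a b t))) (at 0)"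
    using ecc_line_has_derivative[OF assms, of 0 0 t 1] by simp
  then show ?thesis by (simp add: DERIV_at_within_shift_lemma DERIV_shift[of _ _ 0 t, simplified, symmetric] add.commute)
qed

text \<open>Together with \<open>kX\<close> and \<open>kY\<close> this is the classical description
  of the position in the orbital plane by equinoctial elements, with semi-major axis 1 and eccentric
  longitude \<open>F\<close>. These expressions stay smooth in \<open>a\<close> and \<open>b\<close>
  at \<open>a = b = 0\<close>, in contrast to those in eccentricity and perihelion angle.\<close>

definition kbeta :: "real \<Rightarrow> real \<Rightarrow> real" where
  "kbeta a b = 1 / (1 + sqrt (1 - a\<^sup>2 - b\<^sup>2))"

definition kX :: "real \<Rightarrow> real \<Rightarrow> real \<Rightarrow> real" where
  "kX a b F = (1 - b\<^sup>2 * kbeta a b) * cos F + a * b * kbeta a b * sin F - a"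

definition kY :: "real \<Rightarrow> real \<Rightarrow> real \<Rightarrow> real" where
  "kY a b F = (1 - a\<^sup>2 * kbeta a b) * sin F + a * b * kbeta a b * cos F - b"

definition kXd :: "real \<Rightarrow> real \<Rightarrow> real \<Rightarrow> real" where
  "kXd a b F = (a * b * kbeta a b * cos F - (1 - b\<^sup>2 * kbeta a b) * sin F) / (1 - a * cos F - b * sin F)"

definition kYd :: "real \<Rightarrow> real \<Rightarrow> real \<Rightarrow> real" where
  "kYd a b F = ((1 - a\<^sup>2 * kbeta a b) * cos F - a * b * kbeta a b * sin F) / (1 - a * cos F - b * sin F)"

text \<open>\<open>kbeta\<close> is a root of \<open>e^2 * x^2 - 2 * x + 1\<close> with
  \<open>e^2 = a^2 + b^2\<close>. This polynomial relation removes the square root from the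
  identities for the radius and the acceleration.\<close>

lemma kbeta_eq:
  assumes "a\<^sup>2 + b\<^sup>2 < 1"
  shows "(a\<^sup>2 + b\<^sup>2) * (kbeta a b)\<^sup>2 = 2 * kbeta a b - 1"
proof -
  define c where "c = sqrt (1 - a\<^sup>2 - b\<^sup>2)"
  have c: "c \<ge> 0" "c\<^sup>2 = 1 - a\<^sup>2 - b\<^sup>2" using assms by (auto simp: c_def)
  have "kbeta a b * (1 + c) = 1" using c(1) by (simp add: kbeta_def c_def add_nonneg_eq_0_iff)
  then show ?thesis using c(2) by algebra
qed

lemma kX_kY_norm:
  assumes "a\<^sup>2 + b\<^sup>2 < 1"
  shows "(kX a b F)\<^sup>2 + (kY a b F)\<^sup>2 = (1 - a * cos F - b * sin F)\<^sup>2"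
proof -
  define k C S where "k = kbeta a b" and "C = cos F" and "S = sin F"
  have k: "(a * a + b * b) * (k * k) = 2 * k - 1" using kbeta_eq[OF assms] by (simp add: k_def power2_eq_square)
  have cs: "C * C + S * S = 1" using sin_cos_squared_add3[of F] by (simp add: C_def S_def)
  show ?thesis unfolding kX_def kY_def k_def[symmetric] C_def[symmetric] S_def[symmetric] power2_eq_square
    using k cs by algebra
qed

text \<open>Time and eccentric longitude are related by \<open>dt = r dF\<close>, where
  \<open>r\<close> is the radius, so each time derivative brings one more division by
  \<open>r\<close>. What is left of Newton's equation are the polynomial identities
  \<open>idX\<close> and \<open>idY\<close>, valid modulo the relations for \<open>kbeta\<close> and
  for sine and cosine.\<close>

lemma kXd_has_derivative:
  assumes "a\<^sup>2 + b\<^sup>2 < 1"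
  shows "((\<lambda>t. kX a b (ecc a b t)) has_real_derivative kXd a b (ecc a b t)) (at t)"
    and "((\<lambda>t. kY a b (ecc a b t)) has_real_derivative kYd a b (ecc a b t)) (at t)"
    and "((\<lambda>t. kXd a b (ecc a b t)) has_real_derivative - kX a b (ecc a b t) / (1 - a * cos (ecc a b t) - b * sin (ecc a b t)) ^ 3) (at t)"
    and "((\<lambda>t. kYd a b (ecc a b t)) has_real_derivative - kY a b (ecc a b t) / (1 - a * cos (ecc a b t) - b * sin (ecc a b t)) ^ 3) (at t)"
proof -
  define F where "F = ecc a b t"
  define r where "r = 1 - a * cos F - b * sin F"
  have r: "r > 0" unfolding r_def by (rule kepler_denominator_pos[OF assms])
  have dE: "((\<lambda>t. ecc a b t) has_real_derivative 1 / r) (at t)"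
    using ecc_has_derivative[OF assms] by (simp add: r_def F_def)
  define k C S where "k = kbeta a b" and "C = cos F" and "S = sin F"
  have k: "(a * a + b * b) * (k * k) = 2 * k - 1" using kbeta_eq[OF assms] by (simp add: k_def power2_eq_square)
  have cs: "C * C + S * S = 1" using sin_cos_squared_add3[of F] by (simp add: C_def S_def)
  have rCS: "r = 1 - a * C - b * S" by (simp add: r_def C_def S_def)
  have X: "(kX a b has_real_derivative (a * b * k * C - (1 - b\<^sup>2 * k) * S)) (at F)"
    unfolding kX_def k_def[symmetric] by (auto intro!: derivative_eq_intros simp: C_def S_def algebra_simps)
  have Y: "(kY a b has_real_derivative ((1 - a\<^sup>2 * k) * C - a * b * k * S)) (at F)"
    unfolding kY_def k_def[symmetric] by (auto intro!: derivative_eq_intros simp: C_def S_def algebra_simps)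
  have r0: "1 - a * cos F - b * sin F \<noteq> 0" using r by (simp add: r_def)
  have Xd: "(kXd a b has_real_derivative ((- (a * b * k * S) - (1 - b\<^sup>2 * k) * C) * r - (a * b * k * C - (1 - b\<^sup>2 * k) * S) * (a * S - b * C)) / (r * r)) (at F)"
    unfolding kXd_def k_def[symmetric] rCS
    by (rule derivative_eq_intros refl r0 | simp add: C_def S_def mult_ac)+
  have Yd: "(kYd a b has_real_derivative ((- ((1 - a\<^sup>2 * k) * S) - a * b * k * C) * r - ((1 - a\<^sup>2 * k) * C - a * b * k * S) * (a * S - b * C)) / (r * r)) (at F)"
    unfolding kYd_def k_def[symmetric] rCS
    by (rule derivative_eq_intros refl r0 | simp add: C_def S_def mult_ac)+
  have idX: "(- (a * b * k * S) - (1 - b\<^sup>2 * k) * C) * r - (a * b * k * C - (1 - b\<^sup>2 * k) * S) * (a * S - b * C) = - kX a b F"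
    unfolding kX_def k_def[symmetric] C_def[symmetric] S_def[symmetric] rCS power2_eq_square using k cs by algebra
  have idY: "(- ((1 - a\<^sup>2 * k) * S) - a * b * k * C) * r - ((1 - a\<^sup>2 * k) * C - a * b * k * S) * (a * S - b * C) = - kY a b F"
    unfolding kY_def k_def[symmetric] C_def[symmetric] S_def[symmetric] rCS power2_eq_square using k cs by algebra
  have ch: "((\<lambda>t. f (ecc a b t)) has_real_derivative D * (1 / r)) (at t)" if "(f has_real_derivative D) (at F)" for f D
    using DERIV_chain2[of f D "ecc a b" t "1 / r"] that dE by (simp add: F_def)
  show "((\<lambda>t. kX a b (ecc a b t)) has_real_derivative kXd a b (ecc a b t)) (at t)"
    using ch[OF X] by (simp add: kXd_def F_def[symmetric] r_def k_def C_def S_def)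
  show "((\<lambda>t. kY a b (ecc a b t)) has_real_derivative kYd a b (ecc a b t)) (at t)"
    using ch[OF Y] by (simp add: kYd_def F_def[symmetric] r_def k_def C_def S_def)
  show "((\<lambda>t. kXd a b (ecc a b t)) has_real_derivative - kX a b (ecc a b t) / (1 - a * cos (ecc a b t) - b * sin (ecc a b t)) ^ 3) (at t)"
    using ch[OF Xd] unfolding idX by (simp add: F_def[symmetric] r_def[symmetric] power3_eq_cube)
  show "((\<lambda>t. kYd a b (ecc a b t)) has_real_derivative - kY a b (ecc a b t) / (1 - a * cos (ecc a b t) - b * sin (ecc a b t)) ^ 3) (at t)"
    using ch[OF Yd] unfolding idY by (simp add: F_def[symmetric] r_def[symmetric] power3_eq_cube)
qed

text \<open>\<open>frameA\<close>, \<open>frameB\<close> and \<open>frameN\<close> are the images of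
  the three coordinate vectors under \<open>orientation\<close>; \<open>frameN\<close> is the normal
  of the orbital plane.\<close>

definition frameA :: "real \<Rightarrow> real \<Rightarrow> real^3" where
  "frameA p q = cos q *\<^sub>R axis 1 1 - (sin p * sin q) *\<^sub>R axis 2 1 + (cos p * sin q) *\<^sub>R axis 3 1"
definition frameB :: "real \<Rightarrow> real \<Rightarrow> real^3" where
  "frameB p q = cos p *\<^sub>R axis 2 1 + sin p *\<^sub>R axis 3 1"
definition frameN :: "real \<Rightarrow> real \<Rightarrow> real^3" where
  "frameN p q = - sin q *\<^sub>R axis 1 1 - (sin p * cos q) *\<^sub>R axis 2 1 + (cos p * cos q) *\<^sub>R axis 3 1"

lemma axis_inner_3:
  "(axis 1 1 :: real^3) \<bullet> axis 2 1 = 0" "(axis 1 1 :: real^3) \<bullet> axis 3 1 = 0" "(axis 2 1 :: real^3) \<bullet> axis 3 1 = 0"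
  "(axis i 1 :: real^3) \<bullet> axis i 1 = 1"
  by (simp_all add: inner_axis_axis)

lemma frame_orthonormal:
  "frameA p q \<bullet> frameA p q = 1" "frameB p q \<bullet> frameB p q = 1" "frameN p q \<bullet> frameN p q = 1"
  "frameA p q \<bullet> frameB p q = 0" "frameA p q \<bullet> frameN p q = 0" "frameB p q \<bullet> frameN p q = 0"
proof -
  define x y z w where "x = sin p" and "y = cos p" and "z = sin q" and "w = cos q"
  have P: "x * x + y * y = 1" and Q: "z * z + w * w = 1"
    using sin_cos_squared_add3[of p] sin_cos_squared_add3[of q] by (simp_all add: x_def y_def z_def w_def add.commute)
  note ring0 = mult_zero_right mult_zero_left mult_1_right add_0_left add_0_right diff_0_right minus_zero
  note d = frameA_def frameB_def frameN_def x_def[symmetric] y_def[symmetric] z_def[symmetric] w_def[symmetric]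
    inner_add_left inner_add_right inner_diff_left inner_diff_right inner_scaleR_left inner_scaleR_right axis_inner_3
    inner_commute[of "axis 2 1" "axis 1 1"] inner_commute[of "axis 3 1" "axis 1 1"] inner_commute[of "axis 3 1" "axis 2 1"]
  show "frameA p q \<bullet> frameA p q = 1" unfolding d by (simp only: ring0, (use P Q in algebra | simp add: algebra_simps)?)
  show "frameB p q \<bullet> frameB p q = 1" unfolding d by (simp only: ring0, (use P Q in algebra | simp add: algebra_simps)?)
  show "frameN p q \<bullet> frameN p q = 1" unfolding d by (simp only: ring0, (use P Q in algebra | simp add: algebra_simps)?)
  show "frameA p q \<bullet> frameB p q = 0" unfolding d by (simp only: ring0, (use P Q in algebra | simp add: algebra_simps)?)
  show "frameA p q \<bullet> frameN p q = 0" unfolding d by (simp only: ring0, (use P Q in algebra | simp add: algebra_simps)?)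
  show "frameB p q \<bullet> frameN p q = 0" unfolding d by (simp only: ring0, (use P Q in algebra | simp add: algebra_simps)?)
qed

text \<open>Parameters and time are one argument, so that time translation is a direction of
  differentiation, \<open>(0, 1)\<close>, on the same footing as the four parameters.\<close>

definition kchart :: "(real^4) \<times> real \<Rightarrow> real^3" where
  "kchart P = (let p = fst P; F = ecc (p$1) (p$2) (snd P) in
     kX (p$1) (p$2) F *\<^sub>R frameA (p$3) (p$4) + kY (p$1) (p$2) F *\<^sub>R frameB (p$3) (p$4))"

definition kvel :: "(real^4) \<times> real \<Rightarrow> real^3" where
  "kvel P = (let p = fst P; F = ecc (p$1) (p$2) (snd P) in
     kXd (p$1) (p$2) F *\<^sub>R frameA (p$3) (p$4) + kYd (p$1) (p$2) F *\<^sub>R frameB (p$3) (p$4))"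

definition disc4 :: "(real^4) set" where "disc4 = {p. (p$1)\<^sup>2 + (p$2)\<^sup>2 < 1}"

lemma open_disc4: "open disc4"
  unfolding disc4_def by (intro open_Collect_less continuous_intros)

lemma C2_on_kchart: "C2_on (disc4 \<times> UNIV) kchart" and C2_on_kvel: "C2_on (disc4 \<times> UNIV) kvel"
proof -
  have 1: "0 < 1 - (fst P $ 1)\<^sup>2 - (fst P $ 2)\<^sup>2" "1 + sqrt (1 - (fst P $ 1)\<^sup>2 - (fst P $ 2)\<^sup>2) \<noteq> 0"
    "\<And>F. 1 - fst P $ 1 * cos F - fst P $ 2 * sin F \<noteq> 0" if "P \<in> disc4 \<times> (UNIV :: real set)" for P
  proof -
    have *: "(fst P $ 1)\<^sup>2 + (fst P $ 2)\<^sup>2 < 1" using that by (auto simp: disc4_def)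
    then show 0: "0 < 1 - (fst P $ 1)\<^sup>2 - (fst P $ 2)\<^sup>2" by simp
    show "1 + sqrt (1 - (fst P $ 1)\<^sup>2 - (fst P $ 2)\<^sup>2) \<noteq> 0" using real_sqrt_ge_zero[OF less_imp_le[OF 0]] by linarith
    show "1 - fst P $ 1 * cos F - fst P $ 2 * sin F \<noteq> 0" for F using kepler_denominator_pos[OF *, of F] by simp
  qed
  show "C2_on (disc4 \<times> UNIV) kchart"
    unfolding kchart_def[abs_def] Let_def kX_def kY_def kbeta_def frameA_def frameB_def
    by (intro C_intros) (use 1 in \<open>auto simp: disc4_def\<close>)
  show "C2_on (disc4 \<times> UNIV) kvel"
    unfolding kvel_def[abs_def] Let_def kXd_def kYd_def kbeta_def frameA_def frameB_def
    by (intro C_intros) (use 1 in \<open>auto simp: disc4_def\<close>)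
qed

lemma norm_comb: "norm (x *\<^sub>R frameA p q + y *\<^sub>R frameB p q) = sqrt (x\<^sup>2 + y\<^sup>2)"
  by (simp add: norm_eq_sqrt_inner inner_add_left inner_add_right frame_orthonormal inner_commute[of "frameB p q" "frameA p q"] power2_eq_square)

lemma norm_kchart:
  assumes "p \<in> disc4"
  shows "norm (kchart (p, t)) = 1 - p$1 * cos (ecc (p$1) (p$2) t) - p$2 * sin (ecc (p$1) (p$2) t)"
  using assms kepler_denominator_pos[of "p$1" "p$2" "ecc (p$1) (p$2) t"]
  by (simp add: kchart_def Let_def norm_comb kX_kY_norm disc4_def)

lemma kchart_nonzero: "p \<in> disc4 \<Longrightarrow> kchart (p, t) \<noteq> 0"
  using norm_kchart[of p t] kepler_denominator_pos[of "p$1" "p$2" "ecc (p$1) (p$2) t"] by (auto simp: disc4_def)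

lemma kchart_has_derivative:
  assumes "p \<in> disc4"
  shows "((\<lambda>t. kchart (p, t)) has_vector_derivative kvel (p, t)) (at t)"
    and "((\<lambda>t. kvel (p, t)) has_vector_derivative kepler_force (kchart (p, t))) (at t)"
proof -
  have ab: "(p$1)\<^sup>2 + (p$2)\<^sup>2 < 1" using assms by (simp add: disc4_def)
  note d = kXd_has_derivative[OF ab]
  show "((\<lambda>t. kchart (p, t)) has_vector_derivative kvel (p, t)) (at t)"
    unfolding kchart_def kvel_def Let_def fst_conv snd_conv
    by (rule derivative_eq_intros d refl | simp)+
  have *: "(\<lambda>t. kvel (p, t)) = (\<lambda>t. kXd (p$1) (p$2) (ecc (p$1) (p$2) t) *\<^sub>R frameA (p$3) (p$4) + kYd (p$1) (p$2) (ecc (p$1) (p$2) t) *\<^sub>R frameB (p$3) (p$4))"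
    by (simp add: kvel_def Let_def)
  have "((\<lambda>t. kvel (p, t)) has_vector_derivative
     (- kX (p$1) (p$2) (ecc (p$1) (p$2) t) / norm (kchart (p, t)) ^ 3) *\<^sub>R frameA (p$3) (p$4)
     + (- kY (p$1) (p$2) (ecc (p$1) (p$2) t) / norm (kchart (p, t)) ^ 3) *\<^sub>R frameB (p$3) (p$4)) (at t)"
    unfolding * norm_kchart[OF assms]
    by (rule derivative_eq_intros d refl | simp)+
  then show "((\<lambda>t. kvel (p, t)) has_vector_derivative kepler_force (kchart (p, t))) (at t)"
    by (simp add: kepler_force_def) (simp add: kchart_def Let_def algebra_simps scaleR_diff_right)
qed

lemma kchart_periodic: "p \<in> disc4 \<Longrightarrow> kchart (p, t + 2*pi) = kchart (p, t)"
  and kvel_periodic: "p \<in> disc4 \<Longrightarrow> kvel (p, t + 2*pi) = kvel (p, t)"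
  by (simp_all add: kchart_def kvel_def Let_def disc4_def ecc_periodic kX_def kY_def kXd_def kYd_def)

text \<open>Since the cube of \<open>J\<close> is \<open>-J\<close>, odd powers are multiples of
  \<open>J\<close> and positive even powers multiples of its square; the series splits into sine and
  cosine. This is Rodrigues' formula.\<close>

lemma matrix_exp_rotation:
  fixes J :: "real^3^3"
  assumes J: "J ** (J ** J) = - J"
  shows "matrix_exp (\<theta> *\<^sub>R J) = mat 1 + sin \<theta> *\<^sub>R J + (1 - cos \<theta>) *\<^sub>R (J ** J)"
proof -
  define T where "T k = (((**) (\<theta> *\<^sub>R J)) ^^ k) (mat 1)" for k
  have smult: "(c *\<^sub>R A) ** B = c *\<^sub>R (A ** B)" "A ** (c *\<^sub>R B) = c *\<^sub>R (A ** B)" for c and A B :: "real^3^3"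
    by (simp_all add: matrix_matrix_mult_def vec_eq_iff sum_distrib_left mult_ac)
  have TS: "T (Suc k) = \<theta> *\<^sub>R (J ** T k)" for k by (simp add: T_def smult)
  have minus: "J ** (- B) = - (J ** B)" for B :: "real^3^3" using smult(2)[of J "-1" B] by simp
  have T: "T (2 * k + 1) = ((-1) ^ k * \<theta> ^ (2 * k + 1)) *\<^sub>R J \<and> T (2 * k + 2) = ((-1) ^ k * \<theta> ^ (2 * k + 2)) *\<^sub>R (J ** J)" for k
  proof (induction k)
    case 0
    show ?case using TS[of 0] TS[of 1] by (simp add: T_def smult matrix_mul_rid)
  next
    case (Suc k)
    have "T (2 * Suc k + 1) = \<theta> *\<^sub>R (J ** T (2 * k + 2))" using TS[of "2 * k + 2"] by simp
    also have "\<dots> = ((-1) ^ Suc k * \<theta> ^ (2 * Suc k + 1)) *\<^sub>R J" using Suc by (simp add: smult J)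
    finally have 1: "T (2 * Suc k + 1) = ((-1) ^ Suc k * \<theta> ^ (2 * Suc k + 1)) *\<^sub>R J" .
    have "T (2 * Suc k + 2) = \<theta> *\<^sub>R (J ** T (2 * Suc k + 1))" using TS[of "2 * Suc k + 1"] by simp
    then show ?case using 1 by (simp add: smult minus)
  qed
  \<comment> \<open>The cosine series starts with 1, whereas the zeroth term of the exponential is
    the identity and not minus the square of \<open>J\<close>; \<open>I2\<close> corrects this
    single term.\<close>
  define I2 where "I2 k = (if k = 0 then mat 1 + J ** J else 0 :: real^3^3)" for k :: nat
  have termk: "(1 / fact k) *\<^sub>R T k = (sin_coeff k * \<theta> ^ k) *\<^sub>R J - (cos_coeff k * \<theta> ^ k) *\<^sub>R (J ** J) + I2 k" for k
  proof (cases "even k")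
    case True
    show ?thesis
    proof (cases k)
      case 0
      then show ?thesis by (simp add: T_def I2_def cos_coeff_def)
    next
      case (Suc j)
      with True obtain m where m: "k = 2 * m + 2" by (elim evenE) (metis Suc_eq_plus1 add_2_eq_Suc' mult_2 nat.exhaust mult_Suc_right mult_0_right nat.distinct(1) add.commute)
      then have "T k = ((-1) ^ m * \<theta> ^ k) *\<^sub>R (J ** J)" using T[of m] by simp
      then show ?thesis using m by (simp add: I2_def sin_coeff_def cos_coeff_def)
    qed
  next
    case False
    then obtain m where m: "k = 2 * m + 1" by (elim oddE)
    then have "T k = ((-1) ^ m * \<theta> ^ k) *\<^sub>R J" using T[of m] by simp
    then show ?thesis using m by (simp add: I2_def sin_coeff_def cos_coeff_def)
  qed
  have "(\<lambda>k. (sin_coeff k * \<theta> ^ k) *\<^sub>R J - (cos_coeff k * \<theta> ^ k) *\<^sub>R (J ** J) + I2 k) sums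
      (sin \<theta> *\<^sub>R J - cos \<theta> *\<^sub>R (J ** J) + (mat 1 + J ** J))"
  proof (intro sums_add sums_diff sums_scaleR_left)
    show "(\<lambda>k. sin_coeff k * \<theta> ^ k) sums sin \<theta>" using sin_converges[of \<theta>] by simp
    show "(\<lambda>k. cos_coeff k * \<theta> ^ k) sums cos \<theta>" using cos_converges[of \<theta>] by simp
    show "I2 sums (mat 1 + J ** J)" using sums_single[of 0 "\<lambda>_. mat 1 + J ** J"] by (simp add: I2_def[abs_def])
  qed
  then have "(\<Sum>k. (1 / fact k) *\<^sub>R T k) = sin \<theta> *\<^sub>R J - cos \<theta> *\<^sub>R (J ** J) + (mat 1 + J ** J)"
    unfolding termk by (rule sums_unique[symmetric])
  then show ?thesis unfolding matrix_exp_def T_def by (simp add: algebra_simps scaleR_diff_left)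
qed

lemma J_cube: "J1 ** (J1 ** J1) = - J1" "J2 ** (J2 ** J2) = - J2" "J3 ** (J3 ** J3) = - J3"
  by (simp_all add: J1_def J2_def J3_def matrix_explicit)

lemma matrix_exp_J1: "matrix_exp (\<theta> *\<^sub>R J1) *v x = vector [x$1, cos \<theta> * x$2 - sin \<theta> * x$3, sin \<theta> * x$2 + cos \<theta> * x$3]"
  and matrix_exp_J2: "matrix_exp (\<theta> *\<^sub>R J2) *v x = vector [cos \<theta> * x$1 - sin \<theta> * x$3, x$2, sin \<theta> * x$1 + cos \<theta> * x$3]"
  and matrix_exp_J3: "matrix_exp (\<theta> *\<^sub>R J3) *v x = vector [cos \<theta> * x$1 - sin \<theta> * x$2, sin \<theta> * x$1 + cos \<theta> * x$2, x$3]"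
  unfolding matrix_exp_rotation[OF J_cube(1)] matrix_exp_rotation[OF J_cube(2)] matrix_exp_rotation[OF J_cube(3)]
  by (simp_all add: J1_def J2_def J3_def matrix_explicit algebra_simps)

lemma orientation_apply:
  "orientation \<psi> *v vector [x, y, 0] = x *\<^sub>R frameA (\<psi>$1) (\<psi>$2) + y *\<^sub>R frameB (\<psi>$1) (\<psi>$2)"
  unfolding orientation_def matrix_vector_mul_assoc[symmetric] matrix_exp_J1 matrix_exp_J2
  by (simp add: frameA_def frameB_def vec_eq_iff forall_3 axis_def algebra_simps)

lemma circular_orbit_frame:
  "circular_orbit \<psi> t = cos t *\<^sub>R frameA (\<psi>$1) (\<psi>$2) + sin t *\<^sub>R frameB (\<psi>$1) (\<psi>$2)"
  unfolding circular_orbit_def orientation_apply ..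

text \<open>Because \<open>true_anomaly\<close> is a definite description, uniqueness is needed on
  the whole line. The right side is Lipschitz in the angle, and the squared difference of two
  solutions, weighted by a decaying exponential for positive and a growing one for negative times,
  is monotone and starts from 0.\<close>

lemma true_anomaly_unique:
  assumes e: "0 \<le> e" "e < 1"
    and x: "x 0 = 0" "\<And>t. (x has_real_derivative sqrt (1 - e\<^sup>2) / (kepler_radius e (x t))\<^sup>2) (at t)"
    and y: "y 0 = 0" "\<And>t. (y has_real_derivative sqrt (1 - e\<^sup>2) / (kepler_radius e (y t))\<^sup>2) (at t)"
  shows "x t = y t"
proof -
  define K where "K = sqrt (1 - e\<^sup>2) / (1 - e\<^sup>2)\<^sup>2"
  define g where "g s = K * (1 + e * cos s)\<^sup>2" for s
  have e2: "e\<^sup>2 < 1" using e by (simp add: power_less_one_iff abs_square_less_1)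
  then have K: "K \<ge> 0" by (simp add: K_def)
  have g: "sqrt (1 - e\<^sup>2) / (kepler_radius e s)\<^sup>2 = g s" for s
    by (simp add: kepler_radius_def g_def K_def power_divide)
  have dg: "(g has_real_derivative (- 2 * K * (1 + e * cos s) * (e * sin s))) (at s within UNIV)" for s
    unfolding g_def by (auto intro!: derivative_eq_intros simp: power2_eq_square)
  \<comment> \<open>The derivative of \<open>g\<close> is \<open>2 * K\<close> times a factor of
    modulus at most 2 times a factor of modulus at most 1.\<close>
  define L where "L = 4 * K"
  have L: "\<bar>g a - g b\<bar> \<le> L * \<bar>a - b\<bar>" for a b
  proof -
    have "norm (g a - g b) \<le> L * norm (a - b)"
    proof (rule field_differentiable_bound[OF convex_UNIV dg])
      fix s
      have "\<bar>1 + e * cos s\<bar> \<le> 2" "\<bar>e * sin s\<bar> \<le> 1"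
      proof -
        have "\<bar>e * cos s\<bar> \<le> 1 * 1" "\<bar>e * sin s\<bar> \<le> 1 * 1" unfolding abs_mult using e by (intro mult_mono; simp)+
        then show "\<bar>1 + e * cos s\<bar> \<le> 2" "\<bar>e * sin s\<bar> \<le> 1" by linarith+
      qed
      moreover define u v where "u = 1 + e * cos s" and "v = e * sin s"
      ultimately have "(2 * K) * (\<bar>u\<bar> * \<bar>v\<bar>) \<le> (2 * K) * (2 * 1)"
        using K by (intro mult_left_mono mult_mono) auto
      moreover have "norm (- 2 * K * u * v) = (2 * K) * (\<bar>u\<bar> * \<bar>v\<bar>)" using K by (simp add: abs_mult)
      ultimately show "norm (- 2 * K * (1 + e * cos s) * (e * sin s)) \<le> L"
        by (simp add: L_def u_def v_def)
    qed auto
    then show ?thesis by simp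
  qed
  define d where "d t = x t - y t" for t
  have dd: "(d has_real_derivative (g (x t) - g (y t))) (at t)" for t
    unfolding d_def using DERIV_diff[OF x(2) y(2)] by (simp add: g)
  have key: "d t * (g (x t) - g (y t)) \<le> L * (d t)\<^sup>2" "- (d t * (g (x t) - g (y t))) \<le> L * (d t)\<^sup>2" for t
  proof -
    have "\<bar>d t * (g (x t) - g (y t))\<bar> \<le> \<bar>d t\<bar> * (L * \<bar>d t\<bar>)"
      unfolding abs_mult using L[of "x t" "y t"] by (intro mult_left_mono) (auto simp: d_def)
    also have "\<dots> = L * (d t)\<^sup>2" by (simp add: power2_eq_square abs_mult_self_eq mult_ac)
    finally show "d t * (g (x t) - g (y t)) \<le> L * (d t)\<^sup>2" "- (d t * (g (x t) - g (y t))) \<le> L * (d t)\<^sup>2" by linarith+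
  qed
  have d0: "d 0 = 0" by (simp add: d_def x y)
  have "(d t)\<^sup>2 \<le> 0"
  proof (cases "t \<ge> 0")
    case True
    have "(d t)\<^sup>2 * exp (- 2 * L * t) \<le> (d 0)\<^sup>2 * exp (- 2 * L * 0)"
    proof (rule DERIV_nonpos_imp_nonincreasing[OF True])
      fix s
      have "((\<lambda>s. (d s)\<^sup>2 * exp (- 2 * L * s)) has_real_derivative
        2 * (d s * (g (x s) - g (y s)) - L * (d s)\<^sup>2) * exp (- 2 * L * s)) (at s)"
        by (auto intro!: derivative_eq_intros dd simp: algebra_simps power2_eq_square)
      moreover have "2 * (d s * (g (x s) - g (y s)) - L * (d s)\<^sup>2) * exp (- 2 * L * s) \<le> 0"
        by (rule mult_nonpos_nonneg) (use key(1)[of s] in simp_all)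
      ultimately show "\<exists>z. ((\<lambda>s. (d s)\<^sup>2 * exp (- 2 * L * s)) has_real_derivative z) (at s) \<and> z \<le> 0" by blast
    qed
    then show ?thesis by (simp add: d0 mult_le_0_iff)
  next
    case False
    then have "t \<le> 0" by simp
    have "(d t)\<^sup>2 * exp (2 * L * t) \<le> (d 0)\<^sup>2 * exp (2 * L * 0)"
    proof (rule DERIV_nonneg_imp_nondecreasing[OF \<open>t \<le> 0\<close>])
      fix s
      have "((\<lambda>s. (d s)\<^sup>2 * exp (2 * L * s)) has_real_derivative
        2 * (d s * (g (x s) - g (y s)) + L * (d s)\<^sup>2) * exp (2 * L * s)) (at s)"
        by (auto intro!: derivative_eq_intros dd simp: algebra_simps power2_eq_square)
      moreover have "0 \<le> 2 * (d s * (g (x s) - g (y s)) + L * (d s)\<^sup>2) * exp (2 * L * s)"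
      proof (rule mult_nonneg_nonneg)
        show "0 \<le> 2 * (d s * (g (x s) - g (y s)) + L * (d s)\<^sup>2)"
        proof -
          define w where "w = d s * (g (x s) - g (y s))"
          have "- w \<le> L * (d s)\<^sup>2" unfolding w_def by (rule key)
          from add_left_mono[OF this, of w] have "0 \<le> w + L * (d s)\<^sup>2" by simp
          then show ?thesis unfolding w_def[symmetric] by (intro mult_nonneg_nonneg) simp_all
        qed
      qed simp
      ultimately show "\<exists>z. ((\<lambda>s. (d s)\<^sup>2 * exp (2 * L * s)) has_real_derivative z) (at s) \<and> 0 \<le> z" by blast
    qed
    then show ?thesis by (simp add: d0 mult_le_0_iff)
  qed
  then show ?thesis by (simp add: d_def)
qed

text \<open>The half-angle relation between true and eccentric anomaly is used in the form
  \<open>E + 2 * arctan (k * sin E / (1 - k * cos E))\<close> with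
  \<open>k = e / (1 + sqrt (1 - e^2))\<close>. As \<open>k < 1\<close>, this formula is smooth on
  the whole line and has no branch jumps. It solves the defining differential equation, and
  uniqueness identifies it with \<open>true_anomaly\<close>.\<close>

lemma kepler_ellipse_eq:
  assumes e: "0 \<le> e" "e < 1"
  shows "kepler_ellipse e \<tau> = vector [cos (ecc e 0 \<tau>) - e, sqrt (1 - e\<^sup>2) * sin (ecc e 0 \<tau>), 0]"
proof -
  have e2: "e\<^sup>2 < 1" using e by (simp add: power_less_one_iff abs_square_less_1)
  define c where "c = sqrt (1 - e\<^sup>2)"
  have c: "c > 0" "c * c = 1 - e * e" using e2 by (auto simp: c_def power2_eq_square)
  define k where "k = e / (1 + c)"
  have ke: "k * (1 + c) = e" using c by (simp add: k_def)
  have k1: "0 \<le> k" "k < 1" using e c by (auto simp: k_def field_simps)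
  have kc: "(1 + k * k) * c = 1 - k * k" and k2: "(1 + k * k) * e = 2 * k"
  proof -
    have "(1 + c) * ((1 + c) * ((1 + k * k) * c - (1 - k * k)))
        = (1 + c) * (1 + c) * (c - 1) + (k * (1 + c)) * (k * (1 + c)) * (1 + c)" by (simp add: algebra_simps)
    also have "\<dots> = (1 + c) * (c * c - (1 - e * e))" unfolding ke by (simp add: algebra_simps)
    finally have "(1 + c) * ((1 + c) * ((1 + k * k) * c - (1 - k * k))) = 0" using c by simp
    then show "(1 + k * k) * c = 1 - k * k" using c(1) by (simp add: add_nonneg_eq_0_iff)
    have "(1 + c) * ((1 + c) * ((1 + k * k) * e - 2 * k))
        = (1 + c) * (1 + c) * e + (k * (1 + c)) * (k * (1 + c)) * e - 2 * (1 + c) * (k * (1 + c))" by (simp add: algebra_simps)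
    also have "\<dots> = e * (c * c - (1 - e * e))" unfolding ke by (simp add: algebra_simps)
    finally have "(1 + c) * ((1 + c) * ((1 + k * k) * e - 2 * k)) = 0" using c by simp
    then show "(1 + k * k) * e = 2 * k" using c(1) by (simp add: add_nonneg_eq_0_iff)
  qed
  define E where "E t = ecc e 0 t" for t
  define m n r where "m t = 1 - k * cos (E t)" and "n t = k * sin (E t)" and "r t = 1 - e * cos (E t)" for t
  define \<theta> where "\<theta> t = E t + 2 * arctan (n t / m t)" for t
  have ab: "e\<^sup>2 + 0\<^sup>2 < 1" using e2 by simp
  have r: "r t > 0" for t using kepler_denominator_pos[OF ab, of "E t"] by (simp add: r_def)
  have m: "m t > 0" for t
  proof -
    have "k * cos (E t) \<le> k * 1" using k1 by (intro mult_left_mono) auto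
    then show ?thesis using k1 by (simp add: m_def)
  qed
  have mn: "m t * m t + n t * n t = (1 + k * k) * r t" for t
  proof -
    define C S where "C = cos (E t)" and "S = sin (E t)"
    have "C * C + S * S = 1" using sin_cos_squared_add3[of "E t"] by (simp add: C_def S_def)
    then show ?thesis unfolding m_def n_def r_def C_def[symmetric] S_def[symmetric] using k2 by algebra
  qed
  have dE: "(E has_real_derivative 1 / r t) (at t)" for t
    using ecc_has_derivative[OF ab, of t] by (simp add: E_def[abs_def] r_def)
  have dth: "(\<theta> has_real_derivative c / (r t)\<^sup>2) (at t)" for t
  proof -
    have dn: "(n has_real_derivative k * cos (E t) * (1 / r t)) (at t)"
      and dm: "(m has_real_derivative k * sin (E t) * (1 / r t)) (at t)"
      unfolding n_def m_def by (auto intro!: derivative_eq_intros dE)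
    have m0: "m t \<noteq> 0" using m[of t] by simp
    have "(\<theta> has_real_derivative 1 / r t + 2 * (((k * cos (E t) * (1 / r t)) * m t - n t * (k * sin (E t) * (1 / r t))) / (m t * m t) / (1 + (n t / m t)\<^sup>2))) (at t)"
      unfolding \<theta>_def
      by (rule derivative_eq_intros dE dn dm refl m0 | simp add: divide_inverse)+
    moreover have "1 / r t + 2 * (((k * cos (E t) * (1 / r t)) * m t - n t * (k * sin (E t) * (1 / r t))) / (m t * m t) / (1 + (n t / m t)\<^sup>2)) = c / (r t)\<^sup>2"
    proof -
      have "(m t * m t) * (1 + (n t / m t)\<^sup>2) = m t * m t + n t * n t" using m0 by (simp add: power2_eq_square field_simps)
      then have q: "x / (m t * m t) / (1 + (n t / m t)\<^sup>2) = x / ((1 + k * k) * r t)" for x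
        by (metis divide_divide_eq_left mn)
      define C S where "C = cos (E t)" and "S = sin (E t)"
      have cs: "C * C + S * S = 1" using sin_cos_squared_add3[of "E t"] by (simp add: C_def S_def)
      have "k * C * m t - n t * (k * S) = k * C - k * k"
        unfolding m_def n_def C_def[symmetric] S_def[symmetric] using cs by algebra
      then have *: "(k * C * (1 / r t)) * m t - n t * (k * S * (1 / r t)) = (k * C - k * k) / r t"
        by (simp add: diff_divide_distrib[symmetric] field_simps)
      have rt: "r t = 1 - e * C" by (simp add: r_def C_def)
      have rc: "(1 + k * k) * r t + 2 * (k * C - k * k) = (1 + k * k) * c"
        unfolding rt using kc k2 by algebra
      have kk: "1 + k * k > 0" by (simp add: add_pos_nonneg)
      define w where "w = (k * C - k * k) / (1 + k * k)"
      have w: "k * C - k * k = w * (1 + k * k)" using kk by (simp add: w_def)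
      have "(1 + k * k) * (r t + 2 * w) = (1 + k * k) * c"
        using rc w by algebra
      then have cw: "c = r t + 2 * w" using kk by simp
      have "(k * C - k * k) / r t / ((1 + k * k) * r t) = w / (r t * r t)" using kk by (simp add: w)
      then show ?thesis
        unfolding q C_def[symmetric] S_def[symmetric] * cw
        using r[of t] by (simp add: power2_eq_square add_divide_distrib)
    qed
    ultimately show ?thesis by simp
  qed
  have trig: "r t * cos (\<theta> t) = cos (E t) - e" "r t * sin (\<theta> t) = c * sin (E t)" for t
  proof -
    define C S where "C = cos (E t)" and "S = sin (E t)"
    have cs: "C * C + S * S = 1" using sin_cos_squared_add3[of "E t"] by (simp add: C_def S_def)
    define u where "u = arctan (n t / m t)"
    have m0: "m t \<noteq> 0" using m[of t] by simp
    have cu: "cos u \<noteq> 0" unfolding u_def by (rule cos_arctan_not_zero)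
    have tu: "sin u / cos u = n t / m t" using tan_arctan[of "n t / m t"] by (simp add: u_def tan_def)
    then have tu': "sin u * m t = n t * cos u" using m0 cu by (simp add: field_simps)
    have su: "cos u * cos u + sin u * sin u = 1" by (rule sin_cos_squared_add3)
    \<comment> \<open>Multiplication by \<open>q\<close> makes the cosine and sine of twice the
      arctangent polynomial in \<open>m\<close> and \<open>n\<close>; moreover \<open>q\<close> is a
      constant multiple of the radius.\<close>
    define q where "q = m t * m t + n t * n t"
    have "q * (cos u * cos u) = m t * m t" "q * (sin u * sin u) = n t * n t" "q * (sin u * cos u) = n t * m t"
    proof -
      show 1: "q * (cos u * cos u) = m t * m t" unfolding q_def using tu' su by algebra
      have "m t * m t * (q * (sin u * sin u) - n t * n t) = 0" unfolding q_def using tu' su by algebra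
      then show "q * (sin u * sin u) = n t * n t" using m0 by simp
      have "m t * (q * (sin u * cos u) - n t * m t) = 0" using tu' 1 by algebra
      then show "q * (sin u * cos u) = n t * m t" using m0 by simp
    qed
    then have q: "q * cos (2 * u) = m t * m t - n t * n t" "q * sin (2 * u) = 2 * (n t * m t)"
      unfolding cos_double sin_double power2_eq_square by algebra+
    have th: "\<theta> t = E t + 2 * u" by (simp add: \<theta>_def u_def)
    have qr: "q = (1 + k * k) * r t" unfolding q_def by (rule mn)
    have kk: "1 + k * k > 0" by (simp add: add_pos_nonneg)
    have "(1 + k * k) * (r t * cos (\<theta> t)) = q * cos (\<theta> t)" by (simp add: qr)
    also have "\<dots> = C * (q * cos (2 * u)) - S * (q * sin (2 * u))"
      by (simp add: th cos_add C_def S_def algebra_simps)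
    also have "\<dots> = (1 + k * k) * (C - e)"
      unfolding q m_def n_def C_def[symmetric] S_def[symmetric] using cs k2 by algebra
    finally show "r t * cos (\<theta> t) = cos (E t) - e" using kk by (simp add: C_def)
    have "(1 + k * k) * (r t * sin (\<theta> t)) = q * sin (\<theta> t)" by (simp add: qr)
    also have "\<dots> = S * (q * cos (2 * u)) + C * (q * sin (2 * u))"
      by (simp add: th sin_add C_def S_def algebra_simps)
    also have "\<dots> = (1 + k * k) * (c * S)"
      unfolding q m_def n_def C_def[symmetric] S_def[symmetric] using cs kc by algebra
    finally show "r t * sin (\<theta> t) = c * sin (E t)" using kk by (simp add: S_def)
  qed
  have rad: "kepler_radius e (\<theta> t) = r t" for t
  proof -
    have "r t * (1 + e * cos (\<theta> t)) = 1 - e\<^sup>2" proof -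
      have "r t * (1 + e * cos (\<theta> t)) = r t + e * (r t * cos (\<theta> t))" by (simp add: algebra_simps)
      also have "\<dots> = 1 - e\<^sup>2" unfolding trig(1) by (simp add: r_def power2_eq_square algebra_simps)
      finally show ?thesis .
    qed
    moreover from this have "1 + e * cos (\<theta> t) \<noteq> 0" using e2 by auto
    ultimately show ?thesis unfolding kepler_radius_def by (simp add: field_simps)
  qed
  have th0: "\<theta> 0 = 0"
  proof -
    have "E 0 = 0" unfolding E_def by (rule ecc_unique[OF ab]) simp
    then show ?thesis by (simp add: \<theta>_def n_def)
  qed
  have ode: "(\<theta> has_real_derivative sqrt (1 - e\<^sup>2) / (kepler_radius e (\<theta> t))\<^sup>2) (at t)" for t
    using dth[of t] by (simp add: rad c_def)
  have "true_anomaly e = \<theta>"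
    unfolding true_anomaly_def
  proof (rule the_equality)
    show "\<theta> 0 = 0 \<and> (\<forall>\<tau>. (\<theta> has_real_derivative sqrt (1 - e\<^sup>2) / (kepler_radius e (\<theta> \<tau>))\<^sup>2) (at \<tau>))"
      using th0 ode by blast
    show "y = \<theta>" if "y 0 = 0 \<and> (\<forall>\<tau>. (y has_real_derivative sqrt (1 - e\<^sup>2) / (kepler_radius e (y \<tau>))\<^sup>2) (at \<tau>))" for y
      by (rule ext, rule true_anomaly_unique[OF e _ _ th0 ode]) (use that in auto)
  qed
  then show ?thesis
    unfolding kepler_ellipse_def Let_def rad
    using trig[of \<tau>] by (simp add: rad vec_eq_iff forall_3 c_def[symmetric] E_def)
qed

lemma vector_4 [simp]:
  "(vector [w, x, y, z] :: 'a::zero^4) $ 1 = w" "(vector [w, x, y, z] :: 'a::zero^4) $ 2 = x"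
  "(vector [w, x, y, z] :: 'a::zero^4) $ 3 = y" "(vector [w, x, y, z] :: 'a::zero^4) $ 4 = z"
  unfolding vector_def by simp_all

text \<open>Turning the ellipse by the perihelion angle and delaying it by the same angle shifts the
  eccentric anomaly by that angle, which is the substitution behind \<open>ecc\<close>. The addition
  theorems then produce \<open>kX\<close> and \<open>kY\<close>, because \<open>kbeta\<close> times
  the squared eccentricity is \<open>1 - c\<close>.\<close>

lemma kepler_chart_eq:
  assumes "norm \<xi> < 1"
  shows "kepler_chart \<xi> \<psi> t = kchart (vector [\<xi>$1, \<xi>$2, \<psi>$1, \<psi>$2], t)"
proof -
  define a b e where "a = \<xi>$1" and "b = \<xi>$2" and "e = norm \<xi>"
  have e: "0 \<le> e" "e < 1" using assms by (auto simp: e_def)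
  have e2: "a\<^sup>2 + b\<^sup>2 = e\<^sup>2" by (simp add: a_def b_def e_def norm_vec_def L2_set_def sum_2)
  define q where "q = Arg (Complex a b)"
  have "Complex a b = rcis (cmod (Complex a b)) q" by (simp add: q_def rcis_cmod_Arg)
  moreover have "cmod (Complex a b) = e" using e2 e by (simp add: cmod_def)
  ultimately have ab: "a = e * cos q" "b = e * sin q" by (simp_all add: complex_eq_iff rcis_def)
  have lt: "a\<^sup>2 + b\<^sup>2 < 1" "e\<^sup>2 + 0\<^sup>2 < 1" using e by (auto simp: e2 power_less_one_iff abs_square_less_1)
  define F where "F = ecc a b t"
  have E: "ecc e 0 (t - q) = F - q"
  proof (rule ecc_unique[OF lt(2)])
    have "F - a * sin F + b * cos F = t" unfolding F_def by (rule ecc_eq[OF lt(1)])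
    then show "F - q - e * sin (F - q) + 0 * cos (F - q) = t - q"
      by (simp add: ab sin_diff algebra_simps)
  qed
  define C S X Y c k where "C = cos q" and "S = sin q" and "X = cos F" and "Y = sin F"
    and "c = sqrt (1 - e\<^sup>2)" and "k = kbeta a b"
  have cs: "C * C + S * S = 1" by (simp add: C_def S_def sin_cos_squared_add3)
  have c: "c \<ge> 0" "c * c = 1 - e * e" using lt by (auto simp: c_def power2_eq_square)
  have "k = 1 / (1 + c)" by (simp add: k_def kbeta_def c_def e2[symmetric] diff_diff_eq)
  then have k: "k * (1 + c) = 1" using c by (simp add: add_nonneg_eq_0_iff)
  have kee: "k * (e * e) = 1 - c" using k c by algebra
  have x: "C * (cos (F - q) - e) - S * (c * sin (F - q)) = kX a b F"
    unfolding kX_def k_def[symmetric] unfolding cos_diff sin_diff ab C_def[symmetric] S_def[symmetric] X_def[symmetric] Y_def[symmetric] power2_eq_square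
    using kee cs by algebra
  have y: "S * (cos (F - q) - e) + C * (c * sin (F - q)) = kY a b F"
    unfolding kY_def k_def[symmetric] unfolding cos_diff sin_diff ab C_def[symmetric] S_def[symmetric] X_def[symmetric] Y_def[symmetric] power2_eq_square
    using kee cs by algebra
  have "kepler_chart \<xi> \<psi> t = orientation \<psi> *v (matrix_exp (q *\<^sub>R J3) *v kepler_ellipse e (t - q))"
    by (simp add: kepler_chart_def Let_def q_def a_def b_def e_def matrix_vector_mul_assoc)
  also have "matrix_exp (q *\<^sub>R J3) *v kepler_ellipse e (t - q) = vector [kX a b F, kY a b F, 0]"
    unfolding matrix_exp_J3 kepler_ellipse_eq[OF e] E x[symmetric] y[symmetric]
    by (simp add: C_def S_def c_def)
  finally show ?thesis
    by (simp add: orientation_apply kchart_def Let_def F_def a_def b_def vector_4)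
qed

section \<open>Variations of the circular orbit\<close>

lemma translate_tube:
  fixes P :: "'p::real_normed_vector \<times> real"
  assumes "open W" "\<And>t. t \<in> {0..2*pi} \<Longrightarrow> P + (0, t) \<in> W"
  obtains d where "d > 0" "\<And>Q t. norm (Q - P) < d \<Longrightarrow> t \<in> {0..2*pi} \<Longrightarrow> Q + (0, t) \<in> W"
proof -
  have "compact ((\<lambda>t. P + (0, t)) ` {0..2*pi})" by (intro compact_continuous_image continuous_intros) auto
  moreover have "(\<lambda>t. P + (0, t)) ` {0..2*pi} \<subseteq> W" using assms(2) by blast
  ultimately obtain d where d: "d > 0" "(\<Union>x\<in>(\<lambda>t. P + (0, t)) ` {0..2*pi}. ball x d) \<subseteq> W"
    using compact_subset_open_imp_ball_epsilon_subset[OF _ assms(1)] by metis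
  show thesis
  proof (rule that[OF d(1)])
    fix Q and t :: real assume "norm (Q - P) < d" "t \<in> {0..2*pi}"
    then have "Q + (0, t) \<in> ball (P + (0, t)) d" by (simp add: dist_norm norm_minus_commute)
    then show "Q + (0, t) \<in> W" using d(2) \<open>t \<in> _\<close> by blast
  qed
qed

text \<open>Differentiation under the integral along lines is enough, since partial derivatives are
  derivatives along lines. The weight \<open>\<omega>\<close> is constant for the action itself and
  is the correction or its second derivative in the second variation.\<close>

lemma line_integral_has_derivative:
  fixes g :: "('p::real_normed_vector \<times> real) \<Rightarrow> 'v::real_inner"
  assumes W: "open W"
    and g: "\<And>Q. Q \<in> W \<Longrightarrow> (g has_derivative blinfun_apply (g' Q)) (at Q)"
    and g': "continuous_on W g'"
    and \<omega>: "continuous_on {0..2*pi} \<omega>"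
    and P: "\<And>t. t \<in> {0..2*pi} \<Longrightarrow> P + (0, t) \<in> W"
  shows "((\<lambda>s. integral {0..2*pi} (\<lambda>t. g (P + s *\<^sub>R b + (0, t)) \<bullet> \<omega> t)) has_real_derivative
     integral {0..2*pi} (\<lambda>t. blinfun_apply (g' (P + (0, t))) b \<bullet> \<omega> t)) (at 0)"
proof -
  obtain d where d: "d > 0" "\<And>Q t. norm (Q - P) < d \<Longrightarrow> t \<in> {0..2*pi} \<Longrightarrow> Q + (0, t) \<in> W"
    using translate_tube[OF W P] by metis
  define \<delta> where "\<delta> = d / (norm b + 1)"
  have \<delta>: "\<delta> > 0" using d by (simp add: \<delta>_def add_nonneg_pos)
  have inW: "P + s *\<^sub>R b + (0, t) \<in> W" if "s \<in> ball 0 \<delta>" "t \<in> {0..2*pi}" for s t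
  proof (rule d(2)[OF _ that(2)])
    have "\<bar>s\<bar> * norm b \<le> \<bar>s\<bar> * (norm b + 1)" by (intro mult_left_mono) auto
    also have "\<dots> < d" using that(1) by (simp add: \<delta>_def pos_less_divide_eq add_nonneg_pos)
    finally show "norm (P + s *\<^sub>R b - P) < d" by simp
  qed
  have gc: "continuous_on W g" using g by (meson continuous_at_imp_continuous_on has_derivative_continuous)
  have "((\<lambda>s. integral (cbox 0 (2*pi)) (\<lambda>t. g (P + s *\<^sub>R b + (0, t)) \<bullet> \<omega> t)) has_field_derivative
     integral (cbox 0 (2*pi)) (\<lambda>t. blinfun_apply (g' (P + 0 *\<^sub>R b + (0, t))) b \<bullet> \<omega> t)) (at 0 within ball 0 \<delta>)"
  proof (rule leibniz_rule_field_derivative)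
    fix s t :: real assume s: "s \<in> ball 0 \<delta>" and t: "t \<in> cbox 0 (2*pi)"
    have "((\<lambda>s. P + s *\<^sub>R b + (0, t)) has_derivative (\<lambda>h. h *\<^sub>R b)) (at s)"
      by (auto intro!: derivative_eq_intros)
    from has_derivative_compose[OF this g] inW[OF s] t
    have "((\<lambda>s. g (P + s *\<^sub>R b + (0, t))) has_derivative (\<lambda>h. h *\<^sub>R blinfun_apply (g' (P + s *\<^sub>R b + (0, t))) b)) (at s)"
      by (simp add: blinfun.scaleR_right)
    from has_derivative_inner_left[OF this, of "\<omega> t"]
    have "((\<lambda>s. g (P + s *\<^sub>R b + (0, t)) \<bullet> \<omega> t) has_real_derivative blinfun_apply (g' (P + s *\<^sub>R b + (0, t))) b \<bullet> \<omega> t) (at s)"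
      unfolding has_field_derivative_def by (rule has_derivative_eq_rhs) (simp add: fun_eq_iff mult.commute)
    then show "((\<lambda>s. g (P + s *\<^sub>R b + (0, t)) \<bullet> \<omega> t) has_real_derivative blinfun_apply (g' (P + s *\<^sub>R b + (0, t))) b \<bullet> \<omega> t)
        (at s within ball 0 \<delta>)" by (rule has_field_derivative_at_within)
  next
    fix s :: real assume s: "s \<in> ball 0 \<delta>"
    show "(\<lambda>t. g (P + s *\<^sub>R b + (0, t)) \<bullet> \<omega> t) integrable_on cbox 0 (2*pi)"
    proof (rule integrable_continuous)
      show "continuous_on (cbox 0 (2*pi)) (\<lambda>t. g (P + s *\<^sub>R b + (0, t)) \<bullet> \<omega> t)"
        using inW[OF s] \<omega> by (intro continuous_intros continuous_on_compose2[OF gc]) auto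
    qed
  next
    show "continuous_on (ball 0 \<delta> \<times> cbox 0 (2*pi)) (\<lambda>(s, t). blinfun_apply (g' (P + s *\<^sub>R b + (0, t))) b \<bullet> \<omega> t)"
      unfolding case_prod_beta using inW
      by (intro continuous_intros continuous_on_compose2[OF g'] continuous_on_compose2[OF \<omega>]) auto
  qed (use \<delta> in auto)
  then show ?thesis using \<delta> by (simp add: at_within_open[OF _ open_ball] cbox_interval)
qed

section \<open>Parameter derivatives of the chart and Jacobi fields of the circle\<close>

definition kD :: "(real^4) \<times> real \<Rightarrow> ((real^4) \<times> real) \<Rightarrow>\<^sub>L (real^3)" where
  "kD P = (SOME D. (kchart has_derivative blinfun_apply D) (at P))"

definition kD2 :: "(real^4) \<times> real \<Rightarrow> ((real^4) \<times> real) \<Rightarrow>\<^sub>L (((real^4) \<times> real) \<Rightarrow>\<^sub>L (real^3))" where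
  "kD2 P = (SOME D. (kD has_derivative blinfun_apply D) (at P))"

lemma kD: "P \<in> disc4 \<times> UNIV \<Longrightarrow> (kchart has_derivative blinfun_apply (kD P)) (at P)"
  and C1_on_kD: "C1_on (disc4 \<times> UNIV) kD"
proof -
  obtain D where D: "\<And>P. P \<in> disc4 \<times> UNIV \<Longrightarrow> (kchart has_derivative blinfun_apply (D P)) (at P)" "C1_on (disc4 \<times> UNIV) D"
    using C2_on_kchart unfolding C2_on_def by blast
  show d: "(kchart has_derivative blinfun_apply (kD P)) (at P)" if "P \<in> disc4 \<times> UNIV" for P
    unfolding kD_def by (rule someI[of _ "D P"]) (rule D(1)[OF that])
  have "D P = kD P" if "P \<in> disc4 \<times> UNIV" for P
    using has_derivative_unique[OF D(1)[OF that] d[OF that]] by (simp add: blinfun_apply_inject)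
  then show "C1_on (disc4 \<times> UNIV) kD"
    by (intro C1_on_cong_open[OF _ _ D(2)]) (auto intro: open_Times open_disc4)
qed

lemma kD2: "P \<in> disc4 \<times> UNIV \<Longrightarrow> (kD has_derivative blinfun_apply (kD2 P)) (at P)"
  and continuous_on_kD2: "continuous_on (disc4 \<times> UNIV) kD2"
proof -
  obtain D where D: "\<And>P. P \<in> disc4 \<times> UNIV \<Longrightarrow> (kD has_derivative blinfun_apply (D P)) (at P)" "continuous_on (disc4 \<times> UNIV) D"
    using C1_on_kD unfolding C1_on_def by blast
  show d: "(kD has_derivative blinfun_apply (kD2 P)) (at P)" if "P \<in> disc4 \<times> UNIV" for P
    unfolding kD2_def by (rule someI[of _ "D P"]) (rule D(1)[OF that])
  have "D P = kD2 P" if "P \<in> disc4 \<times> UNIV" for P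
    using has_derivative_unique[OF D(1)[OF that] d[OF that]] by (simp add: blinfun_apply_inject)
  then show "continuous_on (disc4 \<times> UNIV) kD2"
    using D(2) by (simp cong: continuous_on_cong)
qed

text \<open>The derivative of the Kepler chart at a circular orbit. The argument is the pair of a variation
  \<open>d\<close> of the four chart parameters and a time shift \<open>\<phi>\<close>.\<close>

definition kjac :: "real^4 \<Rightarrow> (real^4) \<times> real \<Rightarrow> real \<Rightarrow> real^3" where
  "kjac p h t = (let d = fst h; \<phi> = snd h in
     (d$1 * (- 1 - (sin t)\<^sup>2) + d$2 * (sin t * cos t) + d$3 * (sin (p$4) * sin t) - \<phi> * sin t) *\<^sub>R frameA (p$3) (p$4)
   + (d$1 * (sin t * cos t) + d$2 * (- 1 - (cos t)\<^sup>2) - d$3 * (sin (p$4) * cos t) + \<phi> * cos t) *\<^sub>R frameB (p$3) (p$4)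
   + (d$3 * (cos (p$4) * sin t) + d$4 * cos t) *\<^sub>R frameN (p$3) (p$4))"

definition kjacd :: "real^4 \<Rightarrow> (real^4) \<times> real \<Rightarrow> real \<Rightarrow> real^3" where
  "kjacd p h t = (let d = fst h; \<phi> = snd h in
     (d$1 * (- 2 * sin t * cos t) + d$2 * ((cos t)\<^sup>2 - (sin t)\<^sup>2) + d$3 * (sin (p$4) * cos t) - \<phi> * cos t) *\<^sub>R frameA (p$3) (p$4)
   + (d$1 * ((cos t)\<^sup>2 - (sin t)\<^sup>2) + d$2 * (2 * sin t * cos t) + d$3 * (sin (p$4) * sin t) - \<phi> * sin t) *\<^sub>R frameB (p$3) (p$4)
   + (d$3 * (cos (p$4) * cos t) - d$4 * sin t) *\<^sub>R frameN (p$3) (p$4))"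

locale circular =
  fixes p :: "real^4"
  assumes circ: "p$1 = 0" "p$2 = 0"
begin

abbreviation "A \<equiv> frameA (p$3) (p$4)"
abbreviation "B \<equiv> frameB (p$3) (p$4)"
abbreviation "N \<equiv> frameN (p$3) (p$4)"

definition u0 :: "real \<Rightarrow> real^3" where "u0 t = cos t *\<^sub>R A + sin t *\<^sub>R B"
definition v0 :: "real \<Rightarrow> real^3" where "v0 t = - sin t *\<^sub>R A + cos t *\<^sub>R B"

lemma p_disc: "p \<in> disc4" by (simp add: disc4_def circ)

lemma kchart_circ: "kchart (p, t) = u0 t" and kvel_circ: "kvel (p, t) = v0 t"
  by (simp_all add: kchart_def kvel_def Let_def circ ecc_circle kX_def kY_def kXd_def kYd_def u0_def v0_def)

lemma frame_inner: "A \<bullet> A = 1" "B \<bullet> B = 1" "N \<bullet> N = 1" "A \<bullet> B = 0" "B \<bullet> A = 0" "A \<bullet> N = 0" "N \<bullet> A = 0" "B \<bullet> N = 0" "N \<bullet> B = 0"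
  using frame_orthonormal[of "p$3" "p$4"] by (simp_all add: inner_commute)

lemma norm_u0 [simp]: "norm (u0 t) = 1" unfolding u0_def norm_comb by (simp add: sin_squared_eq)

lemma u0_nonzero [simp]: "u0 t \<noteq> 0" using norm_u0[of t] by (metis norm_zero zero_neq_one)

lemma frame_line_has_derivative:
  "((\<lambda>s. frameA (p$3 + s * d$3) (p$4 + s * d$4)) has_vector_derivative d$4 *\<^sub>R N - (d$3 * sin (p$4)) *\<^sub>R B) (at 0)"
  "((\<lambda>s. frameB (p$3 + s * d$3) (p$4 + s * d$4)) has_vector_derivative d$3 *\<^sub>R (sin (p$4) *\<^sub>R A + cos (p$4) *\<^sub>R N)) (at 0)"
proof -
  show fA: "((\<lambda>s. frameA (p$3 + s * d$3) (p$4 + s * d$4)) has_vector_derivative d$4 *\<^sub>R N - (d$3 * sin (p$4)) *\<^sub>R B) (at 0)"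
    unfolding frameA_def
    by (rule has_vector_derivative_eq_rhs, (rule derivative_intros | (rule derivative_eq_intros refl)+)+)
      (simp add: frameN_def frameB_def algebra_simps)
  show fB: "((\<lambda>s. frameB (p$3 + s * d$3) (p$4 + s * d$4)) has_vector_derivative d$3 *\<^sub>R (sin (p$4) *\<^sub>R A + cos (p$4) *\<^sub>R N)) (at 0)"
  proof -
    have "((\<lambda>s. frameB (p$3 + s * d$3) (p$4 + s * d$4)) has_vector_derivative
        (- sin (p$3) * d$3) *\<^sub>R axis 2 1 + (cos (p$3) * d$3) *\<^sub>R axis 3 1) (at 0)"
      unfolding frameB_def
      by (rule has_vector_derivative_eq_rhs, (rule derivative_intros | (rule derivative_eq_intros refl)+)+) simp
    moreover have "sin (p$4) *\<^sub>R A + cos (p$4) *\<^sub>R N = (- sin (p$3)) *\<^sub>R axis 2 1 + cos (p$3) *\<^sub>R axis 3 1"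
    proof -
      define x y z w where "x = sin (p$3)" and "y = cos (p$3)" and "z = sin (p$4)" and "w = cos (p$4)"
      have zw: "z * z + w * w = 1" using sin_cos_squared_add3[of "p$4"] by (simp add: z_def w_def add.commute)
      have "z *\<^sub>R A + w *\<^sub>R N =
        (z * w - w * z) *\<^sub>R axis 1 1 + (- (z * (x * z)) - w * (x * w)) *\<^sub>R axis 2 1 + (z * (y * z) + w * (y * w)) *\<^sub>R axis 3 1"
        by (simp add: frameA_def frameN_def x_def[symmetric] y_def[symmetric] z_def[symmetric] w_def[symmetric] algebra_simps)
      moreover have "- (z * (x * z)) - w * (x * w) = - x" "z * (y * z) + w * (y * w) = y" using zw by algebra+
      ultimately show ?thesis by (simp add: x_def[symmetric] y_def[symmetric] z_def[symmetric] w_def[symmetric])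
    qed
    ultimately show ?thesis by (simp add: scaleR_add_right scaleR_diff_right mult.commute)
  qed
qed

text \<open>The chain rule along a line of parameters. \<open>kbeta\<close> contributes nothing at
  the circle, since it depends on the eccentricity components only through their squares.\<close>

lemma kD_circ: "blinfun_apply (kD (p, t)) h = kjac p h t"
proof -
  define d \<phi> where "d = fst h" and "\<phi> = snd h"
  have "((\<lambda>s. (p, t) + s *\<^sub>R h) has_derivative (\<lambda>s. s *\<^sub>R h)) (at 0)" by (auto intro!: derivative_eq_intros)
  from has_derivative_compose[OF this, of kchart "blinfun_apply (kD (p, t))"] kD[of "(p, t)"] p_disc
  have 1: "((\<lambda>s. kchart ((p, t) + s *\<^sub>R h)) has_vector_derivative blinfun_apply (kD (p, t)) h) (at 0)"
    by (simp add: has_vector_derivative_def blinfun.scaleR_right)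
  define F where "F s = ecc (0 + s * d$1) (0 + s * d$2) (t + s * \<phi>)" for s
  define k where "k s = kbeta (s * d$1) (s * d$2)" for s
  have F0: "F 0 = t" by (simp add: F_def ecc_circle)
  have dF: "(F has_real_derivative (\<phi> + d$1 * sin t - d$2 * cos t)) (at 0)"
    using ecc_line_has_derivative[of 0 0 "d$1" "d$2" t \<phi>] by (simp add: F_def[abs_def] ecc_circle)
  have dk: "(k has_real_derivative 0) (at 0)"
    unfolding k_def kbeta_def by (auto intro!: derivative_eq_intros)
  have dX: "((\<lambda>s. kX (s * d$1) (s * d$2) (F s)) has_real_derivative
      - sin t * (\<phi> + d$1 * sin t - d$2 * cos t) - d$1) (at 0)"
    unfolding kX_def k_def[symmetric]
    by (auto intro!: derivative_eq_intros dF dk simp: F0)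
  have dY: "((\<lambda>s. kY (s * d$1) (s * d$2) (F s)) has_real_derivative
      cos t * (\<phi> + d$1 * sin t - d$2 * cos t) - d$2) (at 0)"
    unfolding kY_def k_def[symmetric]
    by (auto intro!: derivative_eq_intros dF dk simp: F0)
  note fA = frame_line_has_derivative(1)[of d] and fB = frame_line_has_derivative(2)[of d]
  have "((\<lambda>s. kX (s * d$1) (s * d$2) (F s) *\<^sub>R frameA (p$3 + s * d$3) (p$4 + s * d$4)
      + kY (s * d$1) (s * d$2) (F s) *\<^sub>R frameB (p$3 + s * d$3) (p$4 + s * d$4)) has_vector_derivative
      (cos t *\<^sub>R (d$4 *\<^sub>R N - (d$3 * sin (p$4)) *\<^sub>R B) + (- sin t * (\<phi> + d$1 * sin t - d$2 * cos t) - d$1) *\<^sub>R A)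
      + (sin t *\<^sub>R (d$3 *\<^sub>R (sin (p$4) *\<^sub>R A + cos (p$4) *\<^sub>R N)) + (cos t * (\<phi> + d$1 * sin t - d$2 * cos t) - d$2) *\<^sub>R B)) (at 0)"
    using has_vector_derivative_add[OF has_vector_derivative_scaleR[OF dX fA] has_vector_derivative_scaleR[OF dY fB]]
    by (simp add: F0 kX_def kY_def)
  moreover have "(\<lambda>s. kX (s * d$1) (s * d$2) (F s) *\<^sub>R frameA (p$3 + s * d$3) (p$4 + s * d$4)
      + kY (s * d$1) (s * d$2) (F s) *\<^sub>R frameB (p$3 + s * d$3) (p$4 + s * d$4)) = (\<lambda>s. kchart ((p, t) + s *\<^sub>R h))"
    by (simp add: kchart_def Let_def circ F_def d_def \<phi>_def)
  ultimately have "blinfun_apply (kD (p, t)) h =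
      (cos t *\<^sub>R (d$4 *\<^sub>R N - (d$3 * sin (p$4)) *\<^sub>R B) + (- sin t * (\<phi> + d$1 * sin t - d$2 * cos t) - d$1) *\<^sub>R A)
      + (sin t *\<^sub>R (d$3 *\<^sub>R (sin (p$4) *\<^sub>R A + cos (p$4) *\<^sub>R N)) + (cos t * (\<phi> + d$1 * sin t - d$2 * cos t) - d$2) *\<^sub>R B)"
    using vector_derivative_unique_at[OF 1] by simp
  also have "\<dots> = kjac p h t"
    by (simp add: kjac_def Let_def d_def \<phi>_def algebra_simps power2_eq_square)
  finally show ?thesis .
qed

lemma u0_has_derivative: "(u0 has_vector_derivative v0 t) (at t within S)" "(v0 has_vector_derivative - u0 t) (at t within S)"
  unfolding u0_def[abs_def] v0_def[abs_def]
  by (auto intro!: derivative_eq_intros simp: has_vector_derivative_def algebra_simps)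

lemma kepler_force'_u0: "blinfun_apply (kepler_force' (u0 t)) y = - y + (3 * (u0 t \<bullet> y)) *\<^sub>R u0 t"
  by (simp add: kepler_force'_apply)

text \<open>Parameter derivatives of a family of Kepler solutions solve the linearised Kepler
  equation; on the circle this is checked from the explicit formula in the moving frame.\<close>

lemma kjac_has_derivative:
  "(kjac p h has_vector_derivative kjacd p h t) (at t within S)"
  "(kjacd p h has_vector_derivative blinfun_apply (kepler_force' (u0 t)) (kjac p h t)) (at t within S)"
proof -
  define d1 d2 d3 d4 \<phi> c2 s2 where "d1 = fst h $ 1" and "d2 = fst h $ 2" and "d3 = fst h $ 3" and "d4 = fst h $ 4"
    and "\<phi> = snd h" and "c2 = cos (p$4)" and "s2 = sin (p$4)"
  note defs = d1_def[symmetric] d2_def[symmetric] d3_def[symmetric] d4_def[symmetric] \<phi>_def[symmetric] c2_def[symmetric] s2_def[symmetric]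
  have *: "((\<lambda>t. f t *\<^sub>R A + g t *\<^sub>R B + k t *\<^sub>R N) has_vector_derivative f' *\<^sub>R A + g' *\<^sub>R B + k' *\<^sub>R N) (at t within S)"
    if "(f has_real_derivative f') (at t)" "(g has_real_derivative g') (at t)" "(k has_real_derivative k') (at t)" for f g k f' g' k' t
  proof -
    note w = that[THEN has_field_derivative_at_within, of S]
    show ?thesis
      using has_vector_derivative_add[OF has_vector_derivative_add[OF
          has_vector_derivative_scaleR[OF w(1) has_vector_derivative_const[of A]]
          has_vector_derivative_scaleR[OF w(2) has_vector_derivative_const[of B]]]
          has_vector_derivative_scaleR[OF w(3) has_vector_derivative_const[of N]]] by simp
  qed
  show "(kjac p h has_vector_derivative kjacd p h t) (at t within S)"
    unfolding kjac_def[abs_def] kjacd_def Let_def defs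
    by (rule *) (auto intro!: derivative_eq_intros simp: power2_eq_square algebra_simps)
  have "(kjacd p h has_vector_derivative
     (d1 * (- 2 * (cos t * cos t - sin t * sin t)) + d2 * (- 4 * sin t * cos t) - d3 * (s2 * sin t) + \<phi> * sin t) *\<^sub>R A
   + (d1 * (- 4 * sin t * cos t) + d2 * (2 * (cos t * cos t - sin t * sin t)) + d3 * (s2 * cos t) - \<phi> * cos t) *\<^sub>R B
   + (- d3 * (c2 * sin t) - d4 * cos t) *\<^sub>R N) (at t within S)"
    unfolding kjacd_def[abs_def] Let_def defs
    by (rule *) (auto intro!: derivative_eq_intros simp: power2_eq_square algebra_simps)
  moreover have "blinfun_apply (kepler_force' (u0 t)) (kjac p h t) =
     (d1 * (- 2 * (cos t * cos t - sin t * sin t)) + d2 * (- 4 * sin t * cos t) - d3 * (s2 * sin t) + \<phi> * sin t) *\<^sub>R A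
   + (d1 * (- 4 * sin t * cos t) + d2 * (2 * (cos t * cos t - sin t * sin t)) + d3 * (s2 * cos t) - \<phi> * cos t) *\<^sub>R B
   + (- d3 * (c2 * sin t) - d4 * cos t) *\<^sub>R N"
  proof -
    define C Sn where "C = cos t" and "Sn = sin t"
    have cs: "C * C + Sn * Sn = 1" unfolding C_def Sn_def by (rule sin_cos_squared_add3)
    define fa fb fn where "fa = d1 * (- 1 - Sn * Sn) + d2 * (Sn * C) + d3 * (s2 * Sn) - \<phi> * Sn"
      and "fb = d1 * (Sn * C) + d2 * (- 1 - C * C) - d3 * (s2 * C) + \<phi> * C" and "fn = d3 * (c2 * Sn) + d4 * C"
    have kj: "kjac p h t = fa *\<^sub>R A + fb *\<^sub>R B + fn *\<^sub>R N"
      by (simp add: kjac_def Let_def defs fa_def fb_def fn_def C_def Sn_def power2_eq_square)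
    have u: "u0 t = C *\<^sub>R A + Sn *\<^sub>R B" by (simp add: u0_def C_def Sn_def)
    have in1: "u0 t \<bullet> kjac p h t = C * fa + Sn * fb"
      unfolding kj u by (simp add: inner_add_left inner_add_right frame_inner)
    have "blinfun_apply (kepler_force' (u0 t)) (kjac p h t) =
        (- fa + 3 * (C * fa + Sn * fb) * C) *\<^sub>R A + (- fb + 3 * (C * fa + Sn * fb) * Sn) *\<^sub>R B + (- fn) *\<^sub>R N"
      unfolding kepler_force'_u0 in1 unfolding kj u by (simp add: algebra_simps)
    moreover have "- fa + 3 * (C * fa + Sn * fb) * C = d1 * (- 2 * (C * C - Sn * Sn)) + d2 * (- 4 * Sn * C) - d3 * (s2 * Sn) + \<phi> * Sn"
      unfolding fa_def fb_def using cs by algebra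
    moreover have "- fb + 3 * (C * fa + Sn * fb) * Sn = d1 * (- 4 * Sn * C) + d2 * (2 * (C * C - Sn * Sn)) + d3 * (s2 * C) - \<phi> * C"
      unfolding fa_def fb_def using cs by algebra
    moreover have "- fn = - d3 * (c2 * Sn) - d4 * C" by (simp add: fn_def)
    ultimately show ?thesis unfolding C_def[symmetric] Sn_def[symmetric] by simp
  qed
  ultimately show "(kjacd p h has_vector_derivative blinfun_apply (kepler_force' (u0 t)) (kjac p h t)) (at t within S)" by simp
qed

lemma kjac_periodic: "kjac p h (t + 2*pi) = kjac p h t" "kjacd p h (t + 2*pi) = kjacd p h t"
  by (simp_all add: kjac_def kjacd_def Let_def)

text \<open>The Jacobi field of the scaling symmetry of the Kepler problem; it is not periodic because
  the period changes with the energy.\<close>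

definition secular :: "real \<Rightarrow> real^3" where "secular t = 2 *\<^sub>R u0 t - (3 * t) *\<^sub>R v0 t"
definition seculard :: "real \<Rightarrow> real^3" where "seculard t = - v0 t + (3 * t) *\<^sub>R u0 t"

lemma inner_u0_v0: "u0 t \<bullet> v0 t = 0" "u0 t \<bullet> u0 t = 1" "v0 t \<bullet> v0 t = 1"
proof -
  show "u0 t \<bullet> v0 t = 0" by (simp add: u0_def v0_def inner_add_left inner_add_right inner_diff_right frame_inner)
  show "u0 t \<bullet> u0 t = 1" by (simp add: dot_square_norm)
  show "v0 t \<bullet> v0 t = 1"
    using sin_cos_squared_add3[of t] by (simp add: v0_def inner_add_left inner_add_right inner_diff_left inner_diff_right frame_inner add.commute)
qed

lemma secular_has_derivative:
  "(secular has_vector_derivative seculard t) (at t within S)"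
  "(seculard has_vector_derivative blinfun_apply (kepler_force' (u0 t)) (secular t)) (at t within S)"
proof -
  have 3: "((\<lambda>t. 3 * t) has_real_derivative 3) (at t within S)" for t by (auto intro!: derivative_eq_intros)
  show "(secular has_vector_derivative seculard t) (at t within S)"
    unfolding secular_def[abs_def] seculard_def
    by (rule has_vector_derivative_eq_rhs[OF has_vector_derivative_diff[OF
          has_vector_derivative_scaleR[OF DERIV_const u0_has_derivative(1)] has_vector_derivative_scaleR[OF 3 u0_has_derivative(2)]]])
      (simp add: vec_eq_iff algebra_simps)
  have "(seculard has_vector_derivative 4 *\<^sub>R u0 t + (3 * t) *\<^sub>R v0 t) (at t within S)"
    unfolding seculard_def[abs_def]
    by (rule has_vector_derivative_eq_rhs[OF has_vector_derivative_add[OF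
          has_vector_derivative_minus[OF u0_has_derivative(2)] has_vector_derivative_scaleR[OF 3 u0_has_derivative(1)]]])
      (simp add: vec_eq_iff algebra_simps)
  moreover have "blinfun_apply (kepler_force' (u0 t)) (secular t) = 4 *\<^sub>R u0 t + (3 * t) *\<^sub>R v0 t"
    by (simp add: kepler_force'_u0 secular_def inner_diff_right inner_u0_v0 vec_eq_iff algebra_simps)
  ultimately show "(seculard has_vector_derivative blinfun_apply (kepler_force' (u0 t)) (secular t)) (at t within S)" by simp
qed

end

section \<open>The second variation of the averaged interaction\<close>

text \<open>Green's identity. For a solution of the forced linearised equation and a Jacobi field,
  symmetry of \<open>kepler_force'\<close> leaves only the forcing under the integral and only end
  values on the right.\<close>

lemma wronskian_has_integral:
  fixes x y :: "real \<Rightarrow> 'a::real_inner"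
  assumes "a \<le> b"
    and "\<And>t. t \<in> {a..b} \<Longrightarrow> (x has_vector_derivative x1 t) (at t within {a..b})"
    and "\<And>t. t \<in> {a..b} \<Longrightarrow> (x1 has_vector_derivative x2 t) (at t within {a..b})"
    and "\<And>t. t \<in> {a..b} \<Longrightarrow> (y has_vector_derivative y1 t) (at t within {a..b})"
    and "\<And>t. t \<in> {a..b} \<Longrightarrow> (y1 has_vector_derivative y2 t) (at t within {a..b})"
  shows "((\<lambda>t. x2 t \<bullet> y t - x t \<bullet> y2 t) has_integral
    (x1 b \<bullet> y b - x b \<bullet> y1 b) - (x1 a \<bullet> y a - x a \<bullet> y1 a)) {a..b}"
proof (rule fundamental_theorem_of_calculus[OF assms(1)])
  fix t assume t: "t \<in> {a..b}"
  have "((\<lambda>t. x1 t \<bullet> y t - x t \<bullet> y1 t) has_vector_derivative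
      (x1 t \<bullet> y1 t + x2 t \<bullet> y t) - (x t \<bullet> y2 t + x1 t \<bullet> y1 t)) (at t within {a..b})"
    by (intro has_vector_derivative_diff bounded_bilinear.has_vector_derivative[OF bounded_bilinear_inner] assms t)
  then show "((\<lambda>t. x1 t \<bullet> y t - x t \<bullet> y1 t) has_vector_derivative x2 t \<bullet> y t - x t \<bullet> y2 t) (at t within {a..b})"
    by simp
qed

lemma C1_on_SOME_derivative:
  assumes "C1_on S f"
  shows "x \<in> S \<Longrightarrow> (f has_derivative blinfun_apply (SOME D. (f has_derivative blinfun_apply D) (at x))) (at x)"
    and "continuous_on S (\<lambda>x. SOME D. (f has_derivative blinfun_apply D) (at x))"
proof -
  have *: "(f has_derivative blinfun_apply (SOME D. (f has_derivative blinfun_apply D) (at x))) (at x)" if "x \<in> S" for x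
    by (rule someI_ex) (use assms that in \<open>auto simp: C1_on_def\<close>)
  then show "x \<in> S \<Longrightarrow> (f has_derivative blinfun_apply (SOME D. (f has_derivative blinfun_apply D) (at x))) (at x)" .
  show "continuous_on S (\<lambda>x. SOME D. (f has_derivative blinfun_apply D) (at x))"
    by (rule C1_on_derivative_continuous[OF assms *])
qed

definition kepler_force'' :: "real^3 \<Rightarrow> (real^3) \<Rightarrow>\<^sub>L ((real^3) \<Rightarrow>\<^sub>L (real^3))" where
  "kepler_force'' x = (SOME D. (kepler_force' has_derivative blinfun_apply D) (at x))"

lemma kepler_force'_has_derivative: "x \<noteq> 0 \<Longrightarrow> (kepler_force' has_derivative blinfun_apply (kepler_force'' x)) (at x)"
  and continuous_on_kepler_force'': "continuous_on (- {0}) kepler_force''"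
  using C1_on_SOME_derivative[OF C1_on_kepler_force'] by (auto simp: kepler_force''_def[abs_def])

text \<open>Each operator \<open>kepler_force' x\<close> is symmetric, hence so is its derivative in
  any direction. This allows the correction to be exchanged with a Jacobi field in the second
  variation.\<close>

lemma kepler_force''_symmetric:
  assumes "x \<noteq> 0"
  shows "blinfun_apply (blinfun_apply (kepler_force'' x) a) b \<bullet> c = blinfun_apply (blinfun_apply (kepler_force'' x) a) c \<bullet> b"
proof -
  have d: "((\<lambda>x. blinfun_apply (kepler_force' x) b \<bullet> c) has_derivative (\<lambda>a. blinfun_apply (blinfun_apply (kepler_force'' x) a) b \<bullet> c)) (at x)" for b c
    using kepler_force'_has_derivative[OF assms]
    by (auto intro!: derivative_eq_intros bounded_linear.has_derivative[OF blinfun.bounded_linear_left])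
  show ?thesis
    using has_derivative_unique[OF d[of b c] d[of c b, unfolded kepler_force'_symmetric[of _ c b]]] by metis
qed

definition pair_force' :: "(real^3^3) set \<Rightarrow> real^3 \<Rightarrow> (real^3) \<Rightarrow>\<^sub>L (real^3)" where
  "pair_force' H x = (SOME D. (pair_force H has_derivative blinfun_apply D) (at x))"

lemma (in symmetry_group) pair_force_has_derivative:
    "x \<in> off_axes H \<Longrightarrow> (pair_force H has_derivative blinfun_apply (pair_force' H x)) (at x)"
  and continuous_on_pair_force': "continuous_on (off_axes H) (pair_force' H)"
  using C1_on_SOME_derivative[OF C1_on_pair_force] by (auto simp: pair_force'_def[abs_def])

lemma integral_antiperiodic:
  fixes h :: "real \<Rightarrow> real"
  assumes "continuous_on UNIV h" "\<And>t. h (t + pi) = - h t"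
  shows "integral {0..2*pi} h = 0"
proof -
  have i: "h integrable_on {a..b}" for a b
    using assms(1) by (intro integrable_continuous_interval) (auto intro: continuous_on_subset)
  have "(h has_integral integral {pi..2*pi} h) (cbox pi (2*pi))" using i by (simp add: cbox_interval integrable_integral)
  from has_integral_affinity[OF this, of 1 pi]
  have "((\<lambda>t. h (t + pi)) has_integral integral {pi..2*pi} h) {0..pi}" by (simp add: cbox_interval)
  moreover have "((\<lambda>t. h (t + pi)) has_integral - integral {0..pi} h) {0..pi}"
    unfolding assms(2) by (intro has_integral_neg integrable_integral i)
  ultimately have "integral {pi..2*pi} h = - integral {0..pi} h" by (rule has_integral_unique)
  then show ?thesis
    using Henstock_Kurzweil_Integration.integral_combine[of 0 pi "2*pi" h] i by simp
qed

locale circular_symmetric = circular p + symmetry_group H for p :: "real^4" and H +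
  assumes avoids: "u0 t \<in> off_axes H"
begin

definition good :: "((real^4) \<times> real) set" where
  "good = {P \<in> disc4 \<times> UNIV. kchart P \<in> off_axes H}"

text \<open>Ellipse parameters with a phase whose orbit over one period stays off the axes. The
  phase is kept as a fifth coordinate so that variations in time can be treated like the
  others.\<close>

definition goods :: "((real^4) \<times> real) set" where
  "goods = {P. \<forall>t\<in>{0..2*pi}. P + (0, t) \<in> good}"

lemma good_disc: "good \<subseteq> disc4 \<times> UNIV" by (auto simp: good_def)

lemma open_good: "open good"
proof -
  have "open (kchart -` off_axes H \<inter> disc4 \<times> UNIV)"
    by (rule iffD1[OF continuous_on_open_vimage, rule_format, OF _ _ open_off_axes])
      (auto intro!: open_Times open_disc4 C1_on_continuous C2_on_imp_C1_on C2_on_kchart)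
  moreover have "good = kchart -` off_axes H \<inter> disc4 \<times> UNIV" by (auto simp: good_def)
  ultimately show ?thesis by simp
qed

lemma goods_0: "(p, \<phi>) \<in> goods"
  using avoids by (simp add: goods_def good_def p_disc kchart_circ)

lemma goods_line:
  assumes "P \<in> goods"
  obtains d where "d > 0" "\<And>s. \<bar>s\<bar> < d \<Longrightarrow> P + s *\<^sub>R b \<in> goods"
proof -
  obtain e where e: "e > 0" "\<And>Q t. norm (Q - P) < e \<Longrightarrow> t \<in> {0..2*pi} \<Longrightarrow> Q + (0, t) \<in> good"
    using translate_tube[OF open_good, of P] assms unfolding goods_def by blast
  show thesis
  proof (rule that[of "e / (norm b + 1)"])
    show "e / (norm b + 1) > 0" using e by (simp add: add_nonneg_pos)
    fix s :: real assume s: "\<bar>s\<bar> < e / (norm b + 1)"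
    have "\<bar>s\<bar> * norm b \<le> \<bar>s\<bar> * (norm b + 1)" by (intro mult_left_mono) auto
    also have "\<dots> < e" using s by (simp add: pos_less_divide_eq add_nonneg_pos)
    finally show "P + s *\<^sub>R b \<in> goods" using e(2)[of "P + s *\<^sub>R b"] by (simp add: goods_def)
  qed
qed

lemma goodsD: "P \<in> goods \<Longrightarrow> t \<in> {0..2*pi} \<Longrightarrow> P + (0, t) \<in> good" by (simp add: goods_def)

lemma good_facts:
  assumes "P \<in> good"
  shows "P \<in> disc4 \<times> UNIV" "kchart P \<in> off_axes H" "kchart P \<noteq> 0"
  using assms by (auto simp: good_def off_axes_def)

lemma C1_on_good: "C1_on good kchart" "C1_on good kD"
  "C1_on good (\<lambda>P. pair_force H (kchart P))" "C1_on good (\<lambda>P. kepler_force (kchart P))" "C1_on good (\<lambda>P. kepler_force' (kchart P))"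
proof -
  show 1: "C1_on good kchart" "C1_on good kD"
    using C1_on_subset good_disc C2_on_imp_C1_on C2_on_kchart C1_on_kD by blast+
  show "C1_on good (\<lambda>P. pair_force H (kchart P))"
    by (rule C1_on_compose[OF C1_on_pair_force 1(1)]) (auto simp: good_def off_axes_def)
  show "C1_on good (\<lambda>P. kepler_force (kchart P))"
    by (rule C1_on_compose[OF C2_on_imp_C1_on[OF C2_on_kepler_force] 1(1)]) (auto simp: good_def off_axes_def)
  show "C1_on good (\<lambda>P. kepler_force' (kchart P))"
    by (rule C1_on_compose[OF C1_on_kepler_force' 1(1)]) (auto simp: good_def off_axes_def)
qed

lemma kD2_continuous_good: "continuous_on good kD2"
  using continuous_on_subset[OF continuous_on_kD2 good_disc] .

lemma continuous_along:
  assumes "continuous_on good f" "P \<in> goods"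
  shows "continuous_on {0..2*pi} (\<lambda>t. f (P + (0, t)))"
  by (rule continuous_on_compose2[OF assms(1)]) (use goodsD[OF assms(2)] in \<open>auto intro!: continuous_intros\<close>)

lemma line_integral_derivative_C1:
  fixes g :: "(real^4) \<times> real \<Rightarrow> 'v::real_inner"
  assumes g: "C1_on good g" and \<omega>: "continuous_on {0..2*pi} \<omega>" and P: "P \<in> goods"
    and D: "\<And>Q. Q \<in> good \<Longrightarrow> (g has_derivative D Q) (at Q)"
  shows "((\<lambda>s. integral {0..2*pi} (\<lambda>t. g (P + s *\<^sub>R b + (0, t)) \<bullet> \<omega> t)) has_real_derivative
     integral {0..2*pi} (\<lambda>t. D (P + (0, t)) b \<bullet> \<omega> t)) (at 0)"
    and "continuous_on {0..2*pi} (\<lambda>t. D (P + (0, t)) b)"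
proof -
  obtain g' where g': "\<And>Q. Q \<in> good \<Longrightarrow> (g has_derivative blinfun_apply (g' Q)) (at Q)" "continuous_on good g'"
    using g unfolding C1_on_def by blast
  have eq: "blinfun_apply (g' (P + (0, t))) b = D (P + (0, t)) b" if "t \<in> {0..2*pi}" for t
    using has_derivative_unique[OF g'(1) D] goodsD[OF P that] by metis
  have "integral {0..2*pi} (\<lambda>t. blinfun_apply (g' (P + (0, t))) b \<bullet> \<omega> t) = integral {0..2*pi} (\<lambda>t. D (P + (0, t)) b \<bullet> \<omega> t)"
    by (rule Henstock_Kurzweil_Integration.integral_cong) (simp add: eq)
  then show "((\<lambda>s. integral {0..2*pi} (\<lambda>t. g (P + s *\<^sub>R b + (0, t)) \<bullet> \<omega> t)) has_real_derivative
     integral {0..2*pi} (\<lambda>t. D (P + (0, t)) b \<bullet> \<omega> t)) (at 0)"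
    using line_integral_has_derivative[OF open_good g' \<omega> goodsD[OF P], of b] by simp
  have "continuous_on {0..2*pi} (\<lambda>t. blinfun_apply (g' (P + (0, t))) b)"
    using continuous_along[OF g'(2) P] by (intro continuous_intros)
  then show "continuous_on {0..2*pi} (\<lambda>t. D (P + (0, t)) b)"
    by (rule continuous_on_eq) (rule eq)
qed

text \<open>\<open>J1\<close> and \<open>J2\<close> are the first and second variation of the
  averaged interaction in the five coordinates. In this context these names stand for variations and
  not for generators of rotations.\<close>

definition J1 :: "(real^4) \<times> real \<Rightarrow> (real^4) \<times> real \<Rightarrow> real" where
  "J1 P b = integral {0..2*pi} (\<lambda>t. pair_force H (kchart (P + (0, t))) \<bullet> blinfun_apply (kD (P + (0, t))) b)"

definition J2 :: "(real^4) \<times> real \<Rightarrow> (real^4) \<times> real \<Rightarrow> (real^4) \<times> real \<Rightarrow> real" where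
  "J2 P a b = integral {0..2*pi} (\<lambda>t. let Q = P + (0, t) in
      blinfun_apply (pair_force' H (kchart Q)) (blinfun_apply (kD Q) a) \<bullet> blinfun_apply (kD Q) b
      + pair_force H (kchart Q) \<bullet> blinfun_apply (blinfun_apply (kD2 Q) a) b)"

lemma potential_derivative:
  assumes "Q \<in> good"
  shows "((\<lambda>Q. pair_potential H (kchart Q)) has_derivative (\<lambda>b. pair_force H (kchart Q) \<bullet> blinfun_apply (kD Q) b)) (at Q)"
  using has_derivative_compose[OF kD pair_potential_has_derivative] good_facts[OF assms] by blast

lemma C1_potential: "C1_on good (\<lambda>Q. pair_potential H (kchart Q))"
  by (rule C1_on_compose[OF C2_on_imp_C1_on[OF C2_on_pair_potential] C1_on_good(1)]) (use good_facts in blast)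

lemma action_derivative:
  assumes "P \<in> goods"
  shows "((\<lambda>s. integral {0..2*pi} (\<lambda>t. pair_potential H (kchart (P + s *\<^sub>R b + (0, t))))) has_real_derivative J1 P b) (at 0)"
  using line_integral_derivative_C1(1)[OF C1_potential continuous_on_const[of _ 1] assms potential_derivative, of b]
  by (simp add: J1_def)

lemma kD_apply_derivative:
  assumes "Q \<in> good"
  shows "((\<lambda>Q. blinfun_apply (kD Q) b) has_derivative (\<lambda>a. blinfun_apply (blinfun_apply (kD2 Q) a) b)) (at Q)"
  by (rule bounded_linear.has_derivative[OF blinfun.bounded_linear_left kD2[OF good_facts(1)[OF assms]]])

lemma integrand_derivative:
  assumes "Q \<in> good"
  shows "((\<lambda>Q. pair_force H (kchart Q) \<bullet> blinfun_apply (kD Q) b) has_derivative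
    (\<lambda>a. blinfun_apply (pair_force' H (kchart Q)) (blinfun_apply (kD Q) a) \<bullet> blinfun_apply (kD Q) b
      + pair_force H (kchart Q) \<bullet> blinfun_apply (blinfun_apply (kD2 Q) a) b)) (at Q)"
proof -
  have "((\<lambda>Q. pair_force H (kchart Q)) has_derivative (\<lambda>a. blinfun_apply (pair_force' H (kchart Q)) (blinfun_apply (kD Q) a))) (at Q)"
    using has_derivative_compose[OF kD pair_force_has_derivative] good_facts[OF assms] by blast
  from has_derivative_inner[OF this kD_apply_derivative[OF assms, of b]]
  show ?thesis by (rule has_derivative_eq_rhs) (simp add: add.commute)
qed

lemma C1_integrand: "C1_on good (\<lambda>Q. pair_force H (kchart Q) \<bullet> blinfun_apply (kD Q) b)"
  by (intro C_intros C1_on_good)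

lemma J1_derivative:
  assumes "P \<in> goods"
  shows "((\<lambda>s. J1 (P + s *\<^sub>R a) b) has_real_derivative J2 P a b) (at 0)"
  using line_integral_derivative_C1(1)[OF C1_integrand continuous_on_const[of _ 1] assms integrand_derivative, of a b]
  by (simp add: J1_def J2_def Let_def)

lemma J1_integrand_continuous:
  "P \<in> goods \<Longrightarrow> continuous_on {0..2*pi} (\<lambda>t. pair_force H (kchart (P + (0, t))) \<bullet> blinfun_apply (kD (P + (0, t))) b)"
  using continuous_along[OF C1_on_continuous[OF C1_integrand]] by blast

lemma J2_integrand_continuous:
  "P \<in> goods \<Longrightarrow> continuous_on {0..2*pi} (\<lambda>t. let Q = P + (0, t) in
      blinfun_apply (pair_force' H (kchart Q)) (blinfun_apply (kD Q) a) \<bullet> blinfun_apply (kD Q) b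
      + pair_force H (kchart Q) \<bullet> blinfun_apply (blinfun_apply (kD2 Q) a) b)"
  unfolding Let_def
  using line_integral_derivative_C1(2)[OF C1_integrand continuous_on_const[of _ 1] _ integrand_derivative] by blast

lemma linear_J1: "P \<in> goods \<Longrightarrow> linear (J1 P)"
  by (rule linearI)
    (simp_all add: J1_def blinfun.bilinear_simps inner_add_right
      Henstock_Kurzweil_Integration.integral_add integrable_continuous_interval J1_integrand_continuous)

lemma linear_J2: "P \<in> goods \<Longrightarrow> linear (\<lambda>a. J2 P a b)"
proof (rule linearI)
  assume P: "P \<in> goods"
  fix a a'
  define L where "L a t = (let Q = P + (0, t) in
      blinfun_apply (pair_force' H (kchart Q)) (blinfun_apply (kD Q) a) \<bullet> blinfun_apply (kD Q) b
      + pair_force H (kchart Q) \<bullet> blinfun_apply (blinfun_apply (kD2 Q) a) b)" for a t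
  have L: "L a integrable_on {0..2*pi}" for a
    unfolding L_def by (rule integrable_continuous_interval[OF J2_integrand_continuous[OF P]])
  have "L (a + a') = (\<lambda>t. L a t + L a' t)"
    by (auto simp: L_def Let_def blinfun.bilinear_simps inner_add_left inner_add_right)
  then show "J2 P (a + a') b = J2 P a b + J2 P a' b"
    unfolding J2_def L_def[symmetric] by (simp add: Henstock_Kurzweil_Integration.integral_add L)
  fix r
  have "J2 P (r *\<^sub>R a) b = integral {0..2*pi} (\<lambda>t. r * (let Q = P + (0, t) in
      blinfun_apply (pair_force' H (kchart Q)) (blinfun_apply (kD Q) a) \<bullet> blinfun_apply (kD Q) b
      + pair_force H (kchart Q) \<bullet> blinfun_apply (blinfun_apply (kD2 Q) a) b))"
    unfolding J2_def by (simp add: Let_def blinfun.bilinear_simps distrib_left)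
  then show "J2 P (r *\<^sub>R a) b = r *\<^sub>R J2 P a b" by (simp add: J2_def)
qed

text \<open>In the time direction the integrand is a total derivative of a periodic
  function.\<close>

lemma J1_time:
  assumes "P \<in> goods"
  shows "J1 P (0, 1) = 0"
proof -
  obtain q \<phi> where P: "P = (q, \<phi>)" by fastforce
  have q: "q \<in> disc4" using goodsD[OF assms, of 0] by (auto simp: P good_def)
  have "((\<lambda>t. pair_force H (kchart (P + (0, t))) \<bullet> blinfun_apply (kD (P + (0, t))) (0, 1)) has_integral
     pair_potential H (kchart (P + (0, 2*pi))) - pair_potential H (kchart (P + (0, 0)))) {0..2*pi}"
  proof (rule fundamental_theorem_of_calculus)
    fix t assume "t \<in> {0..2*pi}"
    then have g: "P + (0, t) \<in> good" by (rule goodsD[OF assms])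
    have "((\<lambda>t. P + (0, t)) has_derivative (\<lambda>s. s *\<^sub>R (0, 1))) (at t)" by (auto intro!: derivative_eq_intros)
    from has_derivative_compose[OF this potential_derivative[OF g]]
    show "((\<lambda>t. pair_potential H (kchart (P + (0, t)))) has_vector_derivative
        pair_force H (kchart (P + (0, t))) \<bullet> blinfun_apply (kD (P + (0, t))) (0, 1)) (at t within {0..2*pi})"
      by - (rule has_vector_derivative_at_within, simp add: has_vector_derivative_def blinfun.scaleR_right del: scaleR_Pair)
  qed simp
  moreover have "kchart (P + (0, 2*pi)) = kchart (P + (0, 0))" using kchart_periodic[OF q, of \<phi>] by (simp add: P)
  ultimately show ?thesis unfolding J1_def by (simp add: integral_unique)
qed

text \<open>\<open>J1\<close> vanishes in the time direction at all nearby base points, so the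
  derivative of that quantity vanishes as well. This is what forces the multiplier in the linearised
  problem to be 0.\<close>

lemma J2_time: "P \<in> goods \<Longrightarrow> J2 P a (0, 1) = 0"
proof -
  assume P: "P \<in> goods"
  obtain d where d: "d > 0" "\<And>s. \<bar>s\<bar> < d \<Longrightarrow> P + s *\<^sub>R a \<in> goods" using goods_line[OF P] by blast
  have "((\<lambda>s. J1 (P + s *\<^sub>R a) (0, 1)) has_real_derivative 0) (at 0)"
    by (rule has_field_derivative_transform_within_open[OF DERIV_const[of 0], where S = "ball 0 d"])
      (use d J1_time in auto)
  then show ?thesis using J1_derivative[OF P] DERIV_unique by blast
qed

lemma u0_pi: "u0 (t + pi) = - u0 t" by (simp add: u0_def)

text \<open>Half a period turns \<open>u0\<close> into its negative and thereby reverses the pair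
  force, while the Jacobi fields of the two eccentricity directions are unchanged; the integrand is
  antiperiodic. This is the automatic vanishing of the derivatives in the eccentricity vector at a
  circle.\<close>

lemma J1_eccentricity: "i = 1 \<or> i = 2 \<Longrightarrow> J1 (p, 0) (axis i 1, 0) = 0"
proof -
  assume i: "i = 1 \<or> i = 2"
  have k: "kjac p (axis i 1, 0) (t + pi) = kjac p (axis i 1, 0) t" for t
    using i by (auto simp: kjac_def axis_def)
  have "J1 (p, 0) (axis i 1, 0) = integral {0..2*pi} (\<lambda>t. pair_force H (u0 t) \<bullet> kjac p (axis i 1, 0) t)"
    by (simp add: J1_def kchart_circ kD_circ)
  also have "\<dots> = 0"
  proof (rule integral_antiperiodic)
    have 1: "continuous_on UNIV u0" "continuous_on UNIV (kjac p (axis i 1, 0))"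
      by (rule continuous_on_vector_derivative, rule u0_has_derivative kjac_has_derivative)+
    show "continuous_on UNIV (\<lambda>t. pair_force H (u0 t) \<bullet> kjac p (axis i 1, 0) t)"
      by (intro continuous_on_inner 1 continuous_on_compose2[OF C1_on_continuous[OF C1_on_pair_force] 1(1)]) (use avoids in auto)
    show "pair_force H (u0 (t + pi)) \<bullet> kjac p (axis i 1, 0) (t + pi) = - (pair_force H (u0 t) \<bullet> kjac p (axis i 1, 0) t)" for t
      by (simp add: k u0_pi pair_force_minus)
  qed
  finally show ?thesis .
qed

lemma Psi_eq:
  assumes "(q, 0) \<in> goods"
  shows "Psi H q = integral {0..2*pi} (\<lambda>t. pair_potential H (kchart (q, t)))"
proof -
  have q: "(q$1)\<^sup>2 + (q$2)\<^sup>2 < 1" using goodsD[OF assms, of 0] by (auto simp: good_def disc4_def)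
  have "norm (vector [q$1, q$2] :: real^2) < 1" using q by (simp add: norm_vec_def L2_set_def sum_2)
  moreover have "vector [q$1, q$2, q$3, q$4] = q" by (simp add: vec_eq_iff forall_4)
  ultimately have "kepler_chart (vector [q$1, q$2]) (vector [q$3, q$4]) t = kchart (q, t)" for t
    by (simp add: kepler_chart_eq)
  then show ?thesis unfolding Psi_def action1_def pair_potential_def by simp
qed

lemma partial_derivative_Psi:
  assumes "(q, 0) \<in> goods"
  shows "partial_derivative i (Psi H) q = J1 (q, 0) (axis i 1, 0)"
proof -
  obtain d where d: "d > 0" "\<And>s. \<bar>s\<bar> < d \<Longrightarrow> (q, 0) + s *\<^sub>R (axis i 1, 0) \<in> goods" using goods_line[OF assms] by blast
  have "((\<lambda>s. Psi H (q + s *\<^sub>R axis i 1)) has_real_derivative J1 (q, 0) (axis i 1, 0)) (at 0)"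
    by (rule has_field_derivative_transform_within_open[OF action_derivative[OF assms], where S = "ball 0 d"])
      (use d Psi_eq in auto)
  then show ?thesis unfolding partial_derivative_def by (rule DERIV_imp_deriv)
qed

lemma hessian_Psi: "hessian (Psi H) p $ i $ j = J2 (p, 0) (axis i 1, 0) (axis j 1, 0)"
proof -
  obtain d where d: "d > 0" "\<And>s. \<bar>s\<bar> < d \<Longrightarrow> (p, 0) + s *\<^sub>R (axis i 1, 0) \<in> goods" using goods_line[OF goods_0] by blast
  have "((\<lambda>s. partial_derivative j (Psi H) (p + s *\<^sub>R axis i 1)) has_real_derivative J2 (p, 0) (axis i 1, 0) (axis j 1, 0)) (at 0)"
    by (rule has_field_derivative_transform_within_open[OF J1_derivative[OF goods_0], where S = "ball 0 d"])
      (use d partial_derivative_Psi in auto)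
  then show ?thesis unfolding hessian_def by (simp add: partial_derivative_def DERIV_imp_deriv)
qed

lemma J1_zero:
  assumes "partial_derivative 3 (Psi H) p = 0" "partial_derivative 4 (Psi H) p = 0"
  shows "J1 (p, 0) b = 0"
proof -
  have ax: "J1 (p, 0) (axis i 1, 0) = 0" for i
    using assms J1_eccentricity[of i] partial_derivative_Psi[OF goods_0] exhaust_4[of i] by auto
  obtain d \<phi> where b: "b = (d, \<phi>)" by fastforce
  have "b = (\<Sum>i\<in>UNIV. (d$i) *\<^sub>R (axis i 1, 0)) + \<phi> *\<^sub>R (0, 1)"
    by (simp add: b sum_4 vec_eq_iff forall_4 axis_def)
  then have "J1 (p, 0) b = (\<Sum>i\<in>UNIV. (d$i) *\<^sub>R J1 (p, 0) (axis i 1, 0)) + \<phi> *\<^sub>R J1 (p, 0) (0, 1)"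
    by (simp only: linear_add[OF linear_J1[OF goods_0]] linear_sum[OF linear_J1[OF goods_0]] linear_scale[OF linear_J1[OF goods_0]])
  then show ?thesis using ax J1_time[OF goods_0] by simp
qed

text \<open>The row index of \<open>hessian\<close> belongs to the outer derivative, which is the
  first slot of \<open>J2\<close>. Hence \<open>d\<close> multiplies the matrix from the left, and
  its transpose is the matrix to invert.\<close>

lemma hessian_kernel:
  assumes "invertible (hessian (Psi H) p)" "\<And>j. J2 (p, 0) (d, 0) (axis j 1, 0) = 0"
  shows "d = 0"
proof -
  have "(d, 0) = (\<Sum>i\<in>UNIV. (d$i) *\<^sub>R (axis i 1, 0 :: real))" by (simp add: sum_4 vec_eq_iff forall_4 axis_def)
  then have "J2 (p, 0) (d, 0) (axis j 1, 0) = (\<Sum>i\<in>UNIV. (d$i) *\<^sub>R J2 (p, 0) (axis i 1, 0) (axis j 1, 0))" for j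
    by (simp only: linear_sum[OF linear_J2[OF goods_0]] linear_scale[OF linear_J2[OF goods_0]])
  then have "d v* hessian (Psi H) p = 0"
    using assms(2) by (simp add: vector_matrix_mult_def vec_eq_iff hessian_Psi mult.commute)
  then have "transpose (hessian (Psi H) p) *v d = 0" by (simp add: transpose_matrix_vector)
  moreover obtain M where M: "hessian (Psi H) p ** M = mat 1" using assms(1) unfolding invertible_def by blast
  have "transpose M ** transpose (hessian (Psi H) p) = mat 1"
    unfolding matrix_transpose_mul[symmetric] M by (rule transpose_mat)
  ultimately show ?thesis
    by (metis matrix_vector_mul_assoc matrix_vector_mul_lid matrix_vector_mult_0_right)
qed

text \<open>The Hessian contains second parameter derivatives of the chart, whereas the linearised
  rescaled equation contains the correction \<open>w\<close>; this identity exchanges the two. For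
  every ellipse, the Kepler force paired with \<open>w\<close> equals the ellipse paired with the
  second derivative of \<open>w\<close>, by Green's identity. Differentiating twice in the
  parameters produces \<open>kepler_force'\<close> applied to the second derivative of the chart,
  which cancels by symmetry against the linear part of the equation for \<open>w\<close>. What
  remains says that \<open>kepler_force''\<close> on two Jacobi fields, paired with
  \<open>w\<close>, equals the pair force paired with the second derivative of the chart.\<close>

lemma second_variation_identity:
  assumes w: "\<And>t. t \<in> {0..2*pi} \<Longrightarrow> (w has_vector_derivative w1 t) (at t within {0..2*pi})"
    and w1: "\<And>t. t \<in> {0..2*pi} \<Longrightarrow> (w1 has_vector_derivative blinfun_apply (kepler_force' (u0 t)) (w t) + pair_force H (u0 t)) (at t within {0..2*pi})"
    and w_bc: "w 0 = 0" "w (2*pi) = 0" "w1 (2*pi) = w1 0"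
  shows "((\<lambda>t. (blinfun_apply (blinfun_apply (kepler_force'' (u0 t)) (kjac p a t)) (w t)
       + blinfun_apply (pair_force' H (u0 t)) (kjac p a t)) \<bullet> kjac p b t) has_integral J2 (p, 0) a b) {0..2*pi}"
proof -
  define m where "m t = blinfun_apply (kepler_force' (u0 t)) (w t) + pair_force H (u0 t)" for t
  have cw: "continuous_on {0..2*pi} w" using w by (rule continuous_on_vector_derivative)
  have cu: "continuous_on {0..2*pi} u0" using u0_has_derivative(1) by (rule continuous_on_vector_derivative)
  have cm: "continuous_on {0..2*pi} m"
    unfolding m_def
    by (intro continuous_intros cw continuous_on_compose2[OF C1_on_continuous[OF C1_on_kepler_force'] cu]
        continuous_on_compose2[OF C1_on_continuous[OF C1_on_pair_force] cu]) (use avoids in auto)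
  \<comment> \<open>Green's identity without boundary terms: \<open>w\<close> vanishes at both ends,
    its end velocities agree, and the ellipse is periodic. Neither \<open>w\<close> nor its second
    derivative \<open>m\<close> depends on \<open>P\<close>, so the equation may be differentiated
    in \<open>P\<close>.\<close>
  have zero: "integral {0..2*pi} (\<lambda>t. kepler_force (kchart (P + (0, t))) \<bullet> w t)
      = integral {0..2*pi} (\<lambda>t. kchart (P + (0, t)) \<bullet> m t)" if P: "P \<in> goods" for P
  proof -
    obtain q \<phi> where Pq: "P = (q, \<phi>)" by fastforce
    have q: "q \<in> disc4" using goodsD[OF P, of 0] by (auto simp: Pq good_def)
    have sh: "((\<lambda>t. f (q, \<phi> + t)) has_vector_derivative f') (at t within {0..2*pi})"
      if "((\<lambda>t. f (q, t)) has_vector_derivative f') (at (\<phi> + t))" for f :: "(real^4) \<times> real \<Rightarrow> real^3" and f' t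
    proof -
      have "((\<lambda>t. \<phi> + t) has_vector_derivative 1) (at t)" by (auto intro!: derivative_eq_intros)
      from vector_diff_chain_at[OF this that]
      show ?thesis by - (rule has_vector_derivative_at_within, simp add: o_def)
    qed
    have "((\<lambda>t. kepler_force (kchart (q, \<phi> + t)) \<bullet> w t - kchart (q, \<phi> + t) \<bullet> m t) has_integral
      (kvel (q, \<phi> + 2*pi) \<bullet> w (2*pi) - kchart (q, \<phi> + 2*pi) \<bullet> w1 (2*pi)) - (kvel (q, \<phi> + 0) \<bullet> w 0 - kchart (q, \<phi> + 0) \<bullet> w1 0)) {0..2*pi}"
      by (rule wronskian_has_integral) (use w w1 sh kchart_has_derivative[OF q] in \<open>auto simp: m_def\<close>)
    then have "integral {0..2*pi} (\<lambda>t. kepler_force (kchart (P + (0, t))) \<bullet> w t - kchart (P + (0, t)) \<bullet> m t) = 0"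
      using kchart_periodic[OF q, of \<phi>] w_bc by (simp add: Pq integral_unique)
    moreover have "(\<lambda>t. kepler_force (kchart (P + (0, t))) \<bullet> w t) integrable_on {0..2*pi}"
      "(\<lambda>t. kchart (P + (0, t)) \<bullet> m t) integrable_on {0..2*pi}"
      by (intro integrable_continuous_interval continuous_on_inner cw cm
          continuous_along[OF C1_on_continuous P] C1_on_good)+
    ultimately show ?thesis by (simp add: Henstock_Kurzweil_Integration.integral_diff)
  qed
  have d1: "((\<lambda>Q. kepler_force (kchart Q)) has_derivative (\<lambda>b. blinfun_apply (kepler_force' (kchart Q)) (blinfun_apply (kD Q) b))) (at Q)"
    if "Q \<in> good" for Q
    using has_derivative_compose[OF kD kepler_force_has_derivative] good_facts[OF that] by blast
  \<comment> \<open>Needed at every admissible \<open>P\<close>, not only at the base point, because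
    it is differentiated once more.\<close>
  have zero1: "integral {0..2*pi} (\<lambda>t. blinfun_apply (kepler_force' (kchart (P + (0, t)))) (blinfun_apply (kD (P + (0, t))) b) \<bullet> w t)
      = integral {0..2*pi} (\<lambda>t. blinfun_apply (kD (P + (0, t))) b \<bullet> m t)" if P: "P \<in> goods" for P
  proof -
    obtain d where d: "d > 0" "\<And>s. \<bar>s\<bar> < d \<Longrightarrow> P + s *\<^sub>R b \<in> goods" using goods_line[OF P] by blast
    have "((\<lambda>s. integral {0..2*pi} (\<lambda>t. kchart (P + s *\<^sub>R b + (0, t)) \<bullet> m t)) has_real_derivative
        integral {0..2*pi} (\<lambda>t. blinfun_apply (kepler_force' (kchart (P + (0, t)))) (blinfun_apply (kD (P + (0, t))) b) \<bullet> w t)) (at 0)"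
      by (rule has_field_derivative_transform_within_open[OF line_integral_derivative_C1(1)[OF C1_on_good(4) cw P d1], where S = "ball 0 d"])
        (use d zero in auto)
    then show ?thesis
      using line_integral_derivative_C1(1)[OF C1_on_good(1) cm P kD[OF good_facts(1)]] DERIV_unique by blast
  qed
  have d2: "((\<lambda>Q. blinfun_apply (kepler_force' (kchart Q)) (blinfun_apply (kD Q) b)) has_derivative
      (\<lambda>a. blinfun_apply (kepler_force' (kchart Q)) (blinfun_apply (blinfun_apply (kD2 Q) a) b)
         + blinfun_apply (blinfun_apply (kepler_force'' (kchart Q)) (blinfun_apply (kD Q) a)) (blinfun_apply (kD Q) b))) (at Q)"
    if Q: "Q \<in> good" for Q
  proof -
    have "((\<lambda>Q. kepler_force' (kchart Q)) has_derivative (\<lambda>a. blinfun_apply (kepler_force'' (kchart Q)) (blinfun_apply (kD Q) a))) (at Q)"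
      using has_derivative_compose[OF kD kepler_force'_has_derivative] good_facts[OF Q] by blast
    from bounded_bilinear.FDERIV[OF bounded_bilinear_blinfun_apply this kD_apply_derivative[OF Q, of b]]
    show ?thesis .
  qed
  have c2: "C1_on good (\<lambda>Q. blinfun_apply (kepler_force' (kchart Q)) (blinfun_apply (kD Q) b))"
    by (intro C_intros C1_on_good)
  have C3: "C1_on good (\<lambda>Q. blinfun_apply (kD Q) b)" by (intro C_intros C1_on_good)
  obtain d where d: "d > 0" "\<And>s. \<bar>s\<bar> < d \<Longrightarrow> (p, 0) + s *\<^sub>R a \<in> goods" using goods_line[OF goods_0] by blast
  let ?Q = "\<lambda>t. (p, 0) + (0, t)"
  have e1: "integral {0..2*pi} (\<lambda>t. (blinfun_apply (kepler_force' (kchart (?Q t))) (blinfun_apply (blinfun_apply (kD2 (?Q t)) a) b)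
         + blinfun_apply (blinfun_apply (kepler_force'' (kchart (?Q t))) (blinfun_apply (kD (?Q t)) a)) (blinfun_apply (kD (?Q t)) b)) \<bullet> w t)
      = integral {0..2*pi} (\<lambda>t. blinfun_apply (blinfun_apply (kD2 (?Q t)) a) b \<bullet> m t)"
  proof -
    have "((\<lambda>s. integral {0..2*pi} (\<lambda>t. blinfun_apply (kD ((p, 0) + s *\<^sub>R a + (0, t))) b \<bullet> m t)) has_real_derivative
      integral {0..2*pi} (\<lambda>t. (blinfun_apply (kepler_force' (kchart (?Q t))) (blinfun_apply (blinfun_apply (kD2 (?Q t)) a) b)
         + blinfun_apply (blinfun_apply (kepler_force'' (kchart (?Q t))) (blinfun_apply (kD (?Q t)) a)) (blinfun_apply (kD (?Q t)) b)) \<bullet> w t)) (at 0)"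
      by (rule has_field_derivative_transform_within_open[OF line_integral_derivative_C1(1)[OF c2 cw goods_0 d2], where S = "ball 0 d"])
        (use d zero1 in auto)
    then show ?thesis
      using line_integral_derivative_C1(1)[OF C3 cm goods_0 kD_apply_derivative] DERIV_unique by blast
  qed
  define k2 where "k2 t = blinfun_apply (blinfun_apply (kD2 (?Q t)) a) b" for t
  define x where "x t = blinfun_apply (blinfun_apply (kepler_force'' (u0 t)) (kjac p a t)) (kjac p b t)" for t
  have ck2: "continuous_on {0..2*pi} k2"
    unfolding k2_def using continuous_along[OF kD2_continuous_good goods_0] by (intro continuous_intros)
  have cj: "continuous_on {0..2*pi} (kjac p h)" for h using kjac_has_derivative(1) by (rule continuous_on_vector_derivative)
  have cx: "continuous_on {0..2*pi} x"
    unfolding x_def by (intro continuous_intros cj continuous_on_compose2[OF continuous_on_kepler_force'' cu]) auto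
  have cpf: "continuous_on {0..2*pi} (\<lambda>t. pair_force H (u0 t))"
    by (intro continuous_on_compose2[OF C1_on_continuous[OF C1_on_pair_force] cu]) (use avoids in auto)
  have cpf': "continuous_on {0..2*pi} (\<lambda>t. pair_force' H (u0 t))"
    by (intro continuous_on_compose2[OF continuous_on_pair_force' cu]) (use avoids in auto)
  \<comment> \<open>The symmetric operator \<open>kepler_force' (u0 t)\<close>, acting on
    \<open>k2\<close> on one side of \<open>e1\<close> and on \<open>w\<close> on the other,
    cancels.\<close>
  have "integral {0..2*pi} (\<lambda>t. x t \<bullet> w t) = integral {0..2*pi} (\<lambda>t. pair_force H (u0 t) \<bullet> k2 t)"
  proof -
    have "integral {0..2*pi} (\<lambda>t. (blinfun_apply (kepler_force' (u0 t)) (k2 t) + x t) \<bullet> w t) = integral {0..2*pi} (\<lambda>t. k2 t \<bullet> m t)"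
      using e1 by (simp add: k2_def x_def kchart_circ kD_circ)
    moreover have "integral {0..2*pi} (\<lambda>t. k2 t \<bullet> m t) =
       integral {0..2*pi} (\<lambda>t. blinfun_apply (kepler_force' (u0 t)) (k2 t) \<bullet> w t + pair_force H (u0 t) \<bullet> k2 t)"
    proof (rule Henstock_Kurzweil_Integration.integral_cong)
      fix t
      show "k2 t \<bullet> m t = blinfun_apply (kepler_force' (u0 t)) (k2 t) \<bullet> w t + pair_force H (u0 t) \<bullet> k2 t"
        using kepler_force'_symmetric[of "u0 t" "w t" "k2 t"] by (simp add: m_def inner_add_right inner_commute)
    qed
    moreover have i: "(\<lambda>t. blinfun_apply (kepler_force' (u0 t)) (k2 t) \<bullet> w t) integrable_on {0..2*pi}"
      by (intro integrable_continuous_interval continuous_intros ck2 cw continuous_on_compose2[OF C1_on_continuous[OF C1_on_kepler_force'] cu]) auto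
    moreover have "(\<lambda>t. x t \<bullet> w t) integrable_on {0..2*pi}" "(\<lambda>t. pair_force H (u0 t) \<bullet> k2 t) integrable_on {0..2*pi}"
      by (intro integrable_continuous_interval continuous_intros ck2 cw cx cpf)+
    ultimately show ?thesis by (simp add: inner_add_left Henstock_Kurzweil_Integration.integral_add)
  qed
  moreover have "J2 (p, 0) a b = integral {0..2*pi} (\<lambda>t. blinfun_apply (pair_force' H (u0 t)) (kjac p a t) \<bullet> kjac p b t + pair_force H (u0 t) \<bullet> k2 t)"
    by (simp add: J2_def Let_def kchart_circ kD_circ k2_def)
  moreover have I1: "(\<lambda>t. blinfun_apply (pair_force' H (u0 t)) (kjac p a t) \<bullet> kjac p b t) integrable_on {0..2*pi}"
    and "(\<lambda>t. pair_force H (u0 t) \<bullet> k2 t) integrable_on {0..2*pi}" and I2: "(\<lambda>t. x t \<bullet> w t) integrable_on {0..2*pi}"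
    by (intro integrable_continuous_interval continuous_intros ck2 cw cx cpf cpf' cj)+
  ultimately have "J2 (p, 0) a b = integral {0..2*pi} (\<lambda>t. x t \<bullet> w t + blinfun_apply (pair_force' H (u0 t)) (kjac p a t) \<bullet> kjac p b t)"
    by (simp add: Henstock_Kurzweil_Integration.integral_add)
  moreover have "(\<lambda>t. x t \<bullet> w t + blinfun_apply (pair_force' H (u0 t)) (kjac p a t) \<bullet> kjac p b t) =
     (\<lambda>t. (blinfun_apply (blinfun_apply (kepler_force'' (u0 t)) (kjac p a t)) (w t) + blinfun_apply (pair_force' H (u0 t)) (kjac p a t)) \<bullet> kjac p b t)"
    by (simp add: x_def inner_add_left kepler_force''_symmetric[of "u0 _" _ "kjac p b _"])
  ultimately show ?thesis
    using integrable_integral[OF integrable_add[OF I2 I1]] by simp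
qed

end

section \<open>The rescaled equation\<close>

instance bcontfun :: (metric_space, banach) banach ..

type_synonym loopC = "real \<Rightarrow>\<^sub>C (real^3)"
type_synonym params = "(real^4) \<times> (real \<times> real)"

definition lin :: "real^3 \<Rightarrow> loopC" where "lin v = mkC (\<lambda>t. t *\<^sub>R v)"

lemma lin_apply: "t \<in> {0..2*pi} \<Longrightarrow> apply_bcontfun (lin v) t = t *\<^sub>R v"
  unfolding lin_def by (rule mkC_eq) (auto intro!: continuous_intros)

lemma bounded_linear_lin: "bounded_linear lin"
proof (rule bounded_linear_intro[where K = "2 * pi"])
  have c: "continuous_on {0..2*pi} (\<lambda>t. t *\<^sub>R v)" for v :: "real^3" by (intro continuous_intros)
  show "lin (v + w) = lin v + lin w" for v w
    unfolding lin_def mkC_add[OF c c, symmetric] by (simp add: scaleR_add_right)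
  show "lin (r *\<^sub>R v) = r *\<^sub>R lin v" for r v
    unfolding lin_def mkC_scaleR[OF c, symmetric] by (simp add: mult.commute)
  show "norm (lin v) \<le> norm v * (2 * pi)" for v
    unfolding lin_def by (rule norm_mkC[OF c]) (auto simp: mult.commute[of "norm v"] intro!: mult_right_mono)
qed

text \<open>The data that enter the equation at one instant: the value of the correction, the
  ellipse parameters and \<open>\<epsilon>\<close>. In this form the equation is a superposition
  operator in the sense of \<open>nemytskii\<close>.\<close>

definition evc :: "real \<Rightarrow> (loopC \<times> params) \<times> real \<Rightarrow> (real^3) \<times> (real^4) \<times> real" where
  "evc t X = (apply_bcontfun (fst (fst X)) t, fst (snd (fst X)), snd X)"

lemma bounded_linear_evc: "bounded_linear (evc t)"
  unfolding evc_def
  by (intro bounded_linear_Pair bounded_linear_compose[OF bounded_linear_eval] bounded_linear_snd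
      bounded_linear_compose[OF bounded_linear_fst] bounded_linear_compose[OF bounded_linear_snd] bounded_linear_fst)

lemma norm_fst_snd_le: "norm (fst Z) \<le> norm Z" "norm (snd Z) \<le> norm Z"
  using norm_fst_le[of "fst Z" "snd Z"] norm_snd_le[of "snd Z" "fst Z"] by simp_all

lemma norm_evc: "norm (evc t X) \<le> 3 * norm X"
proof -
  have "norm (evc t X) \<le> norm (apply_bcontfun (fst (fst X)) t) + (norm (fst (snd (fst X))) + norm (snd X))"
    unfolding evc_def by (rule order_trans[OF norm_Pair_le add_left_mono[OF norm_Pair_le]])
  moreover have "norm (apply_bcontfun (fst (fst X)) t) \<le> norm X"
    by (rule order_trans[OF norm_bounded order_trans[OF norm_fst_snd_le(1) norm_fst_snd_le(1)]])
  moreover have "norm (fst (snd (fst X))) \<le> norm X" by (rule order_trans[OF norm_fst_snd_le(1) order_trans[OF norm_fst_snd_le(2) norm_fst_snd_le(1)]])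
  moreover have "norm (snd X) \<le> norm X" by (rule norm_fst_snd_le)
  ultimately show ?thesis by linarith
qed

lemma continuous_on_evc: "continuous_on S (\<lambda>t. evc t X)"
  unfolding evc_def by (intro continuous_intros) simp

context circular_symmetric
begin

text \<open>The second derivative required of \<open>w\<close>: Newton's equation for the perturbed
  orbit minus Kepler's equation for the ellipse, divided by \<open>\<epsilon>\<close>.
  \<open>force_quotient\<close> carries out the division so that \<open>\<epsilon> = 0\<close> is a
  regular value of the parameter.\<close>

definition Gam :: "real \<times> (real^3) \<times> (real^4) \<times> real \<Rightarrow> real^3" where
  "Gam Y = (let t = fst Y; y = fst (snd Y); q = fst (snd (snd Y)); e = snd (snd (snd Y)); x = kchart (q, t) in
     force_quotient x y e + pair_force H (x + e *\<^sub>R y))"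

definition GamW :: "(real \<times> (real^3) \<times> (real^4) \<times> real) set" where
  "GamW = {Y. fst (snd (snd Y)) \<in> disc4 \<and> kchart (fst (snd (snd Y)), fst Y) + snd (snd (snd Y)) *\<^sub>R fst (snd Y) \<in> off_axes H}"

lemma C1_GamW: "C1_on {Y. fst (snd (snd Y)) \<in> disc4} (\<lambda>Y. kchart (fst (snd (snd Y)), fst Y))"
  "C1_on {Y. fst (snd (snd Y)) \<in> disc4} (\<lambda>Y. kchart (fst (snd (snd Y)), fst Y) + snd (snd (snd Y)) *\<^sub>R fst (snd Y))"
proof -
  show 1: "C1_on {Y. fst (snd (snd Y)) \<in> disc4} (\<lambda>Y. kchart (fst (snd (snd Y)), fst Y))"
    by (rule C1_on_compose[OF C2_on_imp_C1_on[OF C2_on_kchart]]) (auto intro!: C_intros)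
  show "C1_on {Y. fst (snd (snd Y)) \<in> disc4} (\<lambda>Y. kchart (fst (snd (snd Y)), fst Y) + snd (snd (snd Y)) *\<^sub>R fst (snd Y))"
    by (intro C_intros 1)
qed

lemma open_GamW: "open GamW"
proof -
  have o: "open {Y :: real \<times> (real^3) \<times> (real^4) \<times> real. fst (snd (snd Y)) \<in> disc4}"
    using open_vimage[OF open_disc4, of "\<lambda>Y. fst (snd (snd Y))"] by (simp add: vimage_def continuous_intros)
  have "open ((\<lambda>Y. kchart (fst (snd (snd Y)), fst Y) + snd (snd (snd Y)) *\<^sub>R fst (snd Y)) -` off_axes H \<inter> {Y. fst (snd (snd Y)) \<in> disc4})"
    by (rule iffD1[OF continuous_on_open_vimage[OF o], rule_format, OF C1_on_continuous[OF C1_GamW(2)] open_off_axes])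
  then show ?thesis by (simp add: GamW_def vimage_def Int_def conj_commute)
qed

lemma C1_Gam: "C1_on GamW Gam"
proof -
  have sub: "GamW \<subseteq> {Y. fst (snd (snd Y)) \<in> disc4}" by (auto simp: GamW_def)
  note C = C1_GamW[THEN C1_on_subset[OF _ sub]]
  show ?thesis
    unfolding Gam_def Let_def
  proof (intro C1_on_add C1_on_force_quotient C1_on_compose[OF C1_on_pair_force C(2)] C(1))
    show "C1_on GamW (\<lambda>Y. fst (snd Y))" "C1_on GamW (\<lambda>Y. snd (snd (snd Y)))" by (intro C_intros)+
  qed (auto simp: GamW_def off_axes_def kchart_nonzero)
qed

definition dom :: "((loopC \<times> params) \<times> real) set" where
  "dom = {X. \<forall>t\<in>{0..2*pi}. (t, evc t X) \<in> GamW}"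

definition Nmap :: "(loopC \<times> params) \<times> real \<Rightarrow> loopC" where
  "Nmap X = mkC (\<lambda>t. Gam (t, evc t X))"

lemma open_dom: "open dom" and C1_Nmap: "C1_on dom Nmap"
  using nemytskii[OF open_GamW C1_Gam bounded_linear_evc norm_evc continuous_on_evc]
  by (simp_all add: dom_def Nmap_def[abs_def])

text \<open>The jump \<open>\<kappa>\<close> of the velocity at the end of the period is an additional unknown because
  conservation of energy makes the end conditions dependent: without it the linearisation would
  not be onto.\<close>

definition Fmap :: "(loopC \<times> params) \<times> real \<Rightarrow> loopC \<times> (real^3) \<times> (real^3)" where
  "Fmap X = (let w = fst (fst X); q = fst (snd (fst X)); \<sigma> = fst (snd (snd (fst X))); \<kappa> = snd (snd (snd (fst X))) in
     (w - \<sigma> *\<^sub>R lin (kvel (q, 0)) - blinfun_apply IC (blinfun_apply IC (Nmap X)),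
      apply_bcontfun (blinfun_apply IC (Nmap X)) (2*pi) - \<kappa> *\<^sub>R v0 0, apply_bcontfun w (2*pi)))"

lemma dom_disc: "X \<in> dom \<Longrightarrow> fst (snd (fst X)) \<in> disc4"
  by (auto simp: dom_def GamW_def evc_def dest: bspec[of _ _ 0])

lemma C1_Fmap: "C1_on dom Fmap"
proof -
  have k: "C1_on dom (\<lambda>X. kvel (fst (snd (fst X)), 0))"
    by (rule C1_on_compose[OF C2_on_imp_C1_on[OF C2_on_kvel]]) (auto intro!: C_intros dest: dom_disc)
  have n: "C1_on dom (\<lambda>X. blinfun_apply IC (Nmap X))"
    by (rule C1_on_linear[OF blinfun.bounded_linear_right C1_Nmap])
  have n2: "C1_on dom (\<lambda>X. blinfun_apply IC (blinfun_apply IC (Nmap X)))"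
    by (rule C1_on_linear[OF blinfun.bounded_linear_right n])
  have w: "C1_on dom (\<lambda>X. fst (fst X))" by (intro C_intros)
  show ?thesis
    unfolding Fmap_def[abs_def] Let_def
    by (intro C1_on_Pair C1_on_diff C1_on_scaleR C1_on_linear[OF bounded_linear_lin k] n2
        C1_on_linear[OF bounded_linear_eval n] C1_on_linear[OF bounded_linear_eval w] C1_on_const w) (intro C_intros)+
qed

lemma cu0: "continuous_on S u0" and cv0: "continuous_on S v0"
  by (rule continuous_on_vector_derivative, rule u0_has_derivative)+

lemma ckf': "continuous_on S (\<lambda>t. kepler_force' (u0 t))"
  by (intro continuous_on_compose2[OF C1_on_continuous[OF C1_on_kepler_force'] cu0]) auto

definition pfu :: loopC where "pfu = mkC (\<lambda>t. pair_force H (u0 t))"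

lemma cpfu: "continuous_on S (\<lambda>t. pair_force H (u0 t))"
  by (intro continuous_on_compose2[OF C1_on_continuous[OF C1_on_pair_force] cu0]) (use avoids in auto)

lemma pfu_apply: "t \<in> {0..2*pi} \<Longrightarrow> apply_bcontfun pfu t = pair_force H (u0 t)"
  unfolding pfu_def by (rule mkC_eq[OF cpfu])

lemma norm_kepler_force'_u0: "norm (blinfun_apply (kepler_force' (u0 t)) y) \<le> 4 * norm y"
proof -
  have "norm (blinfun_apply (kepler_force' (u0 t)) y) \<le> norm y + \<bar>3 * (u0 t \<bullet> y)\<bar> * 1"
    unfolding kepler_force'_u0 by (rule order_trans[OF norm_triangle_ineq]) simp
  moreover have "\<bar>u0 t \<bullet> y\<bar> \<le> norm y" using Cauchy_Schwarz_ineq2[of "u0 t" y] by simp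
  ultimately show ?thesis by (simp add: abs_mult)
qed

section \<open>The linearised initial value problem\<close>

definition Mop :: "loopC \<Rightarrow>\<^sub>L loopC" where
  "Mop = Blinfun (\<lambda>z. mkC (\<lambda>t. blinfun_apply (kepler_force' (u0 t)) (apply_bcontfun z t)))"

lemma cM: "continuous_on {0..2*pi} (\<lambda>t. blinfun_apply (kepler_force' (u0 t)) (apply_bcontfun z t))"
  by (intro continuous_intros ckf') simp

lemma Mop_mkC: "blinfun_apply Mop z = mkC (\<lambda>t. blinfun_apply (kepler_force' (u0 t)) (apply_bcontfun z t))"
proof -
  have "bounded_linear (\<lambda>z. mkC (\<lambda>t. blinfun_apply (kepler_force' (u0 t)) (apply_bcontfun z t)))"
  proof (rule bounded_linear_intro[where K = 4])
    show "mkC (\<lambda>t. blinfun_apply (kepler_force' (u0 t)) (apply_bcontfun (z + z') t)) =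
      mkC (\<lambda>t. blinfun_apply (kepler_force' (u0 t)) (apply_bcontfun z t)) + mkC (\<lambda>t. blinfun_apply (kepler_force' (u0 t)) (apply_bcontfun z' t))" for z z'
      unfolding mkC_add[OF cM cM, symmetric] by (simp add: plus_bcontfun.rep_eq blinfun.add_right)
    show "mkC (\<lambda>t. blinfun_apply (kepler_force' (u0 t)) (apply_bcontfun (r *\<^sub>R z) t)) =
      r *\<^sub>R mkC (\<lambda>t. blinfun_apply (kepler_force' (u0 t)) (apply_bcontfun z t))" for r z
      unfolding mkC_scaleR[OF cM, symmetric] by (simp add: scaleR_bcontfun.rep_eq blinfun.scaleR_right)
    show "norm (mkC (\<lambda>t. blinfun_apply (kepler_force' (u0 t)) (apply_bcontfun z t))) \<le> norm z * 4" for z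
    proof (rule norm_mkC[OF cM])
      fix t
      show "norm (blinfun_apply (kepler_force' (u0 t)) (apply_bcontfun z t)) \<le> norm z * 4"
        using norm_kepler_force'_u0[of t "apply_bcontfun z t"] norm_bounded[of z t] by linarith
    qed
  qed
  then show ?thesis by (simp add: Mop_def bounded_linear_Blinfun_apply)
qed

lemma Mop_apply: "t \<in> {0..2*pi} \<Longrightarrow> apply_bcontfun (blinfun_apply Mop z) t = blinfun_apply (kepler_force' (u0 t)) (apply_bcontfun z t)"
  unfolding Mop_mkC by (rule mkC_eq[OF cM])

definition Kop :: "loopC \<Rightarrow>\<^sub>L loopC" where "Kop = IC o\<^sub>L (IC o\<^sub>L Mop)"

text \<open>The operator \<open>kepler_force' (u0 t)\<close> has norm at most \<open>1 + 3\<close>,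
  whence the factor 4. Of the two integrations the outer one is estimated by the length
  \<open>2 * pi\<close>, which leaves the single integral that \<open>volterra_summable\<close>
  expects.\<close>

lemma Kop_summable: "summable (\<lambda>n. norm (((o\<^sub>L) Kop ^^ n) id_blinfun))"
proof (rule volterra_summable[where c = "2 * pi * 4"])
  fix z :: loopC and t assume t: "t \<in> {0..2*pi}"
  define I where "I = integral {0..t} (\<lambda>s. norm (apply_bcontfun z s))"
  have nz: "(\<lambda>s. norm (apply_bcontfun z s)) integrable_on {a..b}" for a b
    by (intro integrable_continuous_interval continuous_intros) simp
  have I0: "I \<ge> 0" unfolding I_def by (rule Henstock_Kurzweil_Integration.integral_nonneg[OF nz]) simp
  have inner: "norm (apply_bcontfun (blinfun_apply IC (blinfun_apply Mop z)) s) \<le> 4 * I" if s: "s \<in> {0..t}" for s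
  proof -
    have s': "s \<in> {0..2*pi}" using s t by auto
    have "norm (integral {0..s} (apply_bcontfun (blinfun_apply Mop z))) \<le> integral {0..s} (\<lambda>r. 4 * norm (apply_bcontfun z r))"
    proof (rule Henstock_Kurzweil_Integration.integral_norm_bound_integral[OF bcontfun_integrable])
      show "(\<lambda>r. 4 * norm (apply_bcontfun z r)) integrable_on {0..s}" by (intro integrable_on_mult_right nz)
      fix r assume "r \<in> {0..s}"
      then have "r \<in> {0..2*pi}" using s' by auto
      then show "norm (apply_bcontfun (blinfun_apply Mop z) r) \<le> 4 * norm (apply_bcontfun z r)"
        by (simp add: Mop_apply norm_kepler_force'_u0 del: atLeastAtMost_iff)
    qed
    also have "\<dots> \<le> 4 * I"
      unfolding I_def using s
      by (auto intro!: integral_subset_le nz)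
    finally show ?thesis using s' by (simp add: IC_apply del: atLeastAtMost_iff)
  qed
  have "norm (apply_bcontfun (blinfun_apply Kop z) t) \<le> 4 * I * (t - 0)"
    unfolding Kop_def blinfun_apply_blinfun_compose IC_apply[OF t]
    by (rule integral_bound) (use t inner in auto)
  also have "\<dots> \<le> 4 * I * (2 * pi)" using t I0 by (intro mult_left_mono) auto
  finally show "norm (apply_bcontfun (blinfun_apply Kop z) t) \<le> 2 * pi * 4 * I" by (simp add: mult_ac)
next
  show "apply_bcontfun (blinfun_apply Kop z) t = apply_bcontfun (blinfun_apply Kop z) (clip t)" for z t
    by (simp add: Kop_def IC_mkC mkC_apply integral_bcontfun_continuous clip_id del: atLeastAtMost_iff)
qed simp

text \<open>The solution operator of the linearised initial value problem in integral form; its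
  argument encodes initial velocity and forcing.\<close>

definition Sop :: "loopC \<Rightarrow>\<^sub>L loopC" where
  "Sop = (SOME T. T o\<^sub>L (id_blinfun - Kop) = id_blinfun \<and> (id_blinfun - Kop) o\<^sub>L T = id_blinfun)"

lemma Sop: "Sop o\<^sub>L (id_blinfun - Kop) = id_blinfun" "(id_blinfun - Kop) o\<^sub>L Sop = id_blinfun"
proof -
  have "\<exists>T. T o\<^sub>L (id_blinfun - Kop) = id_blinfun \<and> (id_blinfun - Kop) o\<^sub>L T = id_blinfun"
    using neumann_inverse[OF Kop_summable] by metis
  from someI_ex[OF this] show "Sop o\<^sub>L (id_blinfun - Kop) = id_blinfun" "(id_blinfun - Kop) o\<^sub>L Sop = id_blinfun"
    unfolding Sop_def by blast+
qed

lemma Sop_fix: "blinfun_apply Sop k = k + blinfun_apply IC (blinfun_apply IC (blinfun_apply Mop (blinfun_apply Sop k)))"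
proof -
  have "blinfun_apply ((id_blinfun - Kop) o\<^sub>L Sop) k = k" by (simp add: Sop(2))
  then show ?thesis by (simp add: Kop_def minus_blinfun.rep_eq algebra_simps)
qed

lemma Sop_unique:
  assumes "z = k + blinfun_apply IC (blinfun_apply IC (blinfun_apply Mop z))"
  shows "z = blinfun_apply Sop k"
proof -
  have "k = blinfun_apply (id_blinfun - Kop) z" using assms by (simp add: Kop_def minus_blinfun.rep_eq algebra_simps)
  then have "blinfun_apply Sop k = blinfun_apply (Sop o\<^sub>L (id_blinfun - Kop)) z" by simp
  then show ?thesis by (simp add: Sop(1))
qed

text \<open>Translates a twice integrated equation back into a differential equation with initial
  position 0 and initial velocity \<open>v\<close>.\<close>

lemma double_integral_derivatives:
  assumes z: "z = lin v + blinfun_apply IC (blinfun_apply IC g)"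
  shows "\<And>t. t \<in> {0..2*pi} \<Longrightarrow> (apply_bcontfun z has_vector_derivative v + apply_bcontfun (blinfun_apply IC g) t) (at t within {0..2*pi})"
    and "\<And>t. t \<in> {0..2*pi} \<Longrightarrow> ((\<lambda>t. v + apply_bcontfun (blinfun_apply IC g) t) has_vector_derivative apply_bcontfun g t) (at t within {0..2*pi})"
    and "apply_bcontfun z 0 = 0"
proof -
  show "(apply_bcontfun z has_vector_derivative v + apply_bcontfun (blinfun_apply IC g) t) (at t within {0..2*pi})"
    if t: "t \<in> {0..2*pi}" for t
  proof (rule has_vector_derivative_transform[OF t])
    show "((\<lambda>t. t *\<^sub>R v + apply_bcontfun (blinfun_apply IC (blinfun_apply IC g)) t) has_vector_derivative
        v + apply_bcontfun (blinfun_apply IC g) t) (at t within {0..2*pi})"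
      using has_vector_derivative_add[OF has_vector_derivative_scaleR[OF DERIV_ident has_vector_derivative_const] IC_has_derivative[OF t], of v]
      by simp
  qed (simp add: z plus_bcontfun.rep_eq lin_apply)
  show "((\<lambda>t. v + apply_bcontfun (blinfun_apply IC g) t) has_vector_derivative apply_bcontfun g t) (at t within {0..2*pi})"
    if t: "t \<in> {0..2*pi}" for t
    using has_vector_derivative_add[OF has_vector_derivative_const IC_has_derivative[OF t], of v] by simp
  show "apply_bcontfun z 0 = 0" by (simp add: z plus_bcontfun.rep_eq lin_apply)
qed

lemma kjac_0: "kjac p (d, \<phi>) 0 = (- d$1) *\<^sub>R A + (\<phi> - 2 * d$2 - d$3 * sin (p$4)) *\<^sub>R B + (d$4) *\<^sub>R N"
  "kjacd p (d, \<phi>) 0 = (d$2 + d$3 * sin (p$4) - \<phi>) *\<^sub>R A + (d$1) *\<^sub>R B + (d$3 * cos (p$4)) *\<^sub>R N"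
  by (simp_all add: kjac_def kjacd_def Let_def algebra_simps)

lemma frame_expand: "x = (x \<bullet> A) *\<^sub>R A + (x \<bullet> B) *\<^sub>R B + (x \<bullet> N) *\<^sub>R N"
proof -
  have orth: "pairwise orthogonal {A, B, N}" and ne: "A \<noteq> B" "A \<noteq> N" "B \<noteq> N" "0 \<notin> {A, B, N}"
    using frame_inner by (auto simp: pairwise_def orthogonal_def)
  have ind: "independent {A, B, N}" by (rule pairwise_orthogonal_independent[OF orth ne(4)])
  have "card {A, B, N} = 3" using ne by simp
  then have "UNIV \<subseteq> span {A, B, N}"
    by (intro card_ge_dim_independent[OF _ ind]) auto
  then have "x \<in> span {A, B, N}" by blast
  then obtain a b c where "x = a *\<^sub>R A + b *\<^sub>R B + c *\<^sub>R N"
    unfolding span_insert[of A] span_insert[of B] span_singleton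
    by (auto simp: algebra_simps)
  then show ?thesis by (simp add: inner_add_left frame_inner)
qed

lemma v0_0: "v0 0 = B" "u0 0 = A" "v0 (2*pi) = B" "u0 (2*pi) = A"
  by (simp_all add: v0_def u0_def)

end

locale nondegenerate_circular = circular_symmetric +
  assumes cosq: "cos (p$4) \<noteq> 0"
    and crit: "partial_derivative 3 (Psi H) p = 0" "partial_derivative 4 (Psi H) p = 0"
    and hess: "invertible (hessian (Psi H) p)"
begin

text \<open>\<open>\<Delta>\<close> is the failure of the position to close and \<open>D\<close>
  that of the velocity. Defects that are symplectically orthogonal to the five periodic Jacobi
  fields form a line, spanned by the direction of the flow, whose position and velocity parts at
  time 0 are \<open>B\<close> and \<open>- A\<close>. The normal component of
  \<open>\<Delta>\<close> is excluded by the field of the first orientation angle, where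
  \<open>cosq\<close> enters.\<close>

lemma monodromy_defect:
  assumes "\<And>b. D \<bullet> kjac p b 0 = \<Delta> \<bullet> kjacd p b 0"
  shows "\<Delta> = (\<Delta> \<bullet> B) *\<^sub>R B \<and> D = - (\<Delta> \<bullet> B) *\<^sub>R A"
proof -
  have 1: "- (D \<bullet> A) = \<Delta> \<bullet> B" using assms[of "(axis 1 1, 0)"] by (simp add: kjac_0 axis_def)
  have 2: "- 2 * (D \<bullet> B) = \<Delta> \<bullet> A" using assms[of "(axis 2 1, 0)"] by (simp add: kjac_0 axis_def)
  have 3: "D \<bullet> B = - (\<Delta> \<bullet> A)" using assms[of "(0, 1)"] by (simp add: kjac_0)
  have 4: "D \<bullet> N = 0" using assms[of "(axis 4 1, 0)"] by (simp add: kjac_0 axis_def)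
  have 5: "- (sin (p$4) * (D \<bullet> B)) = sin (p$4) * (\<Delta> \<bullet> A) + cos (p$4) * (\<Delta> \<bullet> N)"
    using assms[of "(axis 3 1, 0)"] by (simp add: kjac_0 axis_def inner_add_right)
  have z: "D \<bullet> B = 0" "\<Delta> \<bullet> A = 0" using 2 3 by linarith+
  then have "\<Delta> \<bullet> N = 0" using 5 cosq by simp
  moreover have "D \<bullet> A = - (\<Delta> \<bullet> B)" using 1 by linarith
  ultimately show ?thesis using frame_expand[of \<Delta>] frame_expand[of D] z 4 by simp
qed

text \<open>The Jacobi field that starts at 0 with velocity \<open>B\<close>: the effect of a pure
  speed excess along the orbit.\<close>

definition yhom :: loopC where "yhom = blinfun_apply Sop (lin B)"

text \<open>Green's identity against both kinds of Jacobi field. The periodic ones see only the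
  closing defects; the secular one also measures the drift along the orbit, to which they are
  blind.\<close>

lemma variation_pairing:
  assumes z: "z = lin v + blinfun_apply IC (blinfun_apply IC g)"
    and g: "\<And>t. t \<in> {0..2*pi} \<Longrightarrow> apply_bcontfun g t = blinfun_apply (kepler_force' (u0 t)) (apply_bcontfun z t) + h t"
  shows "((\<lambda>t. h t \<bullet> kjac p b t) has_integral
     apply_bcontfun (blinfun_apply IC g) (2*pi) \<bullet> kjac p b 0 - apply_bcontfun z (2*pi) \<bullet> kjacd p b 0) {0..2*pi}"
    and "((\<lambda>t. h t \<bullet> secular t) has_integral
     (v + apply_bcontfun (blinfun_apply IC g) (2*pi)) \<bullet> (2 *\<^sub>R A - (6 * pi) *\<^sub>R B)
       - apply_bcontfun z (2*pi) \<bullet> ((6 * pi) *\<^sub>R A - B) - v \<bullet> (2 *\<^sub>R A)) {0..2*pi}"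
proof -
  note d = double_integral_derivatives[OF z]
  have pair: "apply_bcontfun g t \<bullet> k - apply_bcontfun z t \<bullet> blinfun_apply (kepler_force' (u0 t)) k = h t \<bullet> k"
    if "t \<in> {0..2*pi}" for t k
    using kepler_force'_symmetric[of "u0 t" "apply_bcontfun z t" k]
    by (simp add: g[OF that] inner_add_left inner_commute[of "apply_bcontfun z t"])
  define z1 where "z1 t = v + apply_bcontfun (blinfun_apply IC g) t" for t
  have per: "kjac p b (2*pi) = kjac p b 0" "kjacd p b (2*pi) = kjacd p b 0"
    using kjac_periodic[of b 0] by simp_all
  have "((\<lambda>t. apply_bcontfun g t \<bullet> kjac p b t - apply_bcontfun z t \<bullet> blinfun_apply (kepler_force' (u0 t)) (kjac p b t)) has_integral
    (z1 (2*pi) \<bullet> kjac p b (2*pi) - apply_bcontfun z (2*pi) \<bullet> kjacd p b (2*pi)) - (z1 0 \<bullet> kjac p b 0 - apply_bcontfun z 0 \<bullet> kjacd p b 0)) {0..2*pi}"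
    by (rule wronskian_has_integral) (use d kjac_has_derivative in \<open>auto simp: z1_def\<close>)
  then have I: "((\<lambda>t. apply_bcontfun g t \<bullet> kjac p b t - apply_bcontfun z t \<bullet> blinfun_apply (kepler_force' (u0 t)) (kjac p b t)) has_integral
    (apply_bcontfun (blinfun_apply IC g) (2*pi) \<bullet> kjac p b 0 - apply_bcontfun z (2*pi) \<bullet> kjacd p b 0)) {0..2*pi}"
    unfolding per d(3) by (simp add: z1_def inner_add_left)
  show "((\<lambda>t. h t \<bullet> kjac p b t) has_integral
     apply_bcontfun (blinfun_apply IC g) (2*pi) \<bullet> kjac p b 0 - apply_bcontfun z (2*pi) \<bullet> kjacd p b 0) {0..2*pi}"
    by (rule has_integral_eq[OF pair I])
  have "((\<lambda>t. apply_bcontfun g t \<bullet> secular t - apply_bcontfun z t \<bullet> blinfun_apply (kepler_force' (u0 t)) (secular t)) has_integral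
    (z1 (2*pi) \<bullet> secular (2*pi) - apply_bcontfun z (2*pi) \<bullet> seculard (2*pi)) - (z1 0 \<bullet> secular 0 - apply_bcontfun z 0 \<bullet> seculard 0)) {0..2*pi}"
    by (rule wronskian_has_integral) (use d secular_has_derivative in \<open>auto simp: z1_def\<close>)
  then have I: "((\<lambda>t. apply_bcontfun g t \<bullet> secular t - apply_bcontfun z t \<bullet> blinfun_apply (kepler_force' (u0 t)) (secular t)) has_integral
     (v + apply_bcontfun (blinfun_apply IC g) (2*pi)) \<bullet> (2 *\<^sub>R A - (6 * pi) *\<^sub>R B)
       - apply_bcontfun z (2*pi) \<bullet> ((6 * pi) *\<^sub>R A - B) - v \<bullet> (2 *\<^sub>R A)) {0..2*pi}"
    unfolding d(3) by (simp add: z1_def secular_def seculard_def v0_0)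
  show "((\<lambda>t. h t \<bullet> secular t) has_integral
     (v + apply_bcontfun (blinfun_apply IC g) (2*pi)) \<bullet> (2 *\<^sub>R A - (6 * pi) *\<^sub>R B)
       - apply_bcontfun z (2*pi) \<bullet> ((6 * pi) *\<^sub>R A - B) - v \<bullet> (2 *\<^sub>R A)) {0..2*pi}"
    by (rule has_integral_eq[OF pair I])
qed

lemma yhom: "yhom = lin B + blinfun_apply IC (blinfun_apply IC (blinfun_apply Mop yhom))"
  unfolding yhom_def by (rule Sop_fix)

text \<open>A speed excess \<open>s\<close> lengthens the semi-major axis by \<open>2 s\<close> and
  thus the period by \<open>6 \<pi> s\<close> to first order, so after time \<open>2\<pi>\<close>
  the body lags behind by this amount. Formally, the periodic fields show that the defect points
  along the flow and the secular field gives its size. The value is nonzero, so the speed excess can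
  compensate any drift.\<close>

lemma yhom_end: "apply_bcontfun yhom (2*pi) \<bullet> B = - 6 * pi"
proof -
  have g: "apply_bcontfun (blinfun_apply Mop yhom) t = blinfun_apply (kepler_force' (u0 t)) (apply_bcontfun yhom t) + 0"
    if "t \<in> {0..2*pi}" for t using that by (simp add: Mop_apply del: atLeastAtMost_iff)
  note vp = variation_pairing[OF yhom g]
  define \<Delta> D where "\<Delta> = apply_bcontfun yhom (2*pi)" and "D = apply_bcontfun (blinfun_apply IC (blinfun_apply Mop yhom)) (2*pi)"
  have "D \<bullet> kjac p b 0 - \<Delta> \<bullet> kjacd p b 0 = 0" for b
    using has_integral_unique[OF vp(1)[of b]] by (simp add: \<Delta>_def D_def)
  then have m: "\<Delta> = (\<Delta> \<bullet> B) *\<^sub>R B \<and> D = - (\<Delta> \<bullet> B) *\<^sub>R A" by (intro monodromy_defect) (simp add: algebra_simps)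
  define c where "c = \<Delta> \<bullet> B"
  have \<Delta>: "\<Delta> = c *\<^sub>R B" and D: "D = - c *\<^sub>R A" using m by (auto simp: c_def)
  have "(B + D) \<bullet> (2 *\<^sub>R A - (6 * pi) *\<^sub>R B) - \<Delta> \<bullet> ((6 * pi) *\<^sub>R A - B) - B \<bullet> (2 *\<^sub>R A) = 0"
    using has_integral_unique[OF vp(2)] by (simp add: \<Delta>_def D_def)
  then have "- 6 * pi - c = 0"
    unfolding \<Delta> D by (simp add: inner_add_left inner_diff_left inner_diff_right frame_inner)
  then show ?thesis by (simp add: c_def \<Delta>_def)
qed

text \<open>\<open>wpart\<close> is the response to the pair force with zero initial position and
  velocity. Since \<open>yhom\<close> ends at \<open>-6 * pi\<close> in direction \<open>B\<close>,
  the factor \<open>\<sigma>0\<close> is the speed excess that cancels the drift of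
  \<open>wpart\<close> along the orbit.\<close>

definition wpart :: loopC where "wpart = blinfun_apply Sop (blinfun_apply IC (blinfun_apply IC pfu))"
definition \<sigma>0 :: real where "\<sigma>0 = (apply_bcontfun wpart (2*pi) \<bullet> B) / (6 * pi)"
definition w0 :: loopC where "w0 = wpart + \<sigma>0 *\<^sub>R yhom"
definition h0 :: loopC where "h0 = blinfun_apply Mop w0 + pfu"

lemma h0_apply: "t \<in> {0..2*pi} \<Longrightarrow> apply_bcontfun h0 t = blinfun_apply (kepler_force' (u0 t)) (apply_bcontfun w0 t) + pair_force H (u0 t)"
  by (simp add: h0_def plus_bcontfun.rep_eq Mop_apply pfu_apply del: atLeastAtMost_iff)

lemma w0_eq: "w0 = lin (\<sigma>0 *\<^sub>R B) + blinfun_apply IC (blinfun_apply IC h0)"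
proof -
  have "lin (\<sigma>0 *\<^sub>R B) = \<sigma>0 *\<^sub>R lin B" using bounded_linear_lin by (simp add: linear_simps)
  moreover have "wpart = blinfun_apply IC (blinfun_apply IC pfu) + blinfun_apply IC (blinfun_apply IC (blinfun_apply Mop wpart))"
    unfolding wpart_def by (rule Sop_fix)
  moreover have "\<sigma>0 *\<^sub>R yhom = \<sigma>0 *\<^sub>R (lin B + blinfun_apply IC (blinfun_apply IC (blinfun_apply Mop yhom)))"
    using yhom by (rule arg_cong)
  ultimately have "wpart + \<sigma>0 *\<^sub>R yhom = blinfun_apply IC (blinfun_apply IC pfu) + blinfun_apply IC (blinfun_apply IC (blinfun_apply Mop wpart))
     + \<sigma>0 *\<^sub>R (lin B + blinfun_apply IC (blinfun_apply IC (blinfun_apply Mop yhom)))" and l: "lin (\<sigma>0 *\<^sub>R B) = \<sigma>0 *\<^sub>R lin B"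
    by metis+
  note this(1)
  also have "blinfun_apply IC (blinfun_apply IC pfu) + blinfun_apply IC (blinfun_apply IC (blinfun_apply Mop wpart))
     + \<sigma>0 *\<^sub>R (lin B + blinfun_apply IC (blinfun_apply IC (blinfun_apply Mop yhom)))
     = lin (\<sigma>0 *\<^sub>R B) + blinfun_apply IC (blinfun_apply IC h0)"
    unfolding h0_def w0_def l by (simp add: blinfun.bilinear_simps scaleR_add_right)
  finally show ?thesis unfolding w0_def[symmetric] .
qed

text \<open>Pairing with the periodic Jacobi fields gives the first variation of
  \<open>\<Psi>\<close>, which vanishes at the critical orientation. The remaining defect is a
  multiple of the flow direction, and \<open>\<sigma>0\<close> is chosen to remove it.\<close>

lemma w0_end: "apply_bcontfun w0 (2*pi) = 0" "apply_bcontfun (blinfun_apply IC h0) (2*pi) = 0"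
proof -
  define \<Delta> D where "\<Delta> = apply_bcontfun w0 (2*pi)" and "D = apply_bcontfun (blinfun_apply IC h0) (2*pi)"
  have "D \<bullet> kjac p b 0 - \<Delta> \<bullet> kjacd p b 0 = 0" for b
  proof -
    have "D \<bullet> kjac p b 0 - \<Delta> \<bullet> kjacd p b 0 = integral {0..2*pi} (\<lambda>t. pair_force H (u0 t) \<bullet> kjac p b t)"
      using variation_pairing(1)[OF w0_eq h0_apply, of b] by (simp add: \<Delta>_def D_def integral_unique)
    also have "\<dots> = J1 (p, 0) b" by (simp add: J1_def kchart_circ kD_circ)
    finally show ?thesis using J1_zero[OF crit] by simp
  qed
  then have m: "\<Delta> = (\<Delta> \<bullet> B) *\<^sub>R B \<and> D = - (\<Delta> \<bullet> B) *\<^sub>R A" by (intro monodromy_defect) (simp add: algebra_simps)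
  have "\<Delta> \<bullet> B = 0"
    by (simp add: \<Delta>_def w0_def plus_bcontfun.rep_eq scaleR_bcontfun.rep_eq inner_add_left yhom_end \<sigma>0_def)
  then show "apply_bcontfun w0 (2*pi) = 0" "apply_bcontfun (blinfun_apply IC h0) (2*pi) = 0"
    using m by (auto simp: \<Delta>_def D_def)
qed

definition x0 :: "loopC \<times> params" where "x0 = (w0, (p, (\<sigma>0, 0)))"

lemma base_dom: "(x0, 0) \<in> dom"
  using avoids by (simp add: dom_def GamW_def evc_def x0_def p_disc kchart_circ)

lemma Nmap_base: "Nmap (x0, 0) = h0"
proof -
  have "Nmap (x0, 0) = mkC (\<lambda>t. blinfun_apply (kepler_force' (u0 t)) (apply_bcontfun w0 t) + pair_force H (u0 t))"
    by (simp add: Nmap_def Gam_def evc_def x0_def kchart_circ force_quotient_0 Let_def)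
  also have "\<dots> = h0" unfolding h0_def Mop_mkC pfu_def by (rule mkC_add[OF cM cpfu])
  finally show ?thesis .
qed

lemma Fmap_base: "Fmap (x0, 0) = 0"
proof -
  have "\<sigma>0 *\<^sub>R lin B = lin (\<sigma>0 *\<^sub>R B)" using bounded_linear_lin by (simp add: linear_simps)
  then show ?thesis
    unfolding Fmap_def Nmap_base using w0_eq w0_end
    by (simp add: x0_def Let_def kvel_circ v0_0 zero_prod_def)
qed

end

lemma IC_cong:
  assumes "\<And>t. t \<in> {0..2*pi} \<Longrightarrow> apply_bcontfun g t = apply_bcontfun h t"
  shows "blinfun_apply IC g = blinfun_apply IC (h :: real \<Rightarrow>\<^sub>C 'b::euclidean_space)"
  unfolding IC_mkC
  by (intro mkC_cong Henstock_Kurzweil_Integration.integral_cong assms) auto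

context circular_symmetric
begin

lemma Nmap_apply:
  assumes "X \<in> dom" "t \<in> {0..2*pi}"
  shows "apply_bcontfun (Nmap X) t = Gam (t, evc t X)"
  unfolding Nmap_def
proof (rule mkC_eq[OF _ assms(2)])
  show "continuous_on {0..2*pi} (\<lambda>t. Gam (t, evc t X))"
    by (rule continuous_on_compose2[OF C1_on_continuous[OF C1_Gam]])
      (use assms in \<open>auto simp: dom_def intro!: continuous_intros continuous_on_evc\<close>)
qed

end

context nondegenerate_circular
begin

text \<open>The forcing that a change \<open>d\<close> of the ellipse parameters produces in the
  linearised equation at \<open>w0\<close>.\<close>

definition source :: "real^4 \<Rightarrow> real \<Rightarrow> real^3" where
  "source d t = blinfun_apply (blinfun_apply (kepler_force'' (u0 t)) (kjac p (d, 0) t)) (apply_bcontfun w0 t)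
     + blinfun_apply (pair_force' H (u0 t)) (kjac p (d, 0) t)"

text \<open>At \<open>\<epsilon> = 0\<close> the difference quotient of the force is exactly
  \<open>kepler_force'\<close> at the chart point applied to \<open>w\<close>. Along a line with
  \<open>\<epsilon> = 0\<close> the map is therefore an explicit product, and evaluation at a fixed
  time identifies its abstract derivative.\<close>

lemma Nmap_derivative:
  assumes N': "(Nmap has_derivative blinfun_apply N') (at (x0, 0))" and t: "t \<in> {0..2*pi}"
  shows "apply_bcontfun (blinfun_apply N' ((z, (d, (s, k))), 0)) t
    = blinfun_apply (kepler_force' (u0 t)) (apply_bcontfun z t) + source d t"
proof -
  define h :: "(loopC \<times> params) \<times> real" where "h = ((z, (d, (s, k))), 0)"
  have aff: "((\<lambda>r. (x0, 0) + r *\<^sub>R h) has_derivative (\<lambda>r. r *\<^sub>R h)) (at 0)" by (auto intro!: derivative_eq_intros)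
  from has_derivative_compose[OF this, of Nmap "blinfun_apply N'"] N'
  have "((\<lambda>r. Nmap ((x0, 0) + r *\<^sub>R h)) has_derivative (\<lambda>r. r *\<^sub>R blinfun_apply N' h)) (at 0)"
    by (simp add: blinfun.scaleR_right)
  from bounded_linear.has_derivative[OF bounded_linear_eval[of t] this]
  have 1: "((\<lambda>r. apply_bcontfun (Nmap ((x0, 0) + r *\<^sub>R h)) t) has_vector_derivative apply_bcontfun (blinfun_apply N' h) t) (at 0)"
    by (simp add: has_vector_derivative_def scaleR_bcontfun.rep_eq)
  define c where "c r = kchart ((p, t) + r *\<^sub>R (d, 0))" for r
  have "((\<lambda>r. (p, t) + r *\<^sub>R (d, 0 :: real)) has_derivative (\<lambda>r. r *\<^sub>R (d, 0))) (at 0)" by (auto intro!: derivative_eq_intros)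
  from has_derivative_compose[OF this, of kchart "blinfun_apply (kD (p, t))"] kD[of "(p, t)"] p_disc
  have "(c has_derivative (\<lambda>r. blinfun_apply (kD (p, t)) (r *\<^sub>R (d, 0)))) (at 0)"
    unfolding c_def by simp
  then have dc: "(c has_derivative (\<lambda>r. r *\<^sub>R kjac p (d, 0) t)) (at 0)"
    unfolding blinfun.scaleR_right kD_circ .
  have c0: "c 0 = u0 t" by (simp add: c_def kchart_circ)
  have dk: "((\<lambda>r. kepler_force' (c r)) has_vector_derivative blinfun_apply (kepler_force'' (u0 t)) (kjac p (d, 0) t)) (at 0)"
    using has_derivative_compose[OF dc, of kepler_force' "blinfun_apply (kepler_force'' (u0 t))"] kepler_force'_has_derivative[of "u0 t"]
    by (simp add: c0 has_vector_derivative_def blinfun.scaleR_right)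
  have dp: "((\<lambda>r. pair_force H (c r)) has_vector_derivative blinfun_apply (pair_force' H (u0 t)) (kjac p (d, 0) t)) (at 0)"
    using has_derivative_compose[OF dc, of "pair_force H" "blinfun_apply (pair_force' H (u0 t))"] pair_force_has_derivative[OF avoids]
    by (simp add: c0 has_vector_derivative_def blinfun.scaleR_right)
  have dw: "((\<lambda>r. apply_bcontfun w0 t + r *\<^sub>R apply_bcontfun z t) has_vector_derivative apply_bcontfun z t) (at 0)"
    by (auto intro!: derivative_eq_intros simp: has_vector_derivative_def)
  have 2: "((\<lambda>r. blinfun_apply (kepler_force' (c r)) (apply_bcontfun w0 t + r *\<^sub>R apply_bcontfun z t) + pair_force H (c r)) has_vector_derivative
      (blinfun_apply (kepler_force' (u0 t)) (apply_bcontfun z t)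
       + blinfun_apply (blinfun_apply (kepler_force'' (u0 t)) (kjac p (d, 0) t)) (apply_bcontfun w0 t))
      + blinfun_apply (pair_force' H (u0 t)) (kjac p (d, 0) t)) (at 0)"
    using has_vector_derivative_add[OF bounded_bilinear.has_vector_derivative[OF bounded_bilinear_blinfun_apply dk dw] dp]
    by (simp add: c0)
  have "open ((\<lambda>r. (x0, 0) + r *\<^sub>R h) -` dom)"
    by (intro open_vimage open_dom continuous_intros)
  moreover have "0 \<in> (\<lambda>r. (x0, 0) + r *\<^sub>R h) -` dom" using base_dom by simp
  ultimately have "((\<lambda>r. apply_bcontfun (Nmap ((x0, 0) + r *\<^sub>R h)) t) has_vector_derivative
      (blinfun_apply (kepler_force' (u0 t)) (apply_bcontfun z t)
       + blinfun_apply (blinfun_apply (kepler_force'' (u0 t)) (kjac p (d, 0) t)) (apply_bcontfun w0 t))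
      + blinfun_apply (pair_force' H (u0 t)) (kjac p (d, 0) t)) (at 0)"
  proof (rule has_vector_derivative_transform_within_open[OF 2])
    fix r assume "r \<in> (\<lambda>r. (x0, 0) + r *\<^sub>R h) -` dom"
    then have r: "(x0, 0) + r *\<^sub>R h \<in> dom" by simp
    have "p + r *\<^sub>R d \<in> disc4" using dom_disc[OF r] by (simp add: x0_def h_def)
    then have "kchart (p + r *\<^sub>R d, t) \<noteq> 0" by (rule kchart_nonzero)
    then show "blinfun_apply (kepler_force' (c r)) (apply_bcontfun w0 t + r *\<^sub>R apply_bcontfun z t) + pair_force H (c r)
      = apply_bcontfun (Nmap ((x0, 0) + r *\<^sub>R h)) t"
      unfolding Nmap_apply[OF r t]
      by (simp add: Gam_def Let_def evc_def x0_def h_def c_def force_quotient_0 plus_bcontfun.rep_eq scaleR_bcontfun.rep_eq)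
  qed
  from vector_derivative_unique_at[OF 1 this] show ?thesis by (simp add: h_def source_def)
qed

lemma source_pairing: "((\<lambda>t. source d t \<bullet> kjac p b t) has_integral J2 (p, 0) (d, 0) b) {0..2*pi}"
proof -
  note D = double_integral_derivatives[OF w0_eq]
  have "((\<lambda>t. (blinfun_apply (blinfun_apply (kepler_force'' (u0 t)) (kjac p (d, 0) t)) (apply_bcontfun w0 t)
       + blinfun_apply (pair_force' H (u0 t)) (kjac p (d, 0) t)) \<bullet> kjac p b t) has_integral J2 (p, 0) (d, 0) b) {0..2*pi}"
  proof (rule second_variation_identity[OF D(1)])
    show "((\<lambda>t. \<sigma>0 *\<^sub>R B + apply_bcontfun (blinfun_apply IC h0) t) has_vector_derivative
        blinfun_apply (kepler_force' (u0 t)) (apply_bcontfun w0 t) + pair_force H (u0 t)) (at t within {0..2*pi})"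
      if "t \<in> {0..2*pi}" for t using D(2)[OF that] h0_apply[OF that] by simp
  qed (use D(3) w0_end in auto)
  then show ?thesis by (simp add: source_def)
qed

text \<open>By \<open>bordered_inverse\<close> only the kernel has to be examined. Pairing with the
  time direction gives \<open>k = 0\<close>, pairing with the four parameter directions puts
  \<open>d\<close> into the kernel of the Hessian, and what remains is a multiple of
  \<open>yhom\<close>, which does not close up. The final clause records the derivative for a fixed
  ellipse and zero multiplier, as needed for \<open>linear_bound\<close>.\<close>

lemma bordered_derivative:
  obtains DF R where "(Fmap has_derivative blinfun_apply DF) (at (x0, 0))"
    "R o\<^sub>L (DF o\<^sub>L Blinfun (\<lambda>h. (h, 0))) = id_blinfun" "(DF o\<^sub>L Blinfun (\<lambda>h. (h, 0))) o\<^sub>L R = id_blinfun"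
    "\<And>z s. blinfun_apply DF ((z, (0, (s, 0))), 0) = (z - s *\<^sub>R lin B - blinfun_apply IC (blinfun_apply IC (blinfun_apply Mop z)),
       apply_bcontfun (blinfun_apply IC (blinfun_apply Mop z)) (2*pi), apply_bcontfun z (2*pi))"
proof -
  obtain N' where N': "(Nmap has_derivative blinfun_apply N') (at (x0, 0))"
    using C1_Nmap base_dom unfolding C1_on_def by blast
  obtain V' where V': "(kvel has_derivative blinfun_apply V') (at (p, 0))"
    using C2_on_imp_C1_on[OF C2_on_kvel] p_disc unfolding C1_on_def by blast
  obtain DF where DF: "(Fmap has_derivative blinfun_apply DF) (at (x0, 0))"
    using C1_Fmap base_dom unfolding C1_on_def by blast
  have bl: "bounded_linear (\<lambda>h :: loopC \<times> params. (h, 0 :: real))" by (intro bounded_linear_intros)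
  note ap = bounded_linear_Blinfun_apply[OF bl]
  have DF_apply: "blinfun_apply DF ((z, (d, (s, k))), 0) =
      (z - (\<sigma>0 *\<^sub>R lin (blinfun_apply V' (d, 0)) + s *\<^sub>R lin B) - blinfun_apply IC (blinfun_apply IC (blinfun_apply N' ((z, (d, (s, k))), 0))),
       apply_bcontfun (blinfun_apply IC (blinfun_apply N' ((z, (d, (s, k))), 0))) (2*pi) - k *\<^sub>R B, apply_bcontfun z (2*pi))" for z d s k
  proof -
    have q: "((\<lambda>X :: (loopC \<times> params) \<times> real. (fst (snd (fst X)), 0 :: real)) has_derivative (\<lambda>h. (fst (snd (fst h)), 0))) (at (x0, 0))"
      by (auto intro!: derivative_eq_intros)
    have v: "((\<lambda>X. kvel (fst (snd (fst X)), 0)) has_derivative (\<lambda>h. blinfun_apply V' (fst (snd (fst h)), 0))) (at (x0, 0 :: real))"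
      using has_derivative_compose[OF q, of kvel "blinfun_apply V'"] V' by (simp add: x0_def)
    have l: "((\<lambda>X. lin (kvel (fst (snd (fst X)), 0))) has_derivative (\<lambda>h. lin (blinfun_apply V' (fst (snd (fst h)), 0)))) (at (x0, 0 :: real))"
      by (rule bounded_linear.has_derivative[OF bounded_linear_lin v])
    have n1: "((\<lambda>X. blinfun_apply IC (Nmap X)) has_derivative (\<lambda>h. blinfun_apply IC (blinfun_apply N' h))) (at (x0, 0))"
      by (rule bounded_linear.has_derivative[OF blinfun.bounded_linear_right N'])
    have n2: "((\<lambda>X. blinfun_apply IC (blinfun_apply IC (Nmap X))) has_derivative (\<lambda>h. blinfun_apply IC (blinfun_apply IC (blinfun_apply N' h)))) (at (x0, 0))"
      by (rule bounded_linear.has_derivative[OF blinfun.bounded_linear_right n1])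
    have s: "((\<lambda>X :: (loopC \<times> params) \<times> real. fst (snd (snd (fst X)))) has_derivative (\<lambda>h. fst (snd (snd (fst h))))) (at (x0, 0))"
      and k: "((\<lambda>X :: (loopC \<times> params) \<times> real. snd (snd (snd (fst X)))) has_derivative (\<lambda>h. snd (snd (snd (fst h))))) (at (x0, 0))"
      and w: "((\<lambda>X :: (loopC \<times> params) \<times> real. fst (fst X)) has_derivative (\<lambda>h. fst (fst h))) (at (x0, 0))"
      by (auto intro!: derivative_eq_intros)
    have "(Fmap has_derivative (\<lambda>h. (fst (fst h) - (fst (snd (snd (fst (x0, 0 :: real)))) *\<^sub>R lin (blinfun_apply V' (fst (snd (fst h)), 0)) + fst (snd (snd (fst h))) *\<^sub>R lin (kvel (fst (snd (fst (x0, 0 :: real))), 0)))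
         - blinfun_apply IC (blinfun_apply IC (blinfun_apply N' h)),
       apply_bcontfun (blinfun_apply IC (blinfun_apply N' h)) (2*pi) - snd (snd (snd (fst h))) *\<^sub>R v0 0, apply_bcontfun (fst (fst h)) (2*pi)))) (at (x0, 0))"
      unfolding Fmap_def[abs_def] Let_def
      by (intro has_derivative_Pair has_derivative_diff has_derivative_scaleR s k w l n2 has_derivative_scaleR_left
          bounded_linear.has_derivative[OF bounded_linear_eval n1] bounded_linear.has_derivative[OF bounded_linear_eval w])
    from has_derivative_unique[OF DF this] show ?thesis by (simp add: x0_def kvel_circ v0_0)
  qed
  have N0: "blinfun_apply IC (blinfun_apply N' ((z, (0, (s, k))), 0)) = blinfun_apply IC (blinfun_apply Mop z)" for z s k
  proof (rule IC_cong)
    fix t assume t: "t \<in> {0..2*pi}"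
    have "kjac p (0, 0) t = 0" by (simp add: kjac_def)
    then have "source 0 t = 0" by (simp add: source_def blinfun.bilinear_simps)
    then show "apply_bcontfun (blinfun_apply N' ((z, (0, (s, k))), 0)) t = apply_bcontfun (blinfun_apply Mop z) t"
      using Nmap_derivative[OF N' t] by (simp add: Mop_apply[OF t])
  qed
  define L where "L = DF o\<^sub>L Blinfun (\<lambda>h. (h, 0))"
  have L_apply: "blinfun_apply L h = blinfun_apply DF (h, 0)" for h by (simp add: L_def ap)
  have lin0: "lin 0 = 0" using linear_0[OF bounded_linear.linear[OF bounded_linear_lin]] .
  have special: "blinfun_apply DF ((z, (0, (s, 0))), 0) = (z - s *\<^sub>R lin B - blinfun_apply IC (blinfun_apply IC (blinfun_apply Mop z)),
       apply_bcontfun (blinfun_apply IC (blinfun_apply Mop z)) (2*pi), apply_bcontfun z (2*pi))" for z s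
    unfolding DF_apply N0 by (simp add: blinfun.bilinear_simps zero_prod_def[symmetric] lin0)
  have blz: "bounded_linear (\<lambda>z :: loopC. (z, 0 :: params))" and blr: "bounded_linear (\<lambda>r :: params. (0 :: loopC, r))"
    by (intro bounded_linear_intros)+
  obtain R where R: "R o\<^sub>L L = id_blinfun" "L o\<^sub>L R = id_blinfun"
  proof (rule bordered_inverse[of Sop "id_blinfun - Kop" L])
    show "DIM(params) = DIM((real^3) \<times> (real^3))" by simp
    show "Sop o\<^sub>L (id_blinfun - Kop) = id_blinfun" "(id_blinfun - Kop) o\<^sub>L Sop = id_blinfun" by (rule Sop)+
    fix z :: loopC and r :: params
    have "(z, r) = (z, 0) + (0, r)" by simp
    then have "blinfun_apply L (z, r) = blinfun_apply L (z, 0) + blinfun_apply L (0, r)" by (metis blinfun.add_right)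
    moreover have "fst (blinfun_apply L (z, 0)) = blinfun_apply (id_blinfun - Kop) z"
      using special[of z 0] by (simp add: L_apply zero_prod_def Kop_def minus_blinfun.rep_eq)
    ultimately show "blinfun_apply L (z, r) =
        (blinfun_apply (id_blinfun - Kop) z + blinfun_apply (fst_blinfun o\<^sub>L (L o\<^sub>L Blinfun (\<lambda>r. (0, r)))) r,
         blinfun_apply (snd_blinfun o\<^sub>L (L o\<^sub>L Blinfun (\<lambda>z. (z, 0)))) z + blinfun_apply (snd_blinfun o\<^sub>L (L o\<^sub>L Blinfun (\<lambda>r. (0, r)))) r)"
      by (simp add: bounded_linear_Blinfun_apply[OF blz] bounded_linear_Blinfun_apply[OF blr] prod_eq_iff)
  next
    fix z :: loopC and r :: params assume zero: "blinfun_apply L (z, r) = 0"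
    obtain d s k where r: "r = (d, (s, k))" using prod_cases3 by blast
    define g where "g = blinfun_apply N' ((z, (d, (s, k))), 0)"
    define v where "v = \<sigma>0 *\<^sub>R blinfun_apply V' (d, 0) + s *\<^sub>R B"
    have eqs: "z - (\<sigma>0 *\<^sub>R lin (blinfun_apply V' (d, 0)) + s *\<^sub>R lin B) - blinfun_apply IC (blinfun_apply IC g) = 0"
      "apply_bcontfun (blinfun_apply IC g) (2*pi) = k *\<^sub>R B" "apply_bcontfun z (2*pi) = 0"
      using zero unfolding L_apply r DF_apply g_def[symmetric] by (simp_all add: zero_prod_def)
    have "\<sigma>0 *\<^sub>R lin (blinfun_apply V' (d, 0)) + s *\<^sub>R lin B = lin v"
      using bounded_linear_lin by (simp add: v_def linear_simps)
    then have z: "z = lin v + blinfun_apply IC (blinfun_apply IC g)" using eqs(1) by (simp add: algebra_simps)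
    have g: "apply_bcontfun g t = blinfun_apply (kepler_force' (u0 t)) (apply_bcontfun z t) + source d t" if "t \<in> {0..2*pi}" for t
      unfolding g_def by (rule Nmap_derivative[OF N' that])
    \<comment> \<open>The end position is 0 and the velocity defect is \<open>k *\<^sub>R B\<close>,
      so Green's identity equates this defect with the second variation in the directions
      \<open>d\<close> and \<open>b\<close>.\<close>
    have pair: "k * (B \<bullet> kjac p b 0) = J2 (p, 0) (d, 0) b" for b
      using has_integral_unique[OF variation_pairing(1)[OF z g, of b] source_pairing] by (simp add: eqs)
    have k: "k = 0"
      using pair[of "(0, 1)"] J2_time[OF goods_0, of 0 "(d, 0)"] by (simp add: kjac_0 frame_inner)
    have "J2 (p, 0) (d, 0) (axis j 1, 0) = 0" for j using pair[of "(axis j 1, 0)"] k by simp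
    then have d: "d = 0" by (rule hessian_kernel[OF hess])
    have "blinfun_apply IC g = blinfun_apply IC (blinfun_apply Mop z)" unfolding g_def d by (rule N0)
    moreover have "lin v = s *\<^sub>R lin B"
      using bounded_linear_lin by (simp add: v_def d blinfun.bilinear_simps zero_prod_def[symmetric] linear_simps)
    ultimately have "z = s *\<^sub>R lin B + blinfun_apply IC (blinfun_apply IC (blinfun_apply Mop z))" using z by simp
    then have zs: "z = s *\<^sub>R yhom" unfolding yhom_def by (metis Sop_unique blinfun.scaleR_right)
    have "s * (apply_bcontfun yhom (2*pi) \<bullet> B) = 0" using arg_cong[OF eqs(3), of "\<lambda>x. x \<bullet> B"] by (simp add: zs scaleR_bcontfun.rep_eq)
    then have "s = 0" by (simp add: yhom_end)
    then show "z = 0 \<and> r = 0" using zs k d by (simp add: r zero_prod_def)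
  qed
  show thesis using that[OF DF _ _ special] R unfolding L_def by blast
qed

text \<open>A bounded inverse yields an a priori estimate. Restricted to a fixed ellipse and zero
  multiplier, it controls correction and speed excess by the residuals of the linearised boundary
  value problem; this is the quantitative input for uniqueness.\<close>

lemma linear_bound:
  obtains C where "C > 0" "\<And>z s. norm z + \<bar>s\<bar> \<le> C * (norm (z - s *\<^sub>R lin B - blinfun_apply IC (blinfun_apply IC (blinfun_apply Mop z)))
      + norm (apply_bcontfun (blinfun_apply IC (blinfun_apply Mop z)) (2*pi)) + norm (apply_bcontfun z (2*pi)))"
proof -
  obtain DF :: "((loopC \<times> params) \<times> real) \<Rightarrow>\<^sub>L (loopC \<times> (real^3) \<times> (real^3))"
    and R :: "(loopC \<times> (real^3) \<times> (real^3)) \<Rightarrow>\<^sub>L (loopC \<times> params)" where R: "R o\<^sub>L (DF o\<^sub>L Blinfun (\<lambda>h. (h, 0))) = id_blinfun"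
    and D: "\<And>z s. blinfun_apply DF ((z, (0, (s, 0))), 0) = (z - s *\<^sub>R lin B - blinfun_apply IC (blinfun_apply IC (blinfun_apply Mop z)),
       apply_bcontfun (blinfun_apply IC (blinfun_apply Mop z)) (2*pi), apply_bcontfun z (2*pi))"
    using bordered_derivative by metis
  have bl: "bounded_linear (\<lambda>h :: loopC \<times> params. (h, 0 :: real))" by (intro bounded_linear_intros)
  note ap = bounded_linear_Blinfun_apply[OF bl]
  show thesis
  proof (rule that[of "2 * norm R + 1"])
    show "0 < 2 * norm R + 1" by (simp add: add_nonneg_pos)
    fix z s
    define a b c where "a = z - s *\<^sub>R lin B - blinfun_apply IC (blinfun_apply IC (blinfun_apply Mop z))"
      and "b = apply_bcontfun (blinfun_apply IC (blinfun_apply Mop z)) (2*pi)" and "c = apply_bcontfun z (2*pi)"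
    have "blinfun_apply R (a, b, c) = (z, (0, (s, 0)))"
      using arg_cong[OF R, of "\<lambda>T. blinfun_apply T (z, (0, (s, 0)))"] by (simp add: ap D a_def b_def c_def)
    then have n: "norm (z, (0 :: real^4, (s, 0 :: real))) \<le> norm R * norm (a, b, c)" using norm_blinfun[of R "(a, b, c)"] by simp
    have "norm z \<le> norm (z, (0 :: real^4, (s, 0 :: real)))" by (rule norm_fst_le)
    moreover have "\<bar>s\<bar> \<le> norm (z, (0 :: real^4, (s, 0 :: real)))"
      using order_trans[OF norm_fst_le[of s "0::real"] order_trans[OF norm_snd_le[of "(s, 0::real)" "0 :: real^4"] norm_snd_le[of "(0 :: real^4, (s, 0 :: real))" z]]]
      by simp
    moreover have "norm (a, b, c) \<le> norm a + norm b + norm c"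
      using norm_Pair_le[of a "(b, c)"] norm_Pair_le[of b c] by linarith
    moreover have "norm R * norm (a, b, c) \<le> norm R * (norm a + norm b + norm c)"
      using calculation by (intro mult_left_mono) auto
    ultimately have "norm z + \<bar>s\<bar> \<le> 2 * (norm R * (norm a + norm b + norm c))" using n by linarith
    also have "\<dots> \<le> (2 * norm R + 1) * (norm a + norm b + norm c)" by (simp add: algebra_simps)
    finally show "norm z + \<bar>s\<bar> \<le> (2 * norm R + 1) * (norm a + norm b + norm c)" .
  qed
qed

text \<open>The implicit function theorem, obtained by adjoining \<open>\<epsilon>\<close> to the
  values and applying the inverse function theorem. The radius \<open>r\<close> of uniqueness is the
  same for all small \<open>\<epsilon>\<close>.\<close>

lemma solution_branch:
  obtains \<epsilon>1 r X where "\<epsilon>1 > 0" "r > 0" "C1_on (ball 0 \<epsilon>1) X" "X 0 = x0"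
    "\<And>\<epsilon>. \<bar>\<epsilon>\<bar> < \<epsilon>1 \<Longrightarrow> (X \<epsilon>, \<epsilon>) \<in> dom \<and> Fmap (X \<epsilon>, \<epsilon>) = 0"
    "\<And>x \<epsilon>. \<bar>\<epsilon>\<bar> < \<epsilon>1 \<Longrightarrow> norm (x - x0) < r \<Longrightarrow> Fmap (x, \<epsilon>) = 0 \<Longrightarrow> x = X \<epsilon>"
proof -
  obtain DF :: "((loopC \<times> params) \<times> real) \<Rightarrow>\<^sub>L (loopC \<times> (real^3) \<times> (real^3))"
    and R :: "(loopC \<times> (real^3) \<times> (real^3)) \<Rightarrow>\<^sub>L (loopC \<times> params)" where DF: "(Fmap has_derivative blinfun_apply DF) (at (x0, 0))"
    and R: "R o\<^sub>L (DF o\<^sub>L Blinfun (\<lambda>h. (h, 0))) = id_blinfun" "(DF o\<^sub>L Blinfun (\<lambda>h. (h, 0))) o\<^sub>L R = id_blinfun"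
    using bordered_derivative by metis
  have bl: "bounded_linear (\<lambda>h :: loopC \<times> params. (h, 0 :: real))" by (intro bounded_linear_intros)
  note ap = bounded_linear_Blinfun_apply[OF bl]
  have R1: "blinfun_apply R (blinfun_apply DF (h, 0)) = h" for h
    using arg_cong[OF R(1), of "\<lambda>T. blinfun_apply T h"] by (simp add: ap)
  have R2: "blinfun_apply DF (blinfun_apply R k, 0) = k" for k
    using arg_cong[OF R(2), of "\<lambda>T. blinfun_apply T k"] by (simp add: ap)
  have split: "blinfun_apply DF (h, \<tau>) = blinfun_apply DF (h, 0) + blinfun_apply DF (0, \<tau>)" for h \<tau>
    using blinfun.add_right[of DF "(h, 0)" "(0, \<tau>)"] by simp
  define G where "G X = (Fmap X, snd X)" for X
  define a where "a h = (blinfun_apply DF h, snd h)" for h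
  define b where "b k = (blinfun_apply R (fst k - blinfun_apply DF (0, snd k)), snd k)" for k
  have bla: "bounded_linear a" unfolding a_def by (intro bounded_linear_Pair blinfun.bounded_linear_right bounded_linear_snd)
  have blb: "bounded_linear b" unfolding b_def
    by (intro bounded_linear_Pair bounded_linear_compose[OF blinfun.bounded_linear_right] bounded_linear_sub
        bounded_linear_fst bounded_linear_snd bounded_linear_zero)
  have ab: "a (b k) = k" for k
  proof -
    define m where "m = fst k - blinfun_apply DF (0, snd k)"
    have "blinfun_apply DF (blinfun_apply R m, snd k) = fst k"
      using split[of "blinfun_apply R m" "snd k"] R2[of m] by (simp add: m_def)
    then show ?thesis by (simp add: a_def b_def m_def[symmetric] prod_eq_iff)
  qed
  have ba: "b (a h) = h" for h
  proof -
    have "blinfun_apply DF h - blinfun_apply DF (0, snd h) = blinfun_apply DF (fst h, 0)"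
      using split[of "fst h" "snd h"] by simp
    then have "blinfun_apply R (blinfun_apply DF h - blinfun_apply DF (0, snd h)) = fst h" using R1[of "fst h"] by simp
    then show ?thesis by (simp add: a_def b_def)
  qed
  have inv: "Blinfun b o\<^sub>L Blinfun a = id_blinfun" "Blinfun a o\<^sub>L Blinfun b = id_blinfun"
    by (auto intro!: blinfun_eqI simp: bounded_linear_Blinfun_apply[OF bla] bounded_linear_Blinfun_apply[OF blb] ab ba simp del: split_paired_All)
  have C1G: "C1_on dom G" unfolding G_def by (intro C1_on_Pair C1_Fmap) (intro C_intros)
  have dG: "(G has_derivative blinfun_apply (Blinfun a)) (at (x0, 0))"
    unfolding bounded_linear_Blinfun_apply[OF bla] G_def a_def
    by (intro has_derivative_Pair DF has_derivative_snd has_derivative_ident)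
  obtain U V g where U: "open U" "U \<subseteq> dom" "(x0, 0) \<in> U" and V: "open V" "G (x0, 0) \<in> V"
    and fg: "\<And>X. X \<in> U \<Longrightarrow> G X \<in> V \<and> g (G X) = X" and gf: "\<And>Y. Y \<in> V \<Longrightarrow> g Y \<in> U \<and> G (g Y) = Y" and C1g: "C1_on V g"
    by (rule inverse_function_banach[OF open_dom base_dom C1G dG inv]) (rule that, assumption+)
  have G0: "G (x0, 0) = (0, 0)" by (simp add: G_def Fmap_base)
  define X where "X \<epsilon> = fst (g (0, \<epsilon>))" for \<epsilon>
  obtain e1 where e1: "e1 > 0" "ball (0, 0) e1 \<subseteq> V" using V G0 open_contains_ball by metis
  obtain e2 where e2: "e2 > 0" "ball (x0, 0) e2 \<subseteq> U" using U open_contains_ball by metis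
  have inV: "(0, \<epsilon>) \<in> V" if "\<bar>\<epsilon>\<bar> < e1" for \<epsilon> using that e1(2) by (auto simp: dist_Pair_Pair)
  define e where "e = min e1 (e2 / 2)"
  have sg: "snd (g (0, \<epsilon>)) = \<epsilon>" "g (0, \<epsilon>) \<in> U" "Fmap (g (0, \<epsilon>)) = 0" if "\<bar>\<epsilon>\<bar> < e1" for \<epsilon>
    using gf[OF inV[OF that]] by (auto simp: G_def)
  have Xg: "(X \<epsilon>, \<epsilon>) = g (0, \<epsilon>)" if "\<bar>\<epsilon>\<bar> < e1" for \<epsilon> using sg(1)[OF that] by (simp add: X_def prod_eq_iff)
  show thesis
  proof (rule that[of e "e2 / 2" X])
    show "e > 0" "e2 / 2 > 0" using e1 e2 by (auto simp: e_def)
    show "C1_on (ball 0 e) X"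
      unfolding X_def
      by (intro C1_on_fst C1_on_compose[OF C1g] C1_on_Pair C1_on_const C1_on_id) (use inV in \<open>auto simp: e_def\<close>)
    have "g (0, 0) = (x0, 0)" using fg[OF U(3)] G0 by simp
    then show "X 0 = x0" by (simp add: X_def)
    show "(X \<epsilon>, \<epsilon>) \<in> dom \<and> Fmap (X \<epsilon>, \<epsilon>) = 0" if "\<bar>\<epsilon>\<bar> < e" for \<epsilon>
      using that Xg[of \<epsilon>] sg[of \<epsilon>] U(2) by (auto simp: e_def)
    show "x = X \<epsilon>" if "\<bar>\<epsilon>\<bar> < e" "norm (x - x0) < e2 / 2" "Fmap (x, \<epsilon>) = 0" for x \<epsilon>
    proof -
      have "dist (x0, 0) (x, \<epsilon>) \<le> norm (x0 - x) + norm (0 - \<epsilon>)"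
        unfolding dist_norm diff_Pair by (rule norm_Pair_le)
      also have "\<dots> < e2" using that by (simp add: norm_minus_commute e_def)
      finally have "(x, \<epsilon>) \<in> U" using e2 by auto
      then have "g (G (x, \<epsilon>)) = (x, \<epsilon>)" using fg by blast
      then show ?thesis using that by (simp add: G_def X_def)
    qed
  qed
qed

end

section \<open>Periodic Sobolev loops\<close>

lemma periodic_shift:
  assumes "\<And>t. f (t + 2*pi) = f t"
  shows "f (t + of_int k * (2*pi)) = f t"
proof (induction k rule: int_induct[where k = 0])
  case (step1 i)
  then show ?case using assms[of "t + of_int i * (2*pi)"] by (simp add: algebra_simps)
next
  case (step2 i)
  then show ?case using assms[of "t + of_int (i - 1) * (2*pi)"] by (simp add: algebra_simps)
qed simp

lemma floor_period:
  fixes t :: real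
  defines "k \<equiv> \<lfloor>t / (2*pi)\<rfloor>"
  shows "of_int k * (2*pi) \<le> t" "t < of_int k * (2*pi) + 2*pi"
proof -
  have "of_int k \<le> t / (2*pi)" "t / (2*pi) < of_int k + 1" unfolding k_def by linarith+
  then show "of_int k * (2*pi) \<le> t" "t < of_int k * (2*pi) + 2*pi" by (simp_all add: field_simps)
qed

lemma periodic_reduce:
  assumes "\<And>t. f (t + 2*pi) = f t" "\<And>t. t \<in> {0..2*pi} \<Longrightarrow> Q (f t)"
  shows "Q (f t)"
proof -
  define k where "k = \<lfloor>t / (2*pi)\<rfloor>"
  have "t - of_int k * (2*pi) \<in> {0..2*pi}" using floor_period[of t] by (simp add: k_def)
  then have "Q (f (t - of_int k * (2*pi)))" by (rule assms(2))
  then show ?thesis using periodic_shift[of f "t - of_int k * (2*pi)" k] assms(1) by simp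
qed

lemma continuous_antiderivative:
  fixes g :: "real \<Rightarrow> 'b::euclidean_space"
  assumes "continuous_on UNIV g"
  obtains G where "G (0::real) = 0" "\<And>t::real. (G has_vector_derivative g t) (at t)"
proof -
  let ?G = "\<lambda>u. LBINT y=(0::real)..u. g y"
  have "(?G has_vector_derivative g t) (at t)" for t
  proof -
  define a where "a = \<bar>t\<bar> + 1"
  have "(?G has_vector_derivative g t) (at t within {-a..a})"
    by (rule interval_integral_FTC2) (auto simp: a_def intro: continuous_on_subset[OF assms])
  then have "(?G has_vector_derivative g t) (at t within {-a<..<a})"
    by (rule has_vector_derivative_within_subset) auto
  then show ?thesis
    by (subst (asm) at_within_open) (auto simp: a_def)
  qed
  then show thesis by (intro that[of ?G]) auto
qed

lemma antiderivative_integral: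
  fixes G :: "real \<Rightarrow> 'b::euclidean_space"
  assumes "\<And>t. (G has_vector_derivative g t) (at t)" "a \<le> b"
  shows "(g has_integral G b - G a) {a..b}"
  by (rule fundamental_theorem_of_calculus[OF assms(2) has_vector_derivative_at_within[OF assms(1)]])

lemma antiderivative_periodic:
  fixes G :: "real \<Rightarrow> 'b::euclidean_space"
  assumes G: "\<And>t. (G has_vector_derivative g t) (at t)" and g: "\<And>t. g (t + 2*pi) = g t"
    and mean: "(g has_integral 0) {0..2*pi}"
  shows "G (t + 2*pi) = G t"
proof -
  have "((\<lambda>t. G (t + 2*pi) - G t) has_vector_derivative 0) (at t within UNIV)" for t
  proof -
    have "((\<lambda>t. t + 2*pi) has_vector_derivative 1) (at t)" by (auto intro!: derivative_eq_intros)
    from vector_diff_chain_at[OF this G] have "((\<lambda>t. G (t + 2*pi)) has_vector_derivative g t) (at t)" by (simp add: o_def g)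
    from has_vector_derivative_diff[OF this G] show ?thesis by simp
  qed
  then obtain c where c: "\<And>t. G (t + 2*pi) - G t = c"
    using has_vector_derivative_zero_constant[OF convex_UNIV, of "\<lambda>t. G (t + 2*pi) - G t"] by (metis UNIV_I)
  have "G (2*pi) - G 0 = 0"
    using has_integral_unique[OF antiderivative_integral[OF G, of 0 "2*pi"] mean] by simp
  then have "c = 0" using c[of 0] by simp
  then show ?thesis using c[of t] by simp
qed

definition periodic_ext :: "(real \<Rightarrow> 'b) \<Rightarrow> real \<Rightarrow> 'b" where
  "periodic_ext f t = f (t - of_int \<lfloor>t / (2*pi)\<rfloor> * (2*pi))"

lemma periodic_ext_periodic: "periodic_ext f (t + 2*pi) = periodic_ext f t"
proof -
  have "\<lfloor>(t + 2*pi) / (2*pi)\<rfloor> = \<lfloor>t / (2*pi)\<rfloor> + 1" by (simp add: add_divide_distrib)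
  then show ?thesis by (simp add: periodic_ext_def algebra_simps)
qed

lemma periodic_ext_eq:
  assumes "f 0 = f (2*pi)" "t \<in> {of_int k * (2*pi)..of_int k * (2*pi) + 2*pi}"
  shows "periodic_ext f t = f (t - of_int k * (2*pi))"
proof (cases "t = of_int k * (2*pi) + 2*pi")
  case True
  then have "t / (2*pi) = of_int (k + 1)" by (simp add: field_simps)
  then have "\<lfloor>t / (2*pi)\<rfloor> = k + 1" by (simp only: floor_of_int)
  then show ?thesis using True assms(1) by (simp add: periodic_ext_def algebra_simps)
next
  case False
  then have "\<lfloor>t / (2*pi)\<rfloor> = k" using assms(2) by (intro floor_unique) (auto simp: field_simps)
  then show ?thesis by (simp add: periodic_ext_def)
qed

lemma periodic_ext_continuous:
  fixes f :: "real \<Rightarrow> 'b::topological_space"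
  assumes f: "continuous_on {0..2*pi} f" and e: "f 0 = f (2*pi)"
  shows "continuous_on UNIV (periodic_ext f)"
proof (rule continuous_at_imp_continuous_on, rule ballI)
  fix t :: real
  define k where "k = \<lfloor>t / (2*pi)\<rfloor>"
  have piece: "continuous_on {of_int j * (2*pi)..of_int j * (2*pi) + 2*pi} (periodic_ext f)" for j
  proof (rule continuous_on_eq)
    show "continuous_on {of_int j * (2*pi)..of_int j * (2*pi) + 2*pi} (\<lambda>t. f (t - of_int j * (2*pi)))"
      by (rule continuous_on_compose2[OF f]) (auto intro!: continuous_intros)
  qed (rule periodic_ext_eq[OF e, symmetric])
  define a where "a = of_int k * (2*pi)"
  have "continuous_on ({a - 2*pi..a} \<union> {a..a + 2*pi}) (periodic_ext f)"
    using piece[of "k - 1"] piece[of k] by (intro continuous_on_closed_Un) (auto simp: a_def algebra_simps)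
  then have "continuous_on {a - 2*pi<..<a + 2*pi} (periodic_ext f)"
    by (rule continuous_on_subset) auto
  moreover have "t \<in> {a - 2*pi<..<a + 2*pi}" using floor_period[of t] pi_gt_zero by (auto simp: a_def k_def)
  ultimately show "isCont (periodic_ext f) t"
    by (meson continuous_on_eq_continuous_at open_greaterThanLessThan)
qed

lemma velocity_unique: "(y has_vector_derivative y1) (at t) \<Longrightarrow> velocity y t = y1"
  by (rule vector_derivative_at)

lemma loop_has_velocity: "(loop u has_vector_derivative velocity (loop u) t) (at t)"
  using loop_differentiable vector_derivative_works by blast

lemma velocity_periodic: "velocity (loop u) (t + 2*pi) = velocity (loop u) t"
proof -
  have "((\<lambda>t. t + 2*pi) has_vector_derivative 1) (at t)" by (auto intro!: derivative_eq_intros)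
  from vector_diff_chain_at[OF this loop_has_velocity[of u]]
  have "(loop u has_vector_derivative velocity (loop u) (t + 2*pi)) (at t)" by (simp add: o_def loop_periodic)
  then show ?thesis using loop_has_velocity vector_derivative_unique_at by blast
qed

lemma H2_loop_construct:
  fixes y h :: "real \<Rightarrow> real^3"
  assumes "\<And>t. (y has_vector_derivative y1 t) (at t)" "\<And>t. y (t + 2*pi) = y t"
    and h: "continuous_on {0..2*pi} h" and "\<And>t. t \<in> {0..2*pi} \<Longrightarrow> (h has_integral (y1 t - y1 0)) {0..t}"
  shows "loop (H2_loop y) = y" "has_second_weak_derivative (loop (H2_loop y)) h"
proof -
  have v: "velocity y t = y1 t" for t using assms(1) by (rule velocity_unique)
  have w: "has_second_weak_derivative y h"
    unfolding has_second_weak_derivative_def v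
    using assms(4) h by (auto intro!: integrable_continuous_interval continuous_intros)
  have "y \<in> H2_periodic"
    unfolding H2_periodic_def using assms(1,2) w by (auto intro: differentiableI_vector)
  then show "loop (H2_loop y) = y" by (rule H2_loop_inverse)
  then show "has_second_weak_derivative (loop (H2_loop y)) h" using w by simp
qed

lemma has_second_weak_derivative_loop_add:
  "has_second_weak_derivative (loop u) g \<Longrightarrow> has_second_weak_derivative (loop v) h \<Longrightarrow>
    has_second_weak_derivative (loop (u + v)) (\<lambda>t. g t + h t)"
  using has_second_weak_derivative_add[OF loop_differentiable _ loop_differentiable, of u g v h]
  by (simp add: loop_add[abs_def])

lemma has_second_weak_derivative_loop_scaleR:
  "has_second_weak_derivative (loop u) g \<Longrightarrow> has_second_weak_derivative (loop (c *\<^sub>R u)) (\<lambda>t. c *\<^sub>R g t)"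
  using has_second_weak_derivative_scaleR[OF loop_differentiable, of u g c] by (simp add: loop_scaleR[abs_def])

lemma has_second_weak_derivative_cong:
  assumes "has_second_weak_derivative u g" "\<And>t. t \<in> {0..2*pi} \<Longrightarrow> g t = h t"
  shows "has_second_weak_derivative u h"
proof -
  have "(\<lambda>t. (norm (h t))\<^sup>2) integrable_on {0..2*pi}"
    using assms unfolding has_second_weak_derivative_def
    by (metis (no_types, lifting) integrable_eq)
  moreover have "(h has_integral (velocity u t - velocity u 0)) {0..t}" if "t \<in> {0..2*pi}" for t
    by (rule has_integral_eq[of _ g]) (use assms that in \<open>auto simp: has_second_weak_derivative_def\<close>)
  ultimately show ?thesis by (simp add: has_second_weak_derivative_def)
qed

lemma velocity_eq_integral:
  assumes "has_second_weak_derivative (loop u) h" "t \<in> {0..2*pi}"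
  shows "(h has_integral velocity (loop u) t - velocity (loop u) 0) {0..t}"
  using assms by (auto simp: has_second_weak_derivative_def)

text \<open>The difference of the two loops has constant velocity, and periodicity forces that
  constant to be 0.\<close>

lemma loop_eq_of_second_weak_derivative:
  assumes "has_second_weak_derivative (loop u) g" "has_second_weak_derivative (loop v) g" "loop u 0 = loop v 0"
  shows "u = v"
proof -
  define d where "d = u + (-1) *\<^sub>R v"
  have "has_second_weak_derivative (loop d) (\<lambda>t. g t + (-1) *\<^sub>R g t)"
    unfolding d_def by (intro has_second_weak_derivative_loop_add has_second_weak_derivative_loop_scaleR assms)
  then have Z: "has_second_weak_derivative (loop d) (\<lambda>t. 0)" by simp
  have c: "velocity (loop d) t = velocity (loop d) 0" if "t \<in> {0..2*pi}" for t
    using has_integral_unique[OF velocity_eq_integral[OF Z that] has_integral_0] by simp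
  define c0 where "c0 = velocity (loop d) 0"
  have d0: "loop d 0 = 0" unfolding d_def loop_add loop_scaleR using assms(3) by simp
  have lin: "loop d t = t *\<^sub>R c0" if t: "t \<in> {0..2*pi}" for t
  proof -
    have 1: "(velocity (loop d) has_integral loop d t - loop d 0) {0..t}"
      by (rule antiderivative_integral[OF loop_has_velocity]) (use t in auto)
    have "((\<lambda>_. c0) has_integral t *\<^sub>R c0) {0..t}" using has_integral_const_real[of c0 0 t] t by simp
    then have 2: "(velocity (loop d) has_integral t *\<^sub>R c0) {0..t}"
    proof (rule has_integral_eq[rotated])
      show "c0 = velocity (loop d) s" if "s \<in> {0..t}" for s unfolding c0_def by (rule c[symmetric]) (use that t in auto)
    qed
    show ?thesis using has_integral_unique[OF 1 2] d0 by simp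
  qed
  have "loop d (2*pi) = loop d 0" using loop_periodic[of d 0] by simp
  then have "c0 = 0" using lin[of "2*pi"] d0 by simp
  then have "loop d t = 0" if "t \<in> {0..2*pi}" for t using lin[OF that] by simp
  then have "loop d t = 0" for t by (rule periodic_reduce[of "loop d" "\<lambda>x. x = 0", OF loop_periodic])
  then have "loop u t + (-1) *\<^sub>R loop v t = 0" for t by (simp only: d_def loop_add loop_scaleR)
  then have "loop u t = loop v t" for t by simp
  then show ?thesis by (rule H2_loop_eqI)
qed

text \<open>Weak second derivatives agree outside a null set, so the norm may be computed from any
  representative, in particular from a continuous one.\<close>

lemma norm_loop_sq:
  assumes "has_second_weak_derivative (loop u) h"
  shows "(norm u)\<^sup>2 = integral {0..2*pi} (\<lambda>t. (norm (loop u t))\<^sup>2) + integral {0..2*pi} (\<lambda>t. (norm (velocity (loop u) t))\<^sup>2)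
     + integral {0..2*pi} (\<lambda>t. (norm (h t))\<^sup>2)"
proof -
  obtain Z where Z: "negligible Z" "\<And>t. t \<in> {0..2*pi} - Z \<Longrightarrow> h t = second_weak_derivative (loop u) t"
    using has_second_weak_derivative_unique[OF assms second_weak_derivative_loop] by blast
  have "integral {0..2*pi} (\<lambda>t. (norm (h t))\<^sup>2) =
      integral {0..2*pi} (\<lambda>t. second_weak_derivative (loop u) t \<bullet> second_weak_derivative (loop u) t)"
    by (rule integral_spike[OF Z(1)]) (simp add: Z(2) power2_norm_eq_inner)
  then show ?thesis
    by (simp add: power2_norm_eq_inner inner_H2_loop_def)
qed

text \<open>The values of \<open>x\<close> differ from \<open>x 0\<close> by at most
  \<open>k\<close>, and averaging \<open>k + norm (x s)\<close> over the period bounds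
  \<open>x 0\<close> by \<open>2 * k\<close>, as the period is at least 1.\<close>

lemma sup_bound_of_integrals:
  fixes x g :: "real \<Rightarrow> real^3"
  assumes x: "\<And>t. t \<in> {0..2*pi} \<Longrightarrow> (g has_integral x t - x 0) {0..t}"
    and g: "g absolutely_integrable_on {0..2*pi}" and cx: "continuous_on {0..2*pi} x"
    and k: "integral {0..2*pi} (\<lambda>t. norm (g t)) \<le> k" "integral {0..2*pi} (\<lambda>t. norm (x t)) \<le> k"
    and t: "t \<in> {0..2*pi}"
  shows "norm (x t) \<le> 3 * k"
proof -
  have ng: "(\<lambda>t. norm (g t)) integrable_on {0..2*pi}" using g by (rule absolutely_integrable_on_def[THEN iffD1, THEN conjunct2])
  have d: "norm (x s - x 0) \<le> k" if s: "s \<in> {0..2*pi}" for s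
  proof -
    have sub: "{0..s} \<subseteq> {0..2*pi}" using s by auto
    have "norm (x s - x 0) \<le> integral {0..s} (\<lambda>t. norm (g t))"
      unfolding integral_unique[OF x[OF s], symmetric]
      by (rule Henstock_Kurzweil_Integration.integral_norm_bound_integral[OF has_integral_integrable[OF x[OF s]] integrable_on_subinterval[OF ng sub]]) simp
    also have "\<dots> \<le> integral {0..2*pi} (\<lambda>t. norm (g t))"
      by (rule integral_subset_le[OF sub integrable_on_subinterval[OF ng sub] ng]) simp
    finally show ?thesis using k by simp
  qed
  have k0: "k \<ge> 0" using d[of 0] by simp
  have "norm (x 0) * (2*pi) \<le> k * (2*pi) + k"
  proof -
    have "((\<lambda>s. norm (x 0)) has_integral (2*pi - 0) *\<^sub>R norm (x 0)) {0..2*pi}"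
      using has_integral_const_real[of "norm (x 0)" 0 "2*pi"] by simp
    then have "norm (x 0) * (2*pi) = integral {0..2*pi} (\<lambda>s. norm (x 0))" by (simp add: integral_unique mult.commute)
    also have "\<dots> \<le> integral {0..2*pi} (\<lambda>s. k + norm (x s))"
    proof (rule integral_le)
      show "(\<lambda>s. k + norm (x s)) integrable_on {0..2*pi}" by (intro integrable_continuous_interval continuous_intros cx)
      show "norm (x 0) \<le> k + norm (x s)" if "s \<in> {0..2*pi}" for s
        using d[OF that] norm_triangle_sub[of "x 0" "x s"] by (simp add: norm_minus_commute)
    qed auto
    also have "\<dots> = k * (2*pi) + integral {0..2*pi} (\<lambda>t. norm (x t))"
      by (subst Henstock_Kurzweil_Integration.integral_add)
        (auto intro!: integrable_continuous_interval continuous_intros cx)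
    finally show ?thesis using k by simp
  qed
  moreover have "k * 1 \<le> k * (2*pi)" using k0 pi_gt3 by (intro mult_left_mono) auto
  ultimately have "norm (x 0) * (2*pi) \<le> (2 * k) * (2*pi)" unfolding mult.assoc[of 2 k] by linarith
  then have "norm (x 0) \<le> 2 * k" by simp
  then show ?thesis using d[OF t] norm_triangle_sub[of "x t" "x 0"] by simp
qed

text \<open>The weighted inequality of arithmetic and geometric mean,
  \<open>norm g \<le> n/2 + (norm g)^2 / (2*n)\<close>, is integrated over the period. This gives
  \<open>pi * n + n/2\<close>, and \<open>pi < 4\<close>.\<close>

lemma L1_le_L2:
  fixes g :: "real \<Rightarrow> real^3"
  assumes n: "n > 0" and g2: "(\<lambda>t. (norm (g t))\<^sup>2) integrable_on {0..2*pi}" and g1: "(\<lambda>t. norm (g t)) integrable_on {0..2*pi}"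
    and le: "integral {0..2*pi} (\<lambda>t. (norm (g t))\<^sup>2) \<le> n\<^sup>2"
  shows "integral {0..2*pi} (\<lambda>t. norm (g t)) \<le> 5 * n"
proof -
  have "integral {0..2*pi} (\<lambda>t. norm (g t)) \<le> integral {0..2*pi} (\<lambda>t. n / 2 + (1 / (2 * n)) * (norm (g t))\<^sup>2)"
  proof (rule integral_le[OF g1])
    show "(\<lambda>t. n / 2 + (1 / (2 * n)) * (norm (g t))\<^sup>2) integrable_on {0..2*pi}"
      by (intro integrable_add integrable_const_ivl integrable_on_mult_right g2)
    fix t
    have "2 * (norm (g t) * n) \<le> n * n + (norm (g t))\<^sup>2"
      using zero_le_power2[of "norm (g t) - n"] by (simp add: power2_eq_square algebra_simps)
    then show "norm (g t) \<le> n / 2 + (1 / (2 * n)) * (norm (g t))\<^sup>2" using n by (simp add: field_simps)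
  qed
  also have "\<dots> = integral {0..2*pi} (\<lambda>t. n / 2) + (1 / (2 * n)) * integral {0..2*pi} (\<lambda>t. (norm (g t))\<^sup>2)"
    by (subst Henstock_Kurzweil_Integration.integral_add) (use integrable_on_mult_right[OF g2, of "1 / (2 * n)"] in \<open>auto simp del: times_divide_eq_left\<close>)
  also have "\<dots> \<le> pi * n + (1 / (2 * n)) * n\<^sup>2" using le n by (intro add_mono mult_left_mono) auto
  also have "\<dots> = pi * n + n / 2" using n by (simp add: power2_eq_square)
  also have "\<dots> \<le> 5 * n" using n mult_right_mono[OF less_imp_le[OF pi_less_4] less_imp_le[OF n]] by linarith
  finally show ?thesis .
qed

text \<open>The constant is the product of 3 from \<open>sup_bound_of_integrals\<close> and 5 from
  \<open>L1_le_L2\<close>. The velocity is estimated through the weak second derivative and the loop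
  through its velocity.\<close>

lemma sobolev:
  "norm (loop u t) \<le> 15 * norm u" "norm (velocity (loop u) t) \<le> 15 * norm u"
proof -
  have "norm (loop u t) \<le> 15 * norm u \<and> norm (velocity (loop u) t) \<le> 15 * norm u"
  proof (cases "u = 0")
    case True
    have "loop u = (\<lambda>_. 0)" by (rule ext) (simp add: True loop_zero)
    then show ?thesis using True by (simp add: vector_derivative_const_at)
  next
    case False
    then have n: "norm u > 0" by simp
    define w where "w = second_weak_derivative (loop u)"
    have w: "has_second_weak_derivative (loop u) w" unfolding w_def by (rule second_weak_derivative_loop)
    have wi: "w absolutely_integrable_on {0..2*pi}" by (rule second_weak_derivative_absolutely_integrable[OF w])
    have cl: "continuous_on {0..2*pi} (loop u)" by (rule loop_continuous_on)
    have cv: "continuous_on {0..2*pi} (velocity (loop u))" by (rule velocity_continuous_on[OF w])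
    have i: "(\<lambda>t. (norm (loop u t))\<^sup>2) integrable_on {0..2*pi}" "(\<lambda>t. (norm (velocity (loop u) t))\<^sup>2) integrable_on {0..2*pi}"
      "(\<lambda>t. (norm (w t))\<^sup>2) integrable_on {0..2*pi}"
      using w by (auto intro!: integrable_continuous_interval continuous_intros cl cv simp: has_second_weak_derivative_def)
    have nn: "0 \<le> integral {0..2*pi} (\<lambda>t. (norm (loop u t))\<^sup>2)" "0 \<le> integral {0..2*pi} (\<lambda>t. (norm (velocity (loop u) t))\<^sup>2)"
      "0 \<le> integral {0..2*pi} (\<lambda>t. (norm (w t))\<^sup>2)"
      by (auto intro!: Henstock_Kurzweil_Integration.integral_nonneg i)
    have le: "integral {0..2*pi} (\<lambda>t. (norm (loop u t))\<^sup>2) \<le> (norm u)\<^sup>2" "integral {0..2*pi} (\<lambda>t. (norm (velocity (loop u) t))\<^sup>2) \<le> (norm u)\<^sup>2"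
      "integral {0..2*pi} (\<lambda>t. (norm (w t))\<^sup>2) \<le> (norm u)\<^sup>2"
      using norm_loop_sq[OF w] nn by linarith+
    have i1: "(\<lambda>t. norm (loop u t)) integrable_on {0..2*pi}" "(\<lambda>t. norm (velocity (loop u) t)) integrable_on {0..2*pi}"
      by (auto intro!: integrable_continuous_interval continuous_intros cl cv)
    have i2: "(\<lambda>t. norm (w t)) integrable_on {0..2*pi}" using wi by (rule absolutely_integrable_on_def[THEN iffD1, THEN conjunct2])
    note L = L1_le_L2[OF n i(1) i1(1) le(1)] L1_le_L2[OF n i(2) i1(2) le(2)] L1_le_L2[OF n i(3) i2 le(3)]
    have "norm (velocity (loop u) t) \<le> 3 * (5 * norm u)" if "t \<in> {0..2*pi}" for t
      by (rule sup_bound_of_integrals[OF velocity_eq_integral[OF w] wi cv L(3) L(2) that])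
    then have 1: "norm (velocity (loop u) t) \<le> 3 * (5 * norm u)"
      using periodic_reduce[of "velocity (loop u)" "\<lambda>x. norm x \<le> 3 * (5 * norm u)"] velocity_periodic by blast
    have "norm (loop u t) \<le> 3 * (5 * norm u)" if "t \<in> {0..2*pi}" for t
      by (rule sup_bound_of_integrals[OF antiderivative_integral[OF loop_has_velocity] absolutely_integrable_continuous_real[OF cv] cl L(2) L(1) that]) simp
    then have 2: "norm (loop u t) \<le> 3 * (5 * norm u)"
      using periodic_reduce[of "loop u" "\<lambda>x. norm x \<le> 3 * (5 * norm u)"] loop_periodic by blast
    show ?thesis using 1 2 by simp
  qed
  then show "norm (loop u t) \<le> 15 * norm u" "norm (velocity (loop u) t) \<le> 15 * norm u" by auto
qed

section \<open>The periodic problem with prescribed second derivative\<close>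

definition mean :: "(real \<Rightarrow>\<^sub>C (real^3)) \<Rightarrow> real^3" where
  "mean h = (1 / (2*pi)) *\<^sub>R integral {0..2*pi} (apply_bcontfun h)"

lemma loop_solution_ex:
  "\<exists>u. loop u 0 = a \<and> has_second_weak_derivative (loop u) (\<lambda>t. apply_bcontfun h t - mean h)"
proof -
  define g where "g t = apply_bcontfun h t - mean h" for t
  have cg: "continuous_on S g" for S unfolding g_def by (intro continuous_intros) simp
  define P where "P t = integral {0..t} g" for t
  have cP: "continuous_on {0..2*pi} P"
    unfolding P_def by (rule indefinite_integral_continuous_1[OF integrable_continuous_interval[OF cg]])
  have P2: "P (2*pi) = 0"
  proof -
    have "P (2*pi) = integral {0..2*pi} (apply_bcontfun h) - integral {0..2*pi} (\<lambda>t. mean h)"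
      unfolding P_def g_def by (rule Henstock_Kurzweil_Integration.integral_diff[OF bcontfun_integrable]) auto
    also have "integral {0..2*pi} (\<lambda>t. mean h) = (2*pi) *\<^sub>R mean h"
      using integral_unique[OF has_integral_const_real[of "mean h" 0 "2*pi"]] by simp
    finally show ?thesis by (simp add: mean_def)
  qed
  have P0: "P 0 = 0" by (simp add: P_def)
  define m where "m = (1 / (2*pi)) *\<^sub>R integral {0..2*pi} P"
  define v where "v t = periodic_ext P t - m" for t
  have pe: "periodic_ext P t = P t" if "t \<in> {0..2*pi}" for t
    using periodic_ext_eq[of P t 0] that P0 P2 by simp
  have cv: "continuous_on UNIV v"
    unfolding v_def by (intro continuous_intros periodic_ext_continuous cP) (simp add: P0 P2)
  obtain Y where Y: "Y 0 = 0" "\<And>t. (Y has_vector_derivative v t) (at t)" using continuous_antiderivative[OF cv] by blast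
  have "(v has_integral 0) {0..2*pi}"
  proof -
    have "((\<lambda>t. P t - m) has_integral integral {0..2*pi} P - (2*pi - 0) *\<^sub>R m) {0..2*pi}"
      using has_integral_const_real[of m 0 "2*pi"]
      by (intro has_integral_diff integrable_integral integrable_continuous_interval cP) simp
    then have "((\<lambda>t. P t - m) has_integral 0) {0..2*pi}" by (simp add: m_def)
    then show ?thesis by (rule has_integral_eq[rotated]) (simp add: v_def pe)
  qed
  from antiderivative_periodic[OF Y(2) _ this] have Yp: "Y (t + 2*pi) = Y t" for t
    by (simp add: v_def periodic_ext_periodic)
  have 1: "((\<lambda>t. a + Y t) has_vector_derivative v t) (at t)" for t
    using has_vector_derivative_add[OF has_vector_derivative_const Y(2)] by simp
  have 3: "(g has_integral v t - v 0) {0..t}" if "t \<in> {0..2*pi}" for t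
  proof -
    have "v t - v 0 = integral {0..t} g" using that by (simp add: v_def pe P0) (simp add: P_def)
    then show ?thesis using integrable_integral[OF integrable_continuous_interval[OF cg]] by metis
  qed
  note L = H2_loop_construct[of "\<lambda>t. a + Y t", OF 1 _ cg 3]
  show ?thesis
    using L Yp Y(1) unfolding g_def by (intro exI[of _ "H2_loop (\<lambda>t. a + Y t)"]) auto
qed

text \<open>A periodic loop has a second derivative of mean 0. Subtracting the mean makes the
  problem solvable for every right side, so that the solution operator is defined and linear on the
  whole space; the prescribed initial position fixes the additive constant.\<close>

definition periodic_solution :: "(real \<Rightarrow>\<^sub>C (real^3)) \<times> (real^3) \<Rightarrow> H2_loop" where
  "periodic_solution p = (SOME u. loop u 0 = snd p \<and> has_second_weak_derivative (loop u) (\<lambda>t. apply_bcontfun (fst p) t - mean (fst p)))"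

lemma periodic_solution: "loop (periodic_solution (h, a)) 0 = a"
  "has_second_weak_derivative (loop (periodic_solution (h, a))) (\<lambda>t. apply_bcontfun h t - mean h)"
  using someI_ex[OF loop_solution_ex, of a h] by (simp_all add: periodic_solution_def)

lemma norm_mean: "norm (mean h) \<le> norm h"
proof -
  have "norm (integral {0..2*pi} (apply_bcontfun h)) \<le> norm h * (2*pi - 0)"
    by (rule integral_bound) (auto simp: norm_bounded)
  then show ?thesis by (simp add: mean_def field_simps)
qed

lemma mean_add: "mean (h + k) = mean h + mean k" and mean_scaleR: "mean (r *\<^sub>R h) = r *\<^sub>R mean h"
  by (simp_all add: mean_def plus_bcontfun.rep_eq scaleR_bcontfun.rep_eq scaleR_add_right
      Henstock_Kurzweil_Integration.integral_add bcontfun_integrable)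

text \<open>The velocity of a closed loop has mean 0, so its value at 0 is minus the average of its
  deviations from that value.\<close>

lemma velocity_zero_somewhere_bound:
  assumes "\<And>t. t \<in> {0..2*pi} \<Longrightarrow> norm (velocity (loop u) t - velocity (loop u) 0) \<le> M"
  shows "norm (velocity (loop u) 0) \<le> M"
proof -
  have "(velocity (loop u) has_integral loop u (2*pi) - loop u 0) {0..2*pi}"
    by (rule antiderivative_integral[OF loop_has_velocity]) simp
  then have "(velocity (loop u) has_integral 0) {0..2*pi}" using loop_periodic[of u 0] by simp
  from has_integral_diff[OF this has_integral_const_real[of "velocity (loop u) 0" 0 "2*pi"]]
  have I: "((\<lambda>t. velocity (loop u) t - velocity (loop u) 0) has_integral - ((2*pi) *\<^sub>R velocity (loop u) 0)) {0..2*pi}" by simp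
  have "norm (- ((2*pi) *\<^sub>R velocity (loop u) 0)) \<le> M * (2*pi - 0)"
    using has_integral_bound_real[OF _ finite.emptyI I, of M] assms order_trans[OF norm_ge_zero assms[of 0]] by simp
  then show ?thesis by simp
qed

lemma bounded_linear_periodic_solution: "bounded_linear periodic_solution"
proof (rule bounded_linear_intro)
  fix x y :: "(real \<Rightarrow>\<^sub>C (real^3)) \<times> (real^3)" and r :: real
  obtain h a k b where xy: "x = (h, a)" "y = (k, b)" by fastforce
  show "periodic_solution (x + y) = periodic_solution x + periodic_solution y"
  proof (rule loop_eq_of_second_weak_derivative)
    show "has_second_weak_derivative (loop (periodic_solution (x + y))) (\<lambda>t. (apply_bcontfun h t - mean h) + (apply_bcontfun k t - mean k))"
      using periodic_solution(2)[of "h + k" "a + b"]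
      by (simp add: xy plus_bcontfun.rep_eq mean_add algebra_simps)
    show "has_second_weak_derivative (loop (periodic_solution x + periodic_solution y)) (\<lambda>t. (apply_bcontfun h t - mean h) + (apply_bcontfun k t - mean k))"
      unfolding xy by (intro has_second_weak_derivative_loop_add periodic_solution)
  qed (simp add: xy periodic_solution loop_add)
  show "periodic_solution (r *\<^sub>R x) = r *\<^sub>R periodic_solution x"
  proof (rule loop_eq_of_second_weak_derivative)
    show "has_second_weak_derivative (loop (periodic_solution (r *\<^sub>R x))) (\<lambda>t. r *\<^sub>R (apply_bcontfun h t - mean h))"
      using periodic_solution(2)[of "r *\<^sub>R h" "r *\<^sub>R a"]
      by (simp add: xy scaleR_bcontfun.rep_eq mean_scaleR algebra_simps)
    show "has_second_weak_derivative (loop (r *\<^sub>R periodic_solution x)) (\<lambda>t. r *\<^sub>R (apply_bcontfun h t - mean h))"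
      unfolding xy by (intro has_second_weak_derivative_loop_scaleR periodic_solution)
  qed (simp add: xy periodic_solution loop_scaleR)
  \<comment> \<open>It dominates the constants of three supremum bounds: 2 for the second
    derivative, \<open>8 * pi\<close> for the velocity and \<open>16 * pi * pi + 1\<close> for the
    loop. The three integrals together cost a factor \<open>6 * pi\<close>, which is at most
    36.\<close>
  define K where "K = 16 * pi * pi + 8 * pi + 3"
  define N where "N = norm h + norm a"
  define u where "u = periodic_solution (h, a)"
  have N0: "N \<ge> 0" by (simp add: N_def)
  have K: "2 \<le> K" "8 * pi \<le> K" "16 * pi * pi + 1 \<le> K" using pi_gt_zero by (auto simp: K_def)
  define g where "g t = apply_bcontfun h t - mean h" for t
  have wg: "has_second_weak_derivative (loop u) g" unfolding u_def g_def by (rule periodic_solution)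
  have gb: "norm (g t) \<le> 2 * norm h" for t
    unfolding g_def using norm_triangle_ineq4[of "apply_bcontfun h t" "mean h"] norm_bounded[of h t] norm_mean[of h] by linarith
  have vd: "norm (velocity (loop u) t - velocity (loop u) 0) \<le> 4 * pi * norm h" if t: "t \<in> {0..2*pi}" for t
  proof -
    have "norm (velocity (loop u) t - velocity (loop u) 0) \<le> (2 * norm h) * (t - 0)"
      using has_integral_bound_real[OF _ finite.emptyI velocity_eq_integral[OF wg t], of "2 * norm h"] gb t by simp
    also have "\<dots> \<le> (2 * norm h) * (2*pi)" using t by (intro mult_left_mono) auto
    finally show ?thesis by (simp add: mult_ac)
  qed
  have v: "norm (velocity (loop u) t) \<le> 8 * pi * norm h" if t: "t \<in> {0..2*pi}" for t
    using vd[OF t] velocity_zero_somewhere_bound[OF vd] norm_triangle_sub[of "velocity (loop u) t" "velocity (loop u) 0"] by simp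
  have l: "norm (loop u t) \<le> norm a + 16 * pi * pi * norm h" if t: "t \<in> {0..2*pi}" for t
  proof -
    have "norm (loop u t - loop u 0) \<le> (8 * pi * norm h) * (t - 0)"
      using has_integral_bound_real[OF _ finite.emptyI antiderivative_integral[OF loop_has_velocity[of u], of 0 t], of "8 * pi * norm h"] v t by auto
    also have "\<dots> \<le> (8 * pi * norm h) * (2*pi)" using t by (intro mult_left_mono) auto
    finally show ?thesis using norm_triangle_sub[of "loop u t" "loop u 0"] by (simp add: u_def periodic_solution mult_ac)
  qed
  have cl: "continuous_on {0..2*pi} (loop u)" by (rule loop_continuous_on)
  have cv: "continuous_on {0..2*pi} (velocity (loop u))" by (rule velocity_continuous_on[OF wg])
  have cg: "continuous_on {0..2*pi} g" unfolding g_def by (intro continuous_intros) simp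
  have bound: "integral {0..2*pi} (\<lambda>t. (norm (f t))\<^sup>2) \<le> (K * N)\<^sup>2 * (2*pi)"
    if f: "continuous_on {0..2*pi} f" "\<And>t. t \<in> {0..2*pi} \<Longrightarrow> norm (f t) \<le> K * N" for f :: "real \<Rightarrow> real^3"
  proof -
    have "integral {0..2*pi} (\<lambda>t. (norm (f t))\<^sup>2) \<le> integral {0..2*pi} (\<lambda>t. (K * N)\<^sup>2)"
      using f by (intro integral_le integrable_continuous_interval continuous_intros power_mono) auto
    also have "\<dots> = (K * N)\<^sup>2 * (2*pi)" by simp
    finally show ?thesis .
  qed
  have "norm (g t) \<le> K * N" for t
    using gb[of t] mult_mono[OF K(1), of "norm h" N] N0 K by (auto simp: N_def)
  moreover have "norm (velocity (loop u) t) \<le> K * N" if "t \<in> {0..2*pi}" for t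
    using v[OF that] mult_mono[OF K(2), of "norm h" N] N0 K by (auto simp: N_def)
  moreover have "norm (loop u t) \<le> K * N" if "t \<in> {0..2*pi}" for t
  proof -
    have "norm a + 16 * pi * pi * norm h \<le> (16 * pi * pi + 1) * N" by (simp add: N_def algebra_simps)
    also have "\<dots> \<le> K * N" using K N0 by (intro mult_right_mono)
    finally show ?thesis using l[OF that] by simp
  qed
  ultimately have "(norm u)\<^sup>2 \<le> 3 * ((K * N)\<^sup>2 * (2*pi))"
    unfolding norm_loop_sq[OF wg] using bound[OF cl] bound[OF cv] bound[OF cg] by simp
  also have "\<dots> \<le> (K * N * 6)\<^sup>2"
    using mult_left_mono[of "6 * pi" 36 "(K * N)\<^sup>2"] pi_less_4 by (simp add: power_mult_distrib)
  finally have "norm u \<le> K * N * 6" by (rule power2_le_imp_le) (use K(1) N0 in \<open>intro mult_nonneg_nonneg, auto\<close>)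
  also have "\<dots> \<le> (K * 6) * (2 * norm x)"
  proof -
    have "N \<le> 2 * norm x" using norm_fst_le[of h a] norm_snd_le[of a h] by (simp add: N_def xy)
    from mult_left_mono[OF this, of "K * 6"] show ?thesis using K(1) by (simp add: mult_ac)
  qed
  finally show "norm (periodic_solution x) \<le> norm x * (12 * K)" by (simp add: u_def xy mult_ac)
qed

section \<open>Critical points are classical solutions\<close>

definition potential :: "(real^3^3) set \<Rightarrow> real \<Rightarrow> real^3 \<Rightarrow> real" where
  "potential H e x = 1 / norm x + e * pair_potential H x"

definition force :: "(real^3^3) set \<Rightarrow> real \<Rightarrow> real^3 \<Rightarrow> real^3" where
  "force H e x = kepler_force x + e *\<^sub>R pair_force H x"

definition velocity_form :: "H2_loop \<Rightarrow> H2_loop \<Rightarrow> real" where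
  "velocity_form u v = integral {0..2*pi} (\<lambda>t. velocity (loop u) t \<bullet> velocity (loop v) t)"

lemma continuous_on_velocity: "continuous_on {0..2*pi} (velocity (loop u))"
  by (rule velocity_continuous_on[OF second_weak_derivative_loop])

lemma bounded_bilinear_velocity_form: "bounded_bilinear velocity_form"
proof
  fix u v w :: H2_loop and r :: real
  show "velocity_form (u + v) w = velocity_form u w + velocity_form v w"
    unfolding velocity_form_def velocity_loop_add inner_add_left
    by (rule Henstock_Kurzweil_Integration.integral_add) (rule integrable_velocity)+
  show "velocity_form u (v + w) = velocity_form u v + velocity_form u w"
    unfolding velocity_form_def velocity_loop_add inner_add_right
    by (rule Henstock_Kurzweil_Integration.integral_add) (rule integrable_velocity)+
  show "velocity_form (r *\<^sub>R u) v = r *\<^sub>R velocity_form u v"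
    unfolding velocity_form_def velocity_loop_scaleR by simp
  show "velocity_form u (r *\<^sub>R v) = r *\<^sub>R velocity_form u v"
    unfolding velocity_form_def velocity_loop_scaleR by simp
  show "\<exists>K. \<forall>a b. norm (velocity_form a b) \<le> norm a * norm b * K"
  proof (intro exI allI)
    fix a b :: H2_loop
    have "norm (integral (cbox 0 (2*pi)) (\<lambda>t. velocity (loop a) t \<bullet> velocity (loop b) t)) \<le> (15 * norm a * (15 * norm b)) * measure lborel (cbox 0 (2*pi))"
    proof (rule integrable_bound)
      show "(\<lambda>t. velocity (loop a) t \<bullet> velocity (loop b) t) integrable_on cbox 0 (2*pi)"
        using integrable_velocity[of a b] by (simp add: cbox_interval)
      show "norm (velocity (loop a) t \<bullet> velocity (loop b) t) \<le> 15 * norm a * (15 * norm b)" for t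
        using Cauchy_Schwarz_ineq2[of "velocity (loop a) t" "velocity (loop b) t"]
          mult_mono[OF sobolev(2)[of a t] sobolev(2)[of b t]] by simp
    qed simp
    then show "norm (velocity_form a b) \<le> norm a * norm b * (450 * pi)" by (simp add: velocity_form_def cbox_interval mult_ac)
  qed
qed

lemma velocity_form_parts:
  assumes "has_second_weak_derivative (loop u) g" and g: "continuous_on {0..2*pi} g"
  shows "velocity_form u v = - integral {0..2*pi} (\<lambda>t. g t \<bullet> loop v t)"
proof -
  have d: "(velocity (loop u) has_vector_derivative g t) (at t within {0..2*pi})" if t: "t \<in> {0..2*pi}" for t
  proof (rule has_vector_derivative_transform[OF t])
    show "((\<lambda>t. velocity (loop u) 0 + integral {0..t} g) has_vector_derivative g t) (at t within {0..2*pi})"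
      using has_vector_derivative_add[OF has_vector_derivative_const integral_has_vector_derivative[OF g t]] by simp
    show "velocity (loop u) s = velocity (loop u) 0 + integral {0..s} g" if "s \<in> {0..2*pi}" for s
      using integral_unique[OF velocity_eq_integral[OF assms(1) that]] by simp
  qed
  have "((\<lambda>t. velocity (loop u) t \<bullet> velocity (loop v) t + g t \<bullet> loop v t) has_integral
      velocity (loop u) (2*pi) \<bullet> loop v (2*pi) - velocity (loop u) 0 \<bullet> loop v 0) {0..2*pi}"
  proof (rule fundamental_theorem_of_calculus)
    fix t :: real assume t: "t \<in> {0..2*pi}"
    show "((\<lambda>t. velocity (loop u) t \<bullet> loop v t) has_vector_derivative
        velocity (loop u) t \<bullet> velocity (loop v) t + g t \<bullet> loop v t) (at t within {0..2*pi})"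
      by (rule bounded_bilinear.has_vector_derivative[OF bounded_bilinear_inner d[OF t] has_vector_derivative_at_within[OF loop_has_velocity]])
  qed simp
  then have "((\<lambda>t. velocity (loop u) t \<bullet> velocity (loop v) t + g t \<bullet> loop v t) has_integral 0) {0..2*pi}"
    using velocity_periodic[of u 0] loop_periodic[of v 0] by simp
  moreover have "integral {0..2*pi} (\<lambda>t. velocity (loop u) t \<bullet> velocity (loop v) t + g t \<bullet> loop v t)
      = velocity_form u v + integral {0..2*pi} (\<lambda>t. g t \<bullet> loop v t)"
    unfolding velocity_form_def
    by (intro Henstock_Kurzweil_Integration.integral_add integrable_velocity integrable_continuous_interval continuous_intros g loop_continuous_on)
  ultimately show ?thesis by (simp add: integral_unique)
qed

lemma constant_loop: "\<exists>v. loop v = (\<lambda>_. c)"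
proof (rule exI)
  show "loop (H2_loop (\<lambda>_. c)) = (\<lambda>_. c)"
    by (rule H2_loop_construct(1)[where h = "\<lambda>_. 0" and ?y1.0 = "\<lambda>_. 0"]) auto
qed

context symmetry_group
begin

lemma potential_has_derivative:
  assumes "x \<in> off_axes H"
  shows "(potential H e has_derivative (\<lambda>h. force H e x \<bullet> h)) (at x)"
proof -
  have "x \<noteq> 0" using assms by (simp add: off_axes_def)
  from has_derivative_add[OF kepler_potential_has_derivative[OF this] has_derivative_mult_right[OF pair_potential_has_derivative[OF assms], of e]]
  show ?thesis by (simp add: potential_def[abs_def] force_def inner_add_left)
qed

lemma C1_on_force: "C1_on (off_axes H \<times> UNIV) (\<lambda>(x, e). force H e x)"
proof -
  have 1: "C1_on (off_axes H \<times> UNIV) (\<lambda>z. kepler_force (fst z))"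
    by (rule C1_on_compose[OF C2_on_imp_C1_on[OF C2_on_kepler_force]]) (auto intro: C_intros simp: off_axes_def)
  have 2: "C1_on (off_axes H \<times> UNIV) (\<lambda>z. pair_force H (fst z))"
    by (rule C1_on_compose[OF C1_on_pair_force]) (auto intro: C_intros)
  show ?thesis unfolding force_def case_prod_beta' by (intro C_intros 1 2)
qed

lemma continuous_on_force: "continuous_on (off_axes H) (force H e)"
proof -
  have "continuous_on (off_axes H) (\<lambda>x. (\<lambda>(x, e). force H e x) (x, e))"
    by (rule continuous_on_compose2[OF C1_on_continuous[OF C1_on_force]]) (auto intro!: continuous_intros)
  then show ?thesis by simp
qed

lemma C1_on_potential: "C1_on (off_axes H) (potential H e)"
  unfolding potential_def
  by (intro C_intros C2_on_imp_C1_on[OF C2_on_pair_potential]) (auto simp: off_axes_def)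

lemma collision_free_iff: "u \<in> collision_free H \<longleftrightarrow> (\<forall>t\<in>{0..2*pi}. loop u t \<in> off_axes H)"
proof -
  have "u \<in> collision_free H \<longleftrightarrow> (\<forall>t. loop u t \<in> off_axes H)" by (simp add: collision_free_def off_axes_def)
  then show ?thesis using periodic_reduce[of "loop u" "\<lambda>x. x \<in> off_axes H", OF loop_periodic] by blast
qed

lemma collision_free_off_axes: "u \<in> collision_free H \<Longrightarrow> loop u t \<in> off_axes H"
  by (simp add: collision_free_def off_axes_def)

lemma bounded_linear_loop: "bounded_linear (\<lambda>u. loop u t)"
  by (rule bounded_linear_intro[where K = 15]) (use sobolev(1) in \<open>simp_all add: loop_add loop_scaleR mult.commute\<close>)

lemma potential_nemytskii:
  "open (collision_free H)" "C1_on (collision_free H) (\<lambda>u. mkC (\<lambda>t. potential H e (loop u t)))"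
proof -
  have W: "open (UNIV \<times> off_axes H :: (real \<times> (real^3)) set)" by (intro open_Times open_UNIV open_off_axes)
  have G: "C1_on (UNIV \<times> off_axes H) (\<lambda>z::real \<times> (real^3). potential H e (snd z))"
    by (rule C1_on_compose[OF C1_on_potential]) (auto intro: C_intros)
  have eq: "{u. \<forall>t\<in>{0..2*pi}. (t, loop u t) \<in> UNIV \<times> off_axes H} = collision_free H"
    using collision_free_iff by auto
  note N = nemytskii[OF W G bounded_linear_loop sobolev(1) loop_continuous_on]
  show "open (collision_free H)" using N(1) unfolding eq .
  show "C1_on (collision_free H) (\<lambda>u. mkC (\<lambda>t. potential H e (loop u t)))" using N(2) unfolding eq by simp
qed

lemma continuous_on_force_loop: "u \<in> collision_free H \<Longrightarrow> continuous_on S (\<lambda>t. force H e (loop u t))"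
  by (rule continuous_on_compose2[OF continuous_on_force])
    (auto simp: collision_free_off_axes intro: continuous_on_subset[OF _ subset_UNIV] continuous_at_imp_continuous_on
      has_vector_derivative_continuous[OF loop_has_velocity])

text \<open>\<open>nemytskii\<close> provides some derivative with values in the continuous
  functions. Evaluation at each time shows that it is the pairing with the force, and integration
  over the period is bounded and linear.\<close>

lemma potential_integral_has_derivative:
  assumes u: "u \<in> collision_free H"
  shows "((\<lambda>u. integral {0..2*pi} (\<lambda>t. potential H e (loop u t))) has_derivative
     (\<lambda>v. integral {0..2*pi} (\<lambda>t. force H e (loop u t) \<bullet> loop v t))) (at u)"
proof -
  obtain D where D: "((\<lambda>u. mkC (\<lambda>t. potential H e (loop u t))) has_derivative blinfun_apply D) (at u)"
    using potential_nemytskii(2) u unfolding C1_on_def by blast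
  have co: "continuous_on {0..2*pi} (\<lambda>t. potential H e (loop w t))" if "w \<in> collision_free H" for w
    by (rule continuous_on_compose2[OF C1_on_continuous[OF C1_on_potential] loop_continuous_on])
      (use that collision_free_off_axes in auto)
  have Dv: "apply_bcontfun (blinfun_apply D v) t = force H e (loop u t) \<bullet> loop v t" if t: "t \<in> {0..2*pi}" for v t
  proof -
    have 1: "((\<lambda>u. apply_bcontfun (mkC (\<lambda>t. potential H e (loop u t))) t) has_derivative (\<lambda>v. apply_bcontfun (blinfun_apply D v) t)) (at u)"
      by (rule bounded_linear.has_derivative[OF bounded_linear_eval D])
    have "((\<lambda>u. potential H e (loop u t)) has_derivative (\<lambda>v. apply_bcontfun (blinfun_apply D v) t)) (at u)"
      by (rule has_derivative_transform_within_open[OF 1 potential_nemytskii(1) u]) (rule mkC_eq[OF co t])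
    moreover have "((\<lambda>u. potential H e (loop u t)) has_derivative (\<lambda>v. force H e (loop u t) \<bullet> loop v t)) (at u)"
      by (rule has_derivative_compose[OF bounded_linear_imp_has_derivative[OF bounded_linear_loop] potential_has_derivative[OF collision_free_off_axes[OF u]]])
    ultimately show ?thesis by (rule has_derivative_unique[THEN fun_cong])
  qed
  have pi2: "2*pi \<in> {0..2*pi}" by simp
  have "((\<lambda>u. apply_bcontfun (blinfun_apply IC (mkC (\<lambda>t. potential H e (loop u t)))) (2*pi)) has_derivative
      (\<lambda>v. apply_bcontfun (blinfun_apply IC (blinfun_apply D v)) (2*pi))) (at u)"
    by (rule bounded_linear.has_derivative[OF bounded_linear_eval bounded_linear.has_derivative[OF blinfun.bounded_linear_right D]])
  then have 2: "((\<lambda>u. integral {0..2*pi} (apply_bcontfun (mkC (\<lambda>t. potential H e (loop u t))))) has_derivative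
      (\<lambda>v. integral {0..2*pi} (apply_bcontfun (blinfun_apply D v)))) (at u)"
    unfolding IC_apply[OF pi2] .
  have "integral {0..2*pi} (apply_bcontfun (blinfun_apply D v)) = integral {0..2*pi} (\<lambda>t. force H e (loop u t) \<bullet> loop v t)" for v
    by (rule integral_cong) (rule Dv)
  moreover have "integral {0..2*pi} (apply_bcontfun (mkC (\<lambda>t. potential H e (loop w t)))) = integral {0..2*pi} (\<lambda>t. potential H e (loop w t))"
    if "w \<in> collision_free H" for w
    by (rule integral_cong) (simp add: mkC_eq co that)
  ultimately show ?thesis
    using has_derivative_transform_within_open[OF 2 potential_nemytskii(1) u] by simp
qed

lemma reduced_action_eq:
  assumes u: "u \<in> collision_free H"
  shows "reduced_action H e u = 1/2 * velocity_form u u + integral {0..2*pi} (\<lambda>t. potential H e (loop u t))"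
proof -
  have c1: "continuous_on {0..2*pi} (\<lambda>t. 1 / norm (loop u t))"
    by (intro continuous_intros loop_continuous_on) (use collision_free_off_axes[OF u] in \<open>auto simp: off_axes_def\<close>)
  have c2: "continuous_on {0..2*pi} (\<lambda>t. pair_potential H (loop u t))"
    by (rule continuous_on_compose2[OF C1_on_continuous[OF C2_on_imp_C1_on[OF C2_on_pair_potential]] loop_continuous_on])
      (use u collision_free_off_axes in auto)
  have "action0 (loop u) = integral {0..2*pi} (\<lambda>t. (1/2) * (velocity (loop u) t \<bullet> velocity (loop u) t)) + integral {0..2*pi} (\<lambda>t. 1 / norm (loop u t))"
    unfolding action0_def power2_norm_eq_inner
    by (subst Henstock_Kurzweil_Integration.integral_add[symmetric])
      (auto intro!: integrable_continuous_interval c1 continuous_intros continuous_on_velocity)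
  moreover have "e * action1 H (loop u) = integral {0..2*pi} (\<lambda>t. e * pair_potential H (loop u t))"
    by (simp add: action1_def pair_potential_def)
  moreover have "integral {0..2*pi} (\<lambda>t. potential H e (loop u t)) = integral {0..2*pi} (\<lambda>t. 1 / norm (loop u t)) + integral {0..2*pi} (\<lambda>t. e * pair_potential H (loop u t))"
    unfolding potential_def
    by (rule Henstock_Kurzweil_Integration.integral_add) (intro integrable_continuous_interval c1 c2 continuous_intros)+
  ultimately show ?thesis by (simp add: reduced_action_def velocity_form_def)
qed

lemma reduced_action_has_derivative:
  assumes u: "u \<in> collision_free H"
  shows "(reduced_action H e has_derivative
     (\<lambda>v. velocity_form u v + integral {0..2*pi} (\<lambda>t. force H e (loop u t) \<bullet> loop v t))) (at u)"
proof -
  have sym: "velocity_form v u = velocity_form u v" for v by (simp add: velocity_form_def inner_commute)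
  have "((\<lambda>u. 1/2 * velocity_form u u) has_derivative (\<lambda>v. 1/2 * (velocity_form u v + velocity_form v u))) (at u)"
    by (rule has_derivative_mult_right[OF bounded_bilinear.FDERIV[OF bounded_bilinear_velocity_form has_derivative_ident has_derivative_ident]])
  then have "((\<lambda>u. 1/2 * velocity_form u u) has_derivative velocity_form u) (at u)" by (simp add: sym)
  from has_derivative_add[OF this potential_integral_has_derivative[OF u]]
  show ?thesis
    by (rule has_derivative_transform_within_open[OF _ potential_nemytskii(1) u]) (simp add: reduced_action_eq)
qed

text \<open>One direction is integration by parts. For the other, constant test loops show that the
  force has mean 0 along \<open>u\<close>, so \<open>periodic_solution\<close> yields a loop with
  exactly this second derivative. Its difference from \<open>u\<close> is orthogonal to every loop
  in the velocity form, in particular to itself, and hence has zero velocity.\<close>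

lemma critical_point_iff:
  "critical_point H e u \<longleftrightarrow> u \<in> collision_free H \<and> has_second_weak_derivative (loop u) (\<lambda>t. force H e (loop u t))"
proof (cases "u \<in> collision_free H")
  case True
  note u = True
  define f where "f t = force H e (loop u t)" for t
  have cf: "continuous_on S f" for S unfolding f_def by (rule continuous_on_force_loop[OF u])
  have "critical_point H e u \<longleftrightarrow> (\<forall>v. velocity_form u v + integral {0..2*pi} (\<lambda>t. f t \<bullet> loop v t) = 0)"
  proof -
    define D where "D v = velocity_form u v + integral {0..2*pi} (\<lambda>t. f t \<bullet> loop v t)" for v
    have D: "(reduced_action H e has_derivative D) (at u)"
      using reduced_action_has_derivative[OF u] by (simp add: D_def[abs_def] f_def)
    have "(reduced_action H e has_derivative (\<lambda>_. 0)) (at u) \<longleftrightarrow> D = (\<lambda>_. 0)"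
    proof
      show "D = (\<lambda>_. 0)" if "(reduced_action H e has_derivative (\<lambda>_. 0)) (at u)"
        by (rule has_derivative_unique[OF D that])
      show "(reduced_action H e has_derivative (\<lambda>_. 0)) (at u)" if "D = (\<lambda>_. 0)"
        using D unfolding that .
    qed
    then show ?thesis using u by (simp add: critical_point_def D_def fun_eq_iff)
  qed
  also have "\<dots> \<longleftrightarrow> has_second_weak_derivative (loop u) f"
  proof
    assume "has_second_weak_derivative (loop u) f"
    then show "\<forall>v. velocity_form u v + integral {0..2*pi} (\<lambda>t. f t \<bullet> loop v t) = 0"
      using velocity_form_parts[OF _ cf] by simp
  next
    assume weak: "\<forall>v. velocity_form u v + integral {0..2*pi} (\<lambda>t. f t \<bullet> loop v t) = 0"
    have "integral {0..2*pi} f \<bullet> c = 0" for c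
    proof -
      obtain v where v: "loop v = (\<lambda>_. c)" using constant_loop by blast
      have "velocity_form u v = 0" by (simp add: velocity_form_def v vector_derivative_const_at)
      then have "integral {0..2*pi} (\<lambda>t. f t \<bullet> c) = 0" using weak[rule_format, of v] by (simp add: v)
      then show ?thesis
        using integral_linear[OF integrable_continuous_interval[OF cf] bounded_linear_inner_left[of c], of 0 "2*pi"] by (simp add: o_def)
    qed
    then have "integral {0..2*pi} f = 0" by (metis inner_eq_zero_iff)
    moreover have fe: "apply_bcontfun (mkC f) t = f t" if "t \<in> {0..2*pi}" for t by (rule mkC_eq[OF cf that])
    ultimately have m: "mean (mkC f) = 0" using integral_cong[of "{0..2*pi}" "apply_bcontfun (mkC f)" f] by (simp add: mean_def)
    define s where "s = periodic_solution (mkC f, 0)"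
    have s: "has_second_weak_derivative (loop s) f"
      by (rule has_second_weak_derivative_cong[OF periodic_solution(2)[of "mkC f" 0, folded s_def]]) (simp add: m fe)
    define d where "d = u - s"
    interpret V: bounded_bilinear velocity_form by (rule bounded_bilinear_velocity_form)
    have "velocity_form d v = 0" for v
    proof -
      have "velocity_form u v + integral {0..2*pi} (\<lambda>t. f t \<bullet> loop v t) = 0" using weak by blast
      moreover have "velocity_form s v + integral {0..2*pi} (\<lambda>t. f t \<bullet> loop v t) = 0" using velocity_form_parts[OF s cf] by simp
      ultimately show ?thesis by (simp add: d_def V.diff_left)
    qed
    then have "integral {0..2*pi} (\<lambda>t. velocity (loop d) t \<bullet> velocity (loop d) t) = 0" by (simp add: velocity_form_def)
    then have 0: "((\<lambda>t. velocity (loop d) t \<bullet> velocity (loop d) t) has_integral 0) (cbox 0 (2*pi))"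
      using integrable_integral[OF integrable_velocity[of d d]] by (simp add: cbox_interval)
    have vd: "velocity (loop d) t = 0" if "t \<in> {0..2*pi}" for t
    proof -
      have "velocity (loop d) t \<bullet> velocity (loop d) t = 0"
        by (rule has_integral_0_cbox_imp_0[OF _ _ 0]) (use that in \<open>auto simp: cbox_interval not_le intro!: continuous_intros continuous_on_velocity\<close>)
      then show ?thesis by simp
    qed
    have "has_second_weak_derivative (loop d) (\<lambda>_. 0)"
      unfolding has_second_weak_derivative_def by (simp add: vd integrable_0)
    from has_second_weak_derivative_loop_add[OF s this]
    show "has_second_weak_derivative (loop u) f" by (simp add: d_def)
  qed
  finally show ?thesis using u unfolding f_def by simp
qed (simp add: critical_point_def)

text \<open>The weak second derivative is continuous, so the velocity is a classical antiderivative
  of the force on one period; since both sides are periodic, this extends to all times.\<close>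

lemma critical_point_newton:
  assumes "critical_point H e u"
  shows "(velocity (loop u) has_vector_derivative force H e (loop u t)) (at t)"
proof -
  define f where "f t = force H e (loop u t)" for t
  have u: "u \<in> collision_free H" and w: "has_second_weak_derivative (loop u) f"
    using assms by (auto simp: critical_point_iff f_def[abs_def])
  have cf: "continuous_on UNIV f" unfolding f_def by (rule continuous_on_force_loop[OF u])
  obtain G where G: "G 0 = 0" "\<And>t. (G has_vector_derivative f t) (at t)"
    using continuous_antiderivative[OF cf] by blast
  have fp: "f (t + 2*pi) = f t" for t by (simp add: f_def loop_periodic)
  have eq: "velocity (loop u) t - velocity (loop u) 0 = G t" if t: "t \<in> {0..2*pi}" for t
  proof -
    have "(f has_integral G t - G 0) {0..t}" by (rule antiderivative_integral[OF G(2)]) (use t in simp)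
    from has_integral_unique[OF velocity_eq_integral[OF w t] this] show ?thesis using G(1) by simp
  qed
  have "(f has_integral 0) {0..2*pi}" using velocity_eq_integral[OF w, of "2*pi"] velocity_periodic[of u 0] by simp
  from antiderivative_periodic[OF G(2) fp this] have Gp: "G (t + 2*pi) = G t" for t .
  have "velocity (loop u) t - velocity (loop u) 0 - G t = 0" for t
    by (rule periodic_reduce[where f = "\<lambda>t. velocity (loop u) t - velocity (loop u) 0 - G t" and Q = "\<lambda>x. x = 0"])
      (simp_all add: velocity_periodic Gp eq)
  then have "velocity (loop u) = (\<lambda>t. velocity (loop u) 0 + G t)" by (intro ext) (metis add_diff_cancel_left' diff_add_cancel eq_iff_diff_eq_0)
  moreover have "((\<lambda>t. velocity (loop u) 0 + G t) has_vector_derivative f t) (at t)"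
    using has_vector_derivative_add[OF has_vector_derivative_const G(2)] by simp
  ultimately show ?thesis unfolding f_def by metis
qed

end

section \<open>Existence of the branch\<close>

text \<open>An arc with equal positions and equal velocities at both ends extends periodically. Its
  second derivative then has mean 0, so \<open>periodic_solution\<close>, which subtracts the mean,
  returns exactly this extension.\<close>

lemma H2_loop_of_arc:
  fixes y y1 f :: "real \<Rightarrow> real^3"
  assumes y: "\<And>t. t \<in> {0..2*pi} \<Longrightarrow> (y has_vector_derivative y1 t) (at t within {0..2*pi})"
    and y1: "\<And>t. t \<in> {0..2*pi} \<Longrightarrow> (y1 has_vector_derivative f t) (at t within {0..2*pi})"
    and f: "continuous_on {0..2*pi} f" and closed: "y (2*pi) = y 0" "y1 (2*pi) = y1 0"
  shows "\<forall>t\<in>{0..2*pi}. loop (periodic_solution (mkC f, y 0)) t = y t"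
    and "has_second_weak_derivative (loop (periodic_solution (mkC f, y 0))) f"
proof -
  have cy1: "continuous_on {0..2*pi} y1" by (rule continuous_on_vector_derivative[OF y1])
  have e: "y1 0 = y1 (2*pi)" by (simp add: closed)
  have pe: "periodic_ext y1 t = y1 t" if "t \<in> {0..2*pi}" for t
    using periodic_ext_eq[OF e, of t 0] that by simp
  obtain Y where Y: "Y 0 = 0" "\<And>t. (Y has_vector_derivative periodic_ext y1 t) (at t)"
    using continuous_antiderivative[OF periodic_ext_continuous[OF cy1 e]] by blast
  have I: "(y1 has_integral y t - y 0) {0..t}" if t: "t \<in> {0..2*pi}" for t
  proof (rule fundamental_theorem_of_calculus)
    show "(y has_vector_derivative y1 s) (at s within {0..t})" if "s \<in> {0..t}" for s
      by (rule has_vector_derivative_within_subset[OF y]) (use that t in auto)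
  qed (use t in auto)
  have Yy: "Y t = y t - y 0" if t: "t \<in> {0..2*pi}" for t
  proof -
    have "(periodic_ext y1 has_integral Y t - Y 0) {0..t}"
      by (rule antiderivative_integral[OF Y(2)]) (use t in auto)
    moreover have "(periodic_ext y1 has_integral y t - y 0) {0..t}"
      by (rule has_integral_eq[OF _ I[OF t]]) (use t pe in auto)
    ultimately have "Y t - Y 0 = y t - y 0" by (rule has_integral_unique)
    then show ?thesis by (simp add: Y(1))
  qed
  have "(periodic_ext y1 has_integral 0) {0..2*pi}"
    by (rule has_integral_eq[OF _ I[of "2*pi", unfolded closed, simplified]]) (use pe in auto)
  from antiderivative_periodic[OF Y(2) periodic_ext_periodic this]
  have Yp: "Y (t + 2*pi) = Y t" for t .
  have d: "((\<lambda>t. y 0 + Y t) has_vector_derivative periodic_ext y1 t) (at t)" for t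
    using has_vector_derivative_add[OF has_vector_derivative_const Y(2)] by simp
  have J: "(f has_integral periodic_ext y1 t - periodic_ext y1 0) {0..t}" if t: "t \<in> {0..2*pi}" for t
  proof -
    have "(f has_integral y1 t - y1 0) {0..t}"
    proof (rule fundamental_theorem_of_calculus)
      show "(y1 has_vector_derivative f s) (at s within {0..t})" if "s \<in> {0..t}" for s
        by (rule has_vector_derivative_within_subset[OF y1]) (use that t in auto)
    qed (use t in auto)
    then show ?thesis using pe[OF t] pe[of 0] by simp
  qed
  have Yp': "y 0 + Y (t + 2*pi) = y 0 + Y t" for t by (simp add: Yp)
  define u where "u = H2_loop (\<lambda>t. y 0 + Y t)"
  have u: "loop u = (\<lambda>t. y 0 + Y t)" "has_second_weak_derivative (loop u) f"
    unfolding u_def by (rule H2_loop_construct[OF d Yp' f J]; assumption)+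
  have "integral {0..2*pi} (apply_bcontfun (mkC f)) = integral {0..2*pi} f"
    by (rule integral_cong) (rule mkC_eq[OF f])
  also have "\<dots> = 0" using integral_unique[OF J[of "2*pi"]] pe[of 0] pe[of "2*pi"] closed by simp
  finally have m: "mean (mkC f) = 0" by (simp add: mean_def)
  have "has_second_weak_derivative (loop (periodic_solution (mkC f, y 0))) f"
    by (rule has_second_weak_derivative_cong[OF periodic_solution(2)]) (simp add: m mkC_eq[OF f])
  from loop_eq_of_second_weak_derivative[OF this u(2)]
  have eq: "periodic_solution (mkC f, y 0) = u" by (simp add: periodic_solution(1) u(1) Y(1))
  show "has_second_weak_derivative (loop (periodic_solution (mkC f, y 0))) f" unfolding eq by (rule u(2))
  show "\<forall>t\<in>{0..2*pi}. loop (periodic_solution (mkC f, y 0)) t = y t" unfolding eq u(1) by (simp add: Yy)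
qed

lemma (in symmetry_group) energy_conserved:
  fixes y y1 :: "real \<Rightarrow> real^3"
  assumes y: "\<And>t. t \<in> {0..2*pi} \<Longrightarrow> (y has_vector_derivative y1 t) (at t within {0..2*pi})"
    and y1: "\<And>t. t \<in> {0..2*pi} \<Longrightarrow> (y1 has_vector_derivative force H e (y t)) (at t within {0..2*pi})"
    and off: "\<And>t. t \<in> {0..2*pi} \<Longrightarrow> y t \<in> off_axes H" and closed: "y (2*pi) = y 0"
  shows "y1 (2*pi) \<bullet> y1 (2*pi) = y1 0 \<bullet> y1 0"
proof -
  define E where "E t = y1 t \<bullet> y1 t - 2 * potential H e (y t)" for t
  have "(E has_vector_derivative 0) (at t within {0..2*pi})" if t: "t \<in> {0..2*pi}" for t
  proof -
    have 1: "((\<lambda>t. y1 t \<bullet> y1 t) has_vector_derivative y1 t \<bullet> force H e (y t) + force H e (y t) \<bullet> y1 t) (at t within {0..2*pi})"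
      by (rule bounded_bilinear.has_vector_derivative[OF bounded_bilinear_inner y1[OF t] y1[OF t]])
    have "((\<lambda>t. potential H e (y t)) has_derivative (\<lambda>s. force H e (y t) \<bullet> (s *\<^sub>R y1 t))) (at t within {0..2*pi})"
      by (rule has_derivative_compose[OF y[OF t, unfolded has_vector_derivative_def] potential_has_derivative[OF off[OF t]]])
    then have 2: "((\<lambda>t. potential H e (y t)) has_vector_derivative force H e (y t) \<bullet> y1 t) (at t within {0..2*pi})"
      by (simp add: has_vector_derivative_def)
    show ?thesis
      unfolding E_def
      by (rule has_vector_derivative_eq_rhs[OF has_vector_derivative_diff[OF 1 has_vector_derivative_mult_right[OF 2]]])
        (simp add: inner_commute)
  qed
  then obtain c where "\<And>t. t \<in> {0..2*pi} \<Longrightarrow> E t = c"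
    using has_vector_derivative_zero_constant[OF convex_real_interval(5), of 0 "2*pi" E] by blast
  then have "E (2*pi) = E 0" by simp
  then show ?thesis by (simp add: E_def closed)
qed

context circular_symmetric
begin

section \<open>From continuous solutions to Sobolev loops\<close>

definition Force :: "(loopC \<times> params) \<times> real \<Rightarrow> loopC" where
  "Force X = mkC (\<lambda>t. force H (snd X) (kchart (fst (snd (fst X)), t) + snd X *\<^sub>R apply_bcontfun (fst (fst X)) t))"

lemma C1_Force: "C1_on dom Force"
proof -
  have sub: "GamW \<subseteq> {Y. fst (snd (snd Y)) \<in> disc4}" by (auto simp: GamW_def)
  have "C1_on GamW (\<lambda>Y. (\<lambda>(x, e). force H e x) (kchart (fst (snd (snd Y)), fst Y) + snd (snd (snd Y)) *\<^sub>R fst (snd Y), snd (snd (snd Y))))"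
    by (rule C1_on_compose[OF C1_on_force C1_on_Pair[OF C1_on_subset[OF C1_GamW(2) sub]]])
      (auto simp: GamW_def intro!: C_intros)
  from nemytskii(2)[OF open_GamW this bounded_linear_evc norm_evc continuous_on_evc]
  have "C1_on dom (\<lambda>X. mkC (\<lambda>t. force H (snd X) (kchart (fst (snd (fst X)), t) + snd X *\<^sub>R apply_bcontfun (fst (fst X)) t)))"
    unfolding dom_def by (simp add: evc_def)
  then show ?thesis by (simp add: Force_def[abs_def])
qed

text \<open>The branch is C1 only in the supremum norm. To obtain a C1 branch in the Sobolev space,
  the loop is rebuilt from its force, which is again C1 in the supremum norm, by the bounded linear
  map \<open>periodic_solution\<close>.\<close>

definition solution_loop :: "(loopC \<times> params) \<times> real \<Rightarrow> H2_loop" where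
  "solution_loop X = periodic_solution (Force X, kchart (fst (snd (fst X)), 0))"

lemma C1_solution_loop: "C1_on dom solution_loop"
proof -
  have k: "C1_on dom (\<lambda>X. kchart (fst (snd (fst X)), 0))"
    by (rule C1_on_compose[OF C2_on_imp_C1_on[OF C2_on_kchart]]) (auto intro!: C_intros dest: dom_disc)
  show ?thesis
    unfolding solution_loop_def[abs_def]
    by (rule C1_on_linear[OF bounded_linear_periodic_solution C1_on_Pair[OF C1_Force k]])
qed

text \<open>Undoing the division by \<open>\<epsilon>\<close> gives a classical solution of Newton's
  equation on one period. Its position closes up; the velocity jump
  \<open>\<epsilon> * \<kappa>\<close> in direction \<open>B\<close> is the only obstruction to
  periodicity.\<close>

lemma solution_arc:
  assumes dom: "((w, (q, (\<sigma>, \<kappa>))), \<epsilon>) \<in> dom" and F: "Fmap ((w, (q, (\<sigma>, \<kappa>))), \<epsilon>) = 0"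
  defines "y \<equiv> \<lambda>t. kchart (q, t) + \<epsilon> *\<^sub>R apply_bcontfun w t"
    and "y1 \<equiv> \<lambda>t. kvel (q, t) + \<epsilon> *\<^sub>R (\<sigma> *\<^sub>R kvel (q, 0) + apply_bcontfun (blinfun_apply IC (Nmap ((w, (q, (\<sigma>, \<kappa>))), \<epsilon>))) t)"
  shows "\<And>t. t \<in> {0..2*pi} \<Longrightarrow> (y has_vector_derivative y1 t) (at t within {0..2*pi})"
    and "\<And>t. t \<in> {0..2*pi} \<Longrightarrow> (y1 has_vector_derivative force H \<epsilon> (y t)) (at t within {0..2*pi})"
    and "\<And>t. t \<in> {0..2*pi} \<Longrightarrow> y t \<in> off_axes H"
    and "y (2*pi) = y 0" and "y 0 = kchart (q, 0)" and "y1 0 = (1 + \<epsilon> * \<sigma>) *\<^sub>R kvel (q, 0)"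
    and "y1 (2*pi) = y1 0 + (\<epsilon> * \<kappa>) *\<^sub>R B"
proof -
  define X where "X = ((w, (q, (\<sigma>, \<kappa>))), \<epsilon>)"
  have q: "q \<in> disc4" using dom_disc[OF dom] by simp
  have W: "w = lin (\<sigma> *\<^sub>R kvel (q, 0)) + blinfun_apply IC (blinfun_apply IC (Nmap X))"
    and K: "apply_bcontfun (blinfun_apply IC (Nmap X)) (2*pi) = \<kappa> *\<^sub>R B" and w2: "apply_bcontfun w (2*pi) = 0"
    using F bounded_linear_lin unfolding Fmap_def X_def[symmetric]
    by (simp_all add: X_def Let_def zero_prod_def v0_0 linear_simps algebra_simps)
  note D = double_integral_derivatives[OF W]
  have kp: "kchart (q, 2*pi) = kchart (q, 0)" "kvel (q, 2*pi) = kvel (q, 0)"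
    using kchart_periodic[OF q, of 0] kvel_periodic[OF q, of 0] by simp_all
  show yoff: "y t \<in> off_axes H" if "t \<in> {0..2*pi}" for t
    using dom that by (simp add: dom_def GamW_def evc_def y_def)
  show "(y has_vector_derivative y1 t) (at t within {0..2*pi})" if t: "t \<in> {0..2*pi}" for t
    unfolding y_def y1_def X_def[symmetric]
    using has_vector_derivative_add[OF has_vector_derivative_at_within[OF kchart_has_derivative(1)[OF q]]
        bounded_linear.has_vector_derivative[OF bounded_linear_scaleR_right D(1)[OF t]]] by simp
  show "(y1 has_vector_derivative force H \<epsilon> (y t)) (at t within {0..2*pi})" if t: "t \<in> {0..2*pi}" for t
  proof -
    have n: "kchart (q, t) \<noteq> 0" by (rule kchart_nonzero[OF q])
    have "y t \<noteq> 0" using yoff[OF t] by (simp add: off_axes_def)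
    then have "kepler_force (y t) = kepler_force (kchart (q, t)) + \<epsilon> *\<^sub>R force_quotient (kchart (q, t)) (apply_bcontfun w t) \<epsilon>"
      unfolding y_def by (rule force_quotient[OF n])
    moreover have "apply_bcontfun (Nmap X) t = force_quotient (kchart (q, t)) (apply_bcontfun w t) \<epsilon> + pair_force H (y t)"
      using Nmap_apply[OF dom t] by (simp add: X_def Gam_def evc_def Let_def y_def)
    ultimately have f: "force H \<epsilon> (y t) = kepler_force (kchart (q, t)) + \<epsilon> *\<^sub>R apply_bcontfun (Nmap X) t"
      by (simp add: force_def scaleR_add_right)
    show ?thesis
      unfolding f unfolding y1_def X_def[symmetric]
      using has_vector_derivative_add[OF has_vector_derivative_at_within[OF kchart_has_derivative(2)[OF q]]
          bounded_linear.has_vector_derivative[OF bounded_linear_scaleR_right D(2)[OF t]]] by simp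
  qed
  show "y (2*pi) = y 0" "y 0 = kchart (q, 0)" by (simp_all add: y_def kp w2 D(3))
  show "y1 0 = (1 + \<epsilon> * \<sigma>) *\<^sub>R kvel (q, 0)" by (simp add: y1_def scaleR_add_left)
  show "y1 (2*pi) = y1 0 + (\<epsilon> * \<kappa>) *\<^sub>R B"
    unfolding y1_def X_def[symmetric] K by (simp add: kp scaleR_add_right)
qed

text \<open>Conservation of energy makes the artificial unknown \<open>\<kappa>\<close> vanish: the speeds at both ends
  of the arc agree.\<close>

lemma solution_multiplier_zero:
  assumes "((w, (q, (\<sigma>, \<kappa>))), \<epsilon>) \<in> dom" "Fmap ((w, (q, (\<sigma>, \<kappa>))), \<epsilon>) = 0"
    and "2 * (1 + \<epsilon> * \<sigma>) * (kvel (q, 0) \<bullet> B) + \<epsilon> * \<kappa> > 0"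
  shows "\<epsilon> * \<kappa> = 0"
proof -
  note A = solution_arc[OF assms(1,2)]
  have sq: "c * (2 * (a \<bullet> B) + c) = 0" if "(a + c *\<^sub>R B) \<bullet> (a + c *\<^sub>R B) = a \<bullet> a" for a c
  proof -
    have "(a + c *\<^sub>R B) \<bullet> (a + c *\<^sub>R B) = a \<bullet> a + (c * (a \<bullet> B) + (c * (a \<bullet> B) + c * c))"
      by (simp add: inner_add_left inner_add_right inner_commute[of B a] frame_inner(2) distrib_left)
    also have "c * (a \<bullet> B) + (c * (a \<bullet> B) + c * c) = c * (2 * (a \<bullet> B) + c)" by (simp add: distrib_left)
    finally show ?thesis using that by linarith
  qed
  have "(\<epsilon> * \<kappa>) * (2 * (((1 + \<epsilon> * \<sigma>) *\<^sub>R kvel (q, 0)) \<bullet> B) + \<epsilon> * \<kappa>) = 0"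
    by (rule sq) (use energy_conserved[OF A(1-4)] in \<open>unfold A(7), unfold A(6)\<close>)
  moreover have "2 * (((1 + \<epsilon> * \<sigma>) *\<^sub>R kvel (q, 0)) \<bullet> B) + \<epsilon> * \<kappa> > 0"
    using assms(3) by (simp only: inner_scaleR_left mult.assoc)
  ultimately show ?thesis by (metis less_numeral_extra(3) mult_eq_0_iff)
qed

lemma solution_loop:
  assumes dom: "((w, (q, (\<sigma>, \<kappa>))), \<epsilon>) \<in> dom" and F: "Fmap ((w, (q, (\<sigma>, \<kappa>))), \<epsilon>) = 0" and k: "\<epsilon> * \<kappa> = 0"
  shows "\<forall>t\<in>{0..2*pi}. loop (solution_loop ((w, (q, (\<sigma>, \<kappa>))), \<epsilon>)) t = kchart (q, t) + \<epsilon> *\<^sub>R apply_bcontfun w t"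
    and "critical_point H \<epsilon> (solution_loop ((w, (q, (\<sigma>, \<kappa>))), \<epsilon>))"
proof -
  note A = solution_arc[OF dom F]
  define y where "y t = kchart (q, t) + \<epsilon> *\<^sub>R apply_bcontfun w t" for t
  have cf: "continuous_on {0..2*pi} (\<lambda>t. force H \<epsilon> (y t))"
    by (rule continuous_on_compose2[OF continuous_on_force continuous_on_vector_derivative])
      (use A(1,3) in \<open>auto simp: y_def\<close>)
  note L = H2_loop_of_arc[OF A(1,2) cf[unfolded y_def] A(4)]
  have eq: "solution_loop ((w, (q, (\<sigma>, \<kappa>))), \<epsilon>) = periodic_solution (mkC (\<lambda>t. force H \<epsilon> (kchart (q, t) + \<epsilon> *\<^sub>R apply_bcontfun w t)), kchart (q, 0) + \<epsilon> *\<^sub>R apply_bcontfun w 0)"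
    unfolding A(5) by (simp add: solution_loop_def Force_def)
  show 1: "\<forall>t\<in>{0..2*pi}. loop (solution_loop ((w, (q, (\<sigma>, \<kappa>))), \<epsilon>)) t = kchart (q, t) + \<epsilon> *\<^sub>R apply_bcontfun w t"
    unfolding eq by (rule L(1)) (use A(7) k in simp_all)
  have "has_second_weak_derivative (loop (solution_loop ((w, (q, (\<sigma>, \<kappa>))), \<epsilon>))) (\<lambda>t. force H \<epsilon> (kchart (q, t) + \<epsilon> *\<^sub>R apply_bcontfun w t))"
    unfolding eq by (rule L(2)) (use A(7) k in simp_all)
  then have "has_second_weak_derivative (loop (solution_loop ((w, (q, (\<sigma>, \<kappa>))), \<epsilon>))) (\<lambda>t. force H \<epsilon> (loop (solution_loop ((w, (q, (\<sigma>, \<kappa>))), \<epsilon>)) t))"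
    by (rule has_second_weak_derivative_cong) (simp add: 1)
  then show "critical_point H \<epsilon> (solution_loop ((w, (q, (\<sigma>, \<kappa>))), \<epsilon>))"
    unfolding critical_point_iff collision_free_iff using 1 A(3) by simp
qed

end

context nondegenerate_circular
begin

lemma critical_branch:
  obtains \<epsilon>2 r X where "\<epsilon>2 > 0" "r > 0" "X 0 = x0" "C1_on (ball 0 \<epsilon>2) (\<lambda>\<epsilon>. solution_loop (X \<epsilon>, \<epsilon>))"
    "\<And>\<epsilon>. \<bar>\<epsilon>\<bar> < \<epsilon>2 \<Longrightarrow> critical_point H \<epsilon> (solution_loop (X \<epsilon>, \<epsilon>))"
    "\<And>\<epsilon> t. \<bar>\<epsilon>\<bar> < \<epsilon>2 \<Longrightarrow> t \<in> {0..2*pi} \<Longrightarrow>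
      loop (solution_loop (X \<epsilon>, \<epsilon>)) t = kchart (fst (snd (X \<epsilon>)), t) + \<epsilon> *\<^sub>R apply_bcontfun (fst (X \<epsilon>)) t"
    "\<And>x \<epsilon>. \<bar>\<epsilon>\<bar> < \<epsilon>2 \<Longrightarrow> norm (x - x0) < r \<Longrightarrow> Fmap (x, \<epsilon>) = 0 \<Longrightarrow> x = X \<epsilon>"
proof -
  obtain \<epsilon>1 r X where e1: "\<epsilon>1 > 0" and r: "r > 0" and X: "C1_on (ball 0 \<epsilon>1) X" "X 0 = x0"
    "\<And>\<epsilon>. \<bar>\<epsilon>\<bar> < \<epsilon>1 \<Longrightarrow> (X \<epsilon>, \<epsilon>) \<in> dom \<and> Fmap (X \<epsilon>, \<epsilon>) = 0"
    "\<And>x \<epsilon>. \<bar>\<epsilon>\<bar> < \<epsilon>1 \<Longrightarrow> norm (x - x0) < r \<Longrightarrow> Fmap (x, \<epsilon>) = 0 \<Longrightarrow> x = X \<epsilon>"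
    by (rule solution_branch) blast
  \<comment> \<open>Energy conservation makes the product of the velocity jump with this factor
    vanish. The factor equals 2 at \<open>\<epsilon> = 0\<close> and is continuous, hence positive
    on a smaller interval.\<close>
  define m where "m \<epsilon> = 2 * (1 + \<epsilon> * fst (snd (snd (X \<epsilon>)))) * (kvel (fst (snd (X \<epsilon>)), 0) \<bullet> B) + \<epsilon> * snd (snd (snd (X \<epsilon>)))" for \<epsilon>
  have cX: "continuous_on (ball 0 \<epsilon>1) X" by (rule C1_on_continuous[OF X(1)])
  have disc: "fst (snd (X \<epsilon>)) \<in> disc4" if "\<epsilon> \<in> ball 0 \<epsilon>1" for \<epsilon>
    using dom_disc[of "(X \<epsilon>, \<epsilon>)"] X(3)[of \<epsilon>] that by (simp add: dist_norm)
  have "continuous_on (ball 0 \<epsilon>1) (\<lambda>\<epsilon>. kvel (fst (snd (X \<epsilon>)), 0))"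
    by (rule continuous_on_compose2[OF C1_on_continuous[OF C2_on_imp_C1_on[OF C2_on_kvel]]])
      (use disc in \<open>auto intro!: continuous_intros cX\<close>)
  then have cm: "continuous_on (ball 0 \<epsilon>1) m" unfolding m_def by (intro continuous_intros cX)
  have "m 0 = 2" by (simp add: m_def X(2) x0_def kvel_circ v0_0 frame_inner)
  moreover have "open (m -` {0<..} \<inter> ball 0 \<epsilon>1)"
    by (rule continuous_on_open_vimage[THEN iffD1, rule_format, OF open_ball cm open_greaterThan])
  ultimately obtain \<epsilon>2 where e2: "\<epsilon>2 > 0" "ball 0 \<epsilon>2 \<subseteq> m -` {0<..} \<inter> ball 0 \<epsilon>1"
    using e1 open_contains_ball[of "m -` {0<..} \<inter> ball 0 \<epsilon>1"] by (auto elim!: ballE[of _ _ 0])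
  have sub: "\<bar>\<epsilon>\<bar> < \<epsilon>1" "m \<epsilon> > 0" if "\<bar>\<epsilon>\<bar> < \<epsilon>2" for \<epsilon>
    using subsetD[OF e2(2), of \<epsilon>] that by (auto simp: dist_norm)
  have sol: "(\<forall>t\<in>{0..2*pi}. loop (solution_loop (X \<epsilon>, \<epsilon>)) t = kchart (fst (snd (X \<epsilon>)), t) + \<epsilon> *\<^sub>R apply_bcontfun (fst (X \<epsilon>)) t)
     \<and> critical_point H \<epsilon> (solution_loop (X \<epsilon>, \<epsilon>))" if e: "\<bar>\<epsilon>\<bar> < \<epsilon>2" for \<epsilon>
  proof -
    obtain w q \<sigma> \<kappa> where x: "X \<epsilon> = (w, (q, (\<sigma>, \<kappa>)))" using prod_cases4 by blast
    note D = X(3)[OF sub(1)[OF e], unfolded x]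
    have "\<epsilon> * \<kappa> = 0" by (rule solution_multiplier_zero[OF conjunct1[OF D] conjunct2[OF D]]) (use sub(2)[OF e] in \<open>simp add: m_def x\<close>)
    from solution_loop[OF conjunct1[OF D] conjunct2[OF D] this] show ?thesis by (simp add: x)
  qed
  have C1: "C1_on (ball 0 \<epsilon>2) (\<lambda>\<epsilon>. solution_loop (X \<epsilon>, \<epsilon>))"
  proof (rule C1_on_compose[OF C1_solution_loop C1_on_Pair[OF C1_on_subset[OF X(1)] C1_on_id]])
    show "(\<lambda>\<epsilon>. (X \<epsilon>, \<epsilon>)) ` ball 0 \<epsilon>2 \<subseteq> dom" using X(3) sub(1) by (auto simp: dist_norm)
  qed (use e2 in auto)
  show thesis
    by (rule that[OF e2(1) r X(2) C1]) (use sol X(4) sub(1) in auto)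
qed

end

section \<open>Local uniqueness\<close>

lemma injective_blinfun_inverse:
  fixes L :: "'r::euclidean_space \<Rightarrow>\<^sub>L 'q::euclidean_space"
  assumes dim: "DIM('r) = DIM('q)" and inj: "\<And>r. blinfun_apply L r = 0 \<Longrightarrow> r = 0"
  obtains R where "R o\<^sub>L L = id_blinfun" "L o\<^sub>L R = id_blinfun"
proof -
  have lin: "linear (blinfun_apply L)" by (rule bounded_linear.linear[OF blinfun.bounded_linear_right])
  have injL: "inj (blinfun_apply L)" unfolding linear_injective_0[OF lin] using inj by blast
  have "dim (range (blinfun_apply L)) = DIM('r)" using dim_image_eq[OF lin, of UNIV] injL by simp
  then have "span (range (blinfun_apply L)) = UNIV" using dim dim_eq_full by metis
  then have surj: "surj (blinfun_apply L)" using linear_subspace_image[OF lin subspace_UNIV] span_eq_iff by metis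
  obtain m where m: "linear m" "m \<circ> blinfun_apply L = id" using linear_injective_left_inverse[OF lin injL] by blast
  have bm: "bounded_linear m" using m linear_conv_bounded_linear by blast
  have 1: "m (blinfun_apply L r) = r" for r using m(2) by (metis comp_apply id_apply)
  have 2: "blinfun_apply L (m d) = d" for d
  proof -
    obtain r where "d = blinfun_apply L r" using surj by blast
    then show ?thesis by (simp add: 1)
  qed
  show thesis
    by (rule that[of "Blinfun m"]) (rule blinfun_eqI; simp add: bounded_linear_Blinfun_apply[OF bm] 1 2)+
qed

text \<open>Only \<open>k\<close> ranges over the compact set, while \<open>x\<close> is an
  arbitrary nearby point. A closed neighbourhood of the compact set is again compact, and
  \<open>f\<close> is uniformly continuous on it.\<close>

lemma uniform_near_compact:
  fixes f :: "'a::{real_normed_vector, heine_borel} \<Rightarrow> 'b::real_normed_vector"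
  assumes "compact K" "open S" "K \<subseteq> S" "continuous_on S f" "\<eta> > 0"
  obtains \<rho> where "\<rho> > 0" "\<And>k x. k \<in> K \<Longrightarrow> norm (x - k) < \<rho> \<Longrightarrow> x \<in> S \<and> norm (f x - f k) < \<eta>"
proof -
  obtain e where e: "e > 0" "(\<Union>x\<in>K. ball x e) \<subseteq> S"
    by (rule compact_subset_open_imp_ball_epsilon_subset[OF assms(1-3)])
  define K' where "K' = {x + y | x y. x \<in> K \<and> y \<in> cball 0 (e/2)}"
  have cK: "compact K'" unfolding K'_def by (rule compact_sums[OF assms(1) compact_cball])
  have near: "x \<in> K'" if "k \<in> K" "norm (x - k) \<le> e/2" for k x
  proof -
    have "x = k + (x - k)" "x - k \<in> cball 0 (e/2)" using that by (simp_all add: dist_norm norm_minus_commute)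
    then show ?thesis unfolding K'_def using that(1) by blast
  qed
  have "K' \<subseteq> S"
  proof
    fix x assume "x \<in> K'"
    then obtain k y where "x = k + y" "k \<in> K" "norm y \<le> e/2" by (auto simp: K'_def)
    then have "x \<in> ball k e" using e(1) by (simp add: dist_norm)
    then show "x \<in> S" using e(2) \<open>k \<in> K\<close> by blast
  qed
  then have "uniformly_continuous_on K' f"
    using compact_uniformly_continuous[OF continuous_on_subset[OF assms(4)] cK] by blast
  then obtain d where d: "d > 0" "\<And>x y. x \<in> K' \<Longrightarrow> y \<in> K' \<Longrightarrow> dist y x < d \<Longrightarrow> dist (f y) (f x) < \<eta>"
    using \<open>\<eta> > 0\<close> unfolding uniformly_continuous_on_def by metis
  show thesis
  proof (rule that[of "min d (e/2)"])
    show "0 < min d (e/2)" using d(1) e(1) by simp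
    fix k x assume k: "k \<in> K" and x: "norm (x - k) < min d (e/2)"
    have "x \<in> K'" "k \<in> K'" using near[OF k, of x] near[OF k, of k] x e(1) by auto
    then show "x \<in> S \<and> norm (f x - f k) < \<eta>" using d(2)[of k x] x \<open>K' \<subseteq> S\<close> by (auto simp: dist_norm)
  qed
qed

context circular
begin

lemma compact_orbit: "compact (u0 ` {0..2*pi})"
  by (rule compact_continuous_image[OF continuous_on_vector_derivative[OF u0_has_derivative(1)]]) simp

text \<open>A ball around \<open>u0 t\<close> is convex, so on the segment from \<open>x\<close> to
  \<open>x + W\<close> the derivative of the force stays close to its value on the circle. The bound
  is relative to \<open>W\<close>, without a quadratic remainder; this matters when \<open>W\<close>
  is \<open>\<epsilon>\<close> times a correction of unknown size.\<close>

lemma kepler_force_near_orbit: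
  assumes "\<eta> > 0"
  obtains \<rho> where "\<rho> > 0" "\<And>t x W. t \<in> {0..2*pi} \<Longrightarrow> norm (x - u0 t) < \<rho> \<Longrightarrow> norm (x + W - u0 t) < \<rho> \<Longrightarrow>
     norm (kepler_force (x + W) - kepler_force x - blinfun_apply (kepler_force' (u0 t)) W) \<le> \<eta> * norm W"
proof -
  have o: "open (- {0 :: real^3})" by (simp add: open_Compl)
  obtain \<rho> where \<rho>: "\<rho> > 0" "\<And>k x. k \<in> u0 ` {0..2*pi} \<Longrightarrow> norm (x - k) < \<rho> \<Longrightarrow> x \<in> - {0} \<and> norm (kepler_force' x - kepler_force' k) < \<eta>"
    by (rule uniform_near_compact[OF compact_orbit o _ C1_on_continuous[OF C1_on_kepler_force'] assms]) auto
  show thesis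
  proof (rule that[OF \<rho>(1)])
    fix t x W assume t: "t \<in> {0..2*pi}" and x: "norm (x - u0 t) < \<rho>" "norm (x + W - u0 t) < \<rho>"
    define g where "g z = kepler_force z - blinfun_apply (kepler_force' (u0 t)) z" for z
    have "norm (g (x + W) - g x) \<le> \<eta> * norm (x + W - x)"
    proof (rule differentiable_bound[where S = "ball (u0 t) \<rho>" and f' = "\<lambda>z. blinfun_apply (kepler_force' z - kepler_force' (u0 t))"])
      fix z assume "z \<in> ball (u0 t) \<rho>"
      then have z: "norm (z - u0 t) < \<rho>" by (simp add: dist_norm norm_minus_commute)
      have zz: "z \<in> - {0} \<and> norm (kepler_force' z - kepler_force' (u0 t)) < \<eta>" by (rule \<rho>(2)[OF _ z]) (use t in auto)
      have "(kepler_force has_derivative blinfun_apply (kepler_force' z)) (at z)" by (rule kepler_force_has_derivative) (use zz in simp)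
      then have "(g has_derivative (\<lambda>h. blinfun_apply (kepler_force' z) h - blinfun_apply (kepler_force' (u0 t)) h)) (at z)"
        unfolding g_def by (rule has_derivative_diff[OF _ bounded_linear_imp_has_derivative[OF blinfun.bounded_linear_right]])
      then show "(g has_derivative blinfun_apply (kepler_force' z - kepler_force' (u0 t))) (at z within ball (u0 t) \<rho>)"
        by (simp add: minus_blinfun.rep_eq[abs_def] has_derivative_at_withinI)
      show "onorm (blinfun_apply (kepler_force' z - kepler_force' (u0 t))) \<le> \<eta>" using zz by (simp add: norm_blinfun.rep_eq)
    qed (use x in \<open>auto simp: dist_norm norm_minus_commute\<close>)
    then show "norm (kepler_force (x + W) - kepler_force x - blinfun_apply (kepler_force' (u0 t)) W) \<le> \<eta> * norm W"
      by (simp add: g_def blinfun.add_right algebra_simps)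
  qed
qed

lemma kvel_derivative_circ:
  assumes V: "(kvel has_derivative V) (at (p, 0))"
  shows "V (d, \<phi>) = kjacd p (d, \<phi>) 0"
proof -
  have "((\<lambda>s. (p, 0) + s *\<^sub>R (d, \<phi>)) has_derivative (\<lambda>s. s *\<^sub>R (d, \<phi>))) (at 0)" by (auto intro!: derivative_eq_intros)
  from has_derivative_compose[OF this, of kvel V] V
  have 1: "((\<lambda>s. kvel ((p, 0) + s *\<^sub>R (d, \<phi>))) has_vector_derivative V (d, \<phi>)) (at 0)"
    unfolding has_vector_derivative_def by (simp add: linear_cmul[OF has_derivative_linear[OF V]] del: scaleR_Pair)
  define F where "F s = ecc (0 + s * d$1) (0 + s * d$2) (0 + s * \<phi>)" for s
  define k where "k s = kbeta (s * d$1) (s * d$2)" for s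
  have F0: "F 0 = 0" by (simp add: F_def ecc_circle)
  have dF: "(F has_real_derivative (\<phi> - d$2)) (at 0)"
    using ecc_line_has_derivative[of 0 0 "d$1" "d$2" 0 \<phi>] by (simp add: F_def[abs_def] ecc_circle)
  have dk: "(k has_real_derivative 0) (at 0)"
    unfolding k_def kbeta_def by (auto intro!: derivative_eq_intros)
  have dX: "((\<lambda>s. kXd (s * d$1) (s * d$2) (F s)) has_real_derivative - (\<phi> - d$2)) (at 0)"
    unfolding kXd_def k_def[symmetric]
    by (auto intro!: derivative_eq_intros dF dk simp: F0)
  have dY: "((\<lambda>s. kYd (s * d$1) (s * d$2) (F s)) has_real_derivative d$1) (at 0)"
    unfolding kYd_def k_def[symmetric]
    by (auto intro!: derivative_eq_intros dF dk simp: F0)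
  have "((\<lambda>s. kXd (s * d$1) (s * d$2) (F s) *\<^sub>R frameA (p$3 + s * d$3) (p$4 + s * d$4)
      + kYd (s * d$1) (s * d$2) (F s) *\<^sub>R frameB (p$3 + s * d$3) (p$4 + s * d$4)) has_vector_derivative
      ((- (\<phi> - d$2)) *\<^sub>R A) + (d$3 *\<^sub>R (sin (p$4) *\<^sub>R A + cos (p$4) *\<^sub>R N) + (d$1) *\<^sub>R B)) (at 0)"
    using has_vector_derivative_add[OF has_vector_derivative_scaleR[OF dX frame_line_has_derivative(1)] has_vector_derivative_scaleR[OF dY frame_line_has_derivative(2)]]
    by (simp add: F0 kXd_def kYd_def)
  moreover have "(\<lambda>s. kXd (s * d$1) (s * d$2) (F s) *\<^sub>R frameA (p$3 + s * d$3) (p$4 + s * d$4)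
      + kYd (s * d$1) (s * d$2) (F s) *\<^sub>R frameB (p$3 + s * d$3) (p$4 + s * d$4)) = (\<lambda>s. kvel ((p, 0) + s *\<^sub>R (d, \<phi>)))"
    by (simp add: kvel_def Let_def circ F_def)
  ultimately have "V (d, \<phi>) = ((- (\<phi> - d$2)) *\<^sub>R A) + (d$3 *\<^sub>R (sin (p$4) *\<^sub>R A + cos (p$4) *\<^sub>R N) + (d$1) *\<^sub>R B)"
    using vector_derivative_unique_at[OF 1] by simp
  also have "\<dots> = kjacd p (d, \<phi>) 0" by (simp add: kjacd_def Let_def algebra_simps)
  finally show ?thesis .
qed

end

context nondegenerate_circular
begin

text \<open>Every state near that of the circular orbit at time \<open>0\<close> lies, up to a rescaling of the speed, on a
  Kepler ellipse of the chart; the time coordinate along the ellipse is used to fix the phase.\<close>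

lemma state_chart:
  obtains V g where "open V" "continuous_on V g"
    "\<And>z. z \<in> V \<Longrightarrow> fst (g z) \<in> disc4 \<and> kchart (fst (g z), fst (snd (g z))) = fst z
       \<and> (1 + snd (snd (g z))) *\<^sub>R kvel (fst (g z), fst (snd (g z))) = snd z"
    "\<exists>\<eta>>0. \<forall>\<tau>. \<bar>\<tau>\<bar> < \<eta> \<longrightarrow> (u0 \<tau>, v0 \<tau>) \<in> V \<and> g (u0 \<tau>, v0 \<tau>) = (p, (\<tau>, 0 :: real))"
proof -
  define S where "S = {x :: (real^4) \<times> (real \<times> real). fst x \<in> disc4}"
  define M where "M x = (kchart (fst x, fst (snd x)), (1 + snd (snd x)) *\<^sub>R kvel (fst x, fst (snd x)))" for x :: "(real^4) \<times> (real \<times> real)"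
  define m0 where "m0 = (p, (0 :: real, 0 :: real))"
  have S: "open S" "m0 \<in> S"
    using open_vimage[OF open_disc4, of fst] p_disc by (auto simp: S_def m0_def vimage_def continuous_intros)
  have "C1_on S (\<lambda>x. kchart (fst x, fst (snd x)))" "C1_on S (\<lambda>x. kvel (fst x, fst (snd x)))"
    by (rule C1_on_compose[OF C2_on_imp_C1_on[OF C2_on_kchart]] C1_on_compose[OF C2_on_imp_C1_on[OF C2_on_kvel]];
        auto simp: S_def intro!: C_intros)+
  then have CM: "C1_on S M" unfolding M_def by (intro C_intros)
  obtain DM where DM: "(M has_derivative blinfun_apply DM) (at m0)" using CM S(2) unfolding C1_on_def by blast
  obtain V' where V': "(kvel has_derivative blinfun_apply V') (at (p, 0))"
    using C2_on_imp_C1_on[OF C2_on_kvel] p_disc unfolding C1_on_def by blast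
  have DM_apply: "blinfun_apply DM (d, (\<phi>, s)) = (kjac p (d, \<phi>) 0, kjacd p (d, \<phi>) 0 + s *\<^sub>R B)" for d \<phi> s
  proof -
    have l: "((\<lambda>x :: (real^4) \<times> (real \<times> real). (fst x, fst (snd x))) has_derivative (\<lambda>h. (fst h, fst (snd h)))) (at m0)"
      by (auto intro!: derivative_eq_intros)
    have k: "((\<lambda>x. kchart (fst x, fst (snd x))) has_derivative (\<lambda>h. blinfun_apply (kD (p, 0)) (fst h, fst (snd h)))) (at m0)"
      using has_derivative_compose[OF l, of kchart "blinfun_apply (kD (p, 0))"] kD[of "(p, 0)"] p_disc by (simp add: m0_def)
    have v: "((\<lambda>x. kvel (fst x, fst (snd x))) has_derivative (\<lambda>h. blinfun_apply V' (fst h, fst (snd h)))) (at m0)"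
      using has_derivative_compose[OF l, of kvel "blinfun_apply V'"] V' by (simp add: m0_def)
    have s: "((\<lambda>x :: (real^4) \<times> (real \<times> real). 1 + snd (snd x)) has_derivative (\<lambda>h. snd (snd h))) (at m0)"
      by (auto intro!: derivative_eq_intros)
    have "(M has_derivative (\<lambda>h. (blinfun_apply (kD (p, 0)) (fst h, fst (snd h)),
        (1 + snd (snd m0)) *\<^sub>R blinfun_apply V' (fst h, fst (snd h)) + snd (snd h) *\<^sub>R kvel (fst m0, fst (snd m0))))) (at m0)"
      unfolding M_def[abs_def] by (rule has_derivative_Pair[OF k has_derivative_scaleR[OF s v]])
    from has_derivative_unique[OF DM this] show ?thesis
      by (simp add: m0_def kD_circ kvel_circ v0_0 kvel_derivative_circ[OF V'])
  qed
  obtain R where R: "R o\<^sub>L DM = id_blinfun" "DM o\<^sub>L R = id_blinfun"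
  proof (rule injective_blinfun_inverse[of DM])
    fix h assume 0: "blinfun_apply DM h = 0"
    obtain d \<phi> s where h: "h = (d, (\<phi>, s))" using prod_cases3 by blast
    have e: "kjac p (d, \<phi>) 0 = 0" "kjacd p (d, \<phi>) 0 + s *\<^sub>R B = 0" using 0 by (simp_all add: h DM_apply zero_prod_def)
    \<comment> \<open>In the frame these are six scalar equations. The normal velocity gives
      \<open>d$3 = 0\<close> through \<open>cosq\<close>; the remaining relations
      \<open>\<phi> = 2 * d$2\<close> and \<open>\<phi> = d$2\<close> then leave only 0.\<close>
    note e = e[unfolded kjac_0]
    have "d$1 = 0" using arg_cong[OF e(1), of "\<lambda>x. x \<bullet> A"] by (simp add: inner_add_left inner_diff_left frame_inner)
    moreover have "\<phi> - 2 * d$2 - d$3 * sin (p$4) = 0" using arg_cong[OF e(1), of "\<lambda>x. x \<bullet> B"] by (simp add: inner_add_left inner_diff_left frame_inner)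
    moreover have "d$4 = 0" using arg_cong[OF e(1), of "\<lambda>x. x \<bullet> N"] by (simp add: inner_add_left inner_diff_left frame_inner)
    moreover have "d$2 + d$3 * sin (p$4) - \<phi> = 0" using arg_cong[OF e(2), of "\<lambda>x. x \<bullet> A"] by (simp add: inner_add_left frame_inner)
    moreover have "d$1 + s = 0" using arg_cong[OF e(2), of "\<lambda>x. x \<bullet> B"] by (simp add: inner_add_left frame_inner)
    moreover have "d$3 = 0" using arg_cong[OF e(2), of "\<lambda>x. x \<bullet> N"] cosq by (simp add: inner_add_left frame_inner)
    ultimately have "d$1 = 0" "d$2 = 0" "d$3 = 0" "d$4 = 0" "\<phi> = 0" "s = 0" by auto
    then show "h = 0" by (simp add: h zero_prod_def vec_eq_iff forall_4)
  qed simp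
  obtain U V g where UV: "open U" "U \<subseteq> S" "m0 \<in> U" "open V" "M m0 \<in> V"
    "\<And>x. x \<in> U \<Longrightarrow> M x \<in> V \<and> g (M x) = x" "\<And>y. y \<in> V \<Longrightarrow> g y \<in> U \<and> M (g y) = y" "C1_on V g"
    by (rule inverse_function_banach[OF S CM DM R]) blast
  have M0: "M (p, (\<tau>, 0)) = (u0 \<tau>, v0 \<tau>)" for \<tau> by (simp add: M_def kchart_circ kvel_circ)
  show thesis
  proof (rule that[OF UV(4) C1_on_continuous[OF UV(8)]])
    show "fst (g z) \<in> disc4 \<and> kchart (fst (g z), fst (snd (g z))) = fst z
       \<and> (1 + snd (snd (g z))) *\<^sub>R kvel (fst (g z), fst (snd (g z))) = snd z" if "z \<in> V" for z
    proof -
      have "g z \<in> S" "M (g z) = z" using UV(7)[OF that] UV(2) by auto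
      then show ?thesis by (auto simp: S_def M_def prod_eq_iff)
    qed
    obtain \<eta> where \<eta>: "\<eta> > 0" "ball m0 \<eta> \<subseteq> U" using UV(1,3) open_contains_ball by blast
    have "(p, (\<tau>, 0)) \<in> U" if "\<bar>\<tau>\<bar> < \<eta>" for \<tau>
      by (rule subsetD[OF \<eta>(2)]) (use that in \<open>simp add: m0_def dist_Pair_Pair dist_real_def\<close>)
    then show "\<exists>\<eta>>0. \<forall>\<tau>. \<bar>\<tau>\<bar> < \<eta> \<longrightarrow> (u0 \<tau>, v0 \<tau>) \<in> V \<and> g (u0 \<tau>, v0 \<tau>) = (p, (\<tau>, 0))"
      using UV(6) \<eta>(1) by (metis M0)
  qed
qed

end

context circular_symmetric
begin

text \<open>The converse of \<open>solution_arc\<close>, with zero multiplier and speed excess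
  \<open>s / \<epsilon>\<close>. Nothing bounds the rescaled correction at this point, as it is a
  difference of orbits divided by \<open>\<epsilon>\<close>; that is the task of
  \<open>solution_near_base\<close>.\<close>

lemma arc_solves:
  fixes Y Y1 :: "real \<Rightarrow> real^3"
  assumes Y: "\<And>t. t \<in> {0..2*pi} \<Longrightarrow> (Y has_vector_derivative Y1 t) (at t within {0..2*pi})"
    and Y1: "\<And>t. t \<in> {0..2*pi} \<Longrightarrow> (Y1 has_vector_derivative force H \<epsilon> (Y t)) (at t within {0..2*pi})"
    and off: "\<And>t. t \<in> {0..2*pi} \<Longrightarrow> Y t \<in> off_axes H" and q: "q \<in> disc4" and e: "\<epsilon> \<noteq> 0"
    and start: "Y 0 = kchart (q, 0)" "Y1 0 = (1 + s) *\<^sub>R kvel (q, 0)"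
    and closed: "Y (2*pi) = Y 0" "Y1 (2*pi) = Y1 0"
  defines "w \<equiv> mkC (\<lambda>t. (1/\<epsilon>) *\<^sub>R (Y t - kchart (q, t)))"
  shows "\<And>t. t \<in> {0..2*pi} \<Longrightarrow> kchart (q, t) + \<epsilon> *\<^sub>R apply_bcontfun w t = Y t"
    and "((w, (q, (s/\<epsilon>, 0))), \<epsilon>) \<in> dom" and "Fmap ((w, (q, (s/\<epsilon>, 0))), \<epsilon>) = 0"
proof -
  define X where "X = ((w, (q, (s/\<epsilon>, 0 :: real))), \<epsilon>)"
  define W where "W t = Y t - kchart (q, t)" for t
  define W1 where "W1 t = Y1 t - kvel (q, t)" for t
  define b where "b = (s/\<epsilon>) *\<^sub>R kvel (q, 0)"
  have dW: "(W has_vector_derivative W1 t) (at t within {0..2*pi})" if "t \<in> {0..2*pi}" for t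
    unfolding W_def W1_def
    by (rule has_vector_derivative_diff[OF Y[OF that] has_vector_derivative_at_within[OF kchart_has_derivative(1)[OF q]]])
  have cW: "continuous_on {0..2*pi} (\<lambda>t. (1/\<epsilon>) *\<^sub>R W t)"
    by (intro continuous_intros continuous_on_vector_derivative[OF dW])
  have wt: "apply_bcontfun w t = (1/\<epsilon>) *\<^sub>R W t" if "t \<in> {0..2*pi}" for t
    unfolding w_def W_def[symmetric] by (rule mkC_eq[OF cW that])
  show eq: "kchart (q, t) + \<epsilon> *\<^sub>R apply_bcontfun w t = Y t" if "t \<in> {0..2*pi}" for t
    using e by (simp add: wt[OF that] W_def)
  show dom: "((w, (q, (s/\<epsilon>, 0))), \<epsilon>) \<in> dom"
    unfolding dom_def GamW_def evc_def using eq off q by simp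
  have f: "force H \<epsilon> (Y t) = kepler_force (kchart (q, t)) + \<epsilon> *\<^sub>R apply_bcontfun (Nmap X) t" if t: "t \<in> {0..2*pi}" for t
  proof -
    have n: "kchart (q, t) \<noteq> 0" by (rule kchart_nonzero[OF q])
    have "kchart (q, t) + \<epsilon> *\<^sub>R apply_bcontfun w t \<noteq> 0" using off[OF t] by (simp add: off_axes_def eq[OF t])
    from force_quotient[OF n this]
    have "kepler_force (Y t) = kepler_force (kchart (q, t)) + \<epsilon> *\<^sub>R force_quotient (kchart (q, t)) (apply_bcontfun w t) \<epsilon>"
      unfolding eq[OF t] .
    moreover have "apply_bcontfun (Nmap X) t = force_quotient (kchart (q, t)) (apply_bcontfun w t) \<epsilon> + pair_force H (Y t)"
      using Nmap_apply[OF dom t] eq[OF t] by (simp add: X_def Gam_def evc_def Let_def)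
    ultimately show ?thesis by (simp add: force_def scaleR_add_right)
  qed
  have dW1: "((\<lambda>t. (1/\<epsilon>) *\<^sub>R W1 t) has_vector_derivative apply_bcontfun (Nmap X) t) (at t within {0..2*pi})" if t: "t \<in> {0..2*pi}" for t
  proof -
    have "(W1 has_vector_derivative \<epsilon> *\<^sub>R apply_bcontfun (Nmap X) t) (at t within {0..2*pi})"
      unfolding W1_def
      using has_vector_derivative_diff[OF Y1[OF t] has_vector_derivative_at_within[OF kchart_has_derivative(2)[OF q]]] by (simp add: f[OF t])
    from bounded_linear.has_vector_derivative[OF bounded_linear_scaleR_right this, of "1/\<epsilon>"] show ?thesis using e by simp
  qed
  have W10: "(1/\<epsilon>) *\<^sub>R W1 0 = b" by (simp add: W1_def start scaleR_add_left b_def)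
  have kp: "kchart (q, 2*pi) = kchart (q, 0)" "kvel (q, 2*pi) = kvel (q, 0)"
    using kchart_periodic[OF q, of 0] kvel_periodic[OF q, of 0] by simp_all
  have end1: "W (2*pi) = 0" "W1 (2*pi) = W1 0" "W 0 = 0" by (simp_all add: W_def W1_def closed kp start)
  have I1: "apply_bcontfun (blinfun_apply IC (Nmap X)) t = (1/\<epsilon>) *\<^sub>R W1 t - b" if t: "t \<in> {0..2*pi}" for t
  proof -
    have "(apply_bcontfun (Nmap X) has_integral (1/\<epsilon>) *\<^sub>R W1 t - (1/\<epsilon>) *\<^sub>R W1 0) {0..t}"
      by (rule fundamental_theorem_of_calculus)
        (use t in \<open>auto intro!: has_vector_derivative_within_subset[OF dW1]\<close>)
    then show ?thesis by (simp add: IC_apply[OF t] integral_unique W10)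
  qed
  have I2: "integral {0..t} (apply_bcontfun (blinfun_apply IC (Nmap X))) = (1/\<epsilon>) *\<^sub>R W t - t *\<^sub>R b" if t: "t \<in> {0..2*pi}" for t
  proof -
    have "((\<lambda>t. (1/\<epsilon>) *\<^sub>R W t - t *\<^sub>R b) has_vector_derivative apply_bcontfun (blinfun_apply IC (Nmap X)) s) (at s within {0..t})" if s: "s \<in> {0..t}" for s
    proof -
      have s': "s \<in> {0..2*pi}" using s t by auto
      have "((\<lambda>t. (1/\<epsilon>) *\<^sub>R W t - t *\<^sub>R b) has_vector_derivative apply_bcontfun (blinfun_apply IC (Nmap X)) s) (at s within {0..2*pi})"
        unfolding I1[OF s']
        using has_vector_derivative_diff[OF bounded_linear.has_vector_derivative[OF bounded_linear_scaleR_right dW[OF s']]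
            has_vector_derivative_scaleR[OF DERIV_ident has_vector_derivative_const], of "1/\<epsilon>" b] by simp
      then show ?thesis by (rule has_vector_derivative_within_subset) (use t in auto)
    qed
    then have "(apply_bcontfun (blinfun_apply IC (Nmap X)) has_integral ((1/\<epsilon>) *\<^sub>R W t - t *\<^sub>R b) - ((1/\<epsilon>) *\<^sub>R W 0 - 0 *\<^sub>R b)) {0..t}"
      by (rule fundamental_theorem_of_calculus[rotated]) (use t in auto)
    then show ?thesis by (simp add: integral_unique end1)
  qed
  have "blinfun_apply IC (blinfun_apply IC (Nmap X)) = mkC (\<lambda>t. (1/\<epsilon>) *\<^sub>R W t - t *\<^sub>R b)"
    unfolding IC_mkC by (rule mkC_cong) (rule I2[unfolded IC_mkC])
  also have "\<dots> = w - lin b"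
    unfolding w_def W_def[symmetric] lin_def by (rule mkC_diff[OF cW]) (intro continuous_intros)
  finally have "w - (s/\<epsilon>) *\<^sub>R lin (kvel (q, 0)) - blinfun_apply IC (blinfun_apply IC (Nmap X)) = 0"
    using bounded_linear_lin by (simp add: b_def linear_simps)
  moreover have "apply_bcontfun (blinfun_apply IC (Nmap X)) (2*pi) = 0" using I1[of "2*pi"] W10 by (simp add: end1)
  moreover have "apply_bcontfun w (2*pi) = 0" by (simp add: wt end1)
  ultimately show "Fmap ((w, (q, (s/\<epsilon>, 0))), \<epsilon>) = 0"
    unfolding Fmap_def X_def by (simp add: Let_def zero_prod_def)
qed

end

context nondegenerate_circular
begin

text \<open>The difference from the base solution solves the linearised boundary value problem up to
  residuals of relative size \<open>\<eta>\<close>, so \<open>linear_bound\<close> applies. The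
  residuals contain the unknown norms of \<open>w\<close> and \<open>\<sigma>\<close>, and therefore
  the estimated quantity reappears on the right; for small \<open>\<eta>\<close> it can be absorbed.
  No bound on \<open>w\<close> in terms of \<open>\<epsilon>\<close> is presupposed, which makes the
  result uniform in \<open>\<epsilon>\<close>.\<close>

lemma solution_near_base:
  obtains Q where "Q > 0"
    "\<And>w q \<sigma> \<epsilon> \<eta>. ((w, (q, (\<sigma>, 0))), \<epsilon>) \<in> dom \<Longrightarrow> Fmap ((w, (q, (\<sigma>, 0))), \<epsilon>) = 0 \<Longrightarrow> \<epsilon> \<noteq> 0 \<Longrightarrow>
      norm (kvel (q, 0) - B) \<le> \<eta> \<Longrightarrow>
      (\<And>t. t \<in> {0..2*pi} \<Longrightarrow> norm (kepler_force (kchart (q, t) + \<epsilon> *\<^sub>R apply_bcontfun w t) - kepler_force (kchart (q, t))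
         - blinfun_apply (kepler_force' (u0 t)) (\<epsilon> *\<^sub>R apply_bcontfun w t)) \<le> \<eta> * norm (\<epsilon> *\<^sub>R apply_bcontfun w t)) \<Longrightarrow>
      (\<And>t. t \<in> {0..2*pi} \<Longrightarrow> norm (pair_force H (kchart (q, t) + \<epsilon> *\<^sub>R apply_bcontfun w t) - pair_force H (u0 t)) \<le> \<eta>) \<Longrightarrow>
      norm (w - w0) + \<bar>\<sigma> - \<sigma>0\<bar> \<le> Q * \<eta> * (norm (w - w0) + \<bar>\<sigma> - \<sigma>0\<bar> + (norm w0 + \<bar>\<sigma>0\<bar> + 1))"
proof -
  obtain C where C: "C > 0" "\<And>z s. norm z + \<bar>s\<bar> \<le> C * (norm (z - s *\<^sub>R lin B - blinfun_apply IC (blinfun_apply IC (blinfun_apply Mop z)))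
      + norm (apply_bcontfun (blinfun_apply IC (blinfun_apply Mop z)) (2*pi)) + norm (apply_bcontfun z (2*pi)))"
    by (rule linear_bound) blast
  obtain L where L: "L > 0" "\<And>v. norm (lin v) \<le> norm v * L"
    using bounded_linear.pos_bounded[OF bounded_linear_lin] by blast
  define k where "k = norm (IC :: loopC \<Rightarrow>\<^sub>L loopC)"
  have k: "norm (blinfun_apply IC h) \<le> k * norm h" for h :: loopC unfolding k_def by (rule norm_blinfun)
  have k0: "k \<ge> 0" by (simp add: k_def)
  define K where "K = L + k * k + k"
  have K0: "K > 0" using L(1) k0 by (simp add: K_def add_pos_nonneg)
  show thesis
  proof (rule that[of "C * K"])
    show "0 < C * K" using C(1) K0 by simp
    fix w q \<sigma> \<epsilon> \<eta>
    assume dom: "((w, (q, (\<sigma>, 0))), \<epsilon>) \<in> dom" and F: "Fmap ((w, (q, (\<sigma>, 0))), \<epsilon>) = 0" and e: "\<epsilon> \<noteq> 0"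
      and v: "norm (kvel (q, 0) - B) \<le> \<eta>"
      and kf: "\<And>t. t \<in> {0..2*pi} \<Longrightarrow> norm (kepler_force (kchart (q, t) + \<epsilon> *\<^sub>R apply_bcontfun w t) - kepler_force (kchart (q, t))
         - blinfun_apply (kepler_force' (u0 t)) (\<epsilon> *\<^sub>R apply_bcontfun w t)) \<le> \<eta> * norm (\<epsilon> *\<^sub>R apply_bcontfun w t)"
      and pf: "\<And>t. t \<in> {0..2*pi} \<Longrightarrow> norm (pair_force H (kchart (q, t) + \<epsilon> *\<^sub>R apply_bcontfun w t) - pair_force H (u0 t)) \<le> \<eta>"
    have \<eta>: "\<eta> \<ge> 0" using order_trans[OF norm_ge_zero v] .
    define X where "X = ((w, (q, (\<sigma>, 0 :: real))), \<epsilon>)"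
    define g where "g = Nmap X"
    \<comment> \<open>The deviation of the true right side from the linearised one with the pair
      force frozen on the circle.\<close>
    define R where "R = g - blinfun_apply Mop w - pfu"
    have q: "q \<in> disc4" using dom_disc[OF dom] by simp
    have W: "w - \<sigma> *\<^sub>R lin (kvel (q, 0)) - blinfun_apply IC (blinfun_apply IC g) = 0"
      "apply_bcontfun (blinfun_apply IC g) (2*pi) = 0" "apply_bcontfun w (2*pi) = 0"
      using F unfolding Fmap_def X_def[symmetric] g_def[symmetric] by (simp_all add: X_def Let_def zero_prod_def)
    have Rt: "norm (apply_bcontfun R t) \<le> \<eta> * (norm w + 1)" if t: "t \<in> {0..2*pi}" for t
    proof -
      define x y where "x = kchart (q, t)" and "y = apply_bcontfun w t"
      have gt: "apply_bcontfun g t = force_quotient x y \<epsilon> + pair_force H (x + \<epsilon> *\<^sub>R y)"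
        using Nmap_apply[OF dom t] by (simp add: g_def X_def Gam_def evc_def Let_def x_def y_def)
      have "x + \<epsilon> *\<^sub>R y \<in> off_axes H" using dom t by (simp add: dom_def GamW_def evc_def x_def y_def)
      then have n: "x \<noteq> 0" "x + \<epsilon> *\<^sub>R y \<noteq> 0" using kchart_nonzero[OF q] by (auto simp: x_def off_axes_def)
      have "\<epsilon> *\<^sub>R (force_quotient x y \<epsilon> - blinfun_apply (kepler_force' (u0 t)) y) =
          kepler_force (x + \<epsilon> *\<^sub>R y) - kepler_force x - blinfun_apply (kepler_force' (u0 t)) (\<epsilon> *\<^sub>R y)"
        by (simp add: force_quotient[OF n] scaleR_diff_right blinfun.scaleR_right)
      then have "\<bar>\<epsilon>\<bar> * norm (force_quotient x y \<epsilon> - blinfun_apply (kepler_force' (u0 t)) y) \<le> \<bar>\<epsilon>\<bar> * (\<eta> * norm y)"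
        using kf[OF t, folded x_def y_def] by (metis norm_scaleR mult.left_commute)
      then have 1: "norm (force_quotient x y \<epsilon> - blinfun_apply (kepler_force' (u0 t)) y) \<le> \<eta> * norm y" using e by simp
      have 2: "apply_bcontfun R t = (force_quotient x y \<epsilon> - blinfun_apply (kepler_force' (u0 t)) y) + (pair_force H (x + \<epsilon> *\<^sub>R y) - pair_force H (u0 t))"
        by (simp add: R_def minus_bcontfun.rep_eq gt Mop_apply[OF t] pfu_apply[OF t] y_def)
      have "norm (apply_bcontfun R t) \<le> \<eta> * norm y + \<eta>"
        unfolding 2 by (rule order_trans[OF norm_triangle_ineq add_mono[OF 1 pf[OF t, folded x_def y_def]]])
      also have "\<dots> \<le> \<eta> * norm w + \<eta>" using mult_left_mono[OF norm_bounded[of w t] \<eta>] by (simp add: y_def)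
      finally show ?thesis by (simp add: distrib_left)
    qed
    \<comment> \<open>The pointwise bound holds on one period only. Each of the three summands is
      constant outside it, so the bound extends to the norm over the line.\<close>
    have clipR: "R = mkC (apply_bcontfun R)"
    proof -
      have "g = mkC (apply_bcontfun g)"
        unfolding g_def Nmap_def[of X] by (rule mkC_cong) (simp add: Nmap_apply[OF dom[folded X_def], unfolded Nmap_def])
      moreover have "blinfun_apply Mop w = mkC (apply_bcontfun (blinfun_apply Mop w))"
        unfolding Mop_mkC[of w] by (rule mkC_cong) (simp add: Mop_apply[unfolded Mop_mkC])
      moreover have "pfu = mkC (apply_bcontfun pfu)"
        unfolding pfu_def by (rule mkC_cong) (simp add: pfu_apply[unfolded pfu_def])
      moreover have "mkC (apply_bcontfun R) = mkC (apply_bcontfun g) - mkC (apply_bcontfun (blinfun_apply Mop w)) - mkC (apply_bcontfun pfu)"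
        unfolding R_def minus_bcontfun.rep_eq
        by (subst mkC_diff; (intro continuous_intros)?; simp?) (subst mkC_diff; simp)
      ultimately show ?thesis unfolding R_def by metis
    qed
    have nR: "norm R \<le> \<eta> * (norm w + 1)" by (subst clipR, rule norm_mkC) (use Rt in \<open>auto intro: continuous_intros\<close>)
    define z s where "z = w - w0" and "s = \<sigma> - \<sigma>0"
    have l: "lin (\<sigma>0 *\<^sub>R B) = \<sigma>0 *\<^sub>R lin B" "lin (kvel (q, 0) - B) = lin (kvel (q, 0)) - lin B"
      using bounded_linear_lin by (simp_all add: linear_simps)
    \<comment> \<open>Subtracting the equation of \<open>w0\<close> leaves two error terms: one from
      the velocity of the ellipse in place of \<open>B\<close>, the other from
      \<open>R\<close>.\<close>
    have eq1: "z - s *\<^sub>R lin B - blinfun_apply IC (blinfun_apply IC (blinfun_apply Mop z)) =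
        \<sigma> *\<^sub>R lin (kvel (q, 0) - B) + blinfun_apply IC (blinfun_apply IC R)"
      using W(1) w0_eq unfolding z_def s_def R_def l h0_def
      by (simp add: blinfun.bilinear_simps algebra_simps)
    have eq2: "apply_bcontfun (blinfun_apply IC (blinfun_apply Mop z)) (2*pi) = - apply_bcontfun (blinfun_apply IC R) (2*pi)"
      using W(2) w0_end(2) unfolding z_def R_def h0_def
      by (simp add: blinfun.bilinear_simps minus_bcontfun.rep_eq plus_bcontfun.rep_eq neg_eq_iff_add_eq_0 add.commute)
    have eq3: "apply_bcontfun z (2*pi) = 0" by (simp add: z_def minus_bcontfun.rep_eq W(3) w0_end(1))
    have kk: "norm (blinfun_apply IC (blinfun_apply IC R)) \<le> k * (k * norm R)"
      by (rule order_trans[OF k mult_left_mono[OF k k0]])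
    have b1: "norm (\<sigma> *\<^sub>R lin (kvel (q, 0) - B) + blinfun_apply IC (blinfun_apply IC R)) \<le> \<bar>\<sigma>\<bar> * (\<eta> * L) + k * (k * norm R)"
    proof (rule order_trans[OF norm_triangle_ineq add_mono[OF _ kk]])
      have "norm (lin (kvel (q, 0) - B)) \<le> \<eta> * L" by (rule order_trans[OF L(2) mult_right_mono[OF v]]) (use L(1) in simp)
      then show "norm (\<sigma> *\<^sub>R lin (kvel (q, 0) - B)) \<le> \<bar>\<sigma>\<bar> * (\<eta> * L)" by (simp add: mult_left_mono)
    qed
    have b2: "norm (apply_bcontfun (blinfun_apply IC R) (2*pi)) \<le> k * norm R"
      by (rule order_trans[OF norm_bounded k])
    have "norm z + \<bar>s\<bar> \<le> C * (\<bar>\<sigma>\<bar> * (\<eta> * L) + k * (k * norm R) + k * norm R)"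
      using C(2)[of z s] unfolding eq1 eq2 eq3
      by (rule order_trans) (intro mult_left_mono, use b1 b2 C(1) in auto)
    also have "\<dots> = C * (\<bar>\<sigma>\<bar> * (\<eta> * L) + (k * k + k) * norm R)" by (simp add: algebra_simps)
    also have "\<dots> \<le> C * (\<bar>\<sigma>\<bar> * (\<eta> * K) + K * (\<eta> * (norm w + 1)))"
      using C(1) \<eta> L(1) k0 nR by (intro mult_left_mono add_mono mult_mono) (auto simp: K_def)
    also have "\<dots> = C * K * \<eta> * (\<bar>\<sigma>\<bar> + (norm w + 1))" by (simp add: algebra_simps)
    also have "\<dots> \<le> C * K * \<eta> * (norm z + \<bar>s\<bar> + (norm w0 + \<bar>\<sigma>0\<bar> + 1))"
    proof (rule mult_left_mono)
      have "norm w \<le> norm w0 + norm z" unfolding z_def by (rule norm_triangle_sub)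
      moreover have "\<bar>\<sigma>\<bar> \<le> \<bar>\<sigma>0\<bar> + \<bar>s\<bar>" unfolding s_def by linarith
      ultimately show "\<bar>\<sigma>\<bar> + (norm w + 1) \<le> norm z + \<bar>s\<bar> + (norm w0 + \<bar>\<sigma>0\<bar> + 1)" by linarith
    qed (use C(1) K0 \<eta> in auto)
    finally show "norm (w - w0) + \<bar>\<sigma> - \<sigma>0\<bar> \<le> C * K * \<eta> * (norm (w - w0) + \<bar>\<sigma> - \<sigma>0\<bar> + (norm w0 + \<bar>\<sigma>0\<bar> + 1))"
      by (simp add: z_def s_def)
  qed
qed

end

context nondegenerate_circular
begin

text \<open>All radii are fixed by compactness along the circular orbit before
  \<open>\<epsilon>\<close> and the critical point are given, so one neighbourhood serves every
  \<open>\<epsilon>\<close>. A time shift is found by the intermediate value theorem for the chart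
  phase; the shifted loop solves the rescaled problem and lies within the radius \<open>r\<close> of
  uniqueness.\<close>

lemma branch_locally_unique:
  fixes u :: "real \<Rightarrow> H2_loop"
  assumes r: "r > 0" and uniq: "\<And>x \<epsilon>. \<bar>\<epsilon>\<bar> < \<epsilon>2 \<Longrightarrow> norm (x - x0) < r \<Longrightarrow> Fmap (x, \<epsilon>) = 0 \<Longrightarrow> x = X \<epsilon>"
    and arc: "\<And>\<epsilon> t. \<bar>\<epsilon>\<bar> < \<epsilon>2 \<Longrightarrow> t \<in> {0..2*pi} \<Longrightarrow>
      loop (u \<epsilon>) t = kchart (fst (snd (X \<epsilon>)), t) + \<epsilon> *\<^sub>R apply_bcontfun (fst (X \<epsilon>)) t"
    and base: "loop (u 0) = u0"
  shows "\<exists>U. open U \<and> u 0 \<in> U \<and> (\<forall>\<epsilon>\<in>{0<..<\<epsilon>2}. \<forall>v\<in>U. critical_point H \<epsilon> v \<longrightarrow>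
    (\<exists>\<phi>::real. \<forall>\<tau>. loop v \<tau> = loop (u \<epsilon>) (\<tau> + \<phi>)))"
proof -
  obtain Q where Q: "Q > 0"
    "\<And>w q \<sigma> \<epsilon> \<eta>. ((w, (q, (\<sigma>, 0))), \<epsilon>) \<in> dom \<Longrightarrow> Fmap ((w, (q, (\<sigma>, 0))), \<epsilon>) = 0 \<Longrightarrow> \<epsilon> \<noteq> 0 \<Longrightarrow>
      norm (kvel (q, 0) - B) \<le> \<eta> \<Longrightarrow>
      (\<And>t. t \<in> {0..2*pi} \<Longrightarrow> norm (kepler_force (kchart (q, t) + \<epsilon> *\<^sub>R apply_bcontfun w t) - kepler_force (kchart (q, t))
         - blinfun_apply (kepler_force' (u0 t)) (\<epsilon> *\<^sub>R apply_bcontfun w t)) \<le> \<eta> * norm (\<epsilon> *\<^sub>R apply_bcontfun w t)) \<Longrightarrow>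
      (\<And>t. t \<in> {0..2*pi} \<Longrightarrow> norm (pair_force H (kchart (q, t) + \<epsilon> *\<^sub>R apply_bcontfun w t) - pair_force H (u0 t)) \<le> \<eta>) \<Longrightarrow>
      norm (w - w0) + \<bar>\<sigma> - \<sigma>0\<bar> \<le> Q * \<eta> * (norm (w - w0) + \<bar>\<sigma> - \<sigma>0\<bar> + (norm w0 + \<bar>\<sigma>0\<bar> + 1))"
    by (rule solution_near_base) blast
  define D where "D = norm w0 + \<bar>\<sigma>0\<bar> + 1"
  have D: "D > 0" by (simp add: D_def add_nonneg_pos)
  \<comment> \<open>The first bound lets half of \<open>Z\<close> absorb the term in which
    \<open>Z\<close> reappears, and the second makes the remaining term at most \<open>r/8\<close>,
    so that \<open>Z\<close> is at most \<open>r/4\<close>.\<close>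
  define \<eta> where "\<eta> = min (1 / (2 * Q)) (r / (8 * Q * D))"
  have \<eta>: "\<eta> > 0" "Q * \<eta> \<le> 1/2" "Q * \<eta> * D \<le> r / 8"
  proof -
    show "\<eta> > 0" using Q(1) D r by (simp add: \<eta>_def)
    have "Q * \<eta> \<le> Q * (1 / (2 * Q))" using Q(1) by (intro mult_left_mono) (auto simp: \<eta>_def)
    then show "Q * \<eta> \<le> 1/2" using Q(1) by simp
    have "Q * D * \<eta> \<le> Q * D * (r / (8 * Q * D))" using Q(1) D by (intro mult_left_mono) (auto simp: \<eta>_def)
    then show "Q * \<eta> * D \<le> r / 8" using Q(1) D by (simp add: mult_ac)
  qed
  obtain \<rho>1 where \<rho>1: "\<rho>1 > 0" "\<And>t x W. t \<in> {0..2*pi} \<Longrightarrow> norm (x - u0 t) < \<rho>1 \<Longrightarrow> norm (x + W - u0 t) < \<rho>1 \<Longrightarrow>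
     norm (kepler_force (x + W) - kepler_force x - blinfun_apply (kepler_force' (u0 t)) W) \<le> \<eta> * norm W"
    by (rule kepler_force_near_orbit[OF \<eta>(1)]) blast
  obtain \<rho>2 where \<rho>2: "\<rho>2 > 0" "\<And>k x. k \<in> u0 ` {0..2*pi} \<Longrightarrow> norm (x - k) < \<rho>2 \<Longrightarrow> x \<in> off_axes H \<and> norm (pair_force H x - pair_force H k) < \<eta>"
    by (rule uniform_near_compact[OF compact_orbit open_off_axes _ C1_on_continuous[OF C1_on_pair_force] \<eta>(1)])
      (use avoids in auto)
  define \<rho> where "\<rho> = min \<rho>1 \<rho>2"
  have \<rho>: "\<rho> > 0" "\<rho> \<le> \<rho>1" "\<rho> \<le> \<rho>2" using \<rho>1(1) \<rho>2(1) by (auto simp: \<rho>_def)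
  have dU: "open (disc4 \<times> (UNIV :: real set))" by (intro open_Times open_disc4 open_UNIV)
  have cp: "compact ({p} \<times> {0..2*pi})" by (intro compact_Times compact_Icc) simp
  have cps: "{p} \<times> {0..2*pi} \<subseteq> disc4 \<times> UNIV" using p_disc by auto
  obtain \<rho>3 where \<rho>3: "\<rho>3 > 0" "\<And>k x. k \<in> {p} \<times> {0..2*pi} \<Longrightarrow> norm (x - k) < \<rho>3 \<Longrightarrow> x \<in> disc4 \<times> UNIV \<and> norm (kchart x - kchart k) < \<rho>"
    by (rule uniform_near_compact[OF cp dU cps C1_on_continuous[OF C2_on_imp_C1_on[OF C2_on_kchart]] \<rho>(1)]) blast
  obtain \<rho>4 where \<rho>4: "\<rho>4 > 0" "\<And>k x. k \<in> {p} \<times> {0..2*pi} \<Longrightarrow> norm (x - k) < \<rho>4 \<Longrightarrow> x \<in> disc4 \<times> UNIV \<and> norm (kvel x - kvel k) < \<eta>"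
    by (rule uniform_near_compact[OF cp dU cps C1_on_continuous[OF C2_on_imp_C1_on[OF C2_on_kvel]] \<eta>(1)]) blast
  have \<rho>h: "\<rho> / 2 > 0" using \<rho>(1) by simp
  obtain \<rho>5 where \<rho>5: "\<rho>5 > 0" "\<And>k x. k \<in> {0..2*pi} \<Longrightarrow> norm (x - k) < \<rho>5 \<Longrightarrow> x \<in> UNIV \<and> norm (u0 x - u0 k) < \<rho> / 2"
    by (rule uniform_near_compact[OF compact_Icc open_UNIV subset_UNIV cu0 \<rho>h]) blast
  obtain V g where V: "open V" "continuous_on V g"
    "\<And>z. z \<in> V \<Longrightarrow> fst (g z) \<in> disc4 \<and> kchart (fst (g z), fst (snd (g z))) = fst z
       \<and> (1 + snd (snd (g z))) *\<^sub>R kvel (fst (g z), fst (snd (g z))) = snd z"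
    "\<exists>\<eta>>0. \<forall>\<tau>. \<bar>\<tau>\<bar> < \<eta> \<longrightarrow> (u0 \<tau>, v0 \<tau>) \<in> V \<and> g (u0 \<tau>, v0 \<tau>) = (p, (\<tau>, 0 :: real))"
    by (rule state_chart) blast
  obtain \<eta>1 where \<eta>1: "\<eta>1 > 0" "\<And>\<tau>. \<bar>\<tau>\<bar> < \<eta>1 \<Longrightarrow> (u0 \<tau>, v0 \<tau>) \<in> V \<and> g (u0 \<tau>, v0 \<tau>) = (p, (\<tau>, 0))"
    using V(4) by blast
  \<comment> \<open>Half of each radius, so that for shifts in the closed interval
    \<open>{-a..a}\<close> the chart inverse is known on the circle and \<open>u0\<close> moves by
    less than \<open>\<rho> / 2\<close>.\<close>
  define a where "a = min (\<eta>1 / 2) (\<rho>5 / 2)"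
  have a: "a > 0" "a < \<eta>1" "a < \<rho>5" using \<eta>1(1) \<rho>5(1) by (auto simp: a_def)
  define \<theta> where "\<theta> = min a (min (min \<rho>3 \<rho>4) (r / 4))"
  have \<theta>: "\<theta> > 0" "\<theta> \<le> a" "\<theta> \<le> \<rho>3" "\<theta> \<le> \<rho>4" "\<theta> \<le> r / 4" using a \<rho>3(1) \<rho>4(1) r by (auto simp: \<theta>_def)
  have cst: "compact ((\<lambda>\<tau>. (u0 \<tau>, v0 \<tau>)) ` {-a..a})"
    by (intro compact_continuous_image continuous_intros cu0 cv0) simp
  have sst: "(\<lambda>\<tau>. (u0 \<tau>, v0 \<tau>)) ` {-a..a} \<subseteq> V" using \<eta>1(2) a by auto
  obtain \<rho>6 where \<rho>6: "\<rho>6 > 0" "\<And>k x. k \<in> (\<lambda>\<tau>. (u0 \<tau>, v0 \<tau>)) ` {-a..a} \<Longrightarrow> norm (x - k) < \<rho>6 \<Longrightarrow> x \<in> V \<and> norm (g x - g k) < \<theta>"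
    by (rule uniform_near_compact[OF cst V(1) sst V(2) \<theta>(1)]) blast
  \<comment> \<open>Position and velocity each deviate by less than 15 times
    \<open>\<delta>\<close>, the constant of \<open>sobolev\<close>, so together by less than 30
    times; dividing by 31 keeps the inequalities strict.\<close>
  define \<delta> where "\<delta> = min (\<rho>6 / 31) (\<rho> / 31)"
  have \<delta>: "\<delta> > 0" "30 * \<delta> < \<rho>6" "15 * \<delta> < \<rho> / 2" using \<rho>6(1) \<rho>(1) by (auto simp: \<delta>_def)
  show ?thesis
  proof (intro exI[of _ "ball (u 0) \<delta>"] conjI ballI impI)
    fix \<epsilon> v assume "\<epsilon> \<in> {0<..<\<epsilon>2}"
    then have e: "0 < \<epsilon>" "\<epsilon> < \<epsilon>2" by auto
    assume vU: "v \<in> ball (u 0) \<delta>" and crit: "critical_point H \<epsilon> v"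
    define y y1 where "y = loop v" and "y1 = velocity (loop v)"
    have vcf: "v \<in> collision_free H" using crit by (simp add: critical_point_def)
    have dy: "(y has_vector_derivative y1 t) (at t)" for t unfolding y_def y1_def by (rule loop_has_velocity)
    have dy1: "(y1 has_vector_derivative force H \<epsilon> (y t)) (at t)" for t
      unfolding y_def y1_def by (rule critical_point_newton[OF crit])
    have vel0: "velocity (loop (u 0)) t = v0 t" for t unfolding base by (rule velocity_unique[OF u0_has_derivative(1)])
    have nd: "norm (v - u 0) < \<delta>" using vU by (simp add: dist_norm norm_minus_commute)
    have ny: "norm (y t - u0 t) < 15 * \<delta>" for t
    proof -
      have "norm (loop (v - u 0) t) \<le> 15 * norm (v - u 0)" by (rule sobolev(1))
      then show ?thesis using nd by (simp add: loop_diff base y_def)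
    qed
    have ny1: "norm (y1 t - v0 t) < 15 * \<delta>" for t
    proof -
      have "velocity (loop (v - u 0)) t = velocity (loop v) t - velocity (loop (u 0)) t"
        using velocity_loop_add[of "v - u 0" "u 0" t] by simp
      moreover have "norm (velocity (loop (v - u 0)) t) \<le> 15 * norm (v - u 0)" by (rule sobolev(2))
      ultimately show ?thesis using nd by (simp add: vel0 y1_def)
    qed
    have state: "(y \<tau>, y1 \<tau>) \<in> V \<and> norm (g (y \<tau>, y1 \<tau>) - (p, (\<tau>, 0))) < \<theta>" if \<tau>: "\<tau> \<in> {-a..a}" for \<tau>
    proof -
      have "norm ((y \<tau>, y1 \<tau>) - (u0 \<tau>, v0 \<tau>)) \<le> norm (y \<tau> - u0 \<tau>) + norm (y1 \<tau> - v0 \<tau>)" by (simp add: norm_Pair_le)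
      also have "\<dots> < \<rho>6" using ny[of \<tau>] ny1[of \<tau>] \<delta>(2) by linarith
      finally have "(y \<tau>, y1 \<tau>) \<in> V \<and> norm (g (y \<tau>, y1 \<tau>) - g (u0 \<tau>, v0 \<tau>)) < \<theta>" by (intro \<rho>6(2)) (use \<tau> in auto)
      moreover have "\<bar>\<tau>\<bar> < \<eta>1" using \<tau> a by auto
      ultimately show ?thesis using \<eta>1(2)[of \<tau>] by simp
    qed
    define ph where "ph \<tau> = fst (snd (g (y \<tau>, y1 \<tau>)))" for \<tau>
    have ph: "\<bar>ph \<tau> - \<tau>\<bar> < \<theta>" if "\<tau> \<in> {-a..a}" for \<tau>
    proof -
      have "norm (fst (snd (g (y \<tau>, y1 \<tau>) - (p, (\<tau>, 0))))) \<le> norm (g (y \<tau>, y1 \<tau>) - (p, (\<tau>, 0)))"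
        by (rule order_trans[OF norm_fst_snd_le(1) norm_fst_snd_le(2)])
      then show ?thesis using state[OF that] by (simp add: ph_def)
    qed
    have cy: "continuous_on {-a..a} y" "continuous_on {-a..a} y1"
      by (rule continuous_on_vector_derivative; rule has_vector_derivative_at_within; rule dy dy1)+
    have cph: "continuous_on {-a..a} ph"
      unfolding ph_def
      by (intro continuous_on_fst continuous_on_snd continuous_on_compose2[OF V(2)] continuous_on_Pair cy) (use state in auto)
    \<comment> \<open>The phase \<open>ph\<close> differs from the identity by less than
      \<open>\<theta>\<close>, which is at most \<open>a\<close>, so it changes sign on the
      interval. At its zero the loop passes through the point of its ellipse with chart time
      0.\<close>
    have "ph (-a) \<le> 0" "0 \<le> ph a" using ph[of "-a"] ph[of a] a \<theta> by auto
    then obtain \<tau> where \<tau>: "\<tau> \<in> {-a..a}" "ph \<tau> = 0"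
      using IVT'[of ph "-a" 0 a, OF _ _ _ cph] a by auto
    define q s where "q = fst (g (y \<tau>, y1 \<tau>))" and "s = snd (snd (g (y \<tau>, y1 \<tau>)))"
    have g: "q \<in> disc4" "kchart (q, 0) = y \<tau>" "(1 + s) *\<^sub>R kvel (q, 0) = y1 \<tau>"
      using V(3)[of "(y \<tau>, y1 \<tau>)"] state[OF \<tau>(1)] \<tau>(2) by (auto simp: q_def s_def ph_def)
    have qp: "norm (q - p) < \<theta>"
    proof -
      have "norm (fst (g (y \<tau>, y1 \<tau>) - (p, (\<tau>, 0)))) \<le> norm (g (y \<tau>, y1 \<tau>) - (p, (\<tau>, 0)))" by (rule norm_fst_snd_le(1))
      then show ?thesis using state[OF \<tau>(1)] by (simp add: q_def)
    qed
    define Y Y1 where "Y t = y (t + \<tau>)" and "Y1 t = y1 (t + \<tau>)" for t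
    have sh: "((\<lambda>t. t + \<tau>) has_vector_derivative 1) (at t)" for t by (auto intro!: derivative_eq_intros)
    have dY: "(Y has_vector_derivative Y1 t) (at t within S)" for t S
      unfolding Y_def Y1_def
      using vector_diff_chain_at[OF sh dy] by (simp add: o_def has_vector_derivative_at_within)
    have dY1: "(Y1 has_vector_derivative force H \<epsilon> (Y t)) (at t within S)" for t S
      unfolding Y_def Y1_def
      using vector_diff_chain_at[OF sh dy1] by (simp add: o_def has_vector_derivative_at_within)
    have Yoff: "Y t \<in> off_axes H" for t unfolding Y_def y_def by (rule collision_free_off_axes[OF vcf])
    have Y0: "Y 0 = kchart (q, 0)" "Y1 0 = (1 + s) *\<^sub>R kvel (q, 0)" by (simp_all add: Y_def Y1_def g)
    have Yp: "Y (2*pi) = Y 0" "Y1 (2*pi) = Y1 0"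
      using loop_periodic[of v \<tau>] velocity_periodic[of v \<tau>] by (simp_all add: Y_def Y1_def y_def y1_def add.commute)
    define w where "w = mkC (\<lambda>t. (1/\<epsilon>) *\<^sub>R (Y t - kchart (q, t)))"
    have e0: "\<epsilon> \<noteq> 0" using e by simp
    note S = arc_solves[OF dY dY1 Yoff g(1) e0 Y0 Yp, folded w_def]
    have qt: "norm ((q, t) - (p, t)) = norm (q - p)" for t :: real by (simp add: norm_Pair)
    have near: "norm (kchart (q, t) - u0 t) < \<rho>" "norm (Y t - u0 t) < \<rho>" if t: "t \<in> {0..2*pi}" for t
    proof -
      show "norm (kchart (q, t) - u0 t) < \<rho>"
        using \<rho>3(2)[of "(p, t)" "(q, t)"] t qp \<theta>(3) unfolding qt by (simp add: kchart_circ)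
      have "norm (u0 (t + \<tau>) - u0 t) < \<rho> / 2" using \<rho>5(2)[OF t, of "t + \<tau>"] \<tau>(1) a by auto
      moreover have "norm (y (t + \<tau>) - u0 (t + \<tau>)) < \<rho> / 2" using ny[of "t + \<tau>"] \<delta>(3) by simp
      ultimately have "norm ((y (t + \<tau>) - u0 (t + \<tau>)) + (u0 (t + \<tau>) - u0 t)) < \<rho>"
        by (intro order_le_less_trans[OF norm_triangle_ineq]) simp
      then show "norm (Y t - u0 t) < \<rho>" by (simp add: Y_def)
    qed
    define Z where "Z = norm (w - w0) + \<bar>s/\<epsilon> - \<sigma>0\<bar>"
    have "norm (w - w0) + \<bar>s/\<epsilon> - \<sigma>0\<bar> \<le> Q * \<eta> * (norm (w - w0) + \<bar>s/\<epsilon> - \<sigma>0\<bar> + (norm w0 + \<bar>\<sigma>0\<bar> + 1))"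
    proof (rule Q(2)[OF S(2,3) e0])
      have "norm (kvel (q, 0) - kvel (p, 0)) < \<eta>"
        using \<rho>4(2)[of "(p, 0)" "(q, 0)"] qp \<theta>(4) unfolding qt by simp
      then show "norm (kvel (q, 0) - B) \<le> \<eta>" by (simp add: kvel_circ v0_0)
      fix t assume t: "t \<in> {0..2*pi}"
      show "norm (kepler_force (kchart (q, t) + \<epsilon> *\<^sub>R apply_bcontfun w t) - kepler_force (kchart (q, t))
         - blinfun_apply (kepler_force' (u0 t)) (\<epsilon> *\<^sub>R apply_bcontfun w t)) \<le> \<eta> * norm (\<epsilon> *\<^sub>R apply_bcontfun w t)"
        by (rule \<rho>1(2)[OF t]) (use near[OF t] \<rho>(2) S(1)[OF t] in auto)
      show "norm (pair_force H (kchart (q, t) + \<epsilon> *\<^sub>R apply_bcontfun w t) - pair_force H (u0 t)) \<le> \<eta>"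
        unfolding S(1)[OF t] using \<rho>2(2)[of "u0 t" "Y t"] near(2)[OF t] \<rho>(3) t by auto
    qed
    then have "Z \<le> Q * \<eta> * Z + Q * \<eta> * D" by (simp add: Z_def D_def distrib_left)
    moreover have "Q * \<eta> * Z \<le> 1/2 * Z" using \<eta>(2) by (intro mult_right_mono) (auto simp: Z_def)
    ultimately have Z: "Z \<le> r / 4" using \<eta>(3) by linarith
    have "norm ((w, (q, (s/\<epsilon>, 0 :: real))) - x0) \<le> norm (w - w0) + (norm (q - p) + (\<bar>s/\<epsilon> - \<sigma>0\<bar> + 0))"
    proof -
      have "norm (s/\<epsilon> - \<sigma>0, 0 :: real) \<le> \<bar>s/\<epsilon> - \<sigma>0\<bar> + 0" by (simp add: norm_Pair)
      then have "norm (q - p, (s/\<epsilon> - \<sigma>0, 0 :: real)) \<le> norm (q - p) + (\<bar>s/\<epsilon> - \<sigma>0\<bar> + 0)"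
        by (rule order_trans[OF norm_Pair_le add_left_mono])
      then have "norm (w - w0, (q - p, (s/\<epsilon> - \<sigma>0, 0 :: real))) \<le> norm (w - w0) + (norm (q - p) + (\<bar>s/\<epsilon> - \<sigma>0\<bar> + 0))"
        by (rule order_trans[OF norm_Pair_le add_left_mono])
      then show ?thesis by (simp add: x0_def)
    qed
    also have "\<dots> < r" using Z qp \<theta>(5) r by (simp add: Z_def)
    finally have Xe: "(w, (q, (s/\<epsilon>, 0))) = X \<epsilon>" by (intro uniq) (use e S(3) in auto)
    have "loop v (t + \<tau>) - loop (u \<epsilon>) t = 0" for t
    proof (rule periodic_reduce[where f = "\<lambda>t. loop v (t + \<tau>) - loop (u \<epsilon>) t" and Q = "\<lambda>x. x = 0"])
      show "loop v (t + 2*pi + \<tau>) - loop (u \<epsilon>) (t + 2*pi) = loop v (t + \<tau>) - loop (u \<epsilon>) t" for t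
        using loop_periodic[of v "t + \<tau>"] loop_periodic[of "u \<epsilon>" t] by (simp add: add_ac)
      show "loop v (t + \<tau>) - loop (u \<epsilon>) t = 0" if t: "t \<in> {0..2*pi}" for t
        using arc[of \<epsilon> t] e t S(1)[OF t] unfolding Xe[symmetric] by (simp add: Y_def y_def)
    qed
    from this[of "t - \<tau>" for t] have "loop v t = loop (u \<epsilon>) (t + - \<tau>)" for t by simp
    then show "\<exists>\<phi>. \<forall>\<tau>. loop v \<tau> = loop (u \<epsilon>) (\<tau> + \<phi>)" by blast
  qed (use \<delta> in auto)
qed

end

section \<open>The $(n+1)$-body problem\<close>

context symmetry_group
begin

lemma kepler_force_H: "L \<in> H \<Longrightarrow> kepler_force (L *v x) = L *v kepler_force x"
  by (simp add: kepler_force_def norm_H matrix_vector_mult_scaleR linear_neg[OF matrix_vector_mul_linear])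

lemma kepler_force_minus: "kepler_force (- x) = - kepler_force x"
  by (simp add: kepler_force_def)

lemma pair_force_eq: "pair_force H x = (\<Sum>K\<in>H - {mat 1}. kepler_force (x - K *v x))"
  by (simp add: pair_force_def kepler_force_def sum_negf)

lemma left_translation:
  assumes "L \<in> H" shows "bij_betw ((**) L) H H" "bij_betw ((**) L) (H - {mat 1}) (H - {L})"
proof -
  have inj: "inj_on ((**) L) H"
    by (rule inj_onI) (metis assms matrix_mul_assoc matrix_mul_lid transpose_mult(1))
  have im: "(**) L ` H = H"
  proof
    show "(**) L ` H \<subseteq> H" using mult_H assms by blast
    show "H \<subseteq> (**) L ` H"
    proof
      fix K assume "K \<in> H"
      then have "transpose L ** K \<in> H" "K = L ** (transpose L ** K)"
        using mult_H transpose_H assms by (auto simp: matrix_mul_assoc transpose_mult(2))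
      then show "K \<in> (**) L ` H" by blast
    qed
  qed
  show 1: "bij_betw ((**) L) H H" using inj im by (simp add: bij_betw_def)
  have "(**) L ` (H - {mat 1}) = H - {L}"
    using inj_on_image_set_diff[OF inj, of H "{mat 1}"] one_H im by simp
  then show "bij_betw ((**) L) (H - {mat 1}) (H - {L})"
    using inj_on_subset[OF inj, of "H - {mat 1}"] by (auto simp: bij_betw_def)
qed

text \<open>Left translation permutes the orbit, so the sum is fixed by the whole group.\<close>

lemma sum_H_vector: "(\<Sum>L\<in>H. L *v x) = 0"
proof (rule no_fixed_vector)
  fix K assume K: "K \<in> H"
  have "K *v (\<Sum>L\<in>H. L *v x) = (\<Sum>L\<in>H. (K ** L) *v x)"
    by (simp add: linear_sum[OF matrix_vector_mul_linear] matrix_vector_mul_assoc)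
  also have "\<dots> = (\<Sum>L\<in>H. L *v x)"
    by (rule sum.reindex_bij_betw[OF left_translation(1)[OF K]])
  finally show "K *v (\<Sum>L\<in>H. L *v x) = (\<Sum>L\<in>H. L *v x)" .
qed

lemma orbit_injective:
  assumes x: "x \<in> off_axes H" shows "inj_on (\<lambda>L. L *v x) H"
proof (rule inj_onI)
  fix L K assume LK: "L \<in> H" "K \<in> H" "L *v x = K *v x"
  have "(transpose K ** L) *v x = x"
    using LK by (simp add: matrix_vector_mul_assoc[symmetric] transpose_vector_mult)
  moreover have "transpose K ** L \<in> H" using LK mult_H transpose_H by blast
  ultimately have "transpose K ** L = mat 1" using x unfolding off_axes_def mem_Collect_eq by (metis DiffI singletonD)
  then have "K ** (transpose K ** L) = K" by simp
  then show "L = K" using LK by (simp add: matrix_mul_assoc transpose_mult(2))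
qed

text \<open>Left translation by \<open>L\<close> carries the pair of particles with indices the
  identity and \<open>K\<close> to the pair \<open>L\<close>, \<open>L ** K\<close>. The force on
  particle \<open>L\<close> is thus the image under \<open>L\<close> of the reduced force.\<close>

lemma force_on_particle:
  assumes L: "L \<in> H" and e: "\<epsilon> \<noteq> 0"
  shows "(1/\<epsilon>) *\<^sub>R (L *v force H \<epsilon> x) = (1/\<epsilon>) *\<^sub>R kepler_force (L *v x) + (\<Sum>K\<in>H - {L}. kepler_force (L *v x - K *v x))"
proof -
  have "L *v pair_force H x = (\<Sum>K\<in>H - {mat 1}. kepler_force (L *v x - (L ** K) *v x))"
    by (simp add: pair_force_eq linear_sum[OF matrix_vector_mul_linear] kepler_force_H[OF L, symmetric]
        matrix_vector_mult_diff_distrib matrix_vector_mul_assoc)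
  also have "\<dots> = (\<Sum>K\<in>H - {L}. kepler_force (L *v x - K *v x))"
    by (rule sum.reindex_bij_betw[OF left_translation(2)[OF L]])
  finally show ?thesis
    using e by (simp add: force_def matrix_vector_right_distrib matrix_vector_mult_scaleR kepler_force_H[OF L] scaleR_add_right)
qed

text \<open>The attractions on the centre are the images of one vector under all of
  \<open>H\<close>, and these sum to 0.\<close>

lemma central_gradient:
  assumes "\<And>L. L \<in> H \<Longrightarrow> q L = L *v x" "x \<in> off_axes H"
  shows "GDERIV (\<lambda>y. nbody_potential H \<mu> y q) 0 :> 0"
proof -
  have d: "((\<lambda>y. 1 / norm (q L - y)) has_derivative (\<lambda>h. kepler_force (q L) \<bullet> (- h))) (at 0)" if L: "L \<in> H" for L
  proof -
    have n: "q L - 0 \<noteq> 0" using assms L norm_H[OF L, of x] by (auto simp: off_axes_def)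
    have "((\<lambda>y. q L - y) has_derivative (\<lambda>h. - h)) (at 0)" by (auto intro!: derivative_eq_intros)
    from has_derivative_compose[OF this kepler_potential_has_derivative[OF n]] show ?thesis by simp
  qed
  have "((\<lambda>y. nbody_potential H \<mu> y q) has_derivative (\<lambda>h. - \<mu> * (\<Sum>L\<in>H. kepler_force (q L) \<bullet> (- h)) - 0)) (at 0)"
    unfolding nbody_potential_def
    by (intro has_derivative_diff has_derivative_mult_right has_derivative_sum d has_derivative_const)
  moreover have "(\<Sum>L\<in>H. kepler_force (q L) \<bullet> (- h)) = 0" for h
  proof -
    have "(\<Sum>L\<in>H. kepler_force (q L) \<bullet> (- h)) = (\<Sum>L\<in>H. L *v kepler_force x) \<bullet> (- h)"
      unfolding inner_sum_left by (rule sum.cong) (simp_all add: assms(1) kepler_force_H)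
    then show ?thesis by (simp add: sum_H_vector)
  qed
  ultimately show ?thesis by (simp add: gderiv_def)
qed

text \<open>Each pair containing \<open>L\<close> occurs twice in the sum over ordered pairs. The
  Kepler force is odd, so both occurrences contribute equally and cancel the factor 1/2.\<close>

lemma particle_gradient:
  assumes L: "L \<in> H" and q: "inj_on q H" "\<And>K. K \<in> H \<Longrightarrow> q K \<noteq> 0"
  shows "GDERIV (\<lambda>y. nbody_potential H \<mu> 0 (q(L := y))) (q L) :>
     - (\<mu> *\<^sub>R kepler_force (q L) + (\<Sum>K\<in>H - {L}. kepler_force (q L - q K)))"
proof -
  define c where "c K h = (if K = L then h else 0)" for K and h :: "real^3"
  have c: "((\<lambda>y. (q(L := y)) K) has_derivative c K) (at (q L))" for K
    by (cases "K = L") (simp_all add: c_def[abs_def])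
  have d1: "((\<lambda>y. 1 / norm ((q(L := y)) K - 0)) has_derivative (\<lambda>h. kepler_force (q K) \<bullet> c K h)) (at (q L))" if "K \<in> H" for K
  proof -
    have "(q(L := q L)) K \<noteq> 0" using q(2)[OF that] by simp
    from has_derivative_compose[OF c kepler_potential_has_derivative[OF this]] show ?thesis by simp
  qed
  have d2: "((\<lambda>y. 1 / norm ((q(L := y)) K - (q(L := y)) K')) has_derivative (\<lambda>h. kepler_force (q K - q K') \<bullet> (c K h - c K' h))) (at (q L))"
    if "K \<in> H" "K' \<in> H - {K}" for K K'
  proof -
    have "(q(L := q L)) K - (q(L := q L)) K' \<noteq> 0" using that inj_onD[OF q(1), of K K'] by auto
    from has_derivative_compose[OF has_derivative_diff[OF c c] kepler_potential_has_derivative[OF this]] show ?thesis by simp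
  qed
  define G where "G = (\<Sum>K\<in>H - {L}. kepler_force (q L - q K))"
  have "((\<lambda>y. nbody_potential H \<mu> 0 (q(L := y))) has_derivative
      (\<lambda>h. - \<mu> * (\<Sum>K\<in>H. kepler_force (q K) \<bullet> c K h) - (1/2) * (\<Sum>K\<in>H. \<Sum>K'\<in>H - {K}. kepler_force (q K - q K') \<bullet> (c K h - c K' h)))) (at (q L))"
    unfolding nbody_potential_def
    by (intro has_derivative_diff has_derivative_mult_right has_derivative_sum d1 d2)
  moreover have "(\<Sum>K\<in>H. kepler_force (q K) \<bullet> c K h) = kepler_force (q L) \<bullet> h" for h
    by (subst sum.remove[OF finite_H L]) (simp add: c_def)
  moreover have "(\<Sum>K\<in>H. \<Sum>K'\<in>H - {K}. kepler_force (q K - q K') \<bullet> (c K h - c K' h)) = 2 * (G \<bullet> h)" for h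
  proof -
    have "(\<Sum>K'\<in>H - {L}. kepler_force (q L - q K') \<bullet> (c L h - c K' h)) = G \<bullet> h"
      unfolding G_def inner_sum_left by (rule sum.cong) (auto simp: c_def)
    moreover have "(\<Sum>K'\<in>H - {K}. kepler_force (q K - q K') \<bullet> (c K h - c K' h)) = kepler_force (q L - q K) \<bullet> h" if K: "K \<in> H - {L}" for K
    proof -
      have "L \<in> H - {K}" using K L by auto
      then have "(\<Sum>K'\<in>H - {K}. kepler_force (q K - q K') \<bullet> (c K h - c K' h)) =
          kepler_force (q K - q L) \<bullet> (c K h - c L h) + (\<Sum>K'\<in>H - {K} - {L}. kepler_force (q K - q K') \<bullet> (c K h - c K' h))"
        by (intro sum.remove finite_Diff finite_H)
      also have "(\<Sum>K'\<in>H - {K} - {L}. kepler_force (q K - q K') \<bullet> (c K h - c K' h)) = 0"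
        by (rule sum.neutral) (use K in \<open>auto simp: c_def\<close>)
      finally show ?thesis
        using K kepler_force_minus[of "q L - q K"] by (auto simp: c_def)
    qed
    ultimately show ?thesis
      by (subst sum.remove[OF finite_H L]) (simp add: G_def inner_sum_left)
  qed
  ultimately have "((\<lambda>y. nbody_potential H \<mu> 0 (q(L := y))) has_derivative
      (\<lambda>h. - \<mu> * (kepler_force (q L) \<bullet> h) - (1/2) * (2 * (G \<bullet> h)))) (at (q L))" by simp
  then show ?thesis
    unfolding gderiv_def G_def[symmetric]
    by (rule has_derivative_eq_rhs) (simp add: fun_eq_iff inner_add_right inner_commute algebra_simps)
qed

text \<open>Rescaling time by \<open>1 / sqrt \<epsilon>\<close> multiplies accelerations by
  \<open>1 / \<epsilon>\<close>. The Kepler part becomes the attraction by the central mass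
  \<open>1 / \<epsilon>\<close>, and \<open>\<epsilon>\<close> times the pair force becomes the
  interaction of unit masses.\<close>

lemma nbody_of_critical_point:
  assumes crit: "critical_point H \<epsilon> u" and e: "\<epsilon> > 0"
  defines "q \<equiv> \<lambda>L t. L *v loop u (t / sqrt \<epsilon>)"
  shows "nbody_solution H (1/\<epsilon>) (\<lambda>_. 0) q" and "q L (t + 2 * pi * sqrt \<epsilon>) = q L t"
proof -
  have off: "loop u t \<in> off_axes H" for t
    using crit collision_free_off_axes by (simp add: critical_point_def)
  define k where "k = 1 / sqrt \<epsilon>"
  have kk: "k * k = 1 / \<epsilon>" using e by (simp add: k_def)
  have sc: "((\<lambda>t. t * k) has_vector_derivative k) (at t)" for t by (auto intro!: derivative_eq_intros)
  have qk: "q L t = L *v loop u (t * k)" for L t by (simp add: q_def k_def)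
  have bl: "bounded_linear ((*v) L)" for L :: "real^3^3" by (rule matrix_vector_mul_bounded_linear)
  have acc: "has_acceleration (q L) ((1/\<epsilon>) *\<^sub>R (L *v force H \<epsilon> (loop u (t * k)))) t" for L t
    unfolding has_acceleration_def
  proof (intro exI conjI allI)
    fix s
    have "((\<lambda>t. loop u (t * k)) has_vector_derivative k *\<^sub>R velocity (loop u) (s * k)) (at s)"
      using vector_diff_chain_at[OF sc loop_has_velocity] by (simp add: o_def)
    from bounded_linear.has_vector_derivative[OF bl this]
    show "(q L has_vector_derivative L *v (k *\<^sub>R velocity (loop u) (s * k))) (at s)" unfolding qk[abs_def] .
    have "((\<lambda>t. velocity (loop u) (t * k)) has_vector_derivative k *\<^sub>R force H \<epsilon> (loop u (t * k))) (at t)"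
      using vector_diff_chain_at[OF sc critical_point_newton[OF crit]] by (simp add: o_def)
    then have "((\<lambda>t. k *\<^sub>R velocity (loop u) (t * k)) has_vector_derivative (1/\<epsilon>) *\<^sub>R force H \<epsilon> (loop u (t * k))) (at t)"
      using bounded_linear.has_vector_derivative[OF bounded_linear_scaleR_right[of k]] kk by fastforce
    from bounded_linear.has_vector_derivative[OF bl this]
    show "((\<lambda>s. L *v (k *\<^sub>R velocity (loop u) (s * k))) has_vector_derivative (1/\<epsilon>) *\<^sub>R (L *v force H \<epsilon> (loop u (t * k)))) (at t)"
      by (simp add: matrix_vector_mult_scaleR)
  qed
  show "nbody_solution H (1/\<epsilon>) (\<lambda>_. 0) q"
    unfolding nbody_solution_def
  proof (intro conjI allI ballI)
    fix t
    define x where "x = loop u (t * k)"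
    have x: "x \<in> off_axes H" unfolding x_def by (rule off)
    have qx: "q L t = L *v x" for L by (simp add: qk x_def)
    have nz: "q L t \<noteq> 0" if "L \<in> H" for L
      using norm_H[OF that, of x] x by (auto simp: qx off_axes_def)
    then show "q L t \<noteq> 0" if "L \<in> H" for L using that .
    show inj: "inj_on (\<lambda>L. q L t) H" unfolding qx by (rule orbit_injective[OF x])
    have "has_acceleration (\<lambda>_. 0) 0 t" unfolding has_acceleration_def by (intro exI[of _ "\<lambda>_. 0"]) auto
    moreover have "GDERIV (\<lambda>y. nbody_potential H (1/\<epsilon>) y (\<lambda>K. q K t)) 0 :> 0"
      by (rule central_gradient[OF _ x]) (simp add: qx)
    ultimately show "\<exists>a. has_acceleration (\<lambda>_. 0) a t \<and>
        GDERIV (\<lambda>y. nbody_potential H (1/\<epsilon>) y (\<lambda>K. q K t)) 0 :> - ((1/\<epsilon>) *\<^sub>R a)"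
      by (intro exI[of _ 0]) simp
    fix L assume L: "L \<in> H"
    have "GDERIV (\<lambda>y. nbody_potential H (1/\<epsilon>) 0 ((\<lambda>K. q K t)(L := y))) (q L t) :> - ((1/\<epsilon>) *\<^sub>R (L *v force H \<epsilon> x))"
      using particle_gradient[OF L inj nz, of "1/\<epsilon>"] e unfolding force_on_particle[OF L less_imp_neq[OF e, symmetric]] qx by simp
    then show "\<exists>a. has_acceleration (q L) a t \<and>
        GDERIV (\<lambda>y. nbody_potential H (1/\<epsilon>) 0 ((\<lambda>K. q K t)(L := y))) (q L t) :> - a"
      using acc[of L t] unfolding x_def by blast
  qed
  have "(t + 2 * pi * sqrt \<epsilon>) / sqrt \<epsilon> = t / sqrt \<epsilon> + 2 * pi" using e by (simp add: add_divide_distrib)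
  then show "q L (t + 2 * pi * sqrt \<epsilon>) = q L t" by (simp add: q_def loop_periodic)
qed

end

lemma hessian_Psi_infinite:
  assumes "infinite H" shows "\<not> invertible (hessian (Psi H) p)"
proof -
  have "Psi H = (\<lambda>_. 0)" using assms by (simp add: fun_eq_iff Psi_def action1_def)
  then have "hessian (Psi H) p = 0"
    by (simp add: hessian_def partial_derivative_def[abs_def] vec_eq_iff)
  then show ?thesis by (simp add: invertible_def vec_eq_iff matrix_matrix_mult_def mat_def)
qed

lemma C1_branch_linear_growth:
  fixes u :: "real \<Rightarrow> 'a::real_normed_vector"
  assumes "C1_on (ball 0 r) u" "r > 0"
  shows "(\<lambda>e. norm (u e - u 0)) \<in> O[at_right 0](\<lambda>e. e)"
proof -
  obtain D where D: "(u has_derivative blinfun_apply D) (at 0)"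
    using assms unfolding C1_on_def by (metis centre_in_ball)
  then obtain d where d: "d > 0" "\<And>y. norm (y - 0) < d \<Longrightarrow> norm (u y - u 0 - blinfun_apply D (y - 0)) \<le> 1 * norm (y - 0)"
    unfolding has_derivative_at_alt using zero_less_one by metis
  show ?thesis
  proof (rule bigoI)
    show "\<forall>\<^sub>F e in at_right 0. norm (norm (u e - u 0)) \<le> (1 + norm D) * norm e"
    proof (rule eventually_at_rightI[OF _ d(1)])
      fix e :: real assume "e \<in> {0<..<d}"
      then have 1: "norm (u e - u 0 - blinfun_apply D e) \<le> norm e" using d(2)[of e] by simp
      have "norm (u e - u 0) \<le> norm (blinfun_apply D e) + norm (u e - u 0 - blinfun_apply D e)"
        by (rule norm_triangle_sub)
      also have "\<dots> \<le> (1 + norm D) * norm e" using 1 norm_blinfun[of D e] by (simp add: distrib_right)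
      finally show "norm (norm (u e - u 0)) \<le> (1 + norm D) * norm e" by simp
    qed
  qed
qed

theorem theorem12:
  fixes H :: "(real^3^3) set" and \<psi>0 :: "real^2"
  assumes group: "H \<in> {tetrahedral_group, octahedral_group, icosahedral_group}"
    and cos: "cos (\<psi>0$2) \<noteq> 0"
    and avoids_axes: "\<forall>\<theta>. \<forall>L\<in>H - {mat 1}. L *v circular_orbit \<psi>0 \<theta> \<noteq> circular_orbit \<psi>0 \<theta>"
    and critical: "partial_derivative 3 (Psi H) (vector [0, 0, \<psi>0$1, \<psi>0$2]) = 0"
      "partial_derivative 4 (Psi H) (vector [0, 0, \<psi>0$1, \<psi>0$2]) = 0"
    and nondegenerate: "invertible (hessian (Psi H) (vector [0, 0, \<psi>0$1, \<psi>0$2]))"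
  shows "\<exists>\<epsilon>0>0. \<exists>u :: real \<Rightarrow> H2_loop.
    (\<exists>u'. (\<forall>\<epsilon>\<in>{0..<\<epsilon>0}. (u has_vector_derivative u' \<epsilon>) (at \<epsilon> within {0..<\<epsilon>0})) \<and>
          continuous_on {0..<\<epsilon>0} u') \<and>
    (\<forall>\<epsilon>\<in>{0..<\<epsilon>0}. critical_point H \<epsilon> (u \<epsilon>)) \<and>
    loop (u 0) = circular_orbit \<psi>0 \<and>
    (\<exists>U. open U \<and> u 0 \<in> U \<and>
       (\<forall>\<epsilon>\<in>{0<..<\<epsilon>0}. \<forall>v\<in>U. critical_point H \<epsilon> v \<longrightarrow>
          (\<exists>\<phi>::real. \<forall>\<tau>. loop v \<tau> = loop (u \<epsilon>) (\<tau> + \<phi>)))) \<and>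
    (\<forall>\<epsilon>\<in>{0<..<\<epsilon>0}. let q = (\<lambda>L t. L *v loop (u \<epsilon>) (t / sqrt \<epsilon>)) in
       nbody_solution H (1 / \<epsilon>) (\<lambda>_. 0) q \<and>
       (\<forall>L\<in>H. \<forall>t. q L (t + 2 * pi * sqrt \<epsilon>) = q L t)) \<and>
    (\<exists>(\<xi> :: real \<Rightarrow> real^2) (\<psi> :: real \<Rightarrow> real^2) (k :: real \<Rightarrow> H2_loop).
       (\<forall>\<epsilon>\<in>{0<..<\<epsilon>0}. norm (\<xi> \<epsilon>) < 1 \<and> loop (k \<epsilon>) = kepler_chart (\<xi> \<epsilon>) (\<psi> \<epsilon>)) \<and>
       (\<lambda>\<epsilon>. norm (u \<epsilon> - k \<epsilon>)) \<in> O[at_right 0](\<lambda>\<epsilon>. \<epsilon>) \<and>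
       (\<lambda>\<epsilon>. norm (\<xi> \<epsilon>)) \<in> O[at_right 0](\<lambda>\<epsilon>. \<epsilon>) \<and>
       (\<lambda>\<epsilon>. norm (\<psi> \<epsilon> - \<psi>0)) \<in> O[at_right 0](\<lambda>\<epsilon>. \<epsilon>))"
proof -
  define p :: "real^4" where "p = vector [0, 0, \<psi>0$1, \<psi>0$2]"
  have p: "p$1 = 0" "p$2 = 0" "p$3 = \<psi>0$1" "p$4 = \<psi>0$2" by (simp_all add: p_def vector_4)
  interpret circular p by unfold_locales (simp_all add: p)
  have orb: "circular_orbit \<psi>0 = u0" by (rule ext) (simp add: circular_orbit_frame u0_def p)
  have "finite H" using hessian_Psi_infinite nondegenerate by blast
  then interpret symmetry_group H by (rule symmetry_group_of_cases[OF group])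
  have off: "u0 t \<in> off_axes H" for t
    using avoids_axes by (auto simp: off_axes_def orb) (metis DiffI singletonD)
  interpret nondegenerate_circular p H
    by unfold_locales (use off cos critical nondegenerate in \<open>simp_all add: p, simp_all add: p_def\<close>)
  obtain \<epsilon>2 r X where e2: "\<epsilon>2 > 0" and r: "r > 0" and X0: "X 0 = x0"
    and C1: "C1_on (ball 0 \<epsilon>2) (\<lambda>\<epsilon>. solution_loop (X \<epsilon>, \<epsilon>))"
    and crit: "\<And>\<epsilon>. \<bar>\<epsilon>\<bar> < \<epsilon>2 \<Longrightarrow> critical_point H \<epsilon> (solution_loop (X \<epsilon>, \<epsilon>))"
    and arc: "\<And>\<epsilon> t. \<bar>\<epsilon>\<bar> < \<epsilon>2 \<Longrightarrow> t \<in> {0..2*pi} \<Longrightarrow>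
      loop (solution_loop (X \<epsilon>, \<epsilon>)) t = kchart (fst (snd (X \<epsilon>)), t) + \<epsilon> *\<^sub>R apply_bcontfun (fst (X \<epsilon>)) t"
    and uniq: "\<And>x \<epsilon>. \<bar>\<epsilon>\<bar> < \<epsilon>2 \<Longrightarrow> norm (x - x0) < r \<Longrightarrow> Fmap (x, \<epsilon>) = 0 \<Longrightarrow> x = X \<epsilon>"
    by (rule critical_branch) blast
  define u where "u \<epsilon> = solution_loop (X \<epsilon>, \<epsilon>)" for \<epsilon>
  have u0_periodic: "u0 (t + 2*pi) = u0 t" for t by (simp add: u0_def)
  have base: "loop (u 0) = u0"
  proof
    fix t
    define d where "d t = loop (u 0) t - u0 t" for t
    have "d (t + 2*pi) = d t" for t unfolding d_def loop_periodic u0_periodic ..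
    moreover have "d t = 0" if "t \<in> {0..2*pi}" for t
      using arc[of 0 t] e2 that by (simp add: d_def u_def X0 x0_def kchart_circ)
    ultimately have "d t = 0" by (rule periodic_reduce[where Q = "\<lambda>x. x = 0"])
    then have "loop (u 0) t - u0 t = 0" by (simp only: d_def)
    then show "loop (u 0) t = u0 t" by simp
  qed
  obtain D where D: "\<And>\<epsilon>. \<epsilon> \<in> ball 0 \<epsilon>2 \<Longrightarrow> (u has_derivative blinfun_apply (D \<epsilon>)) (at \<epsilon>)" "continuous_on (ball 0 \<epsilon>2) D"
    using C1 unfolding C1_on_def u_def[abs_def] by blast
  have sub: "\<epsilon> \<in> ball 0 \<epsilon>2" if "\<epsilon> \<in> {0..<\<epsilon>2}" for \<epsilon> using that by (simp add: dist_norm)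
  have smooth: "(u has_vector_derivative blinfun_apply (D \<epsilon>) 1) (at \<epsilon> within {0..<\<epsilon>2})" if "\<epsilon> \<in> {0..<\<epsilon>2}" for \<epsilon>
  proof (rule has_vector_derivative_at_within)
    show "(u has_vector_derivative blinfun_apply (D \<epsilon>) 1) (at \<epsilon>)"
      using D(1)[OF sub[OF that]] by (simp add: has_vector_derivative_def blinfun.scaleR_right[symmetric])
  qed
  have cD: "continuous_on {0..<\<epsilon>2} (\<lambda>\<epsilon>. blinfun_apply (D \<epsilon>) 1)"
    by (intro continuous_intros continuous_on_subset[OF D(2)]) (use sub in blast)
  note unique = branch_locally_unique[OF r uniq arc[folded u_def] base]
  have chart: "kepler_chart 0 \<psi>0 = u0"
    by (rule ext) (simp add: kepler_chart_eq p_def[symmetric] kchart_circ)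
  \<comment> \<open>The constant choice \<open>\<xi> = 0\<close>, \<open>\<psi> = \<psi>0\<close>
    suffices: a branch differentiable at 0 stays within distance \<open>O(\<epsilon>)\<close> of the
    circular orbit itself, which is the chart point with these parameters.\<close>
  have kepler: "\<exists>(\<xi> :: real \<Rightarrow> real^2) (\<psi> :: real \<Rightarrow> real^2) (k :: real \<Rightarrow> H2_loop).
       (\<forall>\<epsilon>\<in>{0<..<\<epsilon>2}. norm (\<xi> \<epsilon>) < 1 \<and> loop (k \<epsilon>) = kepler_chart (\<xi> \<epsilon>) (\<psi> \<epsilon>)) \<and>
       (\<lambda>\<epsilon>. norm (u \<epsilon> - k \<epsilon>)) \<in> O[at_right 0](\<lambda>\<epsilon>. \<epsilon>) \<and>
       (\<lambda>\<epsilon>. norm (\<xi> \<epsilon>)) \<in> O[at_right 0](\<lambda>\<epsilon>. \<epsilon>) \<and>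
       (\<lambda>\<epsilon>. norm (\<psi> \<epsilon> - \<psi>0)) \<in> O[at_right 0](\<lambda>\<epsilon>. \<epsilon>)"
    by (rule exI[of _ "\<lambda>_. 0"], rule exI[of _ "\<lambda>_. \<psi>0"], rule exI[of _ "\<lambda>_. u 0"])
      (use C1_branch_linear_growth[OF C1 e2] in \<open>simp add: u_def[symmetric] chart base\<close>)
  have nbody: "let q = (\<lambda>L t. L *v loop (u \<epsilon>) (t / sqrt \<epsilon>)) in
       nbody_solution H (1 / \<epsilon>) (\<lambda>_. 0) q \<and> (\<forall>L\<in>H. \<forall>t. q L (t + 2 * pi * sqrt \<epsilon>) = q L t)" if "\<epsilon> \<in> {0<..<\<epsilon>2}" for \<epsilon>
    using nbody_of_critical_point[OF crit[of \<epsilon>, folded u_def]] that by (simp add: Let_def)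
  show ?thesis
  proof (rule exI[of _ \<epsilon>2], rule conjI[OF e2], rule exI[of _ u], intro conjI)
    show "\<exists>u'. (\<forall>\<epsilon>\<in>{0..<\<epsilon>2}. (u has_vector_derivative u' \<epsilon>) (at \<epsilon> within {0..<\<epsilon>2})) \<and> continuous_on {0..<\<epsilon>2} u'"
      by (rule exI, rule conjI[OF ballI cD], rule smooth)
    show "\<forall>\<epsilon>\<in>{0..<\<epsilon>2}. critical_point H \<epsilon> (u \<epsilon>)" using crit by (simp add: u_def)
    show "loop (u 0) = circular_orbit \<psi>0" unfolding orb by (rule base)
  qed (rule unique ballI[OF nbody] kepler; assumption?)+
qed

end
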